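(* There exists an explicit continuous monotone expander.
   Context: A continuous expander is a finite family $\Psi$ of maps for which there exists a constant $c_0>0$ such that: every $\psi\in\Psi$ is a smooth map from the interval $[0,1]$ to itself, and for every measurable $A\subset[0,1]$ with $|A|\le 1/2$ (Lebesgue measure) one has $|\Psi(A)|\ge(1+c_0)|A|$, where $\Psi(A)=\bigcup_{\psi\in\Psi}\psi(A)$. It is a continuous monotone expander if in addition every $\psi\in\Psi$ is monotone, i.e. $\psi(x)>\psi(y)$ whenever $x>y$. "Explicit" means: the family $\Psi$ can be (uniformly) described by a constant number of bits, and for every rational $x\in[0,1]$ describable by $b$ bits and every $\psi\in\Psi$, the value $\psi(x)$ is rational and can be computed in time polynomial in $b$. *)

theory Defs
  imports "HOL-Analysis.Analysis" "HOL-Computational_Algebra.Polynomial"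
begin

section \<open>Expanders\<close>

text \<open>\<open>C\<^sup>\<infinity>\<close> on \<open>S\<close>; at the end points of a closed interval the derivatives are one-sided.\<close>

definition smooth_map_on :: "real set \<Rightarrow> (real \<Rightarrow> real) \<Rightarrow> bool" where
  "smooth_map_on S f \<longleftrightarrow>
     (\<exists>D :: nat \<Rightarrow> real \<Rightarrow> real.
        (\<forall>x\<in>S. D 0 x = f x) \<and>
        (\<forall>n. \<forall>x\<in>S. (D n has_real_derivative D (Suc n) x) (at x within S)))"

text \<open>Members of a family are total functions on the reals of which only the restriction
  to the unit interval matters.\<close>

definition continuous_expander :: "(real \<Rightarrow> real) set \<Rightarrow> bool" where
  "continuous_expander \<Psi> \<longleftrightarrow> finite \<Psi> \<and>
     (\<exists>c\<^sub>0>0.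
        (\<forall>\<psi>\<in>\<Psi>. \<psi> \<in> {0..1} \<rightarrow> {0..1} \<and> smooth_map_on {0..1} \<psi>) \<and>
        (\<forall>A. A \<in> sets lebesgue \<and> A \<subseteq> {0..1} \<and> measure lebesgue A \<le> 1 / 2 \<longrightarrow>
           measure lebesgue (\<Union>\<psi>\<in>\<Psi>. \<psi> ` A) \<ge> (1 + c\<^sub>0) * measure lebesgue A))"

definition continuous_monotone_expander :: "(real \<Rightarrow> real) set \<Rightarrow> bool" where
  "continuous_monotone_expander \<Psi> \<longleftrightarrow>
     continuous_expander \<Psi> \<and> (\<forall>\<psi>\<in>\<Psi>. strict_mono_on {0..1} \<psi>)"

section \<open>Turing machines\<close>

text \<open>Deterministic multi-tape machines with two-way infinite tapes. The tape symbols are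
  \<open>0, \<dots>, num_syms - 1\<close>, with \<open>0\<close> the blank. The non-halting states are
  \<open>0, \<dots>, num_states - 1\<close>, with \<open>0\<close> the initial one, and \<open>num_states\<close> is the halting state.
  The input is on the first tape and the output on the last one.\<close>

datatype move = Move_Left | Stay | Move_Right

record tm =
  num_tapes :: nat
  num_syms :: nat
  num_states :: nat
  delta :: "nat \<Rightarrow> nat list \<Rightarrow> nat \<times> (nat \<times> move) list"

definition valid_tm :: "tm \<Rightarrow> bool" where
  "valid_tm M \<longleftrightarrow> num_tapes M \<ge> 1 \<and> num_syms M \<ge> 4 \<and>
     (\<forall>q ss. q < num_states M \<and> length ss = num_tapes M \<and> set ss \<subseteq> {..<num_syms M} \<longrightarrow>
        (case delta M q ss of (q', acts) \<Rightarrow>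
           q' \<le> num_states M \<and> length acts = num_tapes M \<and> fst ` set acts \<subseteq> {..<num_syms M}))"

text \<open>A tape is its head position together with its contents.\<close>

type_synonym tape = "int \<times> (int \<Rightarrow> nat)"

type_synonym config = "nat \<times> tape list"

fun read_head :: "tape \<Rightarrow> nat" where
  "read_head (h, c) = c h"

fun move_head :: "move \<Rightarrow> int \<Rightarrow> int" where
  "move_head Move_Left h = h - 1"
| "move_head Stay h = h"
| "move_head Move_Right h = h + 1"

fun act :: "nat \<times> move \<Rightarrow> tape \<Rightarrow> tape" where
  "act (s, m) (h, c) = (move_head m h, c(h := s))"

fun tm_step :: "tm \<Rightarrow> config \<Rightarrow> config" where
  "tm_step M (q, ts) =
     (if q < num_states M
      then (case delta M q (map read_head ts) of (q', acts) \<Rightarrow> (q', map2 act acts ts))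
      else (q, ts))"

definition word_tape :: "nat list \<Rightarrow> tape" where
  "word_tape w = (0, \<lambda>i. if 0 \<le> i \<and> i < int (length w) then w ! nat i else 0)"

definition init_config :: "tm \<Rightarrow> nat list \<Rightarrow> config" where
  "init_config M w = (0, word_tape w # replicate (num_tapes M - 1) (word_tape []))"

text \<open>The word on a tape is the maximal blank-free word starting at cell \<open>0\<close>.\<close>

definition tape_holds :: "tape \<Rightarrow> nat list \<Rightarrow> bool" where
  "tape_holds t w \<longleftrightarrow> 0 \<notin> set w \<and>
     (\<forall>i<length w. snd t (int i) = w ! i) \<and> snd t (int (length w)) = 0"

definition outputs_within :: "tm \<Rightarrow> nat list \<Rightarrow> nat list \<Rightarrow> nat \<Rightarrow> bool" where
  "outputs_within M w w' T \<longleftrightarrow>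
     (\<exists>t\<le>T. \<exists>ts. (tm_step M ^^ t) (init_config M w) = (num_states M, ts) \<and> tape_holds (last ts) w')"

section \<open>Explicit families\<close>

text \<open>On tapes, the bits are the symbols \<open>1\<close> and \<open>2\<close>, and \<open>3\<close> is a separator.\<close>

definition bits_word :: "bool list \<Rightarrow> nat list" where
  "bits_word bs = map (\<lambda>b. if b then 2 else 1) bs"

text \<open>Binary numbers have their least significant bit first; a pair of bit strings describes
  a non-negative rational as a quotient, not necessarily in lowest terms.\<close>

definition bits_nat :: "bool list \<Rightarrow> nat" where
  "bits_nat bs = horner_sum of_bool 2 bs"

fun describes_rat :: "bool list \<times> bool list \<Rightarrow> real \<Rightarrow> bool" where
  "describes_rat (bs, cs) x \<longleftrightarrow> bits_nat cs > 0 \<and> x = real (bits_nat bs) / real (bits_nat cs)"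

fun rat_word :: "bool list \<times> bool list \<Rightarrow> nat list" where
  "rat_word (bs, cs) = bits_word bs @ [3] @ bits_word cs"

fun rat_bits :: "bool list \<times> bool list \<Rightarrow> nat" where
  "rat_bits (bs, cs) = length bs + length cs"

text \<open>Given the description \<open>d\<close> of a map \<open>\<psi>\<close> and any description of a rational \<open>x\<close> in the unit
  interval, the machine produces a description of \<open>\<psi> x\<close>; in particular \<open>\<psi> x\<close> is rational.\<close>

definition evaluates :: "tm \<Rightarrow> nat poly \<Rightarrow> bool list \<Rightarrow> (real \<Rightarrow> real) \<Rightarrow> bool" where
  "evaluates M p d \<psi> \<longleftrightarrow>
     (\<forall>x r. x \<in> {0..1} \<and> describes_rat r x \<longrightarrow>
        (\<exists>r'. describes_rat r' (\<psi> x) \<and>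
           outputs_within M (bits_word d @ [3] @ rat_word r) (rat_word r') (poly p (rat_bits r))))"

text \<open>The list \<open>ds\<close> of bit strings is the description of the family \<open>\<Psi>\<close>, which is uniform in
  that a single machine evaluates all members from their descriptions. As \<open>\<Psi>\<close> is one fixed family,
  a constant number of bits means finitely many.\<close>

definition explicit_family :: "(real \<Rightarrow> real) set \<Rightarrow> bool" where
  "explicit_family \<Psi> \<longleftrightarrow>
     (\<exists>M p ds \<psi>s. valid_tm M \<and> \<Psi> = set \<psi>s \<and> list_all2 (evaluates M p) ds \<psi>s)"

end

theory Submission
  imports Defs "HOL-Analysis.Analysis" "HOL-Computational_Algebra.Computational_Algebra"
    "HOL-Number_Theory.Cong" "HOL-Real_Asymp.Real_Asymp"
begin

(*
  The expander consists of the identity, the maps x |-> (x + k) / 2^N, and the maps x |-> g(x) / 512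
  for about p/32 or more integral Moebius transformations g of determinant p. After division by
  sqrt p, these g lie in a fixed compact subset of SL_2(R), and they generate freely, since a
  product of generators and their adjugates that is divisible by p must backtrack. Two words that
  are close in SL_2(R) are congruent to each other in a way counted by the divisor function, so few
  pairs of words are close. By a high-moment argument, the average of f over the maps g therefore
  has small norm whenever f lives at the scales between 3l2^i and 6l2^i, where 2^(3l) is about p.
  Bands of different scale are nearly orthogonal, so the average contracts every f without
  component at scales coarser than 2^(-3l). If a set A did not expand, then the maps
  (x + k) / 2^N would force A to be equidistributed at coarse scales, and the indicator of A, minus
  its mean, would be almost invariant under the average, a contradiction.
  On x = n/m each map is (an + bm) / (cn + dm), which a Turing machine computes by
  running twice over the binary digits of n and m with a bounded carry.
*)

text \<open>The contraction has to be uniform over all bands, and this shapes the parameters. Words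
  of n = 8 * 2^i pairs of letters resolve SL_2(R) at the scale \<delta> = 2^(-12 l 2^i), well below
  the finest scale of the band. Every loss, in word counts and in the size of products, is a
  constant to the power n, while the mean square of correlations decays like p^(-n/24) and the
  divisor function costs only p^(n/48). The n-th root leaves a constant over p^(1/96). The constants
  do not depend on p, so p is chosen last. The correlation of f with a single translate of it may be
  large; only its mean square over a region of matrices is small. Since close pairs of words are
  few, the words thickened by \<delta> have a density with small square mean, and this carries the
  smallness over to words. Moebius maps distort length. Lifted to f(x/y) h(y) on the plane they
  become linear maps that preserve area, and moments can be taken by Cauchy-Schwarz alone. Compact
  sets and dyadic coverings of them make every decomposition into scales finite.\<close>

abbreviation ind :: "'a set \<Rightarrow> 'a \<Rightarrow> real" where
  "ind A \<equiv> indicator A"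

lemmas lint_mono = Bochner_Integration.integral_mono
  and lint_cong = Bochner_Integration.integral_cong
  and lint_add = Bochner_Integration.integral_add
  and lint_diff = Bochner_Integration.integral_diff
  and lint_sum = Bochner_Integration.integral_sum

section \<open>Integer two-by-two matrices and the number of words with a given product\<close>

type_synonym imat = "int \<times> int \<times> int \<times> int"

fun mat_mul :: "imat \<Rightarrow> imat \<Rightarrow> imat" where
 "mat_mul (a, b, c, d) (a', b', c', d') = (a*a' + b*c', a*b' + b*d', c*a' + d*c', c*b' + d*d')"

text \<open>The adjugate takes the place of the inverse within integer matrices. It differs from the
  inverse by the factor \<open>mat_det x\<close>, and scalar factors do not affect the Moebius
  action.\<close>

fun mat_adj :: "imat \<Rightarrow> imat" where
 "mat_adj (a, b, c, d) = (d, -b, -c, a)"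

fun mat_det :: "imat \<Rightarrow> int" where
 "mat_det (a, b, c, d) = a*d - b*c"

fun mat_scale :: "int \<Rightarrow> imat \<Rightarrow> imat" where
 "mat_scale k (a, b, c, d) = (k*a, k*b, k*c, k*d)"

fun mat_dvd :: "int \<Rightarrow> imat \<Rightarrow> bool" where
 "mat_dvd k (a, b, c, d) \<longleftrightarrow> k dvd a \<and> k dvd b \<and> k dvd c \<and> k dvd d"

fun mat_div :: "imat \<Rightarrow> int \<Rightarrow> imat" where
 "mat_div (a, b, c, d) k = (a div k, b div k, c div k, d div k)"

definition mat_one :: imat where "mat_one = (1, 0, 0, 1)"

definition mat_prod :: "imat list \<Rightarrow> imat" where
 "mat_prod xs = foldr mat_mul xs mat_one"

lemma mat_prod_Nil [simp]: "mat_prod [] = mat_one"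
 and mat_prod_Cons [simp]: "mat_prod (x # xs) = mat_mul x (mat_prod xs)"
 by (simp_all add: mat_prod_def)

lemma mat_mul_assoc: "mat_mul (mat_mul x y) z = mat_mul x (mat_mul y z)"
 by (cases x; cases y; cases z) (simp add: algebra_simps)

lemma mat_mul_one [simp]: "mat_mul mat_one x = x" "mat_mul x mat_one = x"
 by (cases x, simp add: mat_one_def)+

lemma mat_prod_append: "mat_prod (xs @ ys) = mat_mul (mat_prod xs) (mat_prod ys)"
 by (induction xs) (auto simp: mat_mul_assoc)

lemma mat_det_mul: "mat_det (mat_mul x y) = mat_det x * mat_det y"
 by (cases x; cases y) (simp add: algebra_simps)

lemma mat_adj_mul: "mat_adj (mat_mul x y) = mat_mul (mat_adj y) (mat_adj x)"
 by (cases x; cases y) (simp add: algebra_simps)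

lemma mat_adj_adj [simp]: "mat_adj (mat_adj x) = x"
 by (cases x) simp

lemma mat_det_adj [simp]: "mat_det (mat_adj x) = mat_det x"
 by (cases x) simp

lemma mat_mul_adj: "mat_mul x (mat_adj x) = mat_scale (mat_det x) mat_one"
 "mat_mul (mat_adj x) x = mat_scale (mat_det x) mat_one"
 by (cases x, simp add: mat_one_def)+

lemma mat_mul_scale [simp]: "mat_mul (mat_scale k x) y = mat_scale k (mat_mul x y)"
 "mat_mul x (mat_scale k y) = mat_scale k (mat_mul x y)"
 by (cases x, cases y, simp add: algebra_simps)+

lemma mat_scale_scale [simp]: "mat_scale k (mat_scale l x) = mat_scale (k * l) x"
 by (cases x) (simp add: algebra_simps)

lemma mat_scale_1 [simp]: "mat_scale 1 x = x"
 by (cases x) simp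

lemma mat_scale_inj: "k \<noteq> 0 ==> mat_scale k x = mat_scale k y \<longleftrightarrow> x = y"
 by (cases x; cases y) auto

lemma mat_det_scale: "mat_det (mat_scale k x) = k\<^sup>2 * mat_det x"
 by (cases x) (simp add: algebra_simps power2_eq_square)

lemma mat_scale_div: "mat_dvd k x ==> mat_scale k (mat_div x k) = x"
 by (cases x) auto

lemma mat_dvd_scale [simp]: "mat_dvd k (mat_scale k x)"
 by (cases x) auto

text \<open>The bound sqrt (K p) on the entries is what confines the matrices divided by sqrt p to a
  compact set that depends on K alone. It is stated for squares so that the irrational root stays
  out of the integer arguments.\<close>

definition bounded_letters :: "int \<Rightarrow> int \<Rightarrow> imat set" where
 "bounded_letters K p = {(a, b, c, d). a*d - b*c = p \<and> a\<^sup>2 <= K*p \<and> b\<^sup>2 <= K*p \<and> c\<^sup>2 <= K*p \<and> d\<^sup>2 <= K*p}"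

lemma mat_det_letter: "x \<in> bounded_letters K p ==> mat_det x = p"
 by (cases x) (auto simp: bounded_letters_def)

lemma abs_mult_le_of_squares:
 fixes u v B :: int
 assumes "u\<^sup>2 <= B" "v\<^sup>2 <= B" shows "\<bar>u * v\<bar> <= B"
proof -
 have "B >= 0" using assms(1) zero_le_power2[of u] by linarith
 have "(u * v)\<^sup>2 <= B\<^sup>2" unfolding power_mult_distrib power2_eq_square[of B]
  using assms \<open>B >= 0\<close> by (intro mult_mono) auto
 then show ?thesis using \<open>B >= 0\<close> by (metis abs_le_square_iff abs_of_nonneg)
qed

text \<open>Modulo \<open>p\<close>, the letters that divide \<open>G\<close> on the left all have the same column line as \<open>G\<close>,
 so any two of them differ by right multiplication with a bounded integer matrix.\<close>

lemma card_left_divisors: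
 fixes p K :: int
 assumes p: "prime p" and G: "\<not> mat_dvd p G" and K: "K >= 0"
 shows "finite {x \<in> bounded_letters K p. mat_dvd p (mat_mul (mat_adj x) G)}"
  and "card {x \<in> bounded_letters K p. mat_dvd p (mat_mul (mat_adj x) G)} <= nat ((4*K+1)^4)"
proof -
 let ?Y = "{x \<in> bounded_letters K p. mat_dvd p (mat_mul (mat_adj x) G)}"
 \<comment> \<open>An entry of the product of \<open>mat_adj x0\<close> and \<open>x\<close> is a
   difference of two products, each at most K p. Divided by p, it is one of 4 K + 1
   integers.\<close>
 let ?I = "{-2*K..2*K}"
 have p0: "p > 0" using p by (simp add: prime_gt_0_int)
 have "finite ?Y \<and> card ?Y <= nat ((4*K+1)^4)"
 proof (cases "?Y = {}")
  case False
  then obtain x0 where x0: "x0 \<in> ?Y" by blast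
  let ?h = "%x. mat_div (mat_mul (mat_adj x0) x) p"
  have key: "mat_dvd p (mat_mul (mat_adj x0) x) \<and> ?h x \<in> ?I \<times> ?I \<times> ?I \<times> ?I" if x: "x \<in> ?Y" for x
  proof -
   obtain a b c d where xe: "x = (a,b,c,d)" by (cases x)
   obtain a0 b0 c0 d0 where x0e: "x0 = (a0,b0,c0,d0)" by (cases x0)
   obtain g1 h1 g2 h2 where Ge: "G = (g1,h1,g2,h2)" by (cases G)
   \<comment> \<open>Here \<open>(u, v)\<close> is a column of \<open>G\<close> that does not vanish
     modulo p. As \<open>mat_adj x\<close> annihilates it, both columns of \<open>x\<close> are
     multiples of it modulo p, and \<open>mat_adj x0\<close>, which annihilates it too, therefore
     annihilates the columns of \<open>x\<close>. The identities below say this without division: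
     multiply by whichever of \<open>u\<close> and \<open>v\<close> is invertible modulo p.\<close>
   have *: "p dvd d0*a - b0*c \<and> p dvd d0*b - b0*d \<and> p dvd a0*c - c0*a \<and> p dvd a0*d - c0*b"
    if u: "\<not> p dvd u \<or> \<not> p dvd v" and
     1: "p dvd d*u - b* v" "p dvd a* v - c*u" and 2: "p dvd d0*u - b0* v" "p dvd a0* v - c0*u" for u v
   proof -
    have v1: "v * (d0*a - b0*c) = d0*(a* v - c*u) + c*(d0*u - b0* v)"
     "v * (d0*b - b0*d) = d*(d0*u - b0* v) - d0*(d*u - b* v)"
     "v * (a0*c - c0*a) = c*(a0* v - c0*u) - c0*(a* v - c*u)"
     "v * (a0*d - c0*b) = d*(a0* v - c0*u) + c0*(d*u - b* v)"
     by (auto simp: algebra_simps)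
    have u1: "u * (d0*a - b0*c) = a*(d0*u - b0* v) + b0*(a* v - c*u)"
     "u * (d0*b - b0*d) = b*(d0*u - b0* v) - b0*(d*u - b* v)"
     "u * (a0*c - c0*a) = a*(a0* v - c0*u) - a0*(a* v - c*u)"
     "u * (a0*d - c0*b) = b*(a0* v - c0*u) + a0*(d*u - b* v)"
     by (auto simp: algebra_simps)
    from u show ?thesis
    proof
     assume n: "\<not> p dvd u"
     have "p dvd u * (d0*a - b0*c)" "p dvd u * (d0*b - b0*d)" "p dvd u * (a0*c - c0*a)" "p dvd u * (a0*d - c0*b)"
      unfolding u1 using 1 2 by auto
     then show ?thesis using n p by (auto simp: prime_dvd_mult_iff)
    next
     assume n: "\<not> p dvd v"
     have "p dvd v * (d0*a - b0*c)" "p dvd v * (d0*b - b0*d)" "p dvd v * (a0*c - c0*a)" "p dvd v * (a0*d - c0*b)"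
      unfolding v1 using 1 2 by auto
     then show ?thesis using n p by (auto simp: prime_dvd_mult_iff)
    qed
   qed
   have "mat_dvd p (mat_mul (mat_adj x) G)" "mat_dvd p (mat_mul (mat_adj x0) G)" using x x0 by auto
   then have d: "p dvd d0*a - b0*c \<and> p dvd d0*b - b0*d \<and> p dvd a0*c - c0*a \<and> p dvd a0*d - c0*b"
    using *[of g1 g2] *[of h1 h2] G unfolding xe x0e Ge by (auto simp: algebra_simps)
   have sq: "a\<^sup>2 <= K*p" "b\<^sup>2 <= K*p" "c\<^sup>2 <= K*p" "d\<^sup>2 <= K*p" "a0\<^sup>2 <= K*p" "b0\<^sup>2 <= K*p" "c0\<^sup>2 <= K*p" "d0\<^sup>2 <= K*p"
    using x x0 by (auto simp: xe x0e bounded_letters_def)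
   have bd: "m div p \<in> ?I" if "\<bar>m\<bar> <= 2*K*p" "p dvd m" for m
   proof -
    from that(2) obtain j where j: "m = p * j" by blast
    have "\<bar>p\<bar>*\<bar>j\<bar> <= 2*K*p" using that(1) unfolding j abs_mult .
    then have "p*\<bar>j\<bar> <= p * (2*K)" using p0 by (simp add: algebra_simps)
    then have "\<bar>j\<bar> <= 2*K" using p0 mult_le_cancel_left_pos by blast
    then show ?thesis using p0 by (auto simp: j)
   qed
   have ab: "\<bar>u * v - u' * v'\<bar> <= 2*K*p" if "u\<^sup>2 <= K*p" "v\<^sup>2 <= K*p" "u'\<^sup>2 <= K*p" "v'\<^sup>2 <= K*p" for u v u' v'
    using abs_mult_le_of_squares[OF that(1,2)] abs_mult_le_of_squares[OF that(3,4)] by linarith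
   have e: "mat_mul (mat_adj x0) x = (d0*a - b0*c, d0*b - b0*d, a0*c - c0*a, a0*d - c0*b)"
    by (simp add: xe x0e algebra_simps)
   have "d0*a - b0*c \<in> UNIV" by simp
   show ?thesis unfolding e using d bd ab sq by auto
  qed
  have inj: "inj_on ?h ?Y"
  proof (rule inj_onI)
   fix x y assume x: "x \<in> ?Y" and y: "y \<in> ?Y" and e: "?h x = ?h y"
   have "mat_mul (mat_adj x0) x = mat_mul (mat_adj x0) y"
    using key[OF x] key[OF y] mat_scale_div e by metis
   then have "mat_mul (mat_mul x0 (mat_adj x0)) x = mat_mul (mat_mul x0 (mat_adj x0)) y"
    by (simp add: mat_mul_assoc)
   moreover have "mat_det x0 = p" using x0 mat_det_letter by blast
   ultimately show "x = y" using p0 mat_scale_inj[of p x y] by (simp add: mat_mul_adj)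
  qed
  have sub: "?h ` ?Y \<subseteq> ?I \<times> ?I \<times> ?I \<times> ?I" using key by blast
  have fin: "finite (?I \<times> ?I \<times> ?I \<times> ?I)" by auto
  have "card ?Y <= card (?I \<times> ?I \<times> ?I \<times> ?I)" by (rule card_inj_on_le[OF inj sub fin])
  also have "\<dots> = nat ((4*K+1)^4)"
  proof -
   have ci: "card ?I = nat (4*K+1)" using K by simp
   show ?thesis unfolding card_cartesian_product ci using K
    by (simp add: nat_power_eq power4_eq_xxxx mult.assoc nat_mult_distrib)
  qed
  finally have "card ?Y <= nat ((4*K+1)^4)" .
  moreover have "finite ?Y" by (rule finite_imageD[OF finite_subset[OF sub fin] inj])
  ultimately show ?thesis by blast
 next
  case True
  show ?thesis unfolding True by simp
 qed
 then show "finite ?Y" "card ?Y <= nat ((4*K+1)^4)" by auto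
qed

lemma finite_lists_subset: "finite Lt ==> finite {xs. length xs = L \<and> set xs \<subseteq> Lt \<and> Q xs}"
 by (rule finite_subset[OF _ finite_lists_length_eq[of Lt L]]) auto

text \<open>Induction on the first letter x. At most (4K+1)^4 letters have \<open>mat_adj x\<close>
  times \<open>G0\<close> divisible by p; for these the remaining product is again p^g times a
  matrix not divisible by p, and the bound for the shorter word applies unchanged. Every other
  letter lowers the exponent g by one, so the saved factor p pays for the at most 2 p such letters;
  for g = 0 there are none. Each letter thus costs the constant (4K+1)^4 + 2, which is the
  quantitative form of freeness that is needed.\<close>

lemma card_words_with_product:
 fixes p K :: int
 assumes p: "prime p" and K: "K >= 0" and Lt: "Lt \<subseteq> bounded_letters K p" "finite Lt" "int (card Lt) <= 2*p"
  and G0: "\<not> mat_dvd p G0"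
 shows "int (card {xs. length xs = L \<and> set xs \<subseteq> Lt \<and> mat_prod xs = mat_scale (p^g) G0}) <= ((4*K+1)^4 + 2)^L * p^g"
 using G0
proof (induction L arbitrary: g G0)
 case 0
 have p1: "p >= 1" using prime_gt_0_int[OF p] by simp
 have "{xs. length xs = 0 \<and> set xs \<subseteq> Lt \<and> mat_prod xs = mat_scale (p^g) G0} \<subseteq> {[]}" by auto
 then have "card {xs. length xs = 0 \<and> set xs \<subseteq> Lt \<and> mat_prod xs = mat_scale (p^g) G0} <= card {[]::imat list}"
  by (intro card_mono) auto
 then show ?case using p1 by (simp add: order_trans[OF _ one_le_power])
next
 case (Suc L)
 let ?C = "(4*K+1)^4 + 2"
 have p0: "p > 0" using p by (simp add: prime_gt_0_int)
 define W where "W L G = {xs. length xs = L \<and> set xs \<subseteq> Lt \<and> mat_prod xs = G}" for L G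
 define X1 where "X1 = {x \<in> Lt. mat_dvd p (mat_mul (mat_adj x) G0)}"
 define V where "V x = {xs. length xs = L \<and> set xs \<subseteq> Lt \<and> mat_mul x (mat_prod xs) = mat_scale (p^g) G0}" for x
 have finW: "finite (W L G)" for L G unfolding W_def using Lt(2) by (rule finite_lists_subset)
 have VE: "mat_scale p (mat_prod xs) = mat_mul (mat_adj x) (mat_scale (p^g) G0)" if "xs \<in> V x" "x \<in> Lt" for xs x
 proof -
  have "mat_det x = p" using that Lt(1) mat_det_letter by blast
  then have "mat_mul (mat_adj x) (mat_mul x (mat_prod xs)) = mat_scale p (mat_prod xs)"
   by (simp flip: mat_mul_assoc add: mat_mul_adj)
  then show ?thesis using that by (simp add: V_def)
 qed
 have X1: "int (card (V x)) <= ?C^L * p^g" if x: "x \<in> X1" for x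
 proof -
  define G1 where "G1 = mat_div (mat_mul (mat_adj x) G0) p"
  have G1: "mat_scale p G1 = mat_mul (mat_adj x) G0" using x by (simp add: G1_def X1_def mat_scale_div)
  have dx: "mat_det x = p" using x Lt(1) mat_det_letter unfolding X1_def by blast
  have "\<not> mat_dvd p G1"
  proof
   assume "mat_dvd p G1"
   then obtain G2 where "G1 = mat_scale p G2" by (metis mat_scale_div)
   then have "mat_mul x (mat_scale p (mat_scale p G2)) = mat_mul x (mat_mul (mat_adj x) G0)" using G1 by simp
   also have "\<dots> = mat_scale p G0" by (simp flip: mat_mul_assoc add: mat_mul_adj dx)
   finally have "mat_scale p (mat_scale p (mat_mul x G2)) = mat_scale p G0" by simp
   then have "mat_scale p (mat_mul x G2) = G0" using p0 mat_scale_inj by (metis less_irrefl)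
   then show False using Suc.prems mat_dvd_scale by metis
  qed
  moreover have "V x \<subseteq> W L (mat_scale (p^g) G1)"
  proof
   fix xs assume xs: "xs \<in> V x"
   have "mat_scale p (mat_prod xs) = mat_scale p (mat_scale (p^g) G1)"
    using VE[OF xs] x G1 by (simp add: X1_def) (metis mat_scale_scale mult.commute)
   then have "mat_prod xs = mat_scale (p^g) G1" using p0 mat_scale_inj by (metis less_irrefl)
   then show "xs \<in> W L (mat_scale (p^g) G1)" using xs by (simp add: V_def W_def)
  qed
  ultimately have nd: "\<not> mat_dvd p G1" and sub: "V x \<subseteq> W L (mat_scale (p^g) G1)" by auto
  have "int (card (V x)) <= int (card (W L (mat_scale (p^g) G1)))"
   using card_mono[OF finW sub] by simp
  also have "\<dots> <= ?C^L * p^g" using Suc.IH[OF nd, of g] unfolding W_def .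
  finally show ?thesis .
 qed
 have X2: "int (card (V x)) * p <= ?C^L * p^g" if x: "x \<in> Lt - X1" for x
 proof (cases g)
  case 0
  have "V x = {}"
  proof (rule ccontr)
   assume "V x \<noteq> {}"
   then obtain xs where "xs \<in> V x" by blast
   from VE[OF this] x 0 have "mat_mul (mat_adj x) G0 = mat_scale p (mat_prod xs)" by simp
   then show False using x mat_dvd_scale by (metis (no_types, lifting) DiffD1 DiffD2 X1_def mem_Collect_eq)
  qed
  then show ?thesis using K p0 by simp
 next
  case (Suc g')
  have nd: "\<not> mat_dvd p (mat_mul (mat_adj x) G0)" using x by (auto simp: X1_def)
  have sub: "V x \<subseteq> W L (mat_scale (p^g') (mat_mul (mat_adj x) G0))"
  proof
   fix xs assume xs: "xs \<in> V x"
   have "mat_scale p (mat_prod xs) = mat_scale p (mat_scale (p^g') (mat_mul (mat_adj x) G0))"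
    using VE[OF xs] x Suc by simp
   then have "mat_prod xs = mat_scale (p^g') (mat_mul (mat_adj x) G0)" using p0 mat_scale_inj by (metis less_irrefl)
   then show "xs \<in> W L (mat_scale (p^g') (mat_mul (mat_adj x) G0))" using xs by (simp add: V_def W_def)
  qed
  have "int (card (V x)) <= int (card (W L (mat_scale (p^g') (mat_mul (mat_adj x) G0))))"
   using card_mono[OF finW sub] by simp
  also have "\<dots> <= ?C^L * p^g'" using Suc.IH[OF nd, of g'] unfolding W_def .
  finally have "int (card (V x)) * p <= (?C^L * p^g') * p" using p0 by (intro mult_right_mono) auto
  then show ?thesis by (simp add: Suc algebra_simps)
 qed
 have sub: "W (Suc L) (mat_scale (p^g) G0) \<subseteq> (\<Union>x\<in>Lt. (#) x ` V x)"
 proof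
  fix ys assume ys: "ys \<in> W (Suc L) (mat_scale (p^g) G0)"
  then obtain x xs where "ys = x # xs" by (cases ys) (auto simp: W_def)
  then show "ys \<in> (\<Union>x\<in>Lt. (#) x ` V x)" using ys by (auto simp: W_def V_def)
 qed
 have finV: "finite (V x)" for x unfolding V_def using Lt(2) by (rule finite_lists_subset)
 have "card (W (Suc L) (mat_scale (p^g) G0)) <= card (\<Union>x\<in>Lt. (#) x ` V x)"
  using sub Lt(2) finV by (intro card_mono) auto
 also have "\<dots> <= (\<Sum>x\<in>Lt. card ((#) x ` V x))" using Lt(2) by (rule card_UN_le)
 also have "\<dots> <= (\<Sum>x\<in>Lt. card (V x))" by (intro sum_mono card_image_le finV)
 also have "\<dots> = (\<Sum>x\<in>X1. card (V x)) + (\<Sum>x\<in>Lt - X1. card (V x))"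
  using Lt(2) by (subst sum.subset_diff[of X1 Lt]) (auto simp: X1_def)
 finally have 1: "int (card (W (Suc L) (mat_scale (p^g) G0))) <= (\<Sum>x\<in>X1. int (card (V x))) + (\<Sum>x\<in>Lt - X1. int (card (V x)))"
  by (simp flip: of_nat_sum of_nat_add)
 have cX1: "int (card X1) <= (4*K+1)^4"
 proof -
  have "card X1 <= card {x \<in> bounded_letters K p. mat_dvd p (mat_mul (mat_adj x) G0)}"
   using card_left_divisors(1)[OF p Suc.prems K] Lt(1) by (intro card_mono) (auto simp: X1_def)
  also have "\<dots> <= nat ((4*K+1)^4)" by (rule card_left_divisors(2)[OF p Suc.prems K])
  finally have "int (card X1) <= int (nat ((4*K+1)^4))" by (simp only: of_nat_le_iff)
  then show ?thesis by simp
 qed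
 have s1: "(\<Sum>x\<in>X1. int (card (V x))) <= (4*K+1)^4 * (?C^L * p^g)"
 proof -
  have "(\<Sum>x\<in>X1. int (card (V x))) <= int (card X1) * (?C^L * p^g)"
   using sum_bounded_above[of X1 "%x. int (card (V x))"] X1 by simp
  also have "\<dots> <= (4*K+1)^4 * (?C^L * p^g)" using cX1 p0 K by (intro mult_right_mono) auto
  finally show ?thesis .
 qed
 have s2: "(\<Sum>x\<in>Lt - X1. int (card (V x))) <= 2 * (?C^L * p^g)"
 proof -
  have "(\<Sum>x\<in>Lt - X1. int (card (V x))) * p = (\<Sum>x\<in>Lt - X1. int (card (V x)) * p)" by (simp add: sum_distrib_right)
  also have "\<dots> <= int (card (Lt - X1)) * (?C^L * p^g)"
   using sum_bounded_above[of "Lt - X1" "%x. int (card (V x)) * p"] X2 by simp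
  also have "\<dots> <= (2*p) * (?C^L * p^g)"
  proof (intro mult_right_mono)
   have "card (Lt - X1) <= card Lt" using Lt(2) by (intro card_mono) auto
   then show "int (card (Lt - X1)) <= 2*p" using Lt(3) by simp
  qed (use p0 K in auto)
  finally have "(\<Sum>x\<in>Lt - X1. int (card (V x))) * p <= (2 * (?C^L * p^g)) * p" by (simp add: algebra_simps)
  then show ?thesis using p0 mult_le_cancel_right_pos by blast
 qed
 have "int (card (W (Suc L) (mat_scale (p^g) G0))) <= ?C^Suc L * p^g"
  using 1 s1 s2 by (simp add: algebra_simps)
 then show ?case by (simp add: W_def)
qed

section \<open>The divisor function is smaller than every fixed power\<close>

definition divs :: "nat \<Rightarrow> nat" where "divs m = card {d. d dvd m}"

lemma divs_prime_power_mult: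
 assumes q: "prime q" and m: "m > 0" "\<not> q dvd m"
 shows "divs (q^a * m) <= (a+1) * divs m"
proof -
 have "{d. d dvd q^a * m} \<subseteq> (%(i, d). q^i * d) ` ({..a} \<times> {d. d dvd m})"
 proof
  fix d assume "d \<in> {d. d dvd q^a * m}"
  then obtain x y where xy: "d = x * y" "x dvd q^a" "y dvd m" by (auto elim: dvd_productE)
  then obtain i where "i <= a" "x = q^i" using divides_primepow_nat[OF q] by blast
  then show "d \<in> (%(i, d). q^i * d) ` ({..a} \<times> {d. d dvd m})" using xy by force
 qed
 then have "divs (q^a * m) <= card ((%(i, d). q^i * d) ` ({..a} \<times> {d. d dvd m}))"
  unfolding divs_def using m by (intro card_mono) (auto)
 also have "\<dots> <= card ({..a} \<times> {d. d dvd m})" using m by (intro card_image_le) auto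
 also have "\<dots> = (a+1) * divs m" by (simp add: divs_def card_cartesian_product)
 finally show ?thesis .
qed

lemma exp_dominates_poly: "\<exists>M::nat. M > 0 \<and> (\<forall>a. (a+1)^k <= M * 2^a)"
proof -
 have "(%a. real (a+1)^k / 2^a) \<longlonglongrightarrow> 0"
  by real_asymp
 then have "Bseq (%a. real (a+1)^k / 2^a)" by (intro convergent_imp_Bseq convergentI)
 then obtain B where B: "B > 0" "\<And>a. norm (real (a+1)^k / 2^a) <= B" by (auto elim: BseqE)
 have "(a+1)^k <= nat \<lceil>B\<rceil> * 2^a" for a
 proof -
  have "real (a+1)^k <= B * 2^a" using B(2)[of a] by (simp add: field_simps)
  also have "\<dots> <= real (nat \<lceil>B\<rceil>) * 2^a" by (intro mult_right_mono real_nat_ceiling_ge) simp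
  finally have "real ((a+1)^k) <= real (nat \<lceil>B\<rceil> * 2^a)" by simp
  then show ?thesis by (simp only: of_nat_le_iff)
 qed
 moreover have "nat \<lceil>B\<rceil> > 0" using B(1) by simp
 ultimately show ?thesis by blast
qed

text \<open>The k-th power of the divisor function is compared with m prime by prime. For a prime q
  >= 2^k the local factor (a+1)^k is at most q^a because a + 1 <= 2^a; each of the fewer than 2^k
  smaller primes costs at most a constant \<open>M\<close>. Stating the bound for a k-th power
  avoids real exponents.\<close>

lemma divs_bound: "\<exists>C::nat. C > 0 \<and> (\<forall>m>0. divs m ^ k <= C * m)"
proof -
 obtain M :: nat where M: "M > 0" "\<And>a. (a+1)^k <= M * 2^a" using exp_dominates_poly by blast
 define c where "c q = (if q < 2^k then M else 1)" for q :: nat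
 have c1: "c q >= 1" for q using M(1) by (auto simp: c_def)
 have cq: "(a+1)^k <= c q * q^a" if "prime q" for a q
 proof (cases "q < 2^k")
  case True
  have "(2::nat)^a <= q^a" using prime_ge_2_nat[OF that] by (intro power_mono) auto
  then have "M * 2^a <= c q * q^a" using True by (simp add: c_def)
  then show ?thesis using M(2)[of a] by linarith
 next
  case False
  have "a + 1 <= 2^a" by (induction a) auto
  then have "(a+1)^k <= (2^a)^k" by (intro power_mono) auto
  also have "\<dots> = (2^k)^a" by (simp flip: power_mult add: mult.commute)
  also have "\<dots> <= q^a" using False by (intro power_mono) auto
  finally show ?thesis using False by (simp add: c_def)
 qed
 have main: "divs m ^ k <= (\<Prod>q\<in>prime_factors m. c q) * m" if "m > 0" for m
  using that
 proof (induction m rule: less_induct)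
  case (less m)
  show ?case
  proof (cases "m = 1")
   case True
   then have "{d. d dvd m} = {1}" by auto
   then show ?thesis using True by (simp add: divs_def)
  next
   case False
   then obtain q where q: "prime q" "q dvd m" using prime_factor_nat by blast
   define a where "a = multiplicity q m"
   obtain m' where m': "m = q^a * m'" "\<not> q dvd m'"
    using multiplicity_decompose'[of m q] less.prems q prime_gt_1_nat[OF q(1)] unfolding a_def by auto
   have a0: "a > 0" using q less.prems unfolding a_def by (simp add: prime_multiplicity_gt_zero_iff)
   have m'0: "m' > 0" using m' less.prems by (intro Nat.gr0I) auto
   have lt: "m' < m" using m' m'0 a0 q prime_gt_1_nat[OF q(1)] one_less_power[of q a] by simp
   have pf: "prime_factors m = insert q (prime_factors m')"
    using m' m'0 a0 q by (auto simp: prime_factors_dvd prime_dvd_mult_iff prime_dvd_power_iff primes_dvd_imp_eq)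
   have "divs m ^ k <= ((a+1) * divs m')^k"
    using divs_prime_power_mult[OF q(1) m'0 m'(2), of a] m' by (intro power_mono) auto
   also have "\<dots> = (a+1)^k * divs m' ^ k" by (rule power_mult_distrib)
   also have "\<dots> <= (c q * q^a) * ((\<Prod>q\<in>prime_factors m'. c q) * m')"
    using cq[OF q(1)] less.IH[OF lt m'0] by (intro mult_mono) auto
   also have "\<dots> = (\<Prod>q\<in>prime_factors m. c q) * m"
   proof -
    have "(\<Prod>q\<in>prime_factors m. c q) = c q * (\<Prod>q\<in>prime_factors m'. c q)"
     unfolding pf using m'(2) by (subst prod.insert) (auto simp: prime_factors_dvd)
    then show ?thesis using m'(1) by (metis (no_types, lifting) mult.assoc mult.left_commute)
   qed
   finally show ?thesis .
  qed
 qed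
 have "divs m ^ k <= M^(2^k) * m" if "m > 0" for m
 proof -
  have "(\<Prod>q\<in>prime_factors m. c q) = (\<Prod>q\<in>prime_factors m \<inter> {..<2^k}. c q)"
   by (intro prod.mono_neutral_right) (auto simp: c_def)
  also have "\<dots> = M ^ card (prime_factors m \<inter> {..<2^k})" by (simp add: c_def)
  also have "\<dots> <= M ^ (2^k)"
  proof (rule power_increasing)
   have "card (prime_factors m \<inter> {..<2^k}) <= card {..<(2::nat)^k}" by (intro card_mono) auto
   then show "card (prime_factors m \<inter> {..<2^k}) <= 2^k" by simp
  qed (use M in auto)
  finally show ?thesis using main[OF that] by (meson le_trans mult_le_mono1)
 qed
 then show ?thesis using M(1) by (intro exI[of _ "M^(2^k)"]) auto
qed

section \<open>Number of words whose product is close to a scalar matrix\<close>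

definition near_scalar :: "int \<Rightarrow> real \<Rightarrow> imat set" where
 "near_scalar N H = {(a, b, c, d). a*d - b*c = N\<^sup>2 \<and> \<bar>real_of_int (a-N)\<bar> <= H \<and> \<bar>real_of_int (d-N)\<bar> <= H \<and>
  \<bar>real_of_int b\<bar> <= H \<and> \<bar>real_of_int c\<bar> <= H}"

lemma card_int_abs_le:
 assumes "H >= 0"
 shows "finite {x::int. \<bar>real_of_int x\<bar> <= H}" "real (card {x::int. \<bar>real_of_int x\<bar> <= H}) <= 2*H+1"
proof -
 have e: "{x::int. \<bar>real_of_int x\<bar> <= H} = {-\<lfloor>H\<rfloor>..\<lfloor>H\<rfloor>}" by (auto simp: abs_le_iff le_floor_iff) linarith+
 show "finite {x::int. \<bar>real_of_int x\<bar> <= H}" unfolding e by simp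
 have "card {-\<lfloor>H\<rfloor>..\<lfloor>H\<rfloor>} = nat (2*\<lfloor>H\<rfloor>+1)" by simp
 then show "real (card {x::int. \<bar>real_of_int x\<bar> <= H}) <= 2*H+1" unfolding e
  using assms of_int_floor_le[of H] by (simp add: nat_le_real_less[symmetric]) 
qed

lemma card_int_factorisations:
 fixes m :: int assumes "m \<noteq> 0"
 shows "finite {(b, c). b * c = m}" "card {(b, c). b * c = m} <= 2 * divs (nat \<bar>m\<bar>)"
proof -
 let ?D = "{d. d dvd nat \<bar>m\<bar>}"
 have fD: "finite ?D" by (rule finite_divisors_nat) (use assms in simp)
 have sub: "{(b, c). b * c = m} \<subseteq> (%d. (int d, m div int d)) ` ?D \<union> (%d. (- int d, m div (- int d))) ` ?D"
 proof clarify
  fix b c :: int assume bc: "m = b * c" and n: "(b, c) \<notin> (%d. (- int d, b * c div - int d)) ` {d. d dvd nat \<bar>b * c\<bar>}"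
  have b0: "b \<noteq> 0" using bc assms by auto
  have d: "nat \<bar>b\<bar> dvd nat \<bar>b*c\<bar>" by (simp add: abs_mult nat_mult_distrib)
  show "(b, c) \<in> (%d. (int d, b * c div int d)) ` {d. d dvd nat \<bar>b * c\<bar>}"
  proof (cases "b > 0")
   case True
   then show ?thesis using d b0 by (intro image_eqI[of _ _ "nat \<bar>b\<bar>"]) auto
  next
   case False
   then have "(b, c) \<in> (%d. (- int d, b * c div - int d)) ` {d. d dvd nat \<bar>b * c\<bar>}"
    using d b0 by (intro image_eqI[of _ _ "nat \<bar>b\<bar>"]) auto
   then show ?thesis using n by blast
  qed
 qed
 show "finite {(b, c). b * c = m}" by (rule finite_subset[OF sub]) (use fD in auto)
 have "card {(b, c). b * c = m} <= card ((%d. (int d, m div int d)) ` ?D \<union> (%d. (- int d, m div (- int d))) ` ?D)"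
  using fD by (intro card_mono[OF _ sub]) auto
 also have "\<dots> <= card ((%d. (int d, m div int d)) ` ?D) + card ((%d. (- int d, m div (- int d))) ` ?D)" by (rule card_Un_le)
 also have "\<dots> <= card ?D + card ?D" by (intro add_mono card_image_le fD)
 finally show "card {(b, c). b * c = m} <= 2 * divs (nat \<bar>m\<bar>)" by (simp add: divs_def)
qed

text \<open>A determinant-\<open>N\<^sup>2\<close> matrix within \<open>H\<close> of \<open>N\<close> times the identity has trace within \<open>2H\<^sup>2/N\<close> of
 \<open>2N\<close>; trace and one diagonal entry fix the product of the off-diagonal entries.\<close>

lemma card_near_scalar:
 fixes N :: int and H :: real
 assumes N: "N > 0" and H: "0 <= H" "H < N"
  and D: "\<And>m. 0 < m ==> real m <= (real_of_int N)\<^sup>2 ==> real (divs m) <= D"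
 shows "finite (near_scalar N H)"
  and "real (card (near_scalar N H)) <= D * (2*H+1) * (8 * H\<^sup>2 / N + 6)"
proof -
 define I where "I r = {x::int. \<bar>real_of_int x\<bar> <= r}" for r
 have fI: "finite (I r)" if "r >= 0" for r unfolding I_def by (rule card_int_abs_le(1)[OF that])
 have cI: "real (card (I r)) <= 2*r+1" if "r >= 0" for r unfolding I_def by (rule card_int_abs_le(2)[OF that])
 define T where "T = 2*H\<^sup>2/N"
 have T0: "T >= 0" using N by (simp add: T_def)
 define J where "J = I H \<times> I T"
 define m where "m A t = N*t + A*(t-A)" for A t
 define J' where "J' = {(A,t)\<in>J. m A t \<noteq> 0 \<and> real_of_int \<bar>m A t\<bar> <= H\<^sup>2}"
 \<comment> \<open>With A = a - N and t = a + d - 2 N, the determinant condition reads b c =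
   \<open>m A t\<close>. If this is nonzero, b is one of its divisors up to sign. If it is zero, it
   has infinitely many factorisations, so these matrices go into \<open>Z2\<close>: there a d = N^2,
   which again has few solutions, and one of b and c is zero while the other is only
   bounded.\<close>
 define Z1 where "Z1 = (\<Union>(A,t)\<in>J'. (%(b,c). (N+A,b,c,N+t-A)) ` {(b,c). b*c = m A t})"
 define E where "E = {(a,d). a*d = N\<^sup>2}"
 define Q where "Q = (%b. (b,0)) ` I H \<union> (%c. (0,c)) ` I H"
 define Z2 where "Z2 = (%((a,d),(b,c)). (a,b,c,d)) ` (E \<times> Q)"
 have fJ: "finite J'" by (rule finite_subset[of _ J]) (auto simp: J'_def J_def intro!: fI H T0)
 have D0: "D >= 0" using D[of 1] N order_trans[of 0 "real (divs 1)" D] by (simp add: power2_eq_square)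
   (metis N mult_mono of_nat_0_le_iff int_one_le_iff_zero_less of_int_1_le_iff mult_1 order.trans zero_le_one)
 have sub: "near_scalar N H \<subseteq> Z1 \<union> Z2"
 proof
  fix x assume x: "x \<in> near_scalar N H"
  obtain a b c d where xe: "x = (a,b,c,d)" by (cases x)
  have h: "a*d - b*c = N\<^sup>2" "\<bar>real_of_int (a-N)\<bar> <= H" "\<bar>real_of_int (d-N)\<bar> <= H" "\<bar>real_of_int b\<bar> <= H" "\<bar>real_of_int c\<bar> <= H"
   using x by (auto simp: xe near_scalar_def)
  define A where "A = a - N"
  define t where "t = a + d - 2*N"
  have bc: "b*c = m A t" using h(1) by (simp add: m_def A_def t_def algebra_simps power2_eq_square)
  have bcH: "\<bar>real_of_int b * real_of_int c\<bar> <= H * H" unfolding abs_mult by (intro mult_mono) (use h H in auto)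
  have adH: "\<bar>real_of_int (a-N) * real_of_int (d-N)\<bar> <= H * H" unfolding abs_mult by (intro mult_mono) (use h H in auto)
  have "N * t = b*c - (a-N)*(d-N)" using h(1) by (simp add: t_def algebra_simps power2_eq_square)
  then have "real_of_int N * real_of_int t = real_of_int b * real_of_int c - real_of_int (a-N) * real_of_int (d-N)"
   by (metis of_int_diff of_int_mult)
  then have "\<bar>real_of_int N * real_of_int t\<bar> <= 2 * (H*H)" using bcH adH by linarith
  then have tT: "\<bar>real_of_int t\<bar> <= T" using N by (simp add: T_def abs_mult field_simps power2_eq_square)
  show "x \<in> Z1 \<union> Z2"
  proof (cases "b*c = 0")
   case False
   have "(A,t) \<in> J'" using bc False bcH h tT
    by (auto simp: J'_def J_def I_def A_def power2_eq_square simp flip: of_int_mult)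
   moreover have "x = (%(b,c). (N+A,b,c,N+t-A)) (b,c)" by (simp add: xe A_def t_def)
   ultimately show ?thesis unfolding Z1_def using bc by blast
  next
   case True
   have "(a,d) \<in> E" using h(1) True by (simp add: E_def)
   moreover have "(b,c) \<in> Q" using True h by (auto simp: Q_def I_def)
   moreover have "x = (%((a,d),(b,c)). (a,b,c,d)) ((a,d),(b,c))" by (simp add: xe)
   ultimately show ?thesis unfolding Z2_def by blast
  qed
 qed
 have N2: "N\<^sup>2 \<noteq> 0" using N by simp
 have fE: "finite E" "card E <= 2 * divs (nat \<bar>N\<^sup>2\<bar>)" unfolding E_def using card_int_factorisations[OF N2] by auto
 have fQ: "finite Q" unfolding Q_def using fI[OF H(1)] by auto
 have fZ1: "finite Z1" unfolding Z1_def
  by (intro finite_UN_I fJ) (auto simp: J'_def intro!: finite_imageI card_int_factorisations(1))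
 have fZ2: "finite Z2" unfolding Z2_def using fE fQ by auto
 show "finite (near_scalar N H)" by (rule finite_subset[OF sub]) (use fZ1 fZ2 in auto)
 have c1: "real (card Z1) <= (2*H+1) * (2*T+1) * (2*D)"
 proof -
  have "card Z1 <= (\<Sum>(A,t)\<in>J'. card ((%(b,c). (N+A,b,c,N+t-A)) ` {(b,c). b*c = m A t}))"
   unfolding Z1_def using card_UN_le[OF fJ] by (simp add: case_prod_unfold)
  then have "real (card Z1) <= (\<Sum>(A,t)\<in>J'. real (card ((%(b,c). (N+A,b,c,N+t-A)) ` {(b,c). b*c = m A t})))"
   by (simp add: case_prod_unfold flip: of_nat_sum)
  also have "\<dots> <= (\<Sum>(A,t)\<in>J'. 2*D)"
  proof (intro sum_mono, clarify)
   fix A t assume At: "(A,t) \<in> J'"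
   then have n: "m A t \<noteq> 0" "real_of_int \<bar>m A t\<bar> <= H\<^sup>2" by (auto simp: J'_def)
   have "card ((%(b,c). (N+A,b,c,N+t-A)) ` {(b,c). b*c = m A t}) <= card {(b,c). b*c = m A t}"
    by (intro card_image_le card_int_factorisations(1) n)
   also have "\<dots> <= 2 * divs (nat \<bar>m A t\<bar>)" by (rule card_int_factorisations(2)[OF n(1)])
   finally have "real (card ((%(b,c). (N+A,b,c,N+t-A)) ` {(b,c). b*c = m A t})) <= 2 * real (divs (nat \<bar>m A t\<bar>))"
    by linarith
   moreover have "H\<^sup>2 <= (real_of_int N)\<^sup>2" using H by (intro power_mono) auto
   then have "real (divs (nat \<bar>m A t\<bar>)) <= D" using n by (intro D) auto
   ultimately show "real (card ((%(b,c). (N+A,b,c,N+t-A)) ` {(b,c). b*c = m A t})) <= 2*D" by linarith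
  qed
  also have "\<dots> = real (card J') * (2*D)" by (simp add: case_prod_unfold)
  also have "\<dots> <= ((2*H+1) * (2*T+1)) * (2*D)"
  proof (intro mult_right_mono)
   have "card J' <= card J" by (intro card_mono) (auto simp: J'_def J_def intro!: fI H T0)
   then have "real (card J') <= real (card (I H)) * real (card (I T))" unfolding J_def card_cartesian_product by (simp flip: of_nat_mult)
   also have "\<dots> <= (2*H+1) * (2*T+1)" by (intro mult_mono cI H T0) (use H in auto)
   finally show "real (card J') <= (2*H+1) * (2*T+1)" .
  qed (use D0 in auto)
  finally show ?thesis .
 qed
 have c2: "real (card Z2) <= (2*D) * (2*(2*H+1))"
 proof -
  have "card Z2 <= card (E \<times> Q)" unfolding Z2_def using fE fQ by (intro card_image_le) auto
  then have "real (card Z2) <= real (card E) * real (card Q)" by (simp add: card_cartesian_product flip: of_nat_mult)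
  also have "\<dots> <= (2*D) * (2*(2*H+1))"
  proof (intro mult_mono)
   have "real (divs (nat \<bar>N\<^sup>2\<bar>)) <= D" using N by (intro D) auto
   then show "real (card E) <= 2*D" using fE(2) by linarith
   have "card Q <= card ((%b. (b,0::int)) ` I H) + card ((%c. (0::int,c)) ` I H)" unfolding Q_def by (rule card_Un_le)
   also have "\<dots> <= card (I H) + card (I H)" by (intro add_mono card_image_le fI H)
   finally have "real (card Q) <= real (card (I H)) + real (card (I H))" by (simp only: of_nat_add[symmetric] of_nat_le_iff)
   also have "\<dots> <= (2*H+1) + (2*H+1)" by (intro add_mono cI H)
   finally show "real (card Q) <= 2*(2*H+1)" by simp
  qed (use D0 in auto)
  finally show ?thesis .
 qed
 have "card (near_scalar N H) <= card Z1 + card Z2"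
  by (rule order_trans[OF card_mono[OF _ sub] card_Un_le]) (use fZ1 fZ2 in auto)
 then have "real (card (near_scalar N H)) <= real (card Z1) + real (card Z2)" by linarith
 also have "\<dots> <= (2*H+1) * (2*T+1) * (2*D) + (2*D) * (2*(2*H+1))" using c1 c2 by linarith
 also have "\<dots> = D * (2*H+1) * (8 * H\<^sup>2 / N + 6)" by (simp add: T_def algebra_simps)
 finally show "real (card (near_scalar N H)) <= D * (2*H+1) * (8 * H\<^sup>2 / N + 6)" .
qed

text \<open>The cost per letter in \<open>card_words_with_product\<close> at K = 1600, the value of
  K that \<open>gens_subset_letters\<close> provides.\<close>

definition word_const :: int where "word_const = (4*1600+1)^4 + 2"

lemma mat_content_decompose:
 fixes p :: int
 assumes p: "prime p" and G: "mat_det G \<noteq> 0"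
 shows "\<exists>g G0. G = mat_scale (p^g) G0 \<and> \<not> mat_dvd p G0"
 using G
proof (induction "nat \<bar>mat_det G\<bar>" arbitrary: G rule: less_induct)
 case less
 show ?case
 proof (cases "mat_dvd p G")
  case True
  define G1 where "G1 = mat_div G p"
  have G1: "G = mat_scale p G1" using mat_scale_div[OF True] by (simp add: G1_def)
  have d: "mat_det G = p\<^sup>2 * mat_det G1" by (simp add: G1 mat_det_scale)
  have n0: "mat_det G1 \<noteq> 0" using d less.prems by auto
  have "p\<^sup>2 > 1" using prime_gt_1_int[OF p] by (simp add: one_less_power)
  then have "\<bar>mat_det G1\<bar> < \<bar>p\<^sup>2 * mat_det G1\<bar>" using n0 by (simp add: abs_mult)
  then have "\<bar>mat_det G1\<bar> < \<bar>mat_det G\<bar>" unfolding d .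
  then have "nat \<bar>mat_det G1\<bar> < nat \<bar>mat_det G\<bar>" by linarith
  from less.hyps[OF this n0] obtain g G0 where "G1 = mat_scale (p^g) G0" "\<not> mat_dvd p G0" by blast
  then show ?thesis using G1 by (intro exI[of _ "Suc g"] exI[of _ G0]) simp
 next
  case False
  then show ?thesis by (intro exI[of _ 0] exI[of _ G]) simp
 qed
qed

lemma mat_det_prod: "set xs \<subseteq> bounded_letters K p ==> mat_det (mat_prod xs) = p ^ length xs"
proof (induction xs)
 case (Cons x xs)
 then show ?case using mat_det_letter[of x K p] by (simp add: mat_det_mul)
qed (simp add: mat_one_def)

text \<open>Distance to the scalar matrix is measured relative to the scalar, so e survives the
  removal of a common factor p^g.\<close>

lemma near_scalar_scale:
 fixes p :: int and e :: real
 assumes p: "p > 0" and g: "g <= m" and G: "mat_scale (p^g) G0 \<in> near_scalar (p^m) (e * p^m)"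
 shows "G0 \<in> near_scalar (p^(m-g)) (e * p^(m-g))"
proof -
 obtain a b c d where ge: "G0 = (a,b,c,d)" by (cases G0)
 define P where "P = p^g"
 define N where "N = p^(m-g)"
 have P0: "P > 0" using p by (simp add: P_def)
 have pm: "p^m = P * N" using g by (simp add: P_def N_def flip: power_add)
 have h: "P*a*(P*d) - P*b*(P*c) = (P*N)\<^sup>2" "\<bar>real_of_int (P*a-P*N)\<bar> <= e * (P*N)" "\<bar>real_of_int (P*d-P*N)\<bar> <= e * (P*N)"
   "\<bar>real_of_int (P*b)\<bar> <= e * (P*N)" "\<bar>real_of_int (P*c)\<bar> <= e * (P*N)"
  using G unfolding ge pm by (auto simp: near_scalar_def P_def[symmetric] pm)
 have c: "\<bar>real_of_int z\<bar> <= e * N" if "\<bar>real_of_int (P*z)\<bar> <= e * (P*N)" for z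
 proof -
  have "real_of_int P * \<bar>real_of_int z\<bar> <= real_of_int P * (e * N)" using that P0 by (simp add: abs_mult algebra_simps)
  then show ?thesis using P0 by simp
 qed
 have "P\<^sup>2 * (a*d - b*c) = P\<^sup>2 * N\<^sup>2" using h(1) by (simp add: algebra_simps power2_eq_square)
 then have "a*d - b*c = N\<^sup>2" using P0 by simp
 then show ?thesis unfolding ge near_scalar_def N_def[symmetric]
  using c[of "a-N"] c[of "d-N"] c[of b] c[of c] h by (simp add: right_diff_distrib N_def)
qed

text \<open>The product of such a word is p^g times a matrix not divisible by p. The latter is one
  of the points counted by \<open>card_near_scalar\<close> at the scale p^(2n-g), and each point
  carries at most \<open>word_const^(4*n) * p^g\<close> words. Large g means few points with many
  words each; in the extreme case g = 2n the product is exactly scalar. The hypothesis e^3 p^(2n) >=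
  1 makes these contributions no larger than the proportion e^3 of p^(4n), which is the one to be
  expected in a group of dimension three.\<close>

lemma card_words_near_one:
 fixes p :: int and e D :: real
 assumes p: "prime p" and Lt: "Lt \<subseteq> bounded_letters 1600 p" "finite Lt" "int (card Lt) <= 2*p"
  and e: "0 < e" "e < 1" "e^3 * p^(2*n) >= 1"
  and D: "\<And>m. 0 < m ==> real m <= p^(4*n) ==> real (divs m) <= D"
 shows "real (card {xs. length xs = 4*n \<and> set xs \<subseteq> Lt \<and> mat_prod xs \<in> near_scalar (p^(2*n)) (e * p^(2*n))})
  <= real_of_int word_const^(4*n) * real (2*n+1) * D * 42 * e^3 * real_of_int p^(4*n)"
proof -
 let ?W = "%G. {xs. length xs = 4*n \<and> set xs \<subseteq> Lt \<and> mat_prod xs = G}"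
 let ?A = "{xs. length xs = 4*n \<and> set xs \<subseteq> Lt \<and> mat_prod xs \<in> near_scalar (p^(2*n)) (e * p^(2*n))}"
 have p1: "p > 1" using p by (rule prime_gt_1_int)
 then have p1r: "real_of_int p >= 1" by simp
 define Ns where "Ns g = near_scalar (p^(2*n-g)) (e * p^(2*n-g)) \<inter> {G0. \<not> mat_dvd p G0}" for g
 have cNs: "finite (near_scalar (p^(2*n-g)) (e * p^(2*n-g)))"
  "real (card (near_scalar (p^(2*n-g)) (e * p^(2*n-g)))) <= D * (2*(e * p^(2*n-g))+1) * (8 * (e * p^(2*n-g))\<^sup>2 / (p^(2*n-g)) + 6)" for g
 proof -
  let ?N = "p^(2*n-g)"
  have N0: "?N > 0" using p1 by simp
  then have Nr: "real_of_int ?N > 0" by (simp only: of_int_0_less_iff)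
  have H: "0 <= e * real_of_int ?N" "e * real_of_int ?N < real_of_int ?N"
   using mult_strict_right_mono[OF e(2) Nr] mult_pos_pos[OF e(1) Nr] by linarith+
  have DD: "real (divs m) <= D" if "0 < m" "real m <= (real_of_int ?N)\<^sup>2" for m
  proof (rule D[OF that(1)])
   have "(real_of_int ?N)\<^sup>2 = real_of_int p^(2*(2*n-g))" by (simp add: power_mult[symmetric] mult.commute)
   also have "\<dots> <= real_of_int p^(4*n)" by (rule power_increasing) (use p1r in auto)
   finally show "real m <= p^(4*n)" using that(2) by simp
  qed
  have "finite (near_scalar ?N (e * real_of_int ?N))" by (rule card_near_scalar(1)[OF N0 H DD])
  then show "finite (near_scalar ?N (e * ?N))" by simp
  have "real (card (near_scalar ?N (e * real_of_int ?N))) <= D * (2*(e * real_of_int ?N)+1) * (8 * (e * real_of_int ?N)\<^sup>2 / real_of_int ?N + 6)"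
   by (rule card_near_scalar(2)[OF N0 H DD])
  then show "real (card (near_scalar ?N (e * ?N))) <= D * (2*(e * ?N)+1) * (8 * (e * ?N)\<^sup>2 / ?N + 6)" by simp
 qed
 have fNs: "finite (Ns g)" for g using cNs(1)[of g] by (simp add: Ns_def)
 have fW: "finite (?W G)" for G using Lt(2) by (rule finite_lists_subset)
 have sub: "?A \<subseteq> (\<Union>g\<in>{..2*n}. \<Union>G0\<in>Ns g. ?W (mat_scale (p^g) G0))"
 proof
  fix xs assume xs: "xs \<in> ?A"
  have det: "mat_det (mat_prod xs) = p^(4*n)" using mat_det_prod[of xs 1600 p] xs Lt(1) by auto
  then have "mat_det (mat_prod xs) \<noteq> 0" using p1 by simp
  from mat_content_decompose[OF p this] obtain g G0 where g: "mat_prod xs = mat_scale (p^g) G0" "\<not> mat_dvd p G0" by blast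
  have "p^(2*g) dvd p^(4*n)" using det g(1) by (metis mat_det_scale dvd_triv_left power_mult mult.commute)
  then have "2*g <= 4*n" using p1 by (simp add: dvd_power_iff)
  then have g2: "g <= 2*n" by simp
  have "G0 \<in> Ns g" unfolding Ns_def using near_scalar_scale[of p g "2*n" G0 e] g g2 p1 xs by auto
  then show "xs \<in> (\<Union>g\<in>{..2*n}. \<Union>G0\<in>Ns g. ?W (mat_scale (p^g) G0))" using g g2 xs by auto
 qed
 have "card ?A <= card (\<Union>g\<in>{..2*n}. \<Union>G0\<in>Ns g. ?W (mat_scale (p^g) G0))"
  by (rule card_mono[OF _ sub]) (auto intro!: fNs fW)
 also have "\<dots> <= (\<Sum>g\<in>{..2*n}. card (\<Union>G0\<in>Ns g. ?W (mat_scale (p^g) G0)))" by (rule card_UN_le) simp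
 also have "\<dots> <= (\<Sum>g\<in>{..2*n}. \<Sum>G0\<in>Ns g. card (?W (mat_scale (p^g) G0)))"
  by (intro sum_mono card_UN_le fNs)
 finally have "real (card ?A) <= (\<Sum>g\<in>{..2*n}. \<Sum>G0\<in>Ns g. real (card (?W (mat_scale (p^g) G0))))"
  by (simp flip: of_nat_sum)
 also have "\<dots> <= (\<Sum>g\<in>{..2*n}. \<Sum>G0\<in>Ns g. real_of_int (word_const^(4*n) * p^g))"
 proof (intro sum_mono)
  fix g G0 assume "G0 \<in> Ns g"
  then have nd: "\<not> mat_dvd p G0" by (simp add: Ns_def)
  have "int (card (?W (mat_scale (p^g) G0))) <= word_const^(4*n) * p^g"
   unfolding word_const_def using card_words_with_product[OF p _ Lt nd, where L = "4*n" and g = g] by simp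
  then have "real_of_int (int (card (?W (mat_scale (p^g) G0)))) <= real_of_int (word_const^(4*n) * p^g)"
   by (rule of_int_le_iff[THEN iffD2])
  then show "real (card (?W (mat_scale (p^g) G0))) <= real_of_int (word_const^(4*n) * p^g)"
   by (rule ord_eq_le_trans[OF of_int_of_nat_eq[symmetric]])
 qed
 also have "\<dots> = (\<Sum>g\<in>{..2*n}. word_const^(4*n) * (real_of_int p^g * real (card (Ns g))))"
  by (simp add: algebra_simps)
 also have "\<dots> <= (\<Sum>g\<in>{..2*n}. word_const^(4*n) * (D * 42 * e^3 * p^(4*n)))"
 proof (intro sum_mono mult_left_mono)
  \<comment> \<open>With P N = Q the product expands into four terms with coefficients 16, 12, 8 and
    6, which add up to 42. The first is at most e^3 Q^2; the others are at most Q and hence absorbed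
    by e^3 Q >= 1.\<close>
  fix g assume g: "g \<in> {..2*n}"
  define N where "N = real_of_int p^(2*n-g)"
  define P where "P = real_of_int p^g"
  define Q where "Q = real_of_int p^(2*n)"
  have PN: "P * N = Q" using g by (simp add: P_def N_def Q_def flip: power_add)
  have N0: "N >= 1" and P0: "P >= 1" using p1r by (auto simp: N_def P_def)
  have "real (divs 1) <= D" by (rule D) (use one_le_power[OF p1r, of "4*n"] in simp_all)
  then have D0: "D >= 0" using of_nat_0_le_iff[of "divs 1"] by linarith
  have "real (card (Ns g)) <= real (card (near_scalar (p^(2*n-g)) (e * p^(2*n-g))))"
   unfolding Ns_def by (intro of_nat_mono card_mono cNs(1)) auto
  also have "\<dots> <= D * (2*(e * N)+1) * (8 * (e * N)\<^sup>2 / N + 6)" using cNs(2)[of g] by (simp add: N_def)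
  finally have "P * real (card (Ns g)) <= P * (D * (2*(e * N)+1) * (8 * (e * N)\<^sup>2 / N + 6))"
   using P0 by (intro mult_left_mono) auto
  also have "\<dots> = D * (16 * e^3 * N * (P*N) + 12 * e * (P*N) + 8 * e\<^sup>2 * (P*N) + 6 * P)"
   using N0 by (simp add: field_simps power2_eq_square power3_eq_cube)
  also have "\<dots> = D * (16 * e^3 * (Q * N) + 12 * e * Q + 8 * e\<^sup>2 * Q + 6 * P)" unfolding PN by (simp add: algebra_simps)
  also have "\<dots> <= D * (42 * (e^3 * Q\<^sup>2))"
  proof (intro mult_left_mono D0)
   have Q1: "Q >= 1" using p1r by (simp add: Q_def)
   have NQ: "N <= Q" unfolding N_def Q_def by (rule power_increasing) (use p1r in auto)
   have PQ: "P <= Q" unfolding P_def Q_def by (rule power_increasing) (use p1r g in auto)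
   have e3: "e^3 * Q >= 1" using e(3) by (simp add: Q_def)
   have "e^3 * (Q*N) <= e^3 * (Q * Q)" using NQ Q1 e by (intro mult_left_mono) auto
   moreover have "1 * Q <= (e^3*Q)*Q" using e3 Q1 by (intro mult_right_mono) auto
   moreover have "e * Q <= 1 * Q" "e\<^sup>2 * Q <= 1 * Q" using e Q1 by (intro mult_right_mono; simp add: power_le_one)+
   moreover have "e^3 * Q\<^sup>2 = (e^3*Q)*Q" "e^3 * Q\<^sup>2 = e^3 * (Q*Q)" by (simp_all add: power2_eq_square)
   ultimately show "16 * e^3 * (Q * N) + 12 * e * Q + 8 * e\<^sup>2 * Q + 6 * P <= 42 * (e^3 * Q\<^sup>2)" using PQ by linarith
  qed
  also have "Q\<^sup>2 = p^(4*n)" by (simp add: Q_def flip: power_mult)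
  finally show "real_of_int p^g * real (card (Ns g)) <= D * 42 * e^3 * p^(4*n)" by (simp add: P_def algebra_simps)
 qed (simp add: word_const_def)
 also have "\<dots> = real_of_int word_const^(4*n) * real (2*n+1) * D * 42 * e^3 * real_of_int p^(4*n)" by (simp add: algebra_simps)
 finally show ?thesis by simp
qed

section \<open>Construction and number of the generators\<close>

text \<open>\<open>X\<close> will be the integer part of sqrt p. Every coprime bottom row (c, d) in
  the given range is completed to determinant p in exactly one way. The condition X <= 8 d bounds
  the denominator c t + d on the unit interval below by a multiple of sqrt p, and 0 <= b < d
  together with a > 0 makes the Moebius map nonnegative there.\<close>

definition gens :: "int \<Rightarrow> int \<Rightarrow> imat set" where
 "gens p X = {(a, b, c, d). 1 <= c \<and> c <= X \<and> 1 <= d \<and> d <= X \<and> X <= 8*d \<and> 0 <= b \<and> b < d \<and> coprime c d \<and> a*d - b*c = p}"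

lemma gens_pos:
 assumes "(a,b,c,d) \<in> gens p X" "p > 0" "X >= 1"
 shows "a > 0"
proof (rule ccontr)
 assume "\<not> a > 0"
 have h: "1 <= d" "0 <= b" "1 <= c" "a*d - b*c = p" using assms(1) by (auto simp: gens_def)
 have "a*d <= 0" using \<open>\<not> a > 0\<close> h(1) by (simp add: mult_nonpos_nonneg)
 moreover have "b*c >= 0" using h by simp
 ultimately show False using h assms(2) by linarith
qed

lemma gens_subset_letters:
 fixes p X :: int
 assumes X: "X >= 1" "X\<^sup>2 <= p" "p < (X+1)\<^sup>2"
 shows "gens p X \<subseteq> bounded_letters 1600 p"
proof
 fix x assume x: "x \<in> gens p X"
 obtain a b c d where xe: "x = (a,b,c,d)" by (cases x)
 have h: "1 <= c" "c <= X" "1 <= d" "d <= X" "X <= 8*d" "0 <= b" "b < d" "a*d - b*c = p"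
  using x by (auto simp: xe gens_def)
 have X2: "X <= X\<^sup>2" using X(1) by (simp add: power2_eq_square)
 have p4: "p <= 4*X\<^sup>2"
 proof -
  have "(X+1)\<^sup>2 <= (2*X)\<^sup>2" using X by (intro power_mono) auto
  then show ?thesis using X(3) by (simp add: power_mult_distrib)
 qed
 have p0: "p > 0" using X X2 by linarith
 have a0: "a > 0" using gens_pos x p0 X(1) xe by blast
 \<comment> \<open>The origin of 1600 = 40^2: a X <= 8 a d = 8 p + 8 b c, where p <= 4 X^2 and b c
   <= X^2, so that a <= 40 X.\<close>
 have "a * X <= a * (8*d)" using a0 h by (intro mult_left_mono) auto
 also have "\<dots> = 8*p + 8*(b*c)" using h by (simp add: algebra_simps)
 also have "b*c <= X * X" using h by (intro mult_mono) auto
 finally have "a * X <= (40 * X) * X" using p4 by (simp add: power2_eq_square)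
 then have a40: "a <= 40 * X" using X(1) by simp
 have sq: "z\<^sup>2 <= 1600*p" if "0 <= z" "z <= 40*X" for z
 proof -
  have "z\<^sup>2 <= (40*X)\<^sup>2" using that by (intro power_mono) auto
  then show ?thesis using X(2) by (simp add: power_mult_distrib)
 qed
 show "x \<in> bounded_letters 1600 p" unfolding xe bounded_letters_def using h a0 a40 X(1) sq[of a] sq[of b] sq[of c] sq[of d] by simp
qed

text \<open>Modulo d the determinant condition is b c = -p. As c is invertible modulo d, this fixes
  b modulo d, the range 0 <= b < d fixes b, and then a is determined. \<open>gens_image\<close>
  solves the same congruence for existence.\<close>

lemma gens_inj: "inj_on (%(a,b,c,d). (c,d)) (gens p X)"
proof (rule inj_onI)
 fix x y assume xy: "x \<in> gens p X" "y \<in> gens p X" "(%(a,b,c,d). (c,d)) x = (%(a,b,c,d). (c,d)) y"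
 obtain a b c d where xe: "x = (a,b,c,d)" by (cases x)
 obtain a' b' where ye: "y = (a',b',c,d)" using xy(3) by (cases y) (auto simp: xe)
 have 1: "(a,b,c,d) \<in> gens p X" "(a',b',c,d) \<in> gens p X" using xy xe ye by auto
 have "a*d - b*c = p" "a'*d - b'*c = p" using 1 by (auto simp: gens_def)
 then have e: "(b-b')*c = (a-a')*d" by (simp add: algebra_simps)
 have cd: "coprime c d" "1 <= d" "0 <= b" "b < d" "0 <= b'" "b' < d" using 1 by (auto simp: gens_def)
 have "d dvd (b-b')*c" using e by simp
 then have "d dvd b - b'" using cd(1) by (simp add: coprime_dvd_mult_left_iff coprime_commute)
 moreover have "\<bar>b-b'\<bar> < d" using cd by linarith
 ultimately have "b = b'" using zdvd_imp_le[of d "\<bar>b-b'\<bar>"] by fastforce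
 then show "x = y" using e cd by (auto simp: xe ye)
qed

lemma gens_image: 
 assumes "X >= 1"
 shows "(%(a,b,c,d). (c,d)) ` gens p X = {(c,d). 1 <= c \<and> c <= X \<and> 1 <= d \<and> d <= X \<and> X <= 8*d \<and> coprime c d}" (is "_ = ?R")
proof
 show "(%(a,b,c,d). (c,d)) ` gens p X \<subseteq> ?R" by (auto simp: gens_def)
 show "?R \<subseteq> (%(a,b,c,d). (c,d)) ` gens p X"
 proof clarify
  fix c d assume h: "1 <= c" "c <= X" "1 <= d" "d <= X" "X <= 8*d" "coprime c d"
  obtain u where "[c * u = 1] (mod d)" using cong_solve_coprime_int[OF h(6)] by blast
  then have u: "d dvd c*u - 1" by (simp add: cong_iff_dvd_diff)
  define b where "b = (-p*u) mod d"
  have "d dvd p + b*c"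
  proof -
   have "d dvd (-p*u) - b" by (simp add: b_def minus_mod_eq_mult_div)
   then have "d dvd c * ((-p*u) - b)" by simp
   moreover have "p + b*c = - (c * ((-p*u) - b)) - p*(c*u - 1)" by (simp add: algebra_simps)
   ultimately show ?thesis using u by (metis dvd_diff dvd_minus_iff dvd_mult)
  qed
  then obtain a where "p + b*c = d*a" by blast
  then have "a*d - b*c = p" by (simp add: algebra_simps)
  moreover have "0 <= b" "b < d" using h by (auto simp: b_def)
  ultimately have "(a,b,c,d) \<in> gens p X" using h by (simp add: gens_def)
  then show "(c,d) \<in> (%(a,b,c,d). (c,d)) ` gens p X" by force
 qed
qed

text \<open>Telescoping, started at n = 2 with equality. The gain over the bound 1 is essential,
  since 1 minus this sum becomes the density of coprime pairs.\<close>

lemma sum_inverse_squares: "n >= 2 ==> (\<Sum>l=2..n. 1 / (real l)\<^sup>2) <= 3/4 - 1/n"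
proof (induction n rule: nat_induct_at_least)
 case (Suc n)
 have "1 / (real (Suc n))\<^sup>2 <= 1 / (real n * real (Suc n))"
  using Suc.hyps by (intro divide_left_mono) (auto simp: power2_eq_square intro!: mult_right_mono mult_pos_pos)
 also have "\<dots> = 1/real n - 1/real (Suc n)" using Suc.hyps by (simp add: field_simps)
 finally show ?case using Suc by simp
qed simp

text \<open>A union bound over the gcd suffices: at most (X / l)^2 pairs have both entries divisible
  by l, and summing over l >= 2 removes at most three quarters of the square.\<close>

lemma card_coprime_pairs:
 fixes X :: int assumes X: "X >= 1"
 shows "real (card {(c,d). 1 <= c \<and> c <= X \<and> 1 <= d \<and> d <= X \<and> coprime c d}) >= X\<^sup>2 / 4"
proof -
 let ?B = "{1..X} \<times> {1..X}"
 let ?G = "{(c,d). 1 <= c \<and> c <= X \<and> 1 <= d \<and> d <= X \<and> coprime c d}"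
 let ?M = "%l::nat. (%(i,j). (int l*i, int l*j)) ` ({1..X div int l} \<times> {1..X div int l})"
 have sub: "?B - ?G \<subseteq> (\<Union>l\<in>{2..nat X}. ?M l)"
 proof
  fix x assume x: "x \<in> ?B - ?G"
  obtain c d where xe: "x = (c, d)" by (cases x)
  have h: "c \<in> {1..X}" "d \<in> {1..X}" "\<not> coprime c d" using x by (auto simp: xe)
  define g where "g = gcd c d"
  have g1: "g \<noteq> 1" using h by (auto simp: g_def coprime_iff_gcd_eq_1)
  have g0: "g > 0" using h by (simp add: g_def)
  have "g <= c" using h gcd_le1_int[of c d] unfolding g_def by simp
  then have gX: "g <= X" using h by simp
  obtain i where i: "c = g * i" unfolding g_def by (metis dvdE gcd_dvd1)
  obtain j where j: "d = g * j" unfolding g_def by (metis dvdE gcd_dvd2)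
  have "i >= 1" using h i g0 by (smt (verit) atLeastAtMost_iff mult_nonneg_nonpos)
  moreover have "j >= 1" using h j g0 by (smt (verit) atLeastAtMost_iff mult_nonneg_nonpos)
  moreover have "i <= X div g" using h i g0 by (metis atLeastAtMost_iff nonzero_mult_div_cancel_left order_less_irrefl zdiv_mono1)
  moreover have "j <= X div g" using h j g0 by (metis atLeastAtMost_iff nonzero_mult_div_cancel_left order_less_irrefl zdiv_mono1)
  ultimately have "(c,d) \<in> ?M (nat g)" using i j g0 by (intro image_eqI[of _ _ "(i,j)"]) auto
  moreover have "nat g \<in> {2..nat X}" using g0 g1 gX by auto
  ultimately show "x \<in> (\<Union>l\<in>{2..nat X}. ?M l)" unfolding xe by blast
 qed
 have "card (?B - ?G) <= card (\<Union>l\<in>{2..nat X}. ?M l)" by (rule card_mono[OF _ sub]) auto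
 also have "\<dots> <= (\<Sum>l\<in>{2..nat X}. card (?M l))" by (rule card_UN_le) simp
 also have "\<dots> <= (\<Sum>l\<in>{2..nat X}. card ({1..X div int l} \<times> {1..X div int l}))" by (intro sum_mono card_image_le) auto
 finally have "real (card (?B - ?G)) <= real (\<Sum>l\<in>{2..nat X}. card ({1..X div int l} \<times> {1..X div int l}))"
  by (rule of_nat_mono)
 also have "\<dots> = (\<Sum>l\<in>{2..nat X}. (real_of_int (X div int l))\<^sup>2)"
  using X by (simp add: card_cartesian_product power2_eq_square pos_imp_zdiv_nonneg_iff)
 also have "\<dots> <= (\<Sum>l\<in>{2..nat X}. X\<^sup>2 * (1 / (real l)\<^sup>2))"
 proof (intro sum_mono)
  fix l assume l: "l \<in> {2..nat X}"
  have "real_of_int (X div int l) <= X / l" by (metis of_int_of_nat_eq real_of_int_div4)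
  moreover have "0 <= real_of_int (X div int l)" using X l by (simp add: pos_imp_zdiv_nonneg_iff)
  ultimately have "(real_of_int (X div int l))\<^sup>2 <= (X / l)\<^sup>2" by (intro power_mono) auto
  then show "(real_of_int (X div int l))\<^sup>2 <= X\<^sup>2 * (1 / (real l)\<^sup>2)" by (simp add: power_divide)
 qed
 also have "\<dots> = X\<^sup>2 * (\<Sum>l\<in>{2..nat X}. 1 / (real l)\<^sup>2)" by (simp add: sum_distrib_left)
 also have "\<dots> <= X\<^sup>2 * (3/4)"
 proof (cases "nat X >= 2")
  case True
  have "(\<Sum>l\<in>{2..nat X}. 1 / (real l)\<^sup>2) <= 3/4 - 1/real (nat X)" by (rule sum_inverse_squares[OF True])
  also have "\<dots> <= 3/4" by simp
  finally show ?thesis by (intro mult_left_mono) auto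
 qed simp
 finally have 1: "real (card (?B - ?G)) <= X\<^sup>2 * (3/4)" .
 have "?G \<subseteq> ?B" by auto
 then have "card (?B - ?G) = card ?B - card ?G" "card ?G <= card ?B"
  using card_Diff_subset[of ?G ?B] card_mono[of ?B ?G] finite_subset[of ?G ?B] by auto
 then have "real (card ?G) = real (card ?B) - real (card (?B - ?G))" by simp
 moreover have "real (card ?B) = X\<^sup>2" using X by (simp add: card_cartesian_product power2_eq_square)
 ultimately show ?thesis using 1 by simp
qed

text \<open>Of at least X^2 / 4 coprime rows, at most X^2 / 8 violate X <= 8 d. The remaining X^2 /
  8 are at least p / 32 because p < (X+1)^2 <= 4 X^2.\<close>

lemma card_gens:
 fixes p X :: int
 assumes X: "X >= 1" "X\<^sup>2 <= p" "p < (X+1)\<^sup>2"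
 shows "finite (gens p X)" "int (card (gens p X)) <= p" "32 * int (card (gens p X)) >= p"
proof -
 let ?G = "{(c,d). 1 <= c \<and> c <= X \<and> 1 <= d \<and> d <= X \<and> coprime c d}"
 let ?R = "{(c,d). 1 <= c \<and> c <= X \<and> 1 <= d \<and> d <= X \<and> X <= 8*d \<and> coprime c d}"
 let ?T = "{1..X} \<times> {1..X div 8}"
 have fB: "finite ({1..X} \<times> {1..X})" by auto
 have fR: "finite ?R" by (rule finite_subset[OF _ fB]) auto
 have fin: "finite (gens p X)" by (rule finite_imageD[OF _ gens_inj]) (use gens_image[OF X(1), of p] fR in \<open>simp only:\<close>)
 then show "finite (gens p X)" .
 have c: "card (gens p X) = card ?R" using card_image[OF gens_inj, of p X] unfolding gens_image[OF X(1)] by (rule sym)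
 have "card ?R <= card ({1..X} \<times> {1..X})" by (rule card_mono[OF fB]) auto
 then have "int (card ?R) <= int (nat X * nat X)" unfolding card_cartesian_product of_nat_le_iff by simp
 then have "int (card ?R) <= X\<^sup>2" using X(1) by (simp add: power2_eq_square)
 then show "int (card (gens p X)) <= p" using c X(2) by simp
 have "?G \<subseteq> ?R \<union> ?T" by auto
 then have "card ?G <= card (?R \<union> ?T)" using fR by (intro card_mono) auto
 also have "\<dots> <= card ?R + card ?T" by (rule card_Un_le)
 finally have "real (card ?G) <= real (card ?R + card ?T)" by (rule of_nat_mono)
 then have "real (card ?G) <= real (card ?R) + real (card ?T)" by (simp only: of_nat_add)
 moreover have "real (card ?T) <= X\<^sup>2 / 8"
 proof -
  have "real (card ?T) = real_of_int X * real_of_int (X div 8)" using X(1) by (simp add: card_cartesian_product pos_imp_zdiv_nonneg_iff)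
  also have "\<dots> <= X * (X/8)" using X(1) by (intro mult_left_mono) linarith+
  finally show ?thesis by (simp add: power2_eq_square)
 qed
 ultimately have "real (card ?R) >= X\<^sup>2 / 8" using card_coprime_pairs[OF X(1)] by simp
 then have "8 * real (card ?R) >= real_of_int (X\<^sup>2)" by simp
 then have "8 * int (card ?R) >= X\<^sup>2" by linarith
 moreover have "(X+1)\<^sup>2 <= (2*X)\<^sup>2" using X by (intro power_mono) auto
 ultimately show "32 * int (card (gens p X)) >= p" using X(3) c by (simp add: power_mult_distrib)
qed

section \<open>Bounded Borel functions of bounded support\<close>

text \<open>A class closed under sums, products, linear substitutions and partial integration, on
  which integrability and Fubini are automatic. All analysis below stays within it, so integrability
  conditions reduce to syntactic closure.\<close>

definition tame :: "('a::euclidean_space \<Rightarrow> real) \<Rightarrow> bool" where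
 "tame F \<longleftrightarrow> F \<in> borel_measurable borel \<and> (\<exists>M. \<forall>v. \<bar>F v\<bar> <= M) \<and> (\<exists>R. \<forall>v. F v \<noteq> 0 \<longrightarrow> norm v <= R)"

lemma tameI:
 assumes "F \<in> borel_measurable borel" "\<And>v. \<bar>F v\<bar> <= M" "\<And>v. F v \<noteq> 0 ==> norm v <= R"
 shows "tame F"
 unfolding tame_def using assms by blast

lemma tame_measurable [measurable_dest]: "tame F ==> F \<in> borel_measurable borel"
 by (simp add: tame_def)

lemma tameE:
 assumes "tame F"
 obtains M R where "M >= 0" "R >= 0" "\<And>v. \<bar>F v\<bar> <= M" "\<And>v. F v \<noteq> 0 ==> norm v <= R"
proof -
 obtain M R where MR: "\<forall>v. \<bar>F v\<bar> <= M" "\<forall>v. F v \<noteq> 0 \<longrightarrow> norm v <= R" using assms by (auto simp: tame_def)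
 have "M >= 0" using MR(1) abs_ge_zero order_trans by metis
 then show ?thesis using MR by (intro that[of M "max 0 R"]) (auto simp: le_max_iff_disj)
qed

lemma tame_integrable: 
 assumes "tame F" shows "integrable lborel F"
proof -
 obtain M R where MR: "M >= 0" "R >= 0" "\<And>v. \<bar>F v\<bar> <= M" "\<And>v. F v \<noteq> 0 ==> norm v <= R" using assms by (rule tameE) blast
 have [measurable]: "F \<in> borel_measurable borel" using assms by (rule tame_measurable)
 have fin: "emeasure lborel (cball (0::'a) R) < \<infinity>" by (rule emeasure_bounded_finite) simp
 show ?thesis
  by (rule integrableI_bounded_set[where A = "cball 0 R" and B = M]) (use MR fin in auto)
qed

lemma tame_mult:
 assumes F: "tame F" and G: "G \<in> borel_measurable borel" "\<And>v. F v \<noteq> 0 ==> \<bar>G v\<bar> <= B"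
 shows "tame (%v. F v * G v)"
proof -
 obtain M R where MR: "M >= 0" "R >= 0" "\<And>v. \<bar>F v\<bar> <= M" "\<And>v. F v \<noteq> 0 ==> norm v <= R" using F by (rule tameE) blast
 have [measurable]: "F \<in> borel_measurable borel" using F by (rule tame_measurable)
 show ?thesis
 proof (rule tameI[where M = "M * max 0 B" and R = R])
  show "(%v. F v * G v) \<in> borel_measurable borel" using G(1) by measurable
  show "\<bar>F v * G v\<bar> <= M * max 0 B" for v
  proof (cases "F v = 0")
   case False
   then show ?thesis unfolding abs_mult using MR(1,3) G(2)[OF False] by (intro mult_mono) auto
  qed (use MR(1) in auto)
 qed (use MR in auto)
qed

lemma tame_mult_tame: "tame F ==> tame G ==> tame (%v. F v * G v)"
proof -
 assume F: "tame F" and G: "tame G"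
 obtain M where "\<And>v. \<bar>G v\<bar> <= M" using G by (rule tameE) blast
 then show ?thesis by (intro tame_mult[OF F tame_measurable[OF G]])
qed

lemma tame_cmult: "tame F ==> tame (%v. c * F v)"
 using tame_mult[of F "%_. c" "\<bar>c\<bar>"] by (simp add: mult.commute)

lemma tame_power2: "tame F ==> tame (%v. (F v)\<^sup>2)"
 unfolding power2_eq_square by (rule tame_mult_tame)

lemma tame_abs: "tame F ==> tame (%v. \<bar>F v\<bar>)"
proof -
 assume F: "tame F"
 obtain M R where MR: "\<And>v. \<bar>F v\<bar> <= M" "\<And>v. F v \<noteq> 0 ==> norm v <= R" using F by (rule tameE) blast
 have [measurable]: "F \<in> borel_measurable borel" using F by (rule tame_measurable)
 show ?thesis by (rule tameI[where M = M and R = R]) (use MR in auto)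
qed

lemma tame_zero: "tame (%_. 0)"
 by (auto intro!: tameI[where M = 0])

lemma tame_add:
 assumes "tame F" "tame G" shows "tame (%v. F v + G v)"
proof -
 obtain M R where 1: "\<And>v. \<bar>F v\<bar> <= M" "\<And>v. F v \<noteq> 0 ==> norm v <= R" using assms(1) by (rule tameE) blast
 obtain M' R' where 2: "\<And>v. \<bar>G v\<bar> <= M'" "\<And>v. G v \<noteq> 0 ==> norm v <= R'" using assms(2) by (rule tameE) blast
 have [measurable]: "F \<in> borel_measurable borel" "G \<in> borel_measurable borel" using assms by (auto intro: tame_measurable)
 show ?thesis
 proof (rule tameI[where M = "M + M'" and R = "max R R'"])
  show "norm v <= max R R'" if "F v + G v \<noteq> 0" for v using that 1(2)[of v] 2(2)[of v] by fastforce
  show "\<bar>F v + G v\<bar> <= M + M'" for v using 1(1)[of v] 2(1)[of v] by linarith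
 qed measurable
qed

lemma tame_diff: "tame F ==> tame G ==> tame (%v. F v - G v)"
 using tame_add[of F "%v. (-1) * G v"] tame_cmult[of G "-1"] by simp

lemma tame_sum: "(\<And>i. i \<in> I ==> tame (F i)) ==> tame (%v. \<Sum>i\<in>I. F i v)"
 by (induction I rule: infinite_finite_induct) (auto intro: tame_add tame_zero)

lemma tame_dominated:
 assumes F: "tame F" and G: "G \<in> borel_measurable borel" "\<And>v. \<bar>G v\<bar> <= C * \<bar>F v\<bar>" and C: "C >= 0"
 shows "tame G"
proof -
 obtain M R where 1: "\<And>v. \<bar>F v\<bar> <= M" "\<And>v. F v \<noteq> 0 ==> norm v <= R" using F by (rule tameE) blast
 show ?thesis
 proof (rule tameI[where M = "C * M" and R = R])
  show "\<bar>G v\<bar> <= C * M" for v using G(2)[of v] 1(1)[of v] C by (meson mult_left_mono order_trans)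
  show "norm v <= R" if "G v \<noteq> 0" for v using that G(2)[of v] 1(2)[of v] by fastforce
 qed (rule G(1))
qed

lemma tame_indicator: "A \<in> sets borel ==> bounded A ==> tame (ind A)"
proof -
 assume A: "A \<in> sets borel" "bounded A"
 obtain R where "\<And>v. v \<in> A ==> norm v <= R" using A(2) by (auto simp: bounded_iff)
 then show ?thesis using A(1) by (intro tameI[where M = 1 and R = R]) (auto simp: indicator_def)
qed

lemma tame_CauchySchwarz:
 assumes "tame F" "tame G"
 shows "(LBINT v. F v * G v)\<^sup>2 <= (LBINT v. (F v)\<^sup>2) * (LBINT v. (G v)\<^sup>2)"
proof -
 define a where "a = (LBINT v. (F v)\<^sup>2)"
 define b where "b = (LBINT v. F v * G v)"
 define c where "c = (LBINT v. (G v)\<^sup>2)"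
 have i: "integrable lborel (%v. (F v)\<^sup>2)" "integrable lborel (%v. F v * G v)" "integrable lborel (%v. (G v)\<^sup>2)"
  using assms by (auto intro!: tame_integrable tame_power2 tame_mult_tame)
 have q: "0 <= s\<^sup>2 * a - 2 * s * t * b + t\<^sup>2 * c" for s t
 proof -
  have "0 <= (LBINT v. (s * F v - t * G v)\<^sup>2)" by simp
  also have "\<dots> = (LBINT v. s\<^sup>2 * (F v)\<^sup>2 - 2 * s * t * (F v * G v) + t\<^sup>2 * (G v)\<^sup>2)"
   by (simp add: power2_diff power_mult_distrib algebra_simps)
  also have "\<dots> = s\<^sup>2 * a - 2 * s * t * b + t\<^sup>2 * c"
   using i by (simp add: a_def b_def c_def)
  finally show ?thesis .
 qed
 have ac: "a >= 0" "c >= 0" by (auto simp: a_def c_def)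
 have "b\<^sup>2 <= a * c"
 proof (cases "c = 0")
  case True
  have "b = 0"
  proof (rule ccontr)
   assume "b \<noteq> 0"
   have "0 <= 1 * a - 2 * ((a+1)/(2*b)) * b" using q[of 1 "(a+1)/(2*b)"] True by simp
   also have "\<dots> = -1" using \<open>b \<noteq> 0\<close> by (simp add: field_simps)
   finally show False by simp
  qed
  then show ?thesis using ac by simp
 next
  case False
  have "0 <= c\<^sup>2 * a - 2 * c * b * b + b\<^sup>2 * c" using q[of c b] by simp
  also have "\<dots> = c * (a * c - b\<^sup>2)" by (simp add: algebra_simps power2_eq_square)
  finally show ?thesis using False ac by (simp add: zero_le_mult_iff)
 qed
 then show ?thesis by (simp add: a_def b_def c_def)
qed

lemma integral_abs_le_ball:
 fixes G :: "'c::euclidean_space \<Rightarrow> real"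
 assumes "tame G" "\<And>z. \<bar>G z\<bar> <= M" "\<And>z. G z \<noteq> 0 ==> norm z <= R"
 shows "\<bar>LBINT z. G z\<bar> <= M * measure lborel (cball (0::'c) R)"
proof -
 have M: "M >= 0" using assms(2)[of undefined] by linarith
 have "\<bar>LBINT z. G z\<bar> <= (LBINT z. \<bar>G z\<bar>)" by (rule integral_abs_bound)
 also have "\<dots> <= (LBINT z. M * ind (cball (0::'c) R) z)"
 proof (rule lint_mono)
  show "\<bar>G z\<bar> <= M * ind (cball 0 R) z" for z using assms(2,3)[of z] M by (cases "G z = 0") (auto simp: indicator_def)
 qed (auto intro!: tame_integrable tame_abs assms(1) tame_cmult tame_indicator)
 also have "\<dots> = M * measure lborel (cball (0::'c) R)" by simp
 finally show ?thesis .
qed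

lemma integral_nonzeroD:
 assumes "(\<integral>z. G z \<partial>M) \<noteq> (0::real)" shows "\<exists>z. G z \<noteq> 0"
proof (rule ccontr)
 assume "\<nexists>z. G z \<noteq> 0"
 then have "G = (%_. 0)" by auto
 then show False using assms by simp
qed

lemma tame_Fubini:
 fixes F :: "'a::euclidean_space \<times> 'b::euclidean_space \<Rightarrow> real"
 assumes F: "tame F"
 shows "tame (%y. F (x, y))" "tame (%x. F (x, y))"
  "tame (%x. LBINT y. F (x, y))" "tame (%y. LBINT x. F (x, y))"
  "(LBINT v. F v) = (LBINT x. LBINT y. F (x, y))"
  "(LBINT v. F v) = (LBINT y. LBINT x. F (x, y))"
proof -
 obtain M R where MR: "M >= 0" "R >= 0" "\<And>v. \<bar>F v\<bar> <= M" "\<And>v. F v \<noteq> 0 ==> norm v <= R" using F by (rule tameE) blast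
 have m: "F \<in> borel_measurable borel" using F by (rule tame_measurable)
 then have [measurable]: "F \<in> borel_measurable (borel \<Otimes>\<^sub>M borel)" by (simp add: borel_prod)
 have nx: "norm x <= R" if "F (x, y) \<noteq> 0" for x y using MR(4)[OF that] norm_fst_le[of x y] by linarith
 have ny: "norm y <= R" if "F (x, y) \<noteq> 0" for x y using MR(4)[OF that] norm_snd_le[of y x] by linarith
 show t1: "tame (%y. F (x, y))" for x by (rule tameI[where M = M and R = R]) (use MR ny in auto)
 show t2: "tame (%x. F (x, y))" for y by (rule tameI[where M = M and R = R]) (use MR nx in auto)
 show "tame (%x. LBINT y. F (x, y))"
 proof (rule tameI)
  show "\<bar>LBINT y. F (x, y)\<bar> <= M * measure lborel (cball (0::'b) R)" for x by (rule integral_abs_le_ball) (use t1 MR ny in auto)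
  show "norm x <= R" if "(LBINT y. F (x, y)) \<noteq> 0" for x using integral_nonzeroD[OF that] nx by blast
 qed measurable
 show "tame (%y. LBINT x. F (x, y))"
 proof (rule tameI)
  show "\<bar>LBINT x. F (x, y)\<bar> <= M * measure lborel (cball (0::'a) R)" for y by (rule integral_abs_le_ball) (use t2 MR nx in auto)
  show "norm y <= R" if "(LBINT x. F (x, y)) \<noteq> 0" for y using integral_nonzeroD[OF that] ny by blast
 qed measurable
 have i: "integrable (lborel \<Otimes>\<^sub>M lborel) F" using tame_integrable[OF F] by (simp add: lborel_prod)
 then have i': "integrable (lborel \<Otimes>\<^sub>M lborel) (case_prod (%x y. F (x, y)))" by simp
 show "(LBINT v. F v) = (LBINT x. LBINT y. F (x, y))"
  using lborel_pair.integral_fst'[OF i] by (simp add: lborel_prod)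
 show "(LBINT v. F v) = (LBINT y. LBINT x. F (x, y))"
  using lborel_pair.integral_snd[OF i'] by (simp add: lborel_prod)
qed

lemma tame_swap:
 fixes F :: "'a::euclidean_space \<Rightarrow> 'b::euclidean_space \<Rightarrow> real"
 assumes "tame (%(x, y). F x y)"
 shows "(LBINT x. LBINT y. F x y) = (LBINT y. LBINT x. F x y)"
 using tame_Fubini(5)[OF assms] tame_Fubini(6)[OF assms] by simp

section \<open>Linear maps of the plane\<close>

fun lin :: "real \<times> real \<times> real \<times> real \<Rightarrow> real \<times> real \<Rightarrow> real \<times> real" where
 "lin (a, b, c, d) (x, y) = (a * x + b * y, c * x + d * y)"

lemma measurable_lin [measurable]: "lin m \<in> borel_measurable borel"
proof -
 obtain a b c d where m: "m = (a,b,c,d)" by (cases m)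
 have "lin m = (%v. (a * fst v + b * snd v, c * fst v + d * snd v))" by (auto simp: m)
 then show ?thesis by (simp add: borel_measurable_continuous_onI continuous_on_Pair continuous_intros)
qed

lemma tame_lin:
 assumes F: "tame F" and det: "a*d - b*c \<noteq> 0"
 shows "tame (%v. F (lin (a,b,c,d) v))"
proof -
 obtain M R where MR: "M >= 0" "R >= 0" "\<And>v. \<bar>F v\<bar> <= M" "\<And>v. F v \<noteq> 0 ==> norm v <= R" using F by (rule tameE) blast
 have [measurable]: "F \<in> borel_measurable borel" using F by (rule tame_measurable)
 define D where "D = a*d - b*c"
 show ?thesis
 proof (rule tameI[where M = M])
  show "norm v <= (\<bar>d/D\<bar> + \<bar>b/D\<bar> + \<bar>c/D\<bar> + \<bar>a/D\<bar>) * R" if "F (lin (a,b,c,d) v) \<noteq> 0" for v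
  proof -
   obtain x y where v: "v = (x, y)" by (cases v)
   define x' where "x' = a*x + b*y"
   define y' where "y' = c*x + d*y"
   have n: "norm (x', y') <= R" using MR(4)[OF that] by (simp add: v x'_def y'_def)
   have n1: "\<bar>x'\<bar> <= R" "\<bar>y'\<bar> <= R" using n norm_fst_le[of x' y'] norm_snd_le[of y' x'] by auto
   have D0: "D \<noteq> 0" using det by (simp add: D_def)
   have "D * x = d * x' - b * y'" "D * y = a * y' - c * x'" by (auto simp: x'_def y'_def D_def algebra_simps)
   then have e: "x = (d/D) * x' - (b/D) * y'" "y = (a/D) * y' - (c/D) * x'" using D0 by (auto simp: field_simps)
   have "\<bar>x\<bar> <= \<bar>d/D\<bar> * R + \<bar>b/D\<bar> * R"
   proof -
    have "\<bar>x\<bar> <= \<bar>(d/D) * x'\<bar> + \<bar>(b/D) * y'\<bar>" unfolding e(1) by (rule abs_triangle_ineq4)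
    also have "\<dots> <= \<bar>d/D\<bar> * R + \<bar>b/D\<bar> * R" unfolding abs_mult by (intro add_mono mult_left_mono n1) auto
    finally show ?thesis .
   qed
   moreover have "\<bar>y\<bar> <= \<bar>a/D\<bar> * R + \<bar>c/D\<bar> * R"
   proof -
    have "\<bar>y\<bar> <= \<bar>(a/D) * y'\<bar> + \<bar>(c/D) * x'\<bar>" unfolding e(2) by (rule abs_triangle_ineq4)
    also have "\<dots> <= \<bar>a/D\<bar> * R + \<bar>c/D\<bar> * R" unfolding abs_mult by (intro add_mono mult_left_mono n1) auto
    finally show ?thesis .
   qed
   moreover have "norm v <= \<bar>x\<bar> + \<bar>y\<bar>" using norm_Pair_le[of x y] by (simp add: v)
   ultimately show ?thesis by (simp add: algebra_simps)
  qed
 qed (use MR in auto)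
qed

lemma integral_translate: "(LBINT x. f (t + x)) = (LBINT x. f x)" for f :: "real \<Rightarrow> real"
 using lborel_integral_real_affine[of 1 f t] by simp

lemma integral_shear1:
 assumes F: "tame F" shows "(LBINT v. F (lin (1,b,0,1) v)) = (LBINT v. F v)"
proof -
 have t: "tame (%v. F (lin (1,b,0,1) v))" by (rule tame_lin[OF F]) simp
 have "(LBINT v. F (lin (1,b,0,1) v)) = (LBINT y. LBINT x. F (b * y + x, y))"
  by (simp add: tame_Fubini(6)[OF t] add.commute)
 also have "\<dots> = (LBINT y. LBINT x. F (x, y))"
  using integral_translate[of "%x. F (x, y)" for y] by simp
 finally show ?thesis by (simp add: tame_Fubini(6)[OF F])
qed

lemma integral_shear2:
 assumes F: "tame F" shows "(LBINT v. F (lin (1,0,c,1) v)) = (LBINT v. F v)"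
proof -
 have t: "tame (%v. F (lin (1,0,c,1) v))" by (rule tame_lin[OF F]) simp
 have "(LBINT v. F (lin (1,0,c,1) v)) = (LBINT x. LBINT y. F (x, c * x + y))"
  by (simp add: tame_Fubini(5)[OF t])
 also have "\<dots> = (LBINT x. LBINT y. F (x, y))"
  using integral_translate[of "%y. F (x, y)" for x] by simp
 finally show ?thesis by (simp add: tame_Fubini(5)[OF F])
qed

text \<open>For c nonzero the matrix is a product of three shears, and a shear preserves area by
  Fubini and translation invariance. For c = 0, splitting off the shear (1, 0, 1, 1) leaves a matrix
  whose lower left entry is -d, which is nonzero since a d = 1.\<close>

lemma integral_lin1:
 assumes F: "tame F" and det: "a*d - b*c = 1"
 shows "(LBINT v. F (lin (a,b,c,d) v)) = (LBINT v. F v)"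
proof -
 have *: "(LBINT v. F (lin (a,b,c,d) v)) = (LBINT v. F v)" if F: "tame F" and det: "a*d - b*c = 1" and c: "c \<noteq> 0" for F a b c d
 proof -
  define al where "al = (a-1)/c"
  define be where "be = (d-1)/c"
  have e: "lin (a,b,c,d) v = lin (1,al,0,1) (lin (1,0,c,1) (lin (1,be,0,1) v))" for v
  proof (cases v)
   case (Pair x y)
   have b: "b = be + al * (c * be + 1)" using c det by (simp add: al_def be_def field_simps)
   have a: "a = 1 + al * c" and d: "d = c * be + 1" using c by (auto simp: al_def be_def)
   show ?thesis unfolding Pair lin.simps prod.inject a d b by (simp add: algebra_simps)
  qed
  have t1: "tame (%v. F (lin (1,al,0,1) v))" by (rule tame_lin[OF F]) simp
  have t2: "tame (%v. F (lin (1,al,0,1) (lin (1,0,c,1) v)))" by (rule tame_lin[OF t1]) simp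
  show ?thesis unfolding e using integral_shear1[OF t2, of be] integral_shear2[OF t1, of c] integral_shear1[OF F, of al] by simp
 qed
 show ?thesis
 proof (cases "c = 0")
  case False
  then show ?thesis using * F det by blast
 next
  case True
  then have ad: "a * d = 1" using det by simp
  have e: "lin (a,b,c,d) v = lin (a - b, b, -d, d) (lin (1,0,1,1) v)" for v
   by (cases v) (simp add: True algebra_simps)
  have t: "tame (%v. F (lin (a - b, b, -d, d) v))" by (rule tame_lin[OF F]) (use ad in \<open>simp add: algebra_simps\<close>)
  have "(LBINT v. F (lin (a - b, b, -d, d) v)) = (LBINT v. F v)"
   by (rule *[OF F]) (use ad in \<open>auto simp: algebra_simps\<close>)
  then show ?thesis unfolding e using integral_shear2[OF t, of 1] by simp
 qed
qed

text \<open>Coordinates t = x / y and y, with Jacobian y. In t a linear map of the plane acts as a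
  Moebius map. The support must keep away from y = 0 for t to remain bounded.\<close>

lemma integral_polar:
 fixes F :: "real \<times> real \<Rightarrow> real"
 assumes F: "tame F" and y0: "y0 > 0" "\<And>x y. F (x, y) \<noteq> 0 ==> y >= y0"
 shows "tame (%(t, y). y * F (t * y, y))"
  "(LBINT v. F v) = (LBINT t. LBINT y. y * F (t * y, y))"
proof -
 obtain M R where MR: "M >= 0" "R >= 0" "\<And>v. \<bar>F v\<bar> <= M" "\<And>v. F v \<noteq> 0 ==> norm v <= R" using F by (rule tameE) blast
 have [measurable]: "F \<in> borel_measurable borel" using F by (rule tame_measurable)
 have n: "\<bar>x\<bar> <= R" "\<bar>y\<bar> <= R" if "F (x,y) \<noteq> 0" for x y
  using MR(4)[OF that] norm_fst_le[of x y] norm_snd_le[of y x] by auto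
 show t: "tame (%(t, y). y * F (t * y, y))"
 proof (rule tameI[where M = "R * M" and R = "R/y0 + R"])
  have "(%v::real \<times> real. (fst v * snd v, snd v)) \<in> borel_measurable borel"
   by (simp add: borel_measurable_continuous_onI continuous_on_Pair continuous_intros)
  then have "(%v::real\<times>real. F (fst v * snd v, snd v)) \<in> borel_measurable borel"
   by (rule measurable_compose) measurable
  moreover have "(%v::real\<times>real. snd v) \<in> borel_measurable borel" by (simp add: borel_measurable_continuous_onI continuous_intros)
  ultimately show "(%(t, y). y * F (t * y, y)) \<in> borel_measurable borel" unfolding case_prod_unfold by (rule borel_measurable_times[rotated])
  show "\<bar>case v of (t, y) \<Rightarrow> y * F (t * y, y)\<bar> <= R * M" for v
  proof (cases v)
   case (Pair t y)
   show ?thesis unfolding Pair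
   proof (cases "F (t*y,y) = 0")
    case False
    then show "\<bar>case (t, y) of (t, y) \<Rightarrow> y * F (t * y, y)\<bar> <= R * M" using n[OF False] MR by (auto simp: abs_mult intro!: mult_mono)
   qed (use MR in auto)
  qed
  show "norm v <= R/y0 + R" if "(case v of (t, y) \<Rightarrow> y * F (t * y, y)) \<noteq> 0" for v
  proof (cases v)
   case (Pair t y)
   then have nz: "F (t*y,y) \<noteq> 0" using that by auto
   have y: "y >= y0" using y0(2)[OF nz] .
   have "\<bar>t\<bar> * y0 <= \<bar>t\<bar> * y" using y by (intro mult_left_mono) auto
   also have "\<dots> <= R" using n(1)[OF nz] y y0(1) by (simp add: abs_mult)
   finally have "\<bar>t\<bar> <= R/y0" using y0 by (simp add: field_simps)
   then show ?thesis using norm_Pair_le[of t y] n(2)[OF nz] by (simp add: Pair)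
  qed
 qed
 have "(LBINT v. F v) = (LBINT y. LBINT x. F (x, y))" by (rule tame_Fubini(6)[OF F])
 also have "\<dots> = (LBINT y. LBINT t. y * F (t * y, y))"
 proof (rule lint_cong[OF refl])
  fix y :: real
  show "(LBINT x. F (x, y)) = (LBINT t. y * F (t * y, y))"
  proof (cases "y >= y0")
   case True
   then have "y > 0" using y0 by simp
   then have "(LBINT x. F (x, y)) = \<bar>y\<bar> *\<^sub>R (LBINT t. F (0 + y * t, y))" by (intro lborel_integral_real_affine) auto
   then show ?thesis using \<open>y > 0\<close> by (simp add: mult.commute)
  next
   case False
   then have "F (x, y) = 0" for x using y0(2) by blast
   then show ?thesis by simp
  qed
 qed
 also have "\<dots> = (LBINT t. LBINT y. y * F (t * y, y))" by (rule tame_swap[OF t, symmetric])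
 finally show "(LBINT v. F v) = (LBINT t. LBINT y. y * F (t * y, y))" .
qed

section \<open>Dyadic cells, step functions, and functions of mean zero on cells\<close>

definition fl :: "nat \<Rightarrow> real \<Rightarrow> real" where "fl N x = real_of_int \<lfloor>2^N * x\<rfloor> / 2^N"

definition cell :: "nat \<Rightarrow> int \<Rightarrow> real set" where
 "cell N k = {real_of_int k / 2^N ..< (real_of_int k + 1) / 2^N}"

definition step :: "nat \<Rightarrow> (real \<Rightarrow> real) \<Rightarrow> bool" where
 "step N f \<longleftrightarrow> (\<forall>x. f x = f (fl N x))"

definition mean_zero :: "nat \<Rightarrow> (real \<Rightarrow> real) \<Rightarrow> bool" where
 "mean_zero N f \<longleftrightarrow> (\<forall>k. (LBINT x. f x * ind (cell N k) x) = 0)"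

lemma fl_le: "fl N x <= x" and fl_gt: "x < fl N x + 1 / 2^N"
proof -
 have "real_of_int \<lfloor>2^N * x\<rfloor> <= 2^N * x" "2^N * x < real_of_int \<lfloor>2^N * x\<rfloor> + 1" by linarith+
 then show "fl N x <= x" "x < fl N x + 1 / 2^N" by (auto simp: fl_def field_simps)
qed

lemma in_cell_iff: "x \<in> cell N k \<longleftrightarrow> \<lfloor>2^N * x\<rfloor> = k"
proof -
 have "x \<in> cell N k \<longleftrightarrow> real_of_int k <= 2^N * x \<and> 2^N * x < real_of_int k + 1"
  by (auto simp: cell_def field_simps)
 then show ?thesis by (auto simp: floor_eq_iff)
qed

lemma fl_in_cell: "x \<in> cell N k ==> fl N x = real_of_int k / 2^N"
 by (simp add: in_cell_iff fl_def)

lemma cell_measurable [measurable]: "cell N k \<in> sets borel"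
 by (simp add: cell_def)

lemma tame_cell: "tame (ind (cell N k))"
 by (rule tame_indicator) (auto simp: cell_def)

lemma integral_cell: "(LBINT x. ind (cell N k) x) = 1 / 2^N"
 by (simp add: cell_def field_simps measure_def)

lemma fl_measurable [measurable]: "fl N \<in> borel_measurable borel"
 unfolding fl_def by measurable

lemma step_measurable: "step N f ==> f \<in> borel_measurable borel"
proof -
 assume f: "step N f"
 have "(%x::real. f (real_of_int \<lfloor>2^N * x\<rfloor> / 2^N)) \<in> borel_measurable borel"
  by (rule measurable_compose[of "%x::real. \<lfloor>2^N * x\<rfloor>" borel "count_space UNIV" "%k. f (real_of_int k / 2^N)" borel]) measurable
 moreover have "f = (%x. f (real_of_int \<lfloor>2^N * x\<rfloor> / 2^N))" using f unfolding step_def fl_def by blast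
 ultimately show ?thesis by simp
qed

lemma sum_cells:
 fixes F :: "real \<Rightarrow> real"
 assumes F: "tame F"
 obtains K :: "int set" where "finite K" "\<And>x. F x = (\<Sum>k\<in>K. F x * ind (cell N k) x)"
  "\<And>k x. k \<notin> K ==> x \<in> cell N k ==> F x = 0"
proof -
 obtain M R where MR: "R >= 0" "\<And>v. F v \<noteq> 0 ==> norm v <= R" using F by (rule tameE) blast
 define K where "K = {- \<lceil>2^N * R\<rceil> - 1 .. \<lceil>2^N * R\<rceil>}"
 have K: "\<lfloor>2^N * x\<rfloor> \<in> K" if "F x \<noteq> 0" for x
 proof -
  have "\<bar>x\<bar> <= R" using MR(2)[OF that] by simp
  then have "\<bar>2^N * x\<bar> <= 2^N * R" by (simp add: abs_mult)
  then show ?thesis unfolding K_def atLeastAtMost_iff by linarith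
 qed
 show ?thesis
 proof (rule that[of K])
  show "finite K" by (simp add: K_def)
  show "F x = (\<Sum>k\<in>K. F x * ind (cell N k) x)" for x
  proof (cases "F x = 0")
   case False
   have "(\<Sum>k\<in>K. F x * ind (cell N k) x) = (\<Sum>k\<in>{\<lfloor>2^N * x\<rfloor>}. F x * ind (cell N k) x)"
    using K[OF False] by (intro sum.mono_neutral_right) (auto simp: K_def in_cell_iff indicator_def)
   then show ?thesis by (simp add: in_cell_iff indicator_def)
  qed simp
  show "F x = 0" if "k \<notin> K" "x \<in> cell N k" for k x using K that by (auto simp: in_cell_iff)
 qed
qed

lemma integral_cells:
 fixes F :: "real \<Rightarrow> real"
 assumes F: "tame F"
 obtains K :: "int set" where "finite K"
  "(LBINT x. F x) = (\<Sum>k\<in>K. LBINT x. F x * ind (cell N k) x)"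
  "\<And>k x. k \<notin> K ==> x \<in> cell N k ==> F x = 0"
proof -
 obtain K where K: "finite K" "\<And>x. F x = (\<Sum>k\<in>K. F x * ind (cell N k) x)"
  "\<And>k x. k \<notin> K ==> x \<in> cell N k ==> F x = 0" using sum_cells[OF F, of N] by metis
 have "(LBINT x. F x) = (LBINT x. (\<Sum>k\<in>K. F x * ind (cell N k) x))" using K(2) by simp
 also have "\<dots> = (\<Sum>k\<in>K. LBINT x. F x * ind (cell N k) x)"
  by (rule lint_sum) (intro tame_integrable tame_mult_tame F tame_cell)
 finally show ?thesis using that K by blast
qed

lemma mean_zero_step:
 assumes f: "tame f" "mean_zero N f" and h: "step N h" "\<And>x. f x \<noteq> 0 ==> \<bar>h x\<bar> <= B"
 shows "(LBINT x. f x * h x) = 0"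
proof -
 have t: "tame (%x. f x * h x)" by (rule tame_mult[OF f(1) step_measurable[OF h(1)] h(2)])
 obtain K where "finite K" and K: "(LBINT x. f x * h x) = (\<Sum>k\<in>K. LBINT x. (f x * h x) * ind (cell N k) x)"
  by (rule integral_cells[OF t, of N]) blast
 have "(LBINT x. (f x * h x) * ind (cell N k) x) = 0" for k
 proof -
  have "(f x * h x) * ind (cell N k) x = h (real_of_int k / 2^N) * (f x * ind (cell N k) x)" for x
   using h(1) fl_in_cell[of x N k] by (auto simp: indicator_def step_def) metis
  then have "(LBINT x. (f x * h x) * ind (cell N k) x) = (LBINT x. h (real_of_int k / 2^N) * (f x * ind (cell N k) x))"
   by (intro lint_cong refl)
  also have "\<dots> = h (real_of_int k / 2^N) * (LBINT x. f x * ind (cell N k) x)" by (rule integral_mult_right_zero)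
  also have "\<dots> = 0" using f(2) by (simp add: mean_zero_def)
  finally show ?thesis .
 qed
 then show ?thesis using K by simp
qed

text \<open>The single source of cancellation in the analysis: a test function may be replaced by
  its deviation from the value at the left end of the cell. For a Lipschitz test function the
  deviation is small everywhere, for a step function it is zero except near cell boundaries.\<close>

lemma mean_zero_cancel:
 assumes f: "tame f" "mean_zero N f" and G: "G \<in> borel_measurable borel" "\<And>x. f x \<noteq> 0 ==> \<bar>G x\<bar> <= B"
  "\<And>x. f x \<noteq> 0 ==> \<bar>G (fl N x)\<bar> <= B"
 shows "(LBINT x. f x * G x) = (LBINT x. f x * (G x - G (fl N x)))"
proof -
 have [measurable]: "G \<in> borel_measurable borel" by fact
 have ff: "fl N (fl N x) = fl N x" for x by (simp add: fl_def)
 have s: "step N (%x. G (fl N x))" by (simp add: step_def ff)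
 have 0: "(LBINT x. f x * G (fl N x)) = 0" by (rule mean_zero_step[OF f s]) (use G(3) in auto)
 have i1: "integrable lborel (%x. f x * G x)" by (intro tame_integrable tame_mult[OF f(1), where B = B] G)
 have i2: "integrable lborel (%x. f x * G (fl N x))" by (intro tame_integrable tame_mult[OF f(1), where B = B] G(3)) measurable
 show ?thesis using 0 i1 i2 by (simp add: right_diff_distrib)
qed

lemma mean_zero_lipschitz:
 assumes f: "tame f" "mean_zero N f" and G: "\<And>x y. \<bar>G x - G y\<bar> <= L * \<bar>x - y\<bar>" and L: "L >= 0"
 shows "\<bar>LBINT x. f x * G x\<bar> <= L / 2^N * (LBINT x. \<bar>f x\<bar>)"
proof -
 obtain R where R: "R >= 0" "\<And>v. f v \<noteq> 0 ==> norm v <= R" using f(1) by (rule tameE) blast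
 have cont: "continuous_on UNIV G"
 proof (rule continuous_onI)
  fix x e :: real assume "e > 0"
  show "\<exists>d>0. \<forall>x'\<in>UNIV. dist x' x < d \<longrightarrow> dist (G x') (G x) <= e"
  proof (intro exI[of _ "e/(L+1)"] conjI ballI impI)
   show "e/(L+1) > 0" using \<open>e > 0\<close> L by simp
   fix x' assume d: "dist x' x < e/(L+1)"
   have "dist (G x') (G x) <= L * dist x' x" using G[of x' x] by (simp add: dist_real_def)
   also have "\<dots> <= (L+1) * (e/(L+1))" using d L by (intro mult_mono) auto
   also have "\<dots> = e" using L by simp
   finally show "dist (G x') (G x) <= e" .
  qed
 qed
 then have [measurable]: "G \<in> borel_measurable borel" by (rule borel_measurable_continuous_onI)
 have d: "\<bar>G x - G (fl N x)\<bar> <= L / 2^N" for x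
 proof -
  have "\<bar>x - fl N x\<bar> <= 1 / 2^N" using fl_le[of N x] fl_gt[of x N] by linarith
  then have "L * \<bar>x - fl N x\<bar> <= L * (1 / 2^N)" using L by (rule mult_left_mono)
  then show ?thesis using G[of x "fl N x"] by simp
 qed
 have b: "\<bar>G x\<bar> <= \<bar>G 0\<bar> + L * R" if "f x \<noteq> 0" for x
 proof -
  have "L * \<bar>x\<bar> <= L * R" using R(2)[OF that] L by (intro mult_left_mono) auto
  then show ?thesis using G[of x 0] by auto
 qed
 have "(LBINT x. f x * G x) = (LBINT x. f x * (G x - G (fl N x)))"
 proof (rule mean_zero_cancel[OF f, where B = "\<bar>G 0\<bar> + L * R + L / 2^N"])
  fix x assume x: "f x \<noteq> 0"
  show "\<bar>G x\<bar> <= \<bar>G 0\<bar> + L * R + L / 2^N" using b[OF x] L by (simp add: add_increasing2)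
  show "\<bar>G (fl N x)\<bar> <= \<bar>G 0\<bar> + L * R + L / 2^N" using b[OF x] d[of x] by linarith
 qed measurable
 also have "\<bar>\<dots>\<bar> <= (LBINT x. \<bar>f x * (G x - G (fl N x))\<bar>)" by (rule integral_abs_bound)
 also have "\<dots> <= (LBINT x. L / 2^N * \<bar>f x\<bar>)"
 proof (rule lint_mono)
  show "integrable lborel (%x. \<bar>f x * (G x - G (fl N x))\<bar>)"
   by (intro tame_integrable tame_abs tame_mult[OF f(1), where B = "L/2^N"] d) measurable
  show "integrable lborel (%x. L / 2^N * \<bar>f x\<bar>)" by (intro tame_integrable tame_cmult tame_abs f)
  show "\<bar>f x * (G x - G (fl N x))\<bar> <= L / 2^N * \<bar>f x\<bar>" for x
   using mult_right_mono[OF d[of x], of "\<bar>f x\<bar>"] by (simp add: abs_mult mult.commute)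
 qed
 finally show ?thesis by simp
qed

text \<open>The substitution u = \<alpha> + \<beta> a costs one factor 1 / |\<beta>| in the measure
  and another one in the Lipschitz constant of the test function, hence the square.\<close>

lemma mean_zero_lipschitz_affine:
 assumes f: "tame f" "mean_zero N f" and G: "\<And>x y. \<bar>G x - G y\<bar> <= L * \<bar>x - y\<bar>" and L: "L >= 0" and b: "\<beta> \<noteq> 0"
 shows "\<bar>LBINT a. f (\<alpha> + \<beta> * a) * G a\<bar> <= L / 2^N / \<beta>\<^sup>2 * (LBINT x. \<bar>f x\<bar>)"
proof -
 define H where "H u = G ((u - \<alpha>) / \<beta>)" for u
 have "(LBINT u. f u * H u) = \<bar>\<beta>\<bar> *\<^sub>R (LBINT a. f (\<alpha> + \<beta> * a) * H (\<alpha> + \<beta> * a))"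
  using b by (rule lborel_integral_real_affine)
 then have e: "(LBINT a. f (\<alpha> + \<beta> * a) * G a) = (LBINT u. f u * H u) / \<bar>\<beta>\<bar>" using b by (simp add: H_def)
 have "\<bar>LBINT u. f u * H u\<bar> <= (L/\<bar>\<beta>\<bar>) / 2^N * (LBINT x. \<bar>f x\<bar>)"
 proof (rule mean_zero_lipschitz[OF f])
  fix x y
  have "\<bar>H x - H y\<bar> <= L * \<bar>(x-\<alpha>)/\<beta> - (y-\<alpha>)/\<beta>\<bar>" unfolding H_def by (rule G)
  also have "(x-\<alpha>)/\<beta> - (y-\<alpha>)/\<beta> = (x-y)/\<beta>" by (simp add: diff_divide_distrib)
  finally show "\<bar>H x - H y\<bar> <= L/\<bar>\<beta>\<bar> * \<bar>x-y\<bar>" by (simp add: abs_divide)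
 qed (use L in auto)
 then have "\<bar>LBINT u. f u * H u\<bar> / \<bar>\<beta>\<bar> <= (L/\<bar>\<beta>\<bar>) / 2^N * (LBINT x. \<bar>f x\<bar>) / \<bar>\<beta>\<bar>" by (rule divide_right_mono) simp
 then show ?thesis unfolding e by (simp add: abs_divide power2_eq_square field_simps)
qed

definition edge :: "nat \<Rightarrow> real \<Rightarrow> real \<Rightarrow> real" where
 "edge N t u = (if u - fl N u <= t \<or> fl N u + 1/2^N - u <= t then 1 else 0)"

text \<open>A majorant for the squared change of a step function under a shift by at most t <=
  2^(-N). A shifted point either stays in its cell, where nothing changes, or enters a neighbouring
  one, which requires u to be within t of an edge. The values at u + 2^(-N) and u - 2^(-N) are those
  of the two neighbouring cells, so the majorant does not mention the shifted point.\<close>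

definition oscillation :: "nat \<Rightarrow> real \<Rightarrow> (real \<Rightarrow> real) \<Rightarrow> real \<Rightarrow> real" where
 "oscillation N t f u = 2 * edge N t u * ((f u)\<^sup>2 + (f (u + 1/2^N))\<^sup>2 + (f (u - 1/2^N))\<^sup>2)"

lemma edge_measurable [measurable]: "edge N t \<in> borel_measurable borel"
 unfolding edge_def by measurable

lemma fl_shift: "fl N (x + 1/2^N) = fl N x + 1/2^N" "fl N (x - 1/2^N) = fl N x - 1/2^N"
proof -
 have "2^N * (x + 1/2^N) = 2^N * x + 1" "2^N * (x - 1/2^N) = 2^N * x - 1" by (simp_all add: field_simps)
 then show "fl N (x + 1/2^N) = fl N x + 1/2^N" "fl N (x - 1/2^N) = fl N x - 1/2^N"
  unfolding fl_def by (simp_all add: add_divide_distrib diff_divide_distrib)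
qed

lemma oscillation_nonneg: "oscillation N t f u >= 0"
 by (simp add: oscillation_def edge_def)

lemma step_diff_le:
 assumes f: "step N f" and t: "\<bar>u - u'\<bar> <= t" "t <= 1/2^N"
 shows "(f u - f u')\<^sup>2 <= oscillation N t f u"
proof (cases "fl N u = fl N u'")
 case True
 then have "f u = f u'" using f unfolding step_def by metis
 then show ?thesis using oscillation_nonneg by simp
next
 case False
 have h: "fl N u <= u" "u < fl N u + 1/2^N" "fl N u' <= u'" "u' < fl N u' + 1/2^N" using fl_le fl_gt by auto
 define k where "k = \<lfloor>2^N * u\<rfloor>"
 define k' where "k' = \<lfloor>2^N * u'\<rfloor>"
 have fk: "fl N u = k/2^N" "fl N u' = k'/2^N" by (auto simp: fl_def k_def k'_def)
 have ne: "k \<noteq> k'" using False fk by auto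
 have "\<bar>2^N * u - 2^N * u'\<bar> <= 1"
 proof -
  have "2^N * \<bar>u - u'\<bar> <= 2^N * (1/2^N)" using t by (intro mult_left_mono) auto
  then show ?thesis by (simp add: abs_mult flip: right_diff_distrib)
 qed
 then have kk: "\<bar>k - k'\<bar> <= 1" unfolding k_def k'_def by linarith
 have *: "(f u - f u')\<^sup>2 <= 2 * ((f u)\<^sup>2 + (f u')\<^sup>2)" using sum_squares_bound[of "f u" "- f u'"] by (simp add: power2_eq_square algebra_simps)
 consider "k' = k + 1" | "k' = k - 1" using kk ne by linarith
 then show ?thesis
 proof cases
  case 1
  have e: "fl N u' = fl N u + 1/2^N" using fk 1 by (simp add: add_divide_distrib)
  have "f u' = f (fl N u')" using f by (simp add: step_def)
  also have "\<dots> = f (u + 1/2^N)" using f e fl_shift(1)[of N u] unfolding step_def by metis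
  finally have "f u' = f (u + 1/2^N)" .
  moreover have "edge N t u = 1" using e h t unfolding edge_def by auto
  ultimately show ?thesis using * by (simp add: oscillation_def) (smt (verit) zero_le_power2)
 next
  case 2
  have e: "fl N u' = fl N u - 1/2^N" using fk 2 by (simp add: diff_divide_distrib)
  have "f u' = f (fl N u')" using f by (simp add: step_def)
  also have "\<dots> = f (u - 1/2^N)" using f e fl_shift(2)[of N u] unfolding step_def by metis
  finally have "f u' = f (u - 1/2^N)" .
  moreover have "edge N t u = 1" using e h t unfolding edge_def by auto
  ultimately show ?thesis using * by (simp add: oscillation_def) (smt (verit) zero_le_power2)
 qed
qed

lemma edge_integral:
 assumes f: "tame f" "step N f" "\<And>x. f x >= 0" and t: "t >= 0"
 shows "(LBINT u. edge N t u * f u) <= 2 * t * 2^N * (LBINT u. f u)"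
proof -
 have t1: "tame (%u. f u * edge N t u)" by (rule tame_mult[OF f(1), where B = 1]) (auto simp: edge_def)
 obtain K where K: "finite K" "\<And>x. f x = (\<Sum>k\<in>K. f x * ind (cell N k) x)"
  by (rule sum_cells[OF f(1), of N]) blast
 define c where "c k = f (real_of_int k / 2^N)" for k
 have fc: "f x * ind (cell N k) x = c k * ind (cell N k) x" for k x
  using f(2) fl_in_cell[of x N k] by (auto simp: indicator_def step_def c_def) metis
 have one: "(LBINT u. edge N t u * ind (cell N k) u) <= 2 * t" for k
 proof -
  let ?a = "real_of_int k / 2^N" let ?b = "(real_of_int k + 1) / 2^N"
  have "(LBINT u. edge N t u * ind (cell N k) u) <= (LBINT u. ind {?a..?a+t} u + ind {?b-t..?b} u)"
  proof (rule lint_mono)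
   show "integrable lborel (%u. edge N t u * ind (cell N k) u)"
    using tame_integrable[OF tame_mult[OF tame_cell[of N k], of "edge N t" 1]] by (simp add: edge_def mult.commute)
   show "integrable lborel (%u. ind {?a..?a+t} u + ind {?b-t..?b} u)"
    by (intro tame_integrable tame_add tame_indicator) auto
   show "edge N t u * ind (cell N k) u <= ind {?a..?a+t} u + ind {?b-t..?b} u" for u
   proof (cases "u \<in> cell N k")
    case True
    have "fl N u = ?a" "?a + 1/2^N = ?b" using fl_in_cell[OF True] by (auto simp: add_divide_distrib)
    then show ?thesis using True by (auto simp: edge_def indicator_def cell_def)
   qed auto
  qed
  also have "\<dots> = t + t" using t by (subst lint_add) (auto intro!: tame_integrable tame_indicator)
  finally show ?thesis by simp
 qed
 have i: "integrable lborel (%u. edge N t u * ind (cell N k) u)" for k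
  using tame_integrable[OF tame_mult[OF tame_cell[of N k], of "edge N t" 1]] by (simp add: edge_def mult.commute)
 have "(LBINT u. edge N t u * f u) = (LBINT u. (\<Sum>k\<in>K. c k * (edge N t u * ind (cell N k) u)))"
  by (intro lint_cong refl) (subst K(2), simp add: fc sum_distrib_left mult_ac)
 also have "\<dots> = (\<Sum>k\<in>K. c k * (LBINT u. edge N t u * ind (cell N k) u))"
  by (subst lint_sum) (auto intro!: integrable_mult_right i)
 also have "\<dots> <= (\<Sum>k\<in>K. c k * (2 * t))" by (intro sum_mono mult_left_mono one) (simp add: c_def f)
 also have "\<dots> = 2 * t * 2^N * (\<Sum>k\<in>K. c k * (LBINT u. ind (cell N k) u))"
  unfolding integral_cell by (simp add: sum_distrib_left field_simps)
 also have "(\<Sum>k\<in>K. c k * (LBINT u. ind (cell N k) u)) = (LBINT u. (\<Sum>k\<in>K. c k * ind (cell N k) u))"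
  by (subst lint_sum) (auto intro!: tame_integrable tame_cmult tame_cell)
 also have "\<dots> = (LBINT u. f u)"
 proof -
  have "(\<Sum>k\<in>K. c k * ind (cell N k) x) = f x" for x using K(2)[of x] unfolding fc by simp
  then show ?thesis by simp
 qed
 finally show ?thesis .
qed

lemma tame_translate: "tame f ==> tame (%x. f (x + c))" for f :: "real \<Rightarrow> real"
proof -
 assume f: "tame f"
 obtain M R where MR: "\<And>v. \<bar>f v\<bar> <= M" "\<And>v. f v \<noteq> 0 ==> norm v <= R" using f by (rule tameE) blast
 have [measurable]: "f \<in> borel_measurable borel" using f by (rule tame_measurable)
 show ?thesis
 proof (rule tameI[where M = M and R = "R + \<bar>c\<bar>"])
  show "norm v <= R + \<bar>c\<bar>" if "f (v + c) \<noteq> 0" for v using MR(2)[OF that] by auto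
 qed (use MR in auto)
qed

text \<open>12 = 2 * 3 * 2: the factor in the definition, the three translates, and the proportion 2
  t 2^N of a cell that lies near its two edges.\<close>

lemma oscillation_integral:
 assumes f: "tame f" "step N f" and t: "t >= 0"
 shows "tame (oscillation N t f)" "(LBINT u. oscillation N t f u) <= 12 * t * 2^N * (LBINT u. (f u)\<^sup>2)"
proof -
 define h :: real where "h = 1/2^N"
 define q where "q c u = (f (u + c))\<^sup>2" for c u
 have tq: "tame (q c)" for c unfolding q_def by (intro tame_power2 tame_translate f)
 have sq: "step N (q 0)" "step N (q h)" "step N (q (-h))"
  using f(2) fl_shift unfolding step_def q_def h_def by (simp, metis, simp, metis)
 have te: "tame (%u. edge N t u * q c u)" for c
  using tame_mult[OF tq[of c], of "edge N t" 1] by (simp add: edge_def mult.commute)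
 have iq: "(LBINT u. q c u) = (LBINT u. (f u)\<^sup>2)" for c
  using integral_translate[of "%u. (f u)\<^sup>2" c] by (simp add: q_def add.commute)
 have o: "oscillation N t f = (%u. 2 * (edge N t u * q 0 u + edge N t u * q h u + edge N t u * q (-h) u))"
  by (auto simp: oscillation_def q_def h_def algebra_simps)
 show "tame (oscillation N t f)" unfolding o by (intro tame_cmult tame_add te)
 have "(LBINT u. edge N t u * q c u) <= 2 * t * 2^N * (LBINT u. (f u)\<^sup>2)" if "step N (q c)" for c
  using edge_integral[OF tq that _ t] by (simp add: iq) (simp add: q_def)
 from this[OF sq(1)] this[OF sq(2)] this[OF sq(3)]
 show "(LBINT u. oscillation N t f u) <= 12 * t * 2^N * (LBINT u. (f u)\<^sup>2)"
  unfolding o using te by (simp add: tame_integrable)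
qed

section \<open>Cancellation on average over fractional linear maps\<close>

definition trap :: "real \<Rightarrow> real" where "trap u = max 0 (min 1 (2 - \<bar>u\<bar>))"

lemma trap_bounds: "0 <= trap u" "trap u <= 1" "\<bar>u\<bar> <= 1 ==> trap u = 1" "\<bar>u\<bar> >= 2 ==> trap u = 0"
 by (auto simp: trap_def)

lemma trap_lipschitz: "\<bar>trap u - trap v\<bar> <= \<bar>u - v\<bar>"
 unfolding trap_def by linarith

lemma trap_measurable [measurable]: "trap \<in> borel_measurable borel"
 unfolding trap_def by measurable

text \<open>A Lipschitz substitute for the indicator of [-R, R]. In \<open>flattening\<close> it is
  part of the test function that a function of mean zero is integrated against.\<close>

definition cutoff :: "real \<Rightarrow> real \<Rightarrow> real" where "cutoff R a = trap (a / R)"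

lemma cutoff_bounds: "0 <= cutoff R a" "cutoff R a <= 1"
 by (auto simp: cutoff_def trap_bounds)

lemma cutoff_measurable [measurable]: "cutoff R \<in> borel_measurable borel"
 unfolding cutoff_def by measurable

lemma cutoff_support: "R > 0 ==> cutoff R a \<noteq> 0 ==> \<bar>a\<bar> <= 2 * R"
 using trap_bounds(4)[of "a/R"] by (cases "\<bar>a\<bar> <= 2 * R") (auto simp: cutoff_def abs_divide field_simps)

lemma cutoff_eq_1: "R > 0 ==> \<bar>a\<bar> <= R ==> cutoff R a = 1"
 by (simp add: cutoff_def trap_bounds(3) abs_divide)

lemma cutoff_lipschitz: "R >= 1 ==> \<bar>cutoff R a - cutoff R b\<bar> <= \<bar>a - b\<bar>"
proof -
 assume R: "R >= 1"
 have "\<bar>cutoff R a - cutoff R b\<bar> <= \<bar>(a - b)/R\<bar>" unfolding cutoff_def using trap_lipschitz[of "a/R" "b/R"] by (simp add: diff_divide_distrib)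
 also have "\<dots> = \<bar>a-b\<bar>/R" using R by (simp add: abs_divide)
 also have "\<dots> <= \<bar>a - b\<bar>/1" using R by (intro divide_left_mono) auto
 finally show ?thesis by simp
qed

lemma tame_cutoff: "R > 0 ==> tame (cutoff R)"
 by (rule tameI[where M = 1 and R = "2 * R"]) (use cutoff_support cutoff_bounds in auto)

lemma integral_cutoff_le: "R > 0 ==> (LBINT a. cutoff R a) <= 4 * R"
proof -
 assume R: "R > 0"
 have "(LBINT a. cutoff R a) <= (LBINT a. ind {-2*R..2*R} a)"
 proof (rule lint_mono)
  show "cutoff R a <= ind {-2*R..2*R} a" for a
   using cutoff_support[OF R, of a] cutoff_bounds(2)[of R a] by (cases "cutoff R a = 0") (auto simp: indicator_def)
 qed (use R in \<open>auto intro!: tame_integrable tame_cutoff tame_indicator\<close>)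
 also have "\<dots> = 4 * R" using R by simp
 finally show ?thesis .
qed

text \<open>For a single pair (a, b) the integral \<open>c a b\<close> may be large, but its mean
  square over (a, b) is not. Opening the square gives pairs t, t' with kernel \<open>K t t'\<close>,
  an integral over (a, b). For |t - t'| < \<tau> it is bounded trivially, which yields the first
  term. For |t - t'| >= \<tau> the points (a t + b) / z t and (a t' + b) / z t' vary independently
  with a and b, so the mean zero of \<phi> applies in one of them and yields the second term. The
  parameter \<tau> is left free to balance the two.\<close>

lemma flattening:
 fixes \<phi> g z :: "real \<Rightarrow> real" and P z0 z1 R \<tau> :: real
 assumes phi: "tame \<phi>" "mean_zero N \<phi>"
  and g: "tame g" "\<And>t. g t \<noteq> 0 ==> z0 <= z t \<and> z t <= z1 \<and> \<bar>t\<bar> <= P"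
  and z: "z \<in> borel_measurable borel" "z0 > 0"
  and R: "R >= 1" and tau: "\<tau> > 0"
 defines "c \<equiv> %a b. LBINT t. \<phi> ((a * t + b) / z t) * g t"
 shows "tame (%(a, b). cutoff R a * cutoff R b * (c a b)\<^sup>2)"
  "(LBINT r. cutoff R (fst r) * cutoff R (snd r) * (c (fst r) (snd r))\<^sup>2)
   <= 8 * R * z1 * \<tau> * (LBINT x. (\<phi> x)\<^sup>2) * (LBINT t. (g t)\<^sup>2)
    + (1 + P) * z1^3 / 2^N / \<tau>\<^sup>2 * (LBINT x. \<bar>\<phi> x\<bar>)\<^sup>2 * (LBINT t. \<bar>g t\<bar>)\<^sup>2"
proof -
 have [measurable]: "\<phi> \<in> borel_measurable borel" "g \<in> borel_measurable borel" "z \<in> borel_measurable borel"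
  using phi g z by (auto intro: tame_measurable)
 obtain Mp Rp where Mp: "Mp >= 0" "Rp >= 0" "\<And>v. \<bar>\<phi> v\<bar> <= Mp" "\<And>v. \<phi> v \<noteq> 0 ==> norm v <= Rp" using phi(1) by (rule tameE) blast
 obtain Mg where Mg: "Mg >= 0" "\<And>v. \<bar>g v\<bar> <= Mg" using g(1) by (rule tameE) blast
 define w where "w a b = cutoff R a * cutoff R b" for a b
 have R0: "R > 0" using R by simp
 have w0: "0 <= w a b" "w a b <= 1" for a b using cutoff_bounds[of R a] cutoff_bounds[of R b] by (auto simp: w_def mult_le_one)
 have wsupp: "\<bar>a\<bar> <= 2*R" "\<bar>b\<bar> <= 2*R" if "w a b \<noteq> 0" for a b using that cutoff_support[OF R0] by (auto simp: w_def)
 define \<Theta> where "\<Theta> a b t t' = w a b * \<phi> ((a*t+b)/z t) * \<phi> ((a*t'+b)/z t') * g t * g t'" for a b t t'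
 have tTheta: "tame (%((a,b),(t,t')). \<Theta> a b t t')"
 proof (rule tameI[where M = "1 * Mp * Mp * Mg * Mg" and R = "4*R + 2*P"])
  show "(%((a,b),(t,t')). \<Theta> a b t t') \<in> borel_measurable borel"
   unfolding \<Theta>_def w_def borel_prod[symmetric] case_prod_unfold by measurable
  show "\<bar>(%((a,b),(t,t')). \<Theta> a b t t') v\<bar> <= 1 * Mp * Mp * Mg * Mg" for v
  proof -
   obtain a b t t' where v: "v = ((a,b),(t,t'))" by (cases v) auto
   show ?thesis unfolding v prod.case \<Theta>_def abs_mult
    by (intro mult_mono) (use w0[of a b] Mp Mg in auto)
  qed
  show "norm v <= 4*R + 2*P" if "(%((a,b),(t,t')). \<Theta> a b t t') v \<noteq> 0" for v
  proof -
   obtain a b t t' where v: "v = ((a,b),(t,t'))" by (cases v) auto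
   have nz: "w a b \<noteq> 0" "g t \<noteq> 0" "g t' \<noteq> 0" using that by (auto simp: v \<Theta>_def)
   have "norm v <= norm (a,b) + norm (t,t')" unfolding v by (rule norm_Pair_le)
   also have "\<dots> <= (\<bar>a\<bar>+\<bar>b\<bar>) + (\<bar>t\<bar>+\<bar>t'\<bar>)" using norm_Pair_le[of a b] norm_Pair_le[of t t'] by simp
   finally show ?thesis using wsupp[OF nz(1)] g(2)[OF nz(2)] g(2)[OF nz(3)] by linarith
  qed
 qed
 have sq: "w a b * (c a b)\<^sup>2 = (LBINT q. \<Theta> a b (fst q) (snd q))" for a b
 proof -
  have t: "tame (%q. \<Theta> a b (fst q) (snd q))" using tame_Fubini(1)[OF tTheta, of "(a,b)"] by (simp add: case_prod_unfold)
  have "(LBINT q. \<Theta> a b (fst q) (snd q)) = (LBINT t. LBINT t'. \<Theta> a b t t')"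
   using tame_Fubini(5)[OF t] by simp
  also have "\<dots> = (LBINT t. w a b * c a b * (\<phi> ((a*t+b)/z t) * g t))"
  proof (intro lint_cong refl)
   fix t
   have "(LBINT t'. \<Theta> a b t t') = (LBINT t'. (w a b * \<phi> ((a*t+b)/z t) * g t) * (\<phi> ((a*t'+b)/z t') * g t'))"
    by (intro lint_cong refl) (simp add: \<Theta>_def mult_ac)
   also have "\<dots> = (w a b * \<phi> ((a*t+b)/z t) * g t) * c a b" unfolding c_def by (rule integral_mult_right_zero)
   finally show "(LBINT t'. \<Theta> a b t t') = w a b * c a b * (\<phi> ((a*t+b)/z t) * g t)"
    by (simp only: mult_ac)
  qed
  also have "\<dots> = w a b * (c a b)\<^sup>2" by (simp add: c_def power2_eq_square)
  finally show ?thesis by simp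
 qed
 show "tame (%(a, b). cutoff R a * cutoff R b * (c a b)\<^sup>2)"
  using tame_Fubini(3)[OF tTheta] by (simp add: case_prod_unfold flip: sq) (simp add: w_def)
 define K where "K t t' = (LBINT r. w (fst r) (snd r) * \<phi> ((fst r*t+snd r)/z t) * \<phi> ((fst r*t'+snd r)/z t'))" for t t'
 have KT: "(LBINT r. \<Theta> (fst r) (snd r) t t') = K t t' * (g t * g t')" for t t'
 proof -
  have "(LBINT r. \<Theta> (fst r) (snd r) t t') = (LBINT r. (w (fst r) (snd r) * \<phi> ((fst r*t+snd r)/z t) * \<phi> ((fst r*t'+snd r)/z t')) * (g t * g t'))"
   by (simp only: \<Theta>_def mult.assoc)
  then show ?thesis unfolding K_def by (simp only: integral_mult_left_zero)
 qed
 have LHS: "(LBINT r. w (fst r) (snd r) * (c (fst r) (snd r))\<^sup>2) = (LBINT q. K (fst q) (snd q) * (g (fst q) * g (snd q)))"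
 proof -
  have "(LBINT r. w (fst r) (snd r) * (c (fst r) (snd r))\<^sup>2) = (LBINT r. LBINT q. \<Theta> (fst r) (snd r) (fst q) (snd q))"
   by (simp only: sq)
  also have "\<dots> = (LBINT q. LBINT r. \<Theta> (fst r) (snd r) (fst q) (snd q))"
   by (rule tame_swap) (use tTheta in \<open>simp add: case_prod_unfold\<close>)
  also have "\<dots> = (LBINT q. K (fst q) (snd q) * (g (fst q) * g (snd q)))"
   by (simp only: KT)
  finally show ?thesis .
 qed
 have tK: "tame (%q. K (fst q) (snd q) * (g (fst q) * g (snd q)))"
  using tame_Fubini(4)[OF tTheta] by (simp add: case_prod_unfold KT)
 have substb: "(LBINT b. F b) = zt * (LBINT u. F (zt * u - a * t))" if "zt > 0" for F :: "real \<Rightarrow> real" and zt a t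
  using lborel_integral_real_affine[of zt F "- (a*t)"] that by simp
 define A where "A t = (LBINT r. w (fst r) (snd r) * (\<phi> ((fst r*t+snd r)/z t))\<^sup>2)" for t
 have tA1: "tame (%r. w (fst r) (snd r) * \<phi> ((fst r*t+snd r)/z t) * \<phi> ((fst r*t'+snd r)/z t'))" for t t'
 proof (rule tameI[where M = "1 * Mp * Mp" and R = "4*R"])
  show "(%r. w (fst r) (snd r) * \<phi> ((fst r*t+snd r)/z t) * \<phi> ((fst r*t'+snd r)/z t')) \<in> borel_measurable borel"
   unfolding w_def borel_prod[symmetric] by measurable
  show "\<bar>w (fst r) (snd r) * \<phi> ((fst r*t+snd r)/z t) * \<phi> ((fst r*t'+snd r)/z t')\<bar> <= 1 * Mp * Mp" for r
   unfolding abs_mult by (intro mult_mono) (use w0 Mp in auto)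
  show "norm r <= 4*R" if "w (fst r) (snd r) * \<phi> ((fst r*t+snd r)/z t) * \<phi> ((fst r*t'+snd r)/z t') \<noteq> 0" for r
   using that wsupp[of "fst r" "snd r"] norm_Pair_le[of "fst r" "snd r"] by auto
 qed
 have tA: "tame (%r. w (fst r) (snd r) * (\<phi> ((fst r*t+snd r)/z t))\<^sup>2)" for t
  using tA1[of t t] by (simp add: power2_eq_square mult.assoc)
 have Ale: "A t <= 4 * R * z1 * (LBINT x. (\<phi> x)\<^sup>2)" if "g t \<noteq> 0" for t
 proof -
  have zt: "z0 <= z t" "z t <= z1" using g(2)[OF that] by auto
  then have zt0: "z t > 0" using z(2) by simp
  have "A t = (LBINT a. LBINT b. w a b * (\<phi> ((a*t+b)/z t))\<^sup>2)"
   unfolding A_def by (subst tame_Fubini(5)[OF tA]) simp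
  also have "\<dots> <= (LBINT a. cutoff R a * (z1 * (LBINT x. (\<phi> x)\<^sup>2)))"
  proof (rule lint_mono)
   show "integrable lborel (%a. LBINT b. w a b * (\<phi> ((a*t+b)/z t))\<^sup>2)"
    using tame_integrable[OF tame_Fubini(3)[OF tA[of t]]] by simp
   show "integrable lborel (%a. cutoff R a * (z1 * (LBINT x. (\<phi> x)\<^sup>2)))"
    using tame_integrable[OF tame_cutoff[OF R0]] by simp
   fix a
   have tp: "tame (%b. (\<phi> ((a*t+b)/z t))\<^sup>2)"
   proof (intro tame_power2 tameI[where M = Mp and R = "Rp * z t + \<bar>a*t\<bar>"])
    show "norm b <= Rp * z t + \<bar>a*t\<bar>" if "\<phi> ((a*t+b)/z t) \<noteq> 0" for b
    proof -
     have "\<bar>(a*t+b)/z t\<bar> <= Rp" using Mp(4)[OF that] by simp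
     then have "\<bar>a*t+b\<bar> <= Rp * z t" using zt0 by (simp add: abs_divide field_simps)
     then show ?thesis unfolding real_norm_def by linarith
    qed
   qed (use Mp in auto)
   have "(LBINT b. w a b * (\<phi> ((a*t+b)/z t))\<^sup>2) <= (LBINT b. cutoff R a * (\<phi> ((a*t+b)/z t))\<^sup>2)"
   proof (rule lint_mono)
    show "integrable lborel (%b. w a b * (\<phi> ((a*t+b)/z t))\<^sup>2)" using tame_integrable[OF tame_Fubini(1)[OF tA[of t], of a]] by simp
    show "integrable lborel (%b. cutoff R a * (\<phi> ((a*t+b)/z t))\<^sup>2)" using tame_integrable[OF tp] by simp
    show "w a b * (\<phi> ((a*t+b)/z t))\<^sup>2 <= cutoff R a * (\<phi> ((a*t+b)/z t))\<^sup>2" for b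
     unfolding w_def by (intro mult_right_mono) (use cutoff_bounds[of R a] cutoff_bounds[of R b] in \<open>auto simp: mult_left_le\<close>)
   qed
   also have "\<dots> = cutoff R a * (z t * (LBINT u. (\<phi> u)\<^sup>2))"
    using substb[OF zt0, of "%b. (\<phi> ((a*t+b)/z t))\<^sup>2" a t] zt0 by simp
   also have "\<dots> <= cutoff R a * (z1 * (LBINT x. (\<phi> x)\<^sup>2))"
    by (intro mult_left_mono mult_right_mono zt cutoff_bounds) simp
   finally show "(LBINT b. w a b * (\<phi> ((a*t+b)/z t))\<^sup>2) <= cutoff R a * (z1 * (LBINT x. (\<phi> x)\<^sup>2))" .
  qed
  also have "\<dots> = (LBINT a. cutoff R a) * (z1 * (LBINT x. (\<phi> x)\<^sup>2))" by simp
  also have "\<dots> <= (4 * R) * (z1 * (LBINT x. (\<phi> x)\<^sup>2))"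
   by (intro mult_right_mono integral_cutoff_le[OF R0] mult_nonneg_nonneg) (use zt zt0 in auto)
  finally show ?thesis by (simp add: mult_ac)
 qed
 have Knear: "\<bar>K t t'\<bar> <= 4 * R * z1 * (LBINT x. (\<phi> x)\<^sup>2)" if "g t \<noteq> 0" "g t' \<noteq> 0" for t t'
 proof -
  have "\<bar>K t t'\<bar> <= (LBINT r. \<bar>w (fst r) (snd r) * \<phi> ((fst r*t+snd r)/z t) * \<phi> ((fst r*t'+snd r)/z t')\<bar>)"
   unfolding K_def by (rule integral_abs_bound)
  also have "\<dots> <= (LBINT r. (w (fst r) (snd r) * (\<phi> ((fst r*t+snd r)/z t))\<^sup>2 + w (fst r) (snd r) * (\<phi> ((fst r*t'+snd r)/z t'))\<^sup>2) * (1/2))"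
  proof (rule lint_mono)
   show "\<bar>w (fst r) (snd r) * \<phi> ((fst r*t+snd r)/z t) * \<phi> ((fst r*t'+snd r)/z t')\<bar> <= (w (fst r) (snd r) * (\<phi> ((fst r*t+snd r)/z t))\<^sup>2 + w (fst r) (snd r) * (\<phi> ((fst r*t'+snd r)/z t'))\<^sup>2) * (1/2)" for r
   proof -
    have "\<bar>p * q\<bar> <= (p\<^sup>2 + q\<^sup>2)/2" for p q :: real using sum_squares_bound[of "\<bar>p\<bar>" "\<bar>q\<bar>"] by (simp add: abs_mult)
    from mult_left_mono[OF this[of "\<phi> ((fst r*t+snd r)/z t)" "\<phi> ((fst r*t'+snd r)/z t')"] w0(1)[of "fst r" "snd r"]]
    show ?thesis using w0(1)[of "fst r" "snd r"] by (simp add: abs_mult algebra_simps)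
   qed
  qed (intro tame_integrable tame_abs tA1, intro integrable_mult_left tame_integrable tame_add tA)
  also have "\<dots> = (A t + A t')/2" unfolding A_def
   by (subst integral_mult_left_zero, subst lint_add) (auto intro!: tame_integrable tA)
  also have "\<dots> <= (4 * R * z1 * (LBINT x. (\<phi> x)\<^sup>2) + 4 * R * z1 * (LBINT x. (\<phi> x)\<^sup>2))/2"
   by (intro divide_right_mono add_mono Ale that) simp
  finally show ?thesis by simp
 qed
 have Kfar: "\<bar>K t t'\<bar> <= (1 + P) * z1^3 / 2^N / \<tau>\<^sup>2 * (LBINT x. \<bar>\<phi> x\<bar>)\<^sup>2"
  if nz: "g t \<noteq> 0" "g t' \<noteq> 0" and far: "\<bar>t - t'\<bar> >= \<tau>" for t t'
 proof -
  define I1 where "I1 = (LBINT x. \<bar>\<phi> x\<bar>)"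
  have I10: "I1 >= 0" by (simp add: I1_def)
  have zt: "z0 <= z t" "z t <= z1" "\<bar>t\<bar> <= P" "z0 <= z t'" "z t' <= z1" using g(2)[OF nz(1)] g(2)[OF nz(2)] by auto
  then have zt0: "z t > 0" "z t' > 0" using z(2) by auto
  \<comment> \<open>Substituting b = z t * u - a * t turns the first argument of \<phi> into u, and
    the second into an affine function of a with slope \<beta>. Integration over a then meets
    \<open>mean_zero_lipschitz_affine\<close>, with the two cutoffs as Lipschitz test function;
    their constant 1 + P reflects |t| <= P.\<close>
  define \<beta> where "\<beta> = (t' - t) / z t'"
  have b0: "\<beta> \<noteq> 0" using far tau zt0 by (auto simp: \<beta>_def)
  define Hf where "Hf u a = cutoff R a * cutoff R (z t * u - a * t)" for u a
  have Hlip: "\<bar>Hf u a - Hf u a'\<bar> <= (1 + P) * \<bar>a - a'\<bar>" for u a a'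
  proof -
   have "Hf u a - Hf u a' = (cutoff R a - cutoff R a') * cutoff R (z t * u - a * t) + cutoff R a' * (cutoff R (z t * u - a * t) - cutoff R (z t * u - a' * t))"
    by (simp add: Hf_def algebra_simps)
   also have "\<bar>\<dots>\<bar> <= \<bar>cutoff R a - cutoff R a'\<bar> * \<bar>cutoff R (z t * u - a * t)\<bar> + \<bar>cutoff R a'\<bar> * \<bar>cutoff R (z t * u - a * t) - cutoff R (z t * u - a' * t)\<bar>"
    by (rule order_trans[OF abs_triangle_ineq]) (simp add: abs_mult)
   also have "\<dots> <= \<bar>a - a'\<bar> * 1 + 1 * (P * \<bar>a - a'\<bar>)"
   proof (intro add_mono mult_mono)
    show "\<bar>cutoff R a - cutoff R a'\<bar> <= \<bar>a - a'\<bar>" by (rule cutoff_lipschitz[OF R])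
    have "\<bar>cutoff R (z t * u - a * t) - cutoff R (z t * u - a' * t)\<bar> <= \<bar>(z t * u - a * t) - (z t * u - a' * t)\<bar>" by (rule cutoff_lipschitz[OF R])
    also have "\<dots> = \<bar>t\<bar> * \<bar>a - a'\<bar>" by (simp add: abs_mult[symmetric] algebra_simps abs_minus_commute)
    also have "\<dots> <= P * \<bar>a - a'\<bar>" using zt(3) by (intro mult_right_mono) auto
    finally show "\<bar>cutoff R (z t * u - a * t) - cutoff R (z t * u - a' * t)\<bar> <= P * \<bar>a - a'\<bar>" .
   qed (use cutoff_bounds in auto)
   finally show ?thesis by (simp add: algebra_simps)
  qed
  define F where "F a b = w a b * \<phi> ((a*t+b)/z t) * \<phi> ((a*t'+b)/z t')" for a b
  define J where "J u = (LBINT a. \<phi> (u * z t / z t' + \<beta> * a) * Hf u a)" for u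
  have Jle: "\<bar>J u\<bar> <= (1 + P) / 2^N / \<beta>\<^sup>2 * I1" for u
   unfolding J_def I1_def by (rule mean_zero_lipschitz_affine[OF phi Hlip _ b0]) (use zt in auto)
  have tF: "tame (%(u, a). z t * F a (z t * u - a * t))"
  proof (rule tameI[where M = "z t * (1 * Mp * Mp)" and R = "2*R + (2*R + 2*R*P)/z t"])
   show "(%(u, a). z t * F a (z t * u - a * t)) \<in> borel_measurable borel"
    unfolding F_def w_def borel_prod[symmetric] case_prod_unfold by measurable
   show "\<bar>case v of (u, a) \<Rightarrow> z t * F a (z t * u - a * t)\<bar> <= z t * (1 * Mp * Mp)" for v
    unfolding case_prod_unfold F_def abs_mult by (intro mult_mono) (use w0 Mp zt0 in auto)
   show "norm v <= 2*R + (2*R + 2*R*P)/z t" if "(case v of (u, a) \<Rightarrow> z t * F a (z t * u - a * t)) \<noteq> 0" for v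
   proof -
    obtain u a where v: "v = (u, a)" by (cases v)
    have ww: "w a (z t * u - a * t) \<noteq> 0" using that by (auto simp: v F_def)
    have "\<bar>z t * u\<bar> <= \<bar>z t * u - a * t\<bar> + \<bar>a\<bar> * \<bar>t\<bar>" unfolding abs_mult[symmetric] by linarith
    also have "\<dots> <= 2*R + 2*R*P" using wsupp[OF ww] zt(3) by (intro add_mono mult_mono) auto
    finally have "\<bar>u\<bar> <= (2*R + 2*R*P)/z t" using zt0 by (simp add: abs_mult field_simps)
    then show ?thesis using wsupp[OF ww] norm_Pair_le[of u a] by (simp add: v)
   qed
  qed
  have "K t t' = (LBINT a. LBINT b. F a b)"
   unfolding K_def F_def by (subst tame_Fubini(5)[OF tA1]) simp
  also have "\<dots> = (LBINT a. LBINT u. z t * F a (z t * u - a * t))"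
   using substb[OF zt0(1), of "F a" a t for a] by simp
  also have "\<dots> = (LBINT u. LBINT a. z t * F a (z t * u - a * t))"
   by (rule tame_swap[OF tF, symmetric])
  also have "\<dots> = (LBINT u. z t * (\<phi> u * J u))"
  proof (intro lint_cong refl)
   fix u
   have "z t * F a (z t * u - a * t) = (z t * \<phi> u) * (\<phi> (u * z t / z t' + \<beta> * a) * Hf u a)" for a
   proof -
    have "(a * t' + (z t * u - a * t)) / z t' = u * z t / z t' + \<beta> * a" using zt0 by (simp add: \<beta>_def field_simps)
    moreover have "(a * t + (z t * u - a * t)) / z t = u" using zt0 by simp
    ultimately show ?thesis by (simp add: F_def w_def Hf_def mult_ac)
   qed
   then show "(LBINT a. z t * F a (z t * u - a * t)) = z t * (\<phi> u * J u)"
    unfolding J_def by (simp only: integral_mult_right_zero mult.assoc)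
  qed
  finally have Ke: "K t t' = z t * (LBINT u. \<phi> u * J u)" by simp
  have "\<bar>LBINT u. \<phi> u * J u\<bar> <= (LBINT u. \<bar>\<phi> u * J u\<bar>)" by (rule integral_abs_bound)
  also have "\<dots> <= (LBINT u. \<bar>\<phi> u\<bar> * ((1 + P) / 2^N / \<beta>\<^sup>2 * I1))"
  proof (rule lint_mono)
   have "J \<in> borel_measurable borel" unfolding J_def Hf_def by measurable
   then show "integrable lborel (%u. \<bar>\<phi> u * J u\<bar>)" using Jle by (intro tame_integrable tame_abs tame_mult[OF phi(1)])
   show "integrable lborel (%u. \<bar>\<phi> u\<bar> * ((1 + P) / 2^N / \<beta>\<^sup>2 * I1))" using tame_integrable[OF tame_abs[OF phi(1)]] by simp
   show "\<bar>\<phi> u * J u\<bar> <= \<bar>\<phi> u\<bar> * ((1 + P) / 2^N / \<beta>\<^sup>2 * I1)" for u unfolding abs_mult by (intro mult_left_mono Jle) auto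
  qed
  also have "\<dots> = (1 + P) / 2^N / \<beta>\<^sup>2 * I1\<^sup>2" by (simp add: I1_def power2_eq_square)
  finally have "\<bar>K t t'\<bar> <= z t * ((1 + P) / 2^N / \<beta>\<^sup>2 * I1\<^sup>2)" unfolding Ke abs_mult using zt0 by (intro mult_mono) auto
  also have "\<dots> <= z1 * ((1 + P) / 2^N / (\<tau>/z1)\<^sup>2 * I1\<^sup>2)"
  proof (intro mult_mono mult_right_mono divide_left_mono zt)
   have "\<tau> / z1 <= \<bar>t' - t\<bar> / z t'" using far zt zt0 tau by (intro frac_le) auto
   then have "(\<tau>/z1)\<^sup>2 <= (\<bar>t' - t\<bar> / z t')\<^sup>2" using tau zt zt0 by (intro power_mono) auto
   then show "(\<tau>/z1)\<^sup>2 <= \<beta>\<^sup>2" by (simp add: \<beta>_def power_divide)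
   show "0 < \<beta>\<^sup>2 * (\<tau> / z1)\<^sup>2" using b0 tau zt zt0 by auto
  qed (use zt zt0 I10 in auto)
  also have "\<dots> = (1 + P) * z1^3 / 2^N / \<tau>\<^sup>2 * I1\<^sup>2" by (simp add: power_divide power3_eq_cube power2_eq_square)
  finally show ?thesis by (simp add: I1_def)
 qed
 define C1 where "C1 = 4 * R * z1 * (LBINT x. (\<phi> x)\<^sup>2)"
 define C2 where "C2 = (1 + P) * z1^3 / 2^N / \<tau>\<^sup>2 * (LBINT x. \<bar>\<phi> x\<bar>)\<^sup>2"
 define near where "near t t' = ind {-\<tau>..\<tau>} (t - t')" for t t'
 show "(LBINT r. cutoff R (fst r) * cutoff R (snd r) * (c (fst r) (snd r))\<^sup>2)
   <= 8 * R * z1 * \<tau> * (LBINT x. (\<phi> x)\<^sup>2) * (LBINT t. (g t)\<^sup>2)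
    + (1 + P) * z1^3 / 2^N / \<tau>\<^sup>2 * (LBINT x. \<bar>\<phi> x\<bar>)\<^sup>2 * (LBINT t. \<bar>g t\<bar>)\<^sup>2"
 proof (cases "\<exists>t. g t \<noteq> 0")
  case False
  then have "g = (%_. 0)" by auto
  then show ?thesis by (simp add: c_def)
 next
  case True
  then obtain ta where ta: "g ta \<noteq> 0" by blast
  have z1: "z1 > 0" "P >= 0" using g(2)[OF ta] z(2) by auto
  have C10: "C1 >= 0" using z1 R by (simp add: C1_def)
  have C20: "C2 >= 0" using z1 by (simp add: C2_def)
  have near01: "0 <= near t t'" "near t t' <= 1" for t t' by (auto simp: near_def)
  have [measurable]: "(%q. near (fst q) (snd q)) \<in> borel_measurable (borel \<Otimes>\<^sub>M borel)" unfolding near_def by measurable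
  have tn: "tame (%q. near (fst q) (snd q) * (g (fst q))\<^sup>2)" "tame (%q. near (fst q) (snd q) * (g (snd q))\<^sup>2)"
  proof -
   have m: "(%q. near (fst q) (snd q) * (g (fst q))\<^sup>2) \<in> borel_measurable borel" "(%q. near (fst q) (snd q) * (g (snd q))\<^sup>2) \<in> borel_measurable borel"
    unfolding borel_prod[symmetric] by measurable
   have b: "\<bar>near t t' * (g s)\<^sup>2\<bar> <= 1 * Mg\<^sup>2" for t t' s unfolding abs_mult
   proof (intro mult_mono)
    show "\<bar>(g s)\<^sup>2\<bar> <= Mg\<^sup>2" using Mg(2)[of s] by (simp add: abs_le_square_iff[symmetric])
   qed (use near01 in auto)
   have n: "\<bar>t - t'\<bar> <= \<tau>" if "near t t' \<noteq> 0" for t t' using that by (auto simp: near_def indicator_def split: if_splits)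
   show "tame (%q. near (fst q) (snd q) * (g (fst q))\<^sup>2)"
   proof (rule tameI[OF m(1) b])
    fix q assume "near (fst q) (snd q) * (g (fst q))\<^sup>2 \<noteq> 0"
    then have "near (fst q) (snd q) \<noteq> 0" "g (fst q) \<noteq> 0" by auto
    then show "norm q <= 2*P + \<tau>" using n[of "fst q" "snd q"] g(2)[of "fst q"] norm_Pair_le[of "fst q" "snd q"] unfolding real_norm_def prod.collapse by linarith
   qed
   show "tame (%q. near (fst q) (snd q) * (g (snd q))\<^sup>2)"
   proof (rule tameI[OF m(2) b])
    fix q assume "near (fst q) (snd q) * (g (snd q))\<^sup>2 \<noteq> 0"
    then have "near (fst q) (snd q) \<noteq> 0" "g (snd q) \<noteq> 0" by auto
    then show "norm q <= 2*P + \<tau>" using n[of "fst q" "snd q"] g(2)[of "snd q"] norm_Pair_le[of "fst q" "snd q"] unfolding real_norm_def prod.collapse by linarith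
   qed
  qed
  have nint1: "(LBINT t'. near t t') = 2 * \<tau>" for t
  proof -
   have "near t t' = ind {t-\<tau>..t+\<tau>} t'" for t' by (auto simp: near_def indicator_def)
   then show ?thesis using tau by simp
  qed
  have nint2: "(LBINT t. near t t') = 2 * \<tau>" for t'
  proof -
   have "near t t' = ind {t'-\<tau>..t'+\<tau>} t" for t by (auto simp: near_def indicator_def)
   then show ?thesis using tau by simp
  qed
  have in1: "(LBINT q. near (fst q) (snd q) * (g (fst q))\<^sup>2) = 2 * \<tau> * (LBINT t. (g t)\<^sup>2)"
   using tame_Fubini(5)[OF tn(1)] by (simp add: nint1)
  have in2: "(LBINT q. near (fst q) (snd q) * (g (snd q))\<^sup>2) = 2 * \<tau> * (LBINT t. (g t)\<^sup>2)"
   using tame_Fubini(6)[OF tn(2)] by (simp add: nint2)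
  have tgg: "tame (%q. \<bar>g (fst q)\<bar> * \<bar>g (snd q)\<bar>)"
  proof (rule tameI[where M = "Mg * Mg" and R = "2 * P"])
   show "(%q. \<bar>g (fst q)\<bar> * \<bar>g (snd q)\<bar>) \<in> borel_measurable borel" unfolding borel_prod[symmetric] by measurable
   show "\<bar>\<bar>g (fst q)\<bar> * \<bar>g (snd q)\<bar>\<bar> <= Mg * Mg" for q unfolding abs_mult by (intro mult_mono) (use Mg in auto)
   show "norm q <= 2 * P" if "\<bar>g (fst q)\<bar> * \<bar>g (snd q)\<bar> \<noteq> 0" for q
    using that g(2)[of "fst q"] g(2)[of "snd q"] norm_Pair_le[of "fst q" "snd q"] by auto
  qed
  have igg: "(LBINT q. \<bar>g (fst q)\<bar> * \<bar>g (snd q)\<bar>) = (LBINT t. \<bar>g t\<bar>)\<^sup>2"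
   using tame_Fubini(5)[OF tgg] by (simp add: power2_eq_square)
  have pt: "K (fst q) (snd q) * (g (fst q) * g (snd q)) <= C1/2 * (near (fst q) (snd q) * (g (fst q))\<^sup>2 + near (fst q) (snd q) * (g (snd q))\<^sup>2) + C2 * (\<bar>g (fst q)\<bar> * \<bar>g (snd q)\<bar>)" for q
  proof -
   obtain t t' where q: "q = (t, t')" by (cases q)
   show ?thesis
   proof (cases "g t = 0 \<or> g t' = 0")
    case True
    then show ?thesis using C10 near01[of t t'] by (auto simp: q)
   next
    case False
    then have nz: "g t \<noteq> 0" "g t' \<noteq> 0" by auto
    have "K t t' * (g t * g t') <= \<bar>K t t'\<bar> * (\<bar>g t\<bar> * \<bar>g t'\<bar>)" by (metis abs_ge_self abs_mult)
    also have "\<dots> <= C1/2 * (near t t' * (g t)\<^sup>2 + near t t' * (g t')\<^sup>2) + C2 * (\<bar>g t\<bar> * \<bar>g t'\<bar>)"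
    proof (cases "\<bar>t - t'\<bar> >= \<tau>")
     case True
     have "\<bar>K t t'\<bar> * (\<bar>g t\<bar> * \<bar>g t'\<bar>) <= C2 * (\<bar>g t\<bar> * \<bar>g t'\<bar>)" using Kfar[OF nz True] by (intro mult_right_mono) (auto simp: C2_def)
     moreover have "0 <= C1/2 * (near t t' * (g t)\<^sup>2 + near t t' * (g t')\<^sup>2)" using C10 near01[of t t'] by simp
     ultimately show ?thesis by linarith
    next
     case False
     have n1: "near t t' = 1" using False by (auto simp: near_def indicator_def)
     have "\<bar>K t t'\<bar> * (\<bar>g t\<bar> * \<bar>g t'\<bar>) <= C1 * (((g t)\<^sup>2 + (g t')\<^sup>2)/2)"
     proof (rule mult_mono)
      show "\<bar>K t t'\<bar> <= C1" using Knear[OF nz] by (simp add: C1_def)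
      show "\<bar>g t\<bar> * \<bar>g t'\<bar> <= ((g t)\<^sup>2 + (g t')\<^sup>2)/2" using sum_squares_bound[of "\<bar>g t\<bar>" "\<bar>g t'\<bar>"] by simp
     qed (use C10 in auto)
     moreover have "0 <= C2 * (\<bar>g t\<bar> * \<bar>g t'\<bar>)" using C20 by simp
     ultimately show ?thesis by (simp add: n1)
    qed
    finally show ?thesis by (simp add: q)
   qed
  qed
  have "(LBINT r. w (fst r) (snd r) * (c (fst r) (snd r))\<^sup>2) <=
   (LBINT q. C1/2 * (near (fst q) (snd q) * (g (fst q))\<^sup>2 + near (fst q) (snd q) * (g (snd q))\<^sup>2) + C2 * (\<bar>g (fst q)\<bar> * \<bar>g (snd q)\<bar>))"
   unfolding LHS
   by (rule lint_mono[OF tame_integrable[OF tK] _ pt])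
    (intro tame_integrable tame_add tame_cmult tn tgg)
  also have "\<dots> = C1/2 * ((2 * \<tau> * (LBINT t. (g t)\<^sup>2)) + (2 * \<tau> * (LBINT t. (g t)\<^sup>2))) + C2 * (LBINT t. \<bar>g t\<bar>)\<^sup>2"
   using tn tgg by (simp add: tame_integrable in1 in2 igg)
  also have "\<dots> = 8 * R * z1 * \<tau> * (LBINT x. (\<phi> x)\<^sup>2) * (LBINT t. (g t)\<^sup>2)
    + (1 + P) * z1^3 / 2^N / \<tau>\<^sup>2 * (LBINT x. \<bar>\<phi> x\<bar>)\<^sup>2 * (LBINT t. \<bar>g t\<bar>)\<^sup>2"
   by (simp add: C1_def C2_def algebra_simps)
  finally show ?thesis by (simp add: w_def)
 qed
qed

section \<open>Averages over measure-preserving linear maps\<close>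

text \<open>The pair (s, s') stands for the factor \<open>A s\<close> times the inverse of
  \<open>A s'\<close>, which is how letters occur in powers of the operator \<open>B\<close> below.
  A word of length n therefore has 2 n letters.\<close>

definition words :: "'s set \<Rightarrow> nat \<Rightarrow> ('s \<times> 's) list set" where
 "words S n = {ws. set ws \<subseteq> S \<times> S \<and> length ws = n}"

lemma finite_words: "finite S ==> finite (words S n)"
 unfolding words_def by (rule finite_lists_length_eq) simp

lemma card_words: "finite S ==> card (words S n) = (card S)^(2*n)"
 unfolding words_def by (subst card_lists_length_eq) (auto simp: card_cartesian_product power_mult power2_eq_square)

lemma words_Suc: "words S (Suc n) = (%(q, ws). q # ws) ` ((S \<times> S) \<times> words S n)"
 by (auto simp: words_def length_Suc_conv image_iff)

definition unimodular :: "real \<times> real \<times> real \<times> real \<Rightarrow> bool" where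
 "unimodular m = (case m of (a, b, c, d) \<Rightarrow> a*d - b*c = 1)"

lemma integral_unimodular: "tame F ==> unimodular m ==> (LBINT v. F (lin m v)) = (LBINT v. F v)"
 by (cases m) (auto simp: unimodular_def intro: integral_lin1)

lemma tame_unimodular: "tame F ==> unimodular m ==> tame (%v. F (lin m v))"
 by (cases m) (auto simp: unimodular_def intro!: tame_lin)

locale linear_averages =
 fixes S :: "'s set" and A A' :: "'s \<Rightarrow> real \<times> real \<times> real \<times> real"
 assumes fin: "finite S" "S \<noteq> {}"
  and A: "\<And>s. s \<in> S ==> unimodular (A s)" "\<And>s. s \<in> S ==> unimodular (A' s)"
  and inv: "\<And>s v. s \<in> S ==> lin (A s) (lin (A' s) v) = v" "\<And>s v. s \<in> S ==> lin (A' s) (lin (A s) v) = v"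
begin

definition "k = real (card S)"

lemma k0: "k > 0" using fin by (simp add: k_def card_gt_0_iff)

fun wmap :: "('s \<times> 's) list \<Rightarrow> real \<times> real \<Rightarrow> real \<times> real" where
 "wmap [] v = v"
| "wmap (q # ws) v = lin (A (fst q)) (lin (A' (snd q)) (wmap ws v))"

definition avg :: "(real \<times> real \<Rightarrow> real) \<Rightarrow> real \<times> real \<Rightarrow> real" where
 "avg F v = (\<Sum>s\<in>S. F (lin (A s) v)) / k"

text \<open>The adjoint of \<open>avg\<close> in L^2 of the plane composed with \<open>avg\<close>.
  It is self-adjoint although \<open>avg\<close> need not be, and its quadratic form is the squared
  norm of \<open>avg F\<close>.\<close>

definition B :: "(real \<times> real \<Rightarrow> real) \<Rightarrow> real \<times> real \<Rightarrow> real" where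
 "B F v = (\<Sum>q\<in>S\<times>S. F (lin (A (fst q)) (lin (A' (snd q)) v))) / k^2"

lemma tame_q: "tame F ==> q \<in> S \<times> S ==> tame (%v. F (lin (A (fst q)) (lin (A' (snd q)) v)))"
 using tame_unimodular[OF tame_unimodular[of F "A (fst q)"], of "A' (snd q)"] A by auto

lemma tame_avg: "tame F ==> tame (avg F)"
proof -
 assume F: "tame F"
 have "tame (%v. (1/k) * (\<Sum>s\<in>S. F (lin (A s) v)))" by (intro tame_cmult tame_sum tame_unimodular F A)
 then show ?thesis by (simp add: avg_def[abs_def])
qed

lemma tame_B: "tame F ==> tame (B F)"
proof -
 assume F: "tame F"
 have "tame (%v. (1/k^2) * (\<Sum>q\<in>S\<times>S. F (lin (A (fst q)) (lin (A' (snd q)) v))))" by (intro tame_cmult tame_sum tame_q F)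
 then show ?thesis by (simp add: B_def[abs_def])
qed

lemma tame_B_pow: "tame F ==> tame ((B ^^ n) F)"
 by (induction n) (auto intro: tame_B)

lemma B_pow_words: "(B ^^ n) F v = (\<Sum>ws\<in>words S n. F (wmap ws v)) / k^(2*n)"
proof (induction n arbitrary: F v)
 case 0
 have "words S 0 = {[]}" by (auto simp: words_def)
 then show ?case by simp
next
 case (Suc n)
 have "(B ^^ Suc n) F v = (B ^^ n) (B F) v" by (simp add: funpow_swap1)
 also have "\<dots> = (\<Sum>ws\<in>words S n. B F (wmap ws v)) / k^(2*n)" by (rule Suc.IH)
 also have "\<dots> = (\<Sum>ws\<in>words S n. \<Sum>q\<in>S\<times>S. F (wmap (q # ws) v)) / k^(2 * Suc n)"
  using k0 by (simp add: B_def sum_divide_distrib power2_eq_square mult_ac)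
 also have "(\<Sum>ws\<in>words S n. \<Sum>q\<in>S\<times>S. F (wmap (q # ws) v)) = (\<Sum>(q, ws)\<in>(S\<times>S)\<times>words S n. F (wmap (q # ws) v))"
  by (subst sum.swap) (simp add: sum.cartesian_product)
 also have "\<dots> = (\<Sum>ws\<in>words S (Suc n). F (wmap ws v))"
  unfolding words_Suc by (subst sum.reindex) (auto simp: inj_on_def case_prod_unfold)
 finally show ?case .
qed

lemma integral_q:
 assumes F: "tame F" and G: "tame G" and s: "s \<in> S" "s' \<in> S"
 shows "(LBINT v. F (lin (A s) (lin (A' s') v)) * G v) = (LBINT v. F (lin (A s) v) * G (lin (A s') v))"
proof -
 have t: "tame (%v. F (lin (A s) (lin (A' s') v)) * G v)" using tame_q[OF F, of "(s,s')"] s G by (intro tame_mult_tame) auto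
 show ?thesis using integral_unimodular[OF t A(1)[OF s(2)]] inv s by simp
qed

lemma integral_avg_sq: "tame F ==> (LBINT v. (avg F v)\<^sup>2) = (LBINT v. B F v * F v)"
proof -
 assume F: "tame F"
 have t: "integrable lborel (%v. F (lin (A s) v) * F (lin (A s') v))" if "s \<in> S" "s' \<in> S" for s s'
  using that by (intro tame_integrable tame_mult_tame tame_unimodular F A)
 have t': "integrable lborel (%v. F (lin (A (fst q)) (lin (A' (snd q)) v)) * F v)" if "q \<in> S\<times>S" for q
  using that by (intro tame_integrable tame_mult_tame tame_q F)
 have "(LBINT v. (avg F v)\<^sup>2) = (LBINT v. (\<Sum>q\<in>S\<times>S. F (lin (A (fst q)) v) * F (lin (A (snd q)) v)) * (1/k^2))"
  by (intro lint_cong refl)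
   (simp add: avg_def power2_eq_square sum_product sum.cartesian_product case_prod_unfold)
 also have "\<dots> = (\<Sum>q\<in>S\<times>S. LBINT v. F (lin (A (fst q)) v) * F (lin (A (snd q)) v)) * (1/k^2)"
  unfolding integral_mult_left_zero by (subst lint_sum) (auto intro!: t)
 also have "\<dots> = (\<Sum>q\<in>S\<times>S. LBINT v. F (lin (A (fst q)) (lin (A' (snd q)) v)) * F v) * (1/k^2)"
  by (intro arg_cong2[of _ _ _ _ "(*)"] refl sum.cong) (auto simp: integral_q[OF F F])
 also have "\<dots> = (LBINT v. (\<Sum>q\<in>S\<times>S. F (lin (A (fst q)) (lin (A' (snd q)) v)) * F v) * (1/k^2))"
  unfolding integral_mult_left_zero by (subst lint_sum) (auto intro!: t')
 also have "\<dots> = (LBINT v. B F v * F v)"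
  by (intro lint_cong refl) (simp add: B_def sum_distrib_right)
 finally show ?thesis .
qed

lemma B_selfadjoint: "tame F ==> tame G ==> (LBINT v. B F v * G v) = (LBINT v. F v * B G v)"
proof -
 assume F: "tame F" and G: "tame G"
 have *: "(LBINT v. B F v * G v) = (\<Sum>q\<in>S\<times>S. LBINT v. F (lin (A (fst q)) v) * G (lin (A (snd q)) v)) * (1/k^2)"
  if F: "tame F" and G: "tame G" for F G
 proof -
  have t': "integrable lborel (%v. F (lin (A (fst q)) (lin (A' (snd q)) v)) * G v)" if "q \<in> S\<times>S" for q
   using that by (intro tame_integrable tame_mult_tame tame_q F G)
  have "(LBINT v. B F v * G v) = (LBINT v. (\<Sum>q\<in>S\<times>S. F (lin (A (fst q)) (lin (A' (snd q)) v)) * G v) * (1/k^2))"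
   by (intro lint_cong refl) (simp add: B_def sum_distrib_right)
  also have "\<dots> = (\<Sum>q\<in>S\<times>S. LBINT v. F (lin (A (fst q)) (lin (A' (snd q)) v)) * G v) * (1/k^2)"
   unfolding integral_mult_left_zero by (subst lint_sum) (auto intro!: t')
  also have "\<dots> = (\<Sum>q\<in>S\<times>S. LBINT v. F (lin (A (fst q)) v) * G (lin (A (snd q)) v)) * (1/k^2)"
   by (intro arg_cong2[of _ _ _ _ "(*)"] refl sum.cong) (auto simp: integral_q[OF F G])
  finally show ?thesis .
 qed
 have "(LBINT v. F v * B G v) = (LBINT v. B G v * F v)" by (simp add: mult.commute)
 also have "\<dots> = (\<Sum>q\<in>S\<times>S. LBINT v. F (lin (A (snd q)) v) * G (lin (A (fst q)) v)) * (1/k^2)"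
  by (subst *[OF G F]) (simp add: mult.commute)
 also have "(\<Sum>q\<in>S\<times>S. LBINT v. F (lin (A (snd q)) v) * G (lin (A (fst q)) v)) = (\<Sum>q\<in>S\<times>S. LBINT v. F (lin (A (fst q)) v) * G (lin (A (snd q)) v))"
  by (rule sum.reindex_bij_witness[of _ prod.swap prod.swap]) auto
 finally show ?thesis using *[OF F G] by simp
qed

lemma B_pow_double: "tame F ==> (LBINT v. (B ^^ (2*n)) F v * F v) = (LBINT v. ((B ^^ n) F v)\<^sup>2)"
proof -
 assume F: "tame F"
 have "(LBINT v. (B ^^ (m + n)) F v * F v) = (LBINT v. (B ^^ n) F v * (B ^^ m) F v)" for m n
 proof (induction m arbitrary: n)
  case (Suc m)
  have "(LBINT v. (B ^^ (Suc m + n)) F v * F v) = (LBINT v. (B ^^ (m + Suc n)) F v * F v)" by simp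
  also have "\<dots> = (LBINT v. (B ^^ Suc n) F v * (B ^^ m) F v)" by (rule Suc.IH)
  also have "\<dots> = (LBINT v. (B ^^ n) F v * (B ^^ Suc m) F v)"
   using B_selfadjoint[OF tame_B_pow[OF F, of n] tame_B_pow[OF F, of m]] by simp
  finally show ?case .
 qed simp
 from this[of n n] show ?thesis by (simp add: mult_2 power2_eq_square)
qed

text \<open>Each step is one application of Cauchy-Schwarz: the square of <B^m F, F> is at most |B^m
  F|^2 |F|^2 = <B^(2m) F, F> |F|^2. It replaces the spectral theorem, and its doubling is the reason
  for word lengths that are powers of two.\<close>

lemma power_trick:
 assumes F: "tame F"
 shows "(LBINT v. (avg F v)\<^sup>2)^(2^r) <= (LBINT v. (F v)\<^sup>2)^(2^r - 1) * (LBINT v. (B ^^ (2^r)) F v * F v)"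
proof (induction r)
 case 0
 show ?case by (simp add: integral_avg_sq[OF F])
next
 case (Suc r)
 define a where "a = (LBINT v. (avg F v)\<^sup>2)"
 define f where "f = (LBINT v. (F v)\<^sup>2)"
 define b where "b r = (LBINT v. (B ^^ (2^r)) F v * F v)" for r
 have f0: "f >= 0" "a >= 0" by (auto simp: f_def a_def)
 have "(b r)\<^sup>2 <= b (Suc r) * f"
  using tame_CauchySchwarz[OF tame_B_pow[OF F, of "2^r"] F] B_pow_double[OF F, of "2^r"] by (simp add: b_def f_def)
 have "a^(2^Suc r) = (a^(2^r))\<^sup>2" by (simp flip: power_mult add: mult.commute)
 also have "\<dots> <= (f^(2^r-1) * b r)\<^sup>2" using Suc.IH f0 unfolding a_def f_def b_def by (intro power_mono) auto
 also have "\<dots> = f^(2*(2^r-1)) * (b r)\<^sup>2" by (simp add: power_mult_distrib mult.commute flip: power_mult)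
 also have "\<dots> <= f^(2*(2^r-1)) * (b (Suc r) * f)" using \<open>(b r)\<^sup>2 <= b (Suc r) * f\<close> f0 by (intro mult_left_mono) auto
 also have "\<dots> = f^(2*(2^r-1)+1) * b (Suc r)" by simp
 also have "2*(2^r-1)+1 = (2^Suc r - 1 :: nat)"
 proof -
  obtain m where "(2::nat)^r = Suc m" using gr0_implies_Suc[of "2^r"] by auto
  then show ?thesis by simp
 qed
 finally show ?case by (simp add: a_def f_def b_def)
qed

lemma wmap_unimodular: 
 assumes "ws \<in> words S n"
 shows "tame F ==> tame (%v. F (wmap ws v))"
 using assms
proof (induction ws arbitrary: n F)
 case (Cons q ws)
 have "tame (%v. F (lin (A (fst q)) (lin (A' (snd q)) v)))" using Cons by (intro tame_q) (auto simp: words_def)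
 from Cons.IH[OF this, of "length ws"] show ?case using Cons.prems by (simp add: words_def)
qed simp

lemma power_trick_words:
 assumes F: "tame F"
 shows "(LBINT v. (avg F v)\<^sup>2)^(2^r) <= (LBINT v. (F v)\<^sup>2)^(2^r - 1) *
  ((\<Sum>ws\<in>words S (2^r). LBINT v. F (wmap ws v) * F v) / k^(2*2^r))"
proof -
 have "(LBINT v. (B ^^ (2^r)) F v * F v) = (LBINT v. (\<Sum>ws\<in>words S (2^r). F (wmap ws v) * F v) * (1/k^(2*2^r)))"
  by (intro lint_cong refl) (simp add: B_pow_words sum_distrib_right)
 also have "\<dots> = (\<Sum>ws\<in>words S (2^r). LBINT v. F (wmap ws v) * F v) * (1/k^(2*2^r))"
  unfolding integral_mult_left_zero
  by (subst lint_sum) (auto intro!: tame_integrable tame_mult_tame wmap_unimodular F)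
 finally show ?thesis using power_trick[OF F, of r] by simp
qed

end

section \<open>Lifting from the line to the plane and thickening in the space of matrices\<close>

text \<open>A cutoff in the coordinate y. For a normalised generator and t in the unit interval, c t
  + d lies in [1/16, 2]; with y in [1, 2] the image has second coordinate in [1/16, 4], where
  \<open>psit\<close> has to be 1. Since \<open>psit\<close> averages over dilations by factors up
  to 2, \<open>psi\<close> has to be 1 up to 8.\<close>

definition psi :: "real \<Rightarrow> real" where "psi u = max 0 (min 1 (min (32*u - 1) (9 - u)))"

lemma psi_bounds: "0 <= psi u" "psi u <= 1" and psi_one: "1/16 <= u ==> u <= 8 ==> psi u = 1"
 and psi_support: "psi u \<noteq> 0 ==> 1/32 <= u \<and> u <= 9"
 unfolding psi_def by linarith+

lemma psi_lipschitz: "\<bar>psi u - psi v\<bar> <= 32 * \<bar>u - v\<bar>"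
proof -
 have "\<bar>max 0 (min 1 a) - max 0 (min 1 b)\<bar> <= \<bar>a - b\<bar>" for a b :: real by linarith
 moreover have "\<bar>min (32*u - 1) (9 - u) - min (32 * v - 1) (9 - v)\<bar> <= 32 * \<bar>u - v\<bar>"
  by (cases "32*u - 1 <= 9 - u"; cases "32 * v - 1 <= 9 - v"; simp add: min_def abs_if)
 ultimately show ?thesis unfolding psi_def by (meson order_trans)
qed

lemma psi_measurable [measurable]: "psi \<in> borel_measurable borel"
 unfolding psi_def by measurable

text \<open>The cutoff that arises when \<open>psi\<close> is averaged over the dilations by l in
  [1, 2], the diagonal direction of the set \<open>EE\<close> below; see
  \<open>lift_psit_eq\<close>.\<close>

definition psit :: "real \<Rightarrow> real" where "psit y = (LBINT l. ind {1..2} l * psi (l * y))"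

lemma psit_measurable [measurable]: "psit \<in> borel_measurable borel"
 unfolding psit_def by measurable

lemma tame_psil: "tame (%l. ind {1..2} l * psi (l * y))"
 by (rule tame_mult[OF tame_indicator, where B = 1]) (use psi_bounds in auto)

lemma psit_bounds: "0 <= psit y" "psit y <= 1"
proof -
 show "0 <= psit y" unfolding psit_def by (intro Bochner_Integration.integral_nonneg) (use psi_bounds in auto)
 have "psit y <= (LBINT l. ind {1..2::real} l)" unfolding psit_def
  by (rule lint_mono[OF tame_integrable[OF tame_psil]])
   (use psi_bounds in \<open>auto intro!: tame_integrable tame_indicator simp: mult_left_le\<close>)
 then show "psit y <= 1" by simp
qed

lemma psit_one: "1/16 <= y ==> y <= 4 ==> psit y = 1"
proof -
 assume y: "1/16 <= y" "y <= 4"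
 have "ind {1..2} l * psi (l * y) = ind {1..2::real} l" for l
 proof (cases "l \<in> {1..2}")
  case True
  have "1 * (1/16) <= l * y" "l * y <= 2 * 4" using True y by (intro mult_mono; auto)+
  then show ?thesis using psi_one[of "l * y"] by simp
 qed simp
 then have "psit y = (LBINT l. ind {1..2::real} l)" unfolding psit_def by (simp only:)
 then show ?thesis by simp
qed

lemma psit_support: "psit y \<noteq> 0 ==> 1/64 <= y \<and> y <= 9"
proof -
 assume "psit y \<noteq> 0"
 then obtain l where "ind {1..2} l * psi (l * y) \<noteq> 0" unfolding psit_def using integral_nonzeroD by blast
 then have l: "l \<in> {1..2}" "psi (l * y) \<noteq> 0" by (auto simp: indicator_def split: if_splits)
 have h: "1/32 <= l * y" "l * y <= 9" using psi_support[OF l(2)] by auto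
 have y0: "y > 0" using h(1) l(1) by (smt (verit) atLeastAtMost_iff mult_nonneg_nonpos divide_pos_pos)
 have "1 * y <= l * y" "l * y <= 2 * y" using l y0 by (intro mult_right_mono; auto)+
 then show ?thesis using h by linarith
qed

text \<open>A matrix as a pair of rows, hence a point of the Euclidean space R^4 in which Fubini
  separates the two rows.\<close>

type_synonym rows = "(real \<times> real) \<times> (real \<times> real)"

definition lr :: "rows \<Rightarrow> real \<times> real \<Rightarrow> real \<times> real" where
 "lr m v = (fst (fst m) * fst v + snd (fst m) * snd v, fst (snd m) * fst v + snd (snd m) * snd v)"

text \<open>A function of the slope x / y, confined in y by \<open>h\<close>. Precomposition with a
  linear map acts on the slope by the Moebius map but preserves area, so averages over matrices of
  determinant one act isometrically term by term.\<close>

definition lift :: "(real \<Rightarrow> real) \<Rightarrow> (real \<Rightarrow> real) \<Rightarrow> real \<times> real \<Rightarrow> real" where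
 "lift f h v = f (fst v / snd v) * h (snd v)"

lemma tame_lift:
 assumes f: "tame f" and h: "h \<in> borel_measurable borel" "\<And>y. \<bar>h y\<bar> <= 1" "\<And>y. h y \<noteq> 0 ==> 1/64 <= y \<and> y <= 9"
 shows "tame (lift f h)"
proof -
 obtain M R where MR: "M >= 0" "R >= 0" "\<And>v. \<bar>f v\<bar> <= M" "\<And>v. f v \<noteq> 0 ==> norm v <= R" using f by (rule tameE) blast
 have [measurable]: "f \<in> borel_measurable borel" "h \<in> borel_measurable borel" using f h by (auto intro: tame_measurable)
 show ?thesis
 proof (rule tameI[where M = "M * 1" and R = "9 * R + 9"])
  show "lift f h \<in> borel_measurable borel" unfolding lift_def borel_prod[symmetric] by measurable
  show "\<bar>lift f h v\<bar> <= M * 1" for v unfolding lift_def abs_mult by (intro mult_mono) (use MR h in auto)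
  show "norm v <= 9 * R + 9" if "lift f h v \<noteq> 0" for v
  proof -
   have nz: "f (fst v / snd v) \<noteq> 0" "h (snd v) \<noteq> 0" using that by (auto simp: lift_def)
   have y: "1/64 <= snd v" "snd v <= 9" using h(3)[OF nz(2)] by auto
   have "\<bar>fst v / snd v\<bar> <= R" using MR(4)[OF nz(1)] by simp
   then have "\<bar>fst v\<bar> <= R * snd v" using y by (simp add: abs_divide field_simps)
   also have "\<dots> <= R * 9" using MR y by (intro mult_left_mono) auto
   finally show ?thesis using y norm_Pair_le[of "fst v" "snd v"] by simp
  qed
 qed
qed

lemma tame_lift_psi: "tame f ==> tame (lift f psi)" and tame_lift_psit: "tame f ==> tame (lift f psit)"
proof -
 assume f: "tame f"
 show "tame (lift f psi)"
 proof (rule tame_lift[OF f])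
  show "\<bar>psi y\<bar> <= 1" for y using psi_bounds[of y] by simp
  show "1/64 <= y \<and> y <= 9" if "psi y \<noteq> 0" for y using psi_support[OF that] by linarith
 qed measurable
 show "tame (lift f psit)"
 proof (rule tame_lift[OF f])
  show "\<bar>psit y\<bar> <= 1" for y using psit_bounds[of y] by simp
  show "1/64 <= y \<and> y <= 9" if "psit y \<noteq> 0" for y using psit_support[OF that] .
 qed measurable
qed

text \<open>Matrices within \<delta> of l times the identity, with l in [1, 2]. Dilations do not
  move slopes, so letting l vary is harmless for functions of x / y, and it gives the set positive
  volume in R^4: Lebesgue measure there replaces Haar measure on SL_2(R). The volume 8 \<delta>^3
  reflects the three dimensions of the group.\<close>

definition EE :: "real \<Rightarrow> rows set" where
 "EE \<delta> = {m. 1 <= fst (fst m) \<and> fst (fst m) <= 2 \<and> \<bar>snd (fst m)\<bar> <= \<delta> \<and> \<bar>fst (snd m)\<bar> <= \<delta> \<and> \<bar>snd (snd m) - fst (fst m)\<bar> <= \<delta>}"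

lemma EE_measurable [measurable]: "EE \<delta> \<in> sets borel"
 unfolding EE_def by (intro borel_closed closed_Collect_conj closed_Collect_le continuous_intros)

lemma EE_bounded: "\<delta> <= 1 ==> bounded (EE \<delta>)"
proof (rule boundedI)
 fix m assume d: "\<delta> <= 1" and m: "m \<in> EE \<delta>"
 have "norm m <= norm (fst m) + norm (snd m)" using norm_Pair_le[of "fst m" "snd m"] by simp
 also have "\<dots> <= (\<bar>fst (fst m)\<bar> + \<bar>snd (fst m)\<bar>) + (\<bar>fst (snd m)\<bar> + \<bar>snd (snd m)\<bar>)"
  using norm_Pair_le[of "fst (fst m)" "snd (fst m)"] norm_Pair_le[of "fst (snd m)" "snd (snd m)"] by simp
 also have "\<dots> <= 10" using m d unfolding EE_def by auto
 finally show "norm m <= 10" .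
qed

lemma tame_EE: "\<delta> <= 1 ==> tame (ind (EE \<delta>))"
 by (intro tame_indicator EE_measurable EE_bounded)

lemma integral_EE:
 assumes d: "0 < \<delta>" "\<delta> <= 1" and h: "h \<in> borel_measurable borel" "\<And>l. \<bar>h l\<bar> <= M"
 shows "(LBINT m. ind (EE \<delta>) m * h (fst (fst m))) = 8 * \<delta>^3 * (LBINT l. ind {1..2} l * h l)"
proof -
 have [measurable]: "h \<in> borel_measurable borel" by fact
 have m1: "(%m::rows. h (fst (fst m))) \<in> borel_measurable borel" unfolding borel_prod[symmetric] by measurable
 have t: "tame (%m::rows. ind (EE \<delta>) m * h (fst (fst m)))" by (rule tame_mult[OF tame_EE[OF d(2)] m1 h(2)])
 let ?I = "ind"
 have e: "?I (EE \<delta>) ((a,b),(c,d')) = ?I {1..2} a * ?I {-\<delta>..\<delta>} b * ?I {-\<delta>..\<delta>} c * ?I {a-\<delta>..a+\<delta>} d'" for a b c d'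
  by (auto simp: EE_def indicator_def abs_le_iff)
 have t2: "tame (%r2. ?I (EE \<delta>) (r1, r2) * h (fst r1))" for r1 using tame_Fubini(1)[OF t, of r1] by simp
 have t1: "tame (%r1. LBINT r2. ?I (EE \<delta>) (r1, r2) * h (fst r1))" using tame_Fubini(3)[OF t] by simp
 have i2: "(LBINT r2. ?I (EE \<delta>) (r1, r2) * h (fst r1)) = ?I {1..2} (fst r1) * ?I {-\<delta>..\<delta>} (snd r1) * h (fst r1) * (2*\<delta>) * (2*\<delta>)" for r1
 proof -
  obtain a b where r1: "r1 = (a,b)" by (cases r1)
  have "(LBINT r2. ?I (EE \<delta>) (r1, r2) * h (fst r1)) = (LBINT c. LBINT d'. ?I (EE \<delta>) (r1, (c,d')) * h (fst r1))"
   by (rule tame_Fubini(5)[OF t2])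
  also have "\<dots> = (LBINT c. (?I {1..2} a * ?I {-\<delta>..\<delta>} b * h a) * (?I {-\<delta>..\<delta>} c * (LBINT d'. ?I {a-\<delta>..a+\<delta>} d')))"
  proof (intro lint_cong refl)
   fix c
   have "(LBINT d'. ?I (EE \<delta>) (r1, (c,d')) * h (fst r1)) = (LBINT d'. (?I {1..2} a * ?I {-\<delta>..\<delta>} b * h a * ?I {-\<delta>..\<delta>} c) * ?I {a-\<delta>..a+\<delta>} d')"
    by (intro lint_cong refl) (simp add: r1 e)
   also have "\<dots> = (?I {1..2} a * ?I {-\<delta>..\<delta>} b * h a * ?I {-\<delta>..\<delta>} c) * (LBINT d'. ?I {a-\<delta>..a+\<delta>} d')" by (rule integral_mult_right_zero)
   finally show "(LBINT d'. ?I (EE \<delta>) (r1, (c,d')) * h (fst r1)) = (?I {1..2} a * ?I {-\<delta>..\<delta>} b * h a) * (?I {-\<delta>..\<delta>} c * (LBINT d'. ?I {a-\<delta>..a+\<delta>} d'))" by simp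
  qed
  also have "\<dots> = (?I {1..2} a * ?I {-\<delta>..\<delta>} b * h a) * ((LBINT c. ?I {-\<delta>..\<delta>} c) * (LBINT d'. ?I {a-\<delta>..a+\<delta>} d'))"
   by (simp only: integral_mult_right_zero integral_mult_left_zero)
  finally show ?thesis using d by (simp add: r1 mult_ac)
 qed
 have "(LBINT m. ?I (EE \<delta>) m * h (fst (fst m))) = (LBINT r1. LBINT r2. ?I (EE \<delta>) (r1, r2) * h (fst r1))"
  using tame_Fubini(5)[OF t] by simp
 also have "\<dots> = (LBINT a. LBINT b. ?I {1..2} a * ?I {-\<delta>..\<delta>} b * h a * (2*\<delta>) * (2*\<delta>))"
  by (subst tame_Fubini(5)[OF t1]) (simp only: i2[of "(x, y)" for x y, unfolded fst_conv snd_conv] fst_conv)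
 also have "\<dots> = (LBINT a. (2*\<delta>) * (2*\<delta>) * (2*\<delta>) * (?I {1..2} a * h a))"
 proof (intro lint_cong refl)
  fix a
  have "(LBINT b. ?I {1..2} a * ?I {-\<delta>..\<delta>} b * h a * (2*\<delta>) * (2*\<delta>)) = (LBINT b. (?I {1..2} a * h a * (2*\<delta>) * (2*\<delta>)) * ?I {-\<delta>..\<delta>} b)"
   by (intro lint_cong refl) simp
  also have "\<dots> = (?I {1..2} a * h a * (2*\<delta>) * (2*\<delta>)) * (LBINT b. ?I {-\<delta>..\<delta>} b)" by (rule integral_mult_right_zero)
  finally show "(LBINT b. ?I {1..2} a * ?I {-\<delta>..\<delta>} b * h a * (2*\<delta>) * (2*\<delta>)) = (2*\<delta>) * (2*\<delta>) * (2*\<delta>) * (?I {1..2} a * h a)" using d by simp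
 qed
 also have "\<dots> = 8 * \<delta>^3 * (LBINT l. ?I {1..2} l * h l)"
  unfolding integral_mult_right_zero by (simp add: power3_eq_cube)
 finally show ?thesis .
qed

text \<open>Here and below \<open>1024\<close> bounds the support of the functions on the line.\<close>

lemma perturbation_error:
 fixes \<phi> :: "real \<Rightarrow> real"
 assumes phi: "tame \<phi>" "step N \<phi>" "\<And>x. \<phi> x \<noteq> 0 ==> 0 <= x \<and> x <= 1024"
  and d: "0 < \<delta>" "\<delta> * 2^(24+N) <= 1" and E: "m \<in> EE \<delta>"
 shows "tame (%v. (lift \<phi> psi (fst (fst m) *\<^sub>R v) - lift \<phi> psi (lr m v))\<^sup>2)"
  "(LBINT v. (lift \<phi> psi (fst (fst m) *\<^sub>R v) - lift \<phi> psi (lr m v))\<^sup>2) <= 2^40 * \<delta> * 2^N * (LBINT x. (\<phi> x)\<^sup>2)"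
proof -
 obtain l e2 e3 l' where m: "m = ((l, e2), (e3, l'))" by (metis surj_pair)
 have h: "1 <= l" "l <= 2" "\<bar>e2\<bar> <= \<delta>" "\<bar>e3\<bar> <= \<delta>" "\<bar>l' - l\<bar> <= \<delta>" using E by (auto simp: EE_def m)
 have d24: "\<delta> * 16777216 <= 1"
 proof -
  have "\<delta> * 2^24 <= \<delta> * 2^(24+N)" using d(1) by (intro mult_left_mono power_increasing) auto
  then have "\<delta> * 2^24 <= 1" using d(2) by linarith
  then show ?thesis by simp
 qed
 define det where "det = l * l' - e2 * e3"
 have e23: "\<bar>e2 * e3\<bar> <= 1/4"
 proof -
  have "\<bar>e2 * e3\<bar> <= (1/2) * (1/2)" unfolding abs_mult by (intro mult_mono) (use h d24 in auto)
  then show ?thesis by simp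
 qed
 have det0: "det > 0"
 proof -
  have "1 * (1/2) <= l * l'" using h d24 by (intro mult_mono) auto
  then show ?thesis using e23 by (simp add: det_def)
 qed
 define F where "F v = (lift \<phi> psi (l *\<^sub>R v) - lift \<phi> psi (lr m v))\<^sup>2" for v
 have lin1: "lr m v = lin (l, e2, e3, l') v" for v by (cases v) (simp add: lr_def m)
 have lin2: "l *\<^sub>R v = lin (l, 0, 0, l) v" for v by (cases v) simp
 have t1: "tame (%v. lift \<phi> psi (l *\<^sub>R v))" unfolding lin2 by (rule tame_lin[OF tame_lift_psi[OF phi(1)]]) (use h in auto)
 have t2: "tame (%v. lift \<phi> psi (lr m v))" unfolding lin1 by (rule tame_lin[OF tame_lift_psi[OF phi(1)]]) (use det0 in \<open>auto simp: det_def\<close>)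
 have tF: "tame F" unfolding F_def by (intro tame_power2 tame_diff t1 t2)
 then show "tame (%v. (lift \<phi> psi (fst (fst m) *\<^sub>R v) - lift \<phi> psi (lr m v))\<^sup>2)" by (simp add: F_def[abs_def] m)
 \<comment> \<open>The lower bound on y is what \<open>integral_polar\<close> requires. In the
   second case the slope of the image lies in [0, 1024] and \<open>m\<close> moves slopes by at most
   1 in this range, whence the interval from -1 to 1025.\<close>
 have sup: "y >= 1/512 \<and> -1 <= x/y \<and> x/y <= 1025" if nz: "F (x, y) \<noteq> 0" for x y
 proof -
  consider "lift \<phi> psi (l *\<^sub>R (x,y)) \<noteq> 0" | "lift \<phi> psi (lr m (x,y)) \<noteq> 0" using nz unfolding F_def by (metis diff_zero zero_power2)
  then show ?thesis
  proof cases
   case 1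
   then have "\<phi> (x/y) \<noteq> 0" "psi (l*y) \<noteq> 0" using h by (auto simp: lift_def)
   then have a: "0 <= x/y" "x/y <= 1024" "1/32 <= l * y" using phi(3) psi_support by blast+
   have "y > 0" using a(3) h by (smt (verit) mult_nonneg_nonpos divide_pos_pos)
   then have "l * y <= 2 * y" using h by (intro mult_right_mono) auto
   then show ?thesis using a by auto
  next
   case 2
   define x' where "x' = l*x + e2*y"
   define y' where "y' = e3*x + l'*y"
   have "\<phi> (x'/y') \<noteq> 0" "psi y' \<noteq> 0" using 2 by (auto simp: lift_def lr_def m x'_def y'_def)
   then have a: "0 <= x'/y'" "x'/y' <= 1024" "1/32 <= y'" "y' <= 9" using phi(3) psi_support by blast+
   define t' where "t' = x'/y'"
   have x't: "x' = t' * y'" using a by (simp add: t'_def)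
   have e3t: "\<bar>e3 * t'\<bar> <= 1/4"
   proof -
    have "\<bar>e3 * t'\<bar> <= \<delta> * 1024" unfolding abs_mult by (intro mult_mono) (use h a d in \<open>auto simp: t'_def\<close>)
    then show ?thesis using d24 by linarith
   qed
   have "y * det = l * y' - e3 * x'" by (simp add: x'_def y'_def det_def algebra_simps)
   also have "\<dots> = y' * (l - e3 * t')" by (simp add: x't algebra_simps)
   also have "\<dots> >= (1/32) * (1/2)" using a h e3t by (intro mult_mono) auto
   finally have ydet: "y * det >= 1/64" by simp
   have "y > 0" using ydet det0 by (smt (verit) mult_nonpos_nonneg divide_pos_pos)
   have "det <= 8"
   proof -
    have "l * l' <= 2 * 3" using h d24 by (intro mult_mono) auto
    then show ?thesis using e23 by (simp add: det_def)
   qed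
   then have "y * det <= y * 8" using \<open>y > 0\<close> by (intro mult_left_mono) auto
   then have y1: "y >= 1/512" using ydet by linarith
   define t where "t = x/y"
   have xt: "x = t * y" using \<open>y > 0\<close> by (simp add: t_def)
   have "x' = t' * y'" by fact
   then have "y * (l * t + e2) = y * (t' * (e3 * t + l'))" unfolding x'_def y'_def xt by (simp add: algebra_simps)
   then have "l * t + e2 = t' * (e3 * t + l')" using \<open>y > 0\<close> by simp
   then have "(t - t') * (l - e3 * t') = t' * (l' - l) - e2 + e3 * t' * t'" by (simp add: algebra_simps)
   also have "\<bar>\<dots>\<bar> <= 1024 * \<delta> + \<delta> + \<delta> * 1024 * 1024"
   proof -
    have "\<bar>t' * (l' - l)\<bar> <= 1024 * \<delta>" unfolding abs_mult by (intro mult_mono) (use h a d in \<open>auto simp: t'_def\<close>)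
    moreover have "\<bar>e3 * t' * t'\<bar> <= \<delta> * 1024 * 1024" unfolding abs_mult by (intro mult_mono) (use h a d in \<open>auto simp: t'_def\<close>)
    ultimately show ?thesis using h by linarith
   qed
   also have "\<dots> <= 1/2" using d24 by simp
   finally have "\<bar>t - t'\<bar> * \<bar>l - e3 * t'\<bar> <= 1/2" by (simp add: abs_mult)
   moreover have "\<bar>t - t'\<bar> * (1/2) <= \<bar>t - t'\<bar> * \<bar>l - e3 * t'\<bar>" using h e3t by (intro mult_left_mono) auto
   ultimately have "\<bar>t - t'\<bar> * (1/2) <= 1/2" by (meson order_trans)
   then have "\<bar>t - t'\<bar> <= 1" by simp
   then show ?thesis using y1 a by (auto simp: t_def t'_def)
  qed
 qed
 \<comment> \<open>A bound for the motion of slopes: the difference t - t', multiplied by Y >= 1/2,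
   equals e3 t^2 + (l' - l) t - e2 with |t| <= 1025, which gives 2103302 \<delta>, rounded up. As
   \<kappa> <= 2^(-N), the step function changes only near edges of its cells.\<close>
 define \<kappa> where "\<kappa> = \<delta> * 2^22"
 have kap: "0 <= \<kappa>" "\<kappa> <= 1/2^N"
 proof -
  show "0 <= \<kappa>" using d by (simp add: \<kappa>_def)
  have "\<delta> * 2^22 * 2^N <= \<delta> * 2^24 * 2^N" using d by (intro mult_right_mono) auto
  then show "\<kappa> <= 1/2^N" using d by (simp add: \<kappa>_def power_add field_simps)
 qed
 define G where "G t = 2 * oscillation N \<kappa> \<phi> t + \<delta> * 2^24 * (\<phi> t)\<^sup>2" for t
 have G0: "G t >= 0" for t using oscillation_nonneg[of N \<kappa> \<phi> t] d by (simp add: G_def)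
 have pt: "y * F (t*y, y) <= G t * (ind {0..18} y * 18)" for t y
 proof (cases "F (t*y, y) = 0")
  case True
  then show ?thesis using G0 by simp
 next
  case False
  have y0: "y >= 1/512" and t: "-1 <= t" "t <= 1025" using sup[OF False] by (auto split: if_splits)
  define Y where "Y = e3 * t + l'"
  define t' where "t' = (l * t + e2) / Y"
  have e3t: "\<bar>e3 * t\<bar> <= \<delta> * 1025" unfolding abs_mult by (intro mult_mono) (use h t d in auto)
  have Yl: "\<bar>Y - l\<bar> <= \<delta> * 1026" using e3t h by (simp add: Y_def)
  have Y: "Y >= 1/2" using Yl h d24 by linarith
  have tt: "\<bar>t - t'\<bar> <= \<kappa>"
  proof -
   have "(t - t') * Y = e3 * t * t + (l' - l) * t - e2" using Y by (simp add: t'_def Y_def field_simps)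
   also have "\<bar>\<dots>\<bar> <= \<delta> * 1025 * 1025 + \<delta> * 1025 + \<delta>"
   proof -
    have "\<bar>e3 * t * t\<bar> <= \<delta> * 1025 * 1025" unfolding abs_mult by (intro mult_mono) (use h t d in auto)
    moreover have "\<bar>(l' - l) * t\<bar> <= \<delta> * 1025" unfolding abs_mult by (intro mult_mono) (use h t d in auto)
    ultimately show ?thesis using h by linarith
   qed
   finally have "\<bar>t - t'\<bar> * \<bar>Y\<bar> <= \<delta> * 1051651" by (simp add: abs_mult)
   moreover have "\<bar>t - t'\<bar> * (1/2) <= \<bar>t - t'\<bar> * \<bar>Y\<bar>" using Y by (intro mult_left_mono) auto
   ultimately have "\<bar>t - t'\<bar> * (1/2) <= \<delta> * 1051651" by (meson order_trans)
   then have "\<bar>t - t'\<bar> <= \<delta> * 2103302" by simp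
   also have "\<dots> <= \<kappa>" using d by (simp add: \<kappa>_def)
   finally show ?thesis .
  qed
  have "t' * Y = l * t + e2" using Y by (simp add: t'_def)
  then have "(t' * Y) * y = (l * t + e2) * y" by simp
  then have ly: "l * t * y + e2 * y = t' * (Y * y)" by (simp add: algebra_simps)
  have e1: "lift \<phi> psi (l *\<^sub>R (t*y,y)) = \<phi> t * psi (l*y)" using y0 h by (simp add: lift_def)
  have e2: "lift \<phi> psi (lr m (t*y,y)) = \<phi> t' * psi (Y*y)"
  proof -
   have "lr m (t*y,y) = (t' * (Y*y), Y*y)" using ly by (simp add: lr_def m Y_def algebra_simps)
   then show ?thesis using y0 Y by (simp add: lift_def)
  qed
  have y18: "y <= 18"
  proof -
   have "psi (l*y) \<noteq> 0 \<or> psi (Y*y) \<noteq> 0" using False unfolding F_def e1 e2 by auto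
   then have "l*y <= 9 \<or> Y*y <= 9" using psi_support by blast
   moreover have "1/2 * y <= l*y" "1/2 * y <= Y * y" using h Y y0 by (intro mult_right_mono; auto)+
   ultimately show ?thesis by linarith
  qed
  have o: "(\<phi> t - \<phi> t')\<^sup>2 <= oscillation N \<kappa> \<phi> t" by (rule step_diff_le[OF phi(2) tt kap(2)])
  have ps: "(psi (l*y) - psi (Y*y))\<^sup>2 <= \<delta> * 2^23"
  proof -
   have "\<bar>psi (l*y) - psi (Y*y)\<bar> <= 32 * \<bar>l*y - Y*y\<bar>" by (rule psi_lipschitz)
   also have "\<bar>l*y - Y*y\<bar> = \<bar>Y - l\<bar> * \<bar>y\<bar>" by (simp add: abs_mult[symmetric] algebra_simps abs_minus_commute)
   also have "\<dots> <= (\<delta> * 1026) * 18" using Yl y18 y0 d by (intro mult_mono) auto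
   finally have a: "\<bar>psi (l*y) - psi (Y*y)\<bar> <= \<delta> * 590976" by simp
   have b: "\<bar>psi (l*y) - psi (Y*y)\<bar> <= 1" using psi_bounds[of "l*y"] psi_bounds[of "Y*y"] by linarith
   have "(psi (l*y) - psi (Y*y))\<^sup>2 = \<bar>psi (l*y) - psi (Y*y)\<bar> * \<bar>psi (l*y) - psi (Y*y)\<bar>" by (simp add: power2_eq_square)
   also have "\<dots> <= (\<delta> * 590976) * 1" using a b d by (intro mult_mono) auto
   finally show ?thesis using d by simp
  qed
  have "F (t*y, y) = ((\<phi> t - \<phi> t') * psi (Y*y) + \<phi> t * (psi (l*y) - psi (Y*y)))\<^sup>2"
   unfolding F_def e1 e2 by (simp add: algebra_simps)
  also have "\<dots> <= 2 * ((\<phi> t - \<phi> t') * psi (Y*y))\<^sup>2 + 2 * (\<phi> t * (psi (l*y) - psi (Y*y)))\<^sup>2"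
  proof -
   have "(p + q)\<^sup>2 <= 2 * p\<^sup>2 + 2 * q\<^sup>2" for p q :: real using zero_le_power2[of "p - q"] by (simp add: power2_eq_square algebra_simps)
   then show ?thesis by blast
  qed
  also have "\<dots> <= 2 * oscillation N \<kappa> \<phi> t + 2 * ((\<phi> t)\<^sup>2 * (\<delta> * 2^23))"
  proof (intro add_mono mult_left_mono)
   have "((\<phi> t - \<phi> t') * psi (Y*y))\<^sup>2 <= (\<phi> t - \<phi> t')\<^sup>2 * 1" unfolding power_mult_distrib
    using psi_bounds[of "Y*y"] by (intro mult_left_mono) (auto simp: power_le_one)
   then show "((\<phi> t - \<phi> t') * psi (Y*y))\<^sup>2 <= oscillation N \<kappa> \<phi> t" using o by linarith
   show "(\<phi> t * (psi (l*y) - psi (Y*y)))\<^sup>2 <= (\<phi> t)\<^sup>2 * (\<delta> * 2^23)" unfolding power_mult_distrib by (intro mult_left_mono ps) auto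
  qed auto
  also have "\<dots> = G t" by (simp add: G_def)
  finally have "F (t*y, y) <= G t" .
  then have "y * F (t*y,y) <= 18 * G t" using y0 y18 G0[of t] by (intro mult_mono) (auto simp: F_def)
  then show ?thesis using y0 y18 by (simp add: mult.commute)
 qed
 have pol: "tame (%(t, y). y * F (t * y, y))" "(LBINT v. F v) = (LBINT t. LBINT y. y * F (t * y, y))"
  using integral_polar[OF tF, of "1/512"] sup by auto
 have tG: "tame G" unfolding G_def using oscillation_integral(1)[OF phi(1,2) kap(1)] by (intro tame_add tame_cmult tame_power2 phi(1))
 have "(LBINT v. F v) <= (LBINT t. G t * 324)" unfolding pol(2)
 proof (rule lint_mono)
  show "integrable lborel (%t. LBINT y. y * F (t * y, y))" using tame_integrable[OF tame_Fubini(3)[OF pol(1)]] by simp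
  show "integrable lborel (%t. G t * 324)" using tame_integrable[OF tG] by simp
  fix t
  have "(LBINT y. y * F (t * y, y)) <= (LBINT y. G t * (ind {0..18::real} y * 18))"
  proof (rule lint_mono)
   show "integrable lborel (%y. y * F (t * y, y))" using tame_integrable[OF tame_Fubini(1)[OF pol(1), of t]] by simp
  qed (use pt in \<open>auto intro!: integrable_mult_right integrable_mult_left tame_integrable tame_indicator\<close>)
  also have "\<dots> = G t * 324" by simp
  finally show "(LBINT y. y * F (t * y, y)) <= G t * 324" .
 qed
 also have "\<dots> = 324 * (2 * (LBINT t. oscillation N \<kappa> \<phi> t) + \<delta> * 2^24 * (LBINT x. (\<phi> x)\<^sup>2))"
  using oscillation_integral(1)[OF phi(1,2) kap(1)] phi(1) by (simp add: G_def tame_integrable tame_power2)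
 also have "\<dots> <= 324 * (2 * (12 * \<kappa> * 2^N * (LBINT x. (\<phi> x)\<^sup>2)) + \<delta> * 2^24 * (2^N * (LBINT x. (\<phi> x)\<^sup>2)))"
 proof (intro mult_left_mono add_mono oscillation_integral(2)[OF phi(1,2) kap(1)])
  have "1 * (LBINT x. (\<phi> x)\<^sup>2) <= 2^N * (LBINT x. (\<phi> x)\<^sup>2)" by (intro mult_right_mono) auto
  then show "(LBINT x. (\<phi> x)\<^sup>2) <= 2^N * (LBINT x. (\<phi> x)\<^sup>2)" by simp
 qed (use d in auto)
 also have "\<dots> = (324 * (24 * 2^22 + 2^24)) * (\<delta> * 2^N * (LBINT x. (\<phi> x)\<^sup>2))" by (simp add: \<kappa>_def algebra_simps)
 also have "\<dots> <= 2^40 * (\<delta> * 2^N * (LBINT x. (\<phi> x)\<^sup>2))" using d by (intro mult_right_mono) auto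
 finally show "(LBINT v. (lift \<phi> psi (fst (fst m) *\<^sub>R v) - lift \<phi> psi (lr m v))\<^sup>2) <= 2^40 * \<delta> * 2^N * (LBINT x. (\<phi> x)\<^sup>2)"
  by (simp add: F_def m mult.assoc)
qed

text \<open>The matrix product of \<open>m\<close> and \<open>w\<close>. A row is multiplied from
  the right, which is the transpose of \<open>w\<close> acting on it; hence the order (a, c, b,
  d).\<close>

fun mrow :: "rows \<Rightarrow> real \<times> real \<times> real \<times> real \<Rightarrow> rows" where
 "mrow m (a, b, c, d) = (lin (a, c, b, d) (fst m), lin (a, c, b, d) (snd m))"

fun rinv :: "real \<times> real \<times> real \<times> real \<Rightarrow> real \<times> real \<times> real \<times> real" where
 "rinv (a, b, c, d) = (d, -b, -c, a)"

lemma unimodular_rinv: "unimodular w ==> unimodular (rinv w)"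
 by (cases w) (simp add: unimodular_def mult.commute)

lemma lr_mrow: "lr (mrow m w) v = lr m (lin w v)"
 by (cases w; cases v; cases m) (auto simp: lr_def algebra_simps)

lemma unimodular_eq: "unimodular (a,b,c,d) ==> a * d = 1 + b * c"
 by (simp add: unimodular_def)

lemma mrow_rinv: assumes "unimodular w" shows "mrow (mrow m w) (rinv w) = m"
proof -
 obtain a b c d where w: "w = (a,b,c,d)" by (cases w)
 have e: "a * d = 1 + b * c" using assms unimodular_eq w by blast
 have *: "lin (d, -c, -b, a) (lin (a, c, b, d) v) = v" for v
 proof (cases v)
  case (Pair x y)
  have "d * (a * x + c * y) + - c * (b * x + d * y) = (a * d - b * c) * x" by (simp add: algebra_simps)
  moreover have "- b * (a * x + c * y) + a * (b * x + d * y) = (a * d - b * c) * y" by (simp add: algebra_simps)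
  ultimately show ?thesis using e by (simp add: Pair)
 qed
 show ?thesis by (simp add: w * prod_eq_iff)
qed

lemma mrow_measurable [measurable]: "(%m. mrow m w) \<in> borel_measurable borel"
proof -
 obtain a b c d where w: "w = (a,b,c,d)" by (cases w)
 have "(%m. mrow m w) = (%m. ((a * fst (fst m) + c * snd (fst m), b * fst (fst m) + d * snd (fst m)), (a * fst (snd m) + c * snd (snd m), b * fst (snd m) + d * snd (snd m))))"
  by (auto simp: w)
 then show ?thesis by (simp add: borel_measurable_continuous_onI continuous_on_Pair continuous_intros)
qed

lemma unimodular_lin_bound:
 assumes "unimodular w" obtains K where "K >= 0" "\<And>v. norm v <= K * norm (lin w v)"
proof -
 obtain a b c d where w: "w = (a,b,c,d)" by (cases w)
 have e: "a * d = 1 + b * c" using assms unimodular_eq w by blast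
 show ?thesis
 proof (rule that[of "\<bar>a\<bar>+\<bar>b\<bar>+\<bar>c\<bar>+\<bar>d\<bar>"])
  fix v :: "real \<times> real"
  obtain x y where v: "v = (x,y)" by (cases v)
  define x' where "x' = a*x + b*y"
  define y' where "y' = c*x + d*y"
  have "d * x' - b * y' = (a*d - b*c) * x" "a * y' - c * x' = (a*d - b*c) * y" by (auto simp: x'_def y'_def algebra_simps)
  then have xy: "x = d * x' - b * y'" "y = a * y' - c * x'" using e by auto
  have n: "\<bar>x'\<bar> <= norm (x',y')" "\<bar>y'\<bar> <= norm (x',y')" using norm_fst_le[of x' y'] norm_snd_le[of y' x'] by auto
  have "\<bar>x\<bar> <= \<bar>d\<bar> * norm (x',y') + \<bar>b\<bar> * norm (x',y')" unfolding xy(1)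
   by (rule order_trans[OF abs_triangle_ineq4]) (auto simp: abs_mult intro!: add_mono mult_left_mono n)
  moreover have "\<bar>y\<bar> <= \<bar>a\<bar> * norm (x',y') + \<bar>c\<bar> * norm (x',y')" unfolding xy(2)
   by (rule order_trans[OF abs_triangle_ineq4]) (auto simp: abs_mult intro!: add_mono mult_left_mono n)
  moreover have "norm v <= \<bar>x\<bar> + \<bar>y\<bar>" unfolding v using norm_Pair_le[of x y] by simp
  ultimately show "norm v <= (\<bar>a\<bar>+\<bar>b\<bar>+\<bar>c\<bar>+\<bar>d\<bar>) * norm (lin w v)" by (simp add: v w x'_def y'_def algebra_simps)
 qed simp
qed

lemma tame_mrow:
 assumes G: "tame G" and w: "unimodular w"
 shows "tame (%m. G (mrow m w))"
proof -
 obtain M R where MR: "M >= 0" "R >= 0" "\<And>v. \<bar>G v\<bar> <= M" "\<And>v. G v \<noteq> 0 ==> norm v <= R" using G by (rule tameE) blast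
 have [measurable]: "G \<in> borel_measurable borel" using G by (rule tame_measurable)
 obtain a b c d where we: "w = (a,b,c,d)" by (cases w)
 have u: "unimodular (a,c,b,d)" using w by (simp add: we unimodular_def mult.commute)
 obtain K where K: "K >= 0" "\<And>v. norm v <= K * norm (lin (a,c,b,d) v)" using unimodular_lin_bound[OF u] by blast
 show ?thesis
 proof (rule tameI[where M = M and R = "K * R + K * R"])
  show "norm m <= K * R + K * R" if "G (mrow m w) \<noteq> 0" for m
  proof -
   have "norm (mrow m w) <= R" using MR(4)[OF that] .
   then have "norm (lin (a,c,b,d) (fst m)) <= R" "norm (lin (a,c,b,d) (snd m)) <= R"
    using norm_fst_le[of "lin (a,c,b,d) (fst m)" "lin (a,c,b,d) (snd m)"] norm_snd_le[of "lin (a,c,b,d) (snd m)" "lin (a,c,b,d) (fst m)"]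
    by (auto simp: we)
   then have "norm (fst m) <= K * R" "norm (snd m) <= K * R"
    using K by (meson mult_left_mono order_trans)+
   then show ?thesis using norm_Pair_le[of "fst m" "snd m"] by simp
  qed
 qed (use MR in auto)
qed

text \<open>Right multiplication acts on each of the two rows by the same map of determinant one.
  This invariance is the only property of Haar measure that is used.\<close>

lemma integral_mrow:
 assumes G: "tame G" and w: "unimodular w"
 shows "(LBINT m. G (mrow m w)) = (LBINT m. G m)"
proof -
 obtain a b c d where we: "w = (a,b,c,d)" by (cases w)
 have u: "unimodular (a,c,b,d)" using w by (simp add: we unimodular_def mult.commute)
 have "(LBINT m. G (mrow m w)) = (LBINT r1. LBINT r2. G (lin (a,c,b,d) r1, lin (a,c,b,d) r2))"
  by (subst tame_Fubini(5)[OF tame_mrow[OF G w]]) (simp add: we)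
 also have "\<dots> = (LBINT r1. LBINT r2. G (lin (a,c,b,d) r1, r2))"
  by (intro lint_cong refl integral_unimodular[OF tame_Fubini(1)[OF G] u])
 also have "\<dots> = (LBINT r1. LBINT r2. G (r1, r2))"
  using integral_unimodular[OF tame_Fubini(3)[OF G] u] by simp
 finally show ?thesis using tame_Fubini(5)[OF G] by simp
qed

lemma lift_psi_measurable [measurable]:
 assumes [measurable]: "\<phi> \<in> borel_measurable borel" shows "lift \<phi> psi \<in> borel_measurable borel" "lift \<phi> psit \<in> borel_measurable borel"
 unfolding lift_def borel_prod[symmetric] by measurable

lemma lr_measurable: "(%q::rows \<times> (real \<times> real). lr (fst q) (snd q)) \<in> borel_measurable borel"
 unfolding lr_def by (simp add: borel_measurable_continuous_onI continuous_on_Pair continuous_intros)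

definition box :: "real \<Rightarrow> rows set" where
 "box R = {m. \<bar>fst (fst m)\<bar> <= R \<and> \<bar>snd (fst m)\<bar> <= R \<and> \<bar>fst (snd m)\<bar> <= R \<and> \<bar>snd (snd m)\<bar> <= R}"

lemma box_measurable [measurable]: "box R \<in> sets borel"
 unfolding box_def by (intro borel_closed closed_Collect_conj closed_Collect_le continuous_intros)

lemma bounded_box: "bounded (box R)"
proof (rule boundedI)
 fix m assume m: "m \<in> box R"
 have "norm m <= norm (fst m) + norm (snd m)" using norm_Pair_le[of "fst m" "snd m"] by simp
 also have "\<dots> <= (\<bar>fst (fst m)\<bar> + \<bar>snd (fst m)\<bar>) + (\<bar>fst (snd m)\<bar> + \<bar>snd (snd m)\<bar>)"
  using norm_Pair_le[of "fst (fst m)" "snd (fst m)"] norm_Pair_le[of "fst (snd m)" "snd (snd m)"] by simp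
 also have "\<dots> <= 4 * R" using m unfolding box_def by auto
 finally show "norm m <= 4 * R" .
qed

text \<open>\<open>Q\<close> is what the two cutoffs in a correlation leave behind after integration
  over y. On the support of \<open>psit\<close> one has 1/64 <= y <= 9, which bounds the integrand
  by 9 on an interval of length 9 and, together with 1/32 <= z y <= 9, confines z between 1/288 and
  576.\<close>

lemma psi_psit_weight:
 defines "Q \<equiv> %z. LBINT y. y * psi (z * y) * psit y"
 shows "tame (%y. y * psi (z * y) * psit y)" "\<bar>Q z\<bar> <= 81" "Q z \<noteq> 0 ==> 1/288 <= z \<and> z <= 576" "Q \<in> borel_measurable borel"
proof -
 have b: "\<bar>y * psi (z * y) * psit y\<bar> <= 9 * ind {0..9} y" for y z
 proof (cases "psit y = 0")
  case False
  then have y: "1/64 <= y" "y <= 9" using psit_support by auto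
  have "\<bar>y * psi (z * y) * psit y\<bar> <= 9 * 1 * 1" unfolding abs_mult
   by (intro mult_mono) (use y psi_bounds[of "z*y"] psit_bounds[of y] in auto)
  then show ?thesis using y by simp
 qed simp
 have t9: "tame (%y. 9 * ind {0..9::real} y)" by (intro tame_cmult tame_indicator) auto
 show t: "tame (%y. y * psi (z * y) * psit y)" for z
  by (rule tame_dominated[OF t9, where C = 1]) (use b in \<open>auto simp: indicator_def split: if_splits\<close>)
 have "\<bar>Q z\<bar> <= (LBINT y. \<bar>y * psi (z * y) * psit y\<bar>)" unfolding Q_def by (rule integral_abs_bound)
 also have "\<dots> <= (LBINT y. 9 * ind {0..9::real} y)"
  by (rule lint_mono) (use b in \<open>auto intro!: tame_integrable tame_abs t t9\<close>)
 finally show "\<bar>Q z\<bar> <= 81" by simp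
 show "1/288 <= z \<and> z <= 576" if Qz: "Q z \<noteq> 0"
 proof -
  obtain y where "y * psi (z * y) * psit y \<noteq> 0" using integral_nonzeroD[OF Qz[unfolded Q_def]] by blast
  then have nz: "psi (z * y) \<noteq> 0" "psit y \<noteq> 0" by auto
  have y: "1/64 <= y" "y <= 9" "1/32 <= z * y" "z * y <= 9" using psi_support[OF nz(1)] psit_support[OF nz(2)] by auto
  have z0: "z > 0" using y by (smt (verit) mult_nonpos_nonneg divide_pos_pos)
  have "z * (1/64) <= z * y" "z * y <= z * 9" using z0 y by (intro mult_left_mono; auto)+
  then show ?thesis using y by linarith
 qed
 show "Q \<in> borel_measurable borel" unfolding Q_def by measurable
qed

lemma norm_lift_psit:
 assumes phi: "tame \<phi>"
 shows "(LBINT v. (lift \<phi> psit v)\<^sup>2) <= 81 * (LBINT x. (\<phi> x)\<^sup>2)"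
proof -
 let ?F = "%v. (lift \<phi> psit v)\<^sup>2"
 have t: "tame ?F" by (intro tame_power2 tame_lift_psit phi)
 have s: "y >= 1/64" if "?F (x,y) \<noteq> 0" for x y using that psit_support by (auto simp: lift_def)
 have p: "tame (%(t, y). y * ?F (t * y, y))" "(LBINT v. ?F v) = (LBINT t. LBINT y. y * ?F (t * y, y))"
  by (rule integral_polar[OF t _ s]; simp)+
 have "(LBINT v. ?F v) = (LBINT t. LBINT y. y * ?F (t * y, y))" using p(2) by simp
 also have "\<dots> <= (LBINT t. (\<phi> t)\<^sup>2 * 81)"
 proof (rule lint_mono)
  show "integrable lborel (%t. LBINT y. y * ?F (t * y, y))" using tame_integrable[OF tame_Fubini(3)[OF p(1)]] by simp
  show "integrable lborel (%t. (\<phi> t)\<^sup>2 * 81)" using tame_integrable[OF tame_power2[OF phi]] by simp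
  fix t
  have t9: "tame (%y. (\<phi> t)\<^sup>2 * (9 * ind {0..9::real} y))" by (intro tame_cmult tame_indicator) auto
  have "(LBINT y. y * ?F (t * y, y)) <= (LBINT y. (\<phi> t)\<^sup>2 * (9 * ind {0..9::real} y))"
  proof (rule lint_mono)
   show "integrable lborel (%y. y * ?F (t * y, y))" using tame_integrable[OF tame_Fubini(1)[OF p(1), of t]] by simp
   show "integrable lborel (%y. (\<phi> t)\<^sup>2 * (9 * ind {0..9::real} y))" by (rule tame_integrable[OF t9])
   show "y * ?F (t * y, y) <= (\<phi> t)\<^sup>2 * (9 * ind {0..9::real} y)" for y
   proof (cases "psit y = 0")
    case False
    then have y: "1/64 <= y" "y <= 9" using psit_support by auto
    have "y * ((\<phi> t)\<^sup>2 * (psit y)\<^sup>2) <= 9 * ((\<phi> t)\<^sup>2 * 1)"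
     by (intro mult_mono) (use y psit_bounds[of y] in \<open>auto simp: power_le_one\<close>)
    then show ?thesis using y by (simp add: lift_def power_mult_distrib)
   qed (auto simp: lift_def)
  qed
  also have "\<dots> = (\<phi> t)\<^sup>2 * 81" by simp
  finally show "(LBINT y. y * ?F (t * y, y)) <= (\<phi> t)\<^sup>2 * 81" .
 qed
 finally show ?thesis by simp
qed

lemma L1_le_L2:
 fixes f :: "real \<Rightarrow> real"
 assumes f: "tame f" "\<And>x. f x \<noteq> 0 ==> 0 <= x \<and> x <= P" and P: "P >= 0"
 shows "(LBINT x. \<bar>f x\<bar>)\<^sup>2 <= P * (LBINT x. (f x)\<^sup>2)"
proof -
 have ti: "tame (ind {0..P})" by (intro tame_indicator) auto
 have "\<bar>f x\<bar> = \<bar>f x\<bar> * ind {0..P} x" for x using f(2)[of x] by (cases "f x = 0") auto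
 then have "(LBINT x. \<bar>f x\<bar>)\<^sup>2 = (LBINT x. \<bar>f x\<bar> * ind {0..P} x)\<^sup>2" by presburger
 also have "\<dots> <= (LBINT x. \<bar>f x\<bar>\<^sup>2) * (LBINT x. (ind {0..P} x)\<^sup>2)"
  by (rule tame_CauchySchwarz[OF tame_abs[OF f(1)] ti])
 also have "(LBINT x. (ind {0..P} x)\<^sup>2) = P"
 proof -
  have "(ind {0..P} x)\<^sup>2 = ind {0..P} x" for x by (auto simp: indicator_def)
  then show ?thesis using P by simp
 qed
 finally show ?thesis by (simp add: mult.commute)
qed

text \<open>The two factors carry different cutoffs because averaging \<open>m\<close> over
  dilations turns \<open>psi\<close> in the first factor into \<open>psit\<close>, after which both
  agree.\<close>

definition corr :: "(real \<Rightarrow> real) \<Rightarrow> rows \<Rightarrow> real" where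
 "corr f m = (LBINT v. lift f psi (lr m v) * lift f psit v)"

context
 fixes \<phi> :: "real \<Rightarrow> real" and Mo :: nat
 assumes phi: "tame \<phi>" "mean_zero (3*Mo) \<phi>" "\<And>x. \<phi> x \<noteq> 0 ==> 0 <= x \<and> x <= 1024"
begin

lemma phi_meas [measurable]: "\<phi> \<in> borel_measurable borel" using phi(1) by (rule tame_measurable)

lemma tame_corr_integrand: "tame (%v. lift \<phi> psi (lr m v) * lift \<phi> psit v)"
 and tame_corr_box: "tame (%(m, v). ind (box R) m * (lift \<phi> psi (lr m v) * lift \<phi> psit v))"
proof -
 obtain M where M: "M >= 0" "\<And>v. \<bar>lift \<phi> psi v\<bar> <= M" using tame_lift_psi[OF phi(1)] by (rule tameE) blast
 obtain M' R' where M': "M' >= 0" "\<And>v. \<bar>lift \<phi> psit v\<bar> <= M'" "\<And>v. lift \<phi> psit v \<noteq> 0 ==> norm v <= R'"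
  using tame_lift_psit[OF phi(1)] by (rule tameE) blast
 have lm: "(%v. lr m v) \<in> borel_measurable borel" unfolding lr_def by (simp add: borel_measurable_continuous_onI continuous_on_Pair continuous_intros)
 have "(%v. lift \<phi> psi (lr m v)) \<in> borel_measurable borel" by (rule measurable_compose[OF lm]) measurable
 then have "tame (%v. lift \<phi> psit v * lift \<phi> psi (lr m v))" by (rule tame_mult[OF tame_lift_psit[OF phi(1)]]) (rule M(2))
 then show "tame (%v. lift \<phi> psi (lr m v) * lift \<phi> psit v)" by (simp add: mult.commute)
 obtain Rb where Rb: "\<And>m. m \<in> box R ==> norm m <= Rb" using bounded_box[of R] by (auto simp: bounded_iff)
 have m1: "(%q::rows\<times>(real\<times>real). lift \<phi> psi (lr (fst q) (snd q))) \<in> borel_measurable borel"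
  by (rule measurable_compose[OF lr_measurable]) measurable
 have m2: "(%q::rows\<times>(real\<times>real). lift \<phi> psit (snd q)) \<in> borel_measurable borel"
  by (rule measurable_compose[of snd borel borel]) (simp_all add: borel_measurable_continuous_onI continuous_intros)
 have m3: "(%q::rows\<times>(real\<times>real). ind (box R) (fst q)) \<in> borel_measurable borel"
  by (rule measurable_compose[of fst borel borel]) (simp_all add: borel_measurable_continuous_onI continuous_intros)
 show "tame (%(m, v). ind (box R) m * (lift \<phi> psi (lr m v) * lift \<phi> psit v))"
 proof (rule tameI[where M = "1 * (M * M')" and R = "Rb + R'"])
  show "(%(m, v). ind (box R) m * (lift \<phi> psi (lr m v) * lift \<phi> psit v)) \<in> borel_measurable borel"
   unfolding case_prod_unfold by (intro borel_measurable_times m1 m2 m3)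
  show "\<bar>case q of (m, v) \<Rightarrow> ind (box R) m * (lift \<phi> psi (lr m v) * lift \<phi> psit v)\<bar> <= 1 * (M * M')" for q
   unfolding case_prod_unfold abs_mult by (intro mult_mono) (use M M' in \<open>auto simp: indicator_def\<close>)
  show "norm q <= Rb + R'" if "(case q of (m, v) \<Rightarrow> ind (box R) m * (lift \<phi> psi (lr m v) * lift \<phi> psit v)) \<noteq> 0" for q
  proof -
   have "fst q \<in> box R" "lift \<phi> psit (snd q) \<noteq> 0" using that by (auto simp: case_prod_unfold indicator_def split: if_splits)
   then show ?thesis using Rb M'(3) norm_Pair_le[of "fst q" "snd q"] by fastforce
  qed
 qed
qed

lemma tame_boxcorr: "tame (%m. ind (box R) m * corr \<phi> m)"
 using tame_Fubini(3)[OF tame_corr_box[of R]] by (simp add: corr_def)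

text \<open>In the coordinates t and y the matrix acts on t as a Moebius map and multiplies y by c t
  + d. For a fixed bottom row (c, d) the correlation, as a function of the top row (a, b), has
  exactly the form treated in \<open>flattening\<close>, with z t = c t + d.\<close>

lemma corr_formula:
 "corr \<phi> ((a, b), (c, d)) = (LBINT t. \<phi> ((a * t + b) / (c * t + d)) * (\<phi> t * (LBINT y. y * psi ((c * t + d) * y) * psit y)))"
proof -
 let ?F = "%v. lift \<phi> psi (lr ((a,b),(c,d)) v) * lift \<phi> psit v"
 have s: "y >= 1/64" if "?F (x,y) \<noteq> 0" for x y using that psit_support by (auto simp: lift_def)
 have "corr \<phi> ((a, b), (c, d)) = (LBINT t. LBINT y. y * ?F (t * y, y))"
  unfolding corr_def using integral_polar(2)[OF tame_corr_integrand _ s] by simp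
 also have "\<dots> = (LBINT t. \<phi> ((a * t + b) / (c * t + d)) * (\<phi> t * (LBINT y. y * psi ((c * t + d) * y) * psit y)))"
 proof (intro lint_cong refl)
  fix t
  have "y * ?F (t * y, y) = (\<phi> ((a * t + b) / (c * t + d)) * \<phi> t) * (y * psi ((c * t + d) * y) * psit y)" for y
  proof (cases "psit y = 0")
   case False
   then have y: "y > 0" using psit_support by fastforce
   have "(a * (t * y) + b * y) / (c * (t * y) + d * y) = ((a * t + b) * y) / ((c * t + d) * y)" by (simp add: algebra_simps)
   also have "\<dots> = (a * t + b) / (c * t + d)" using y by simp
   finally show ?thesis using y by (simp add: lift_def lr_def algebra_simps)
  qed (simp add: lift_def)
  then have "(LBINT y. y * ?F (t * y, y)) = (LBINT y. (\<phi> ((a * t + b) / (c * t + d)) * \<phi> t) * (y * psi ((c * t + d) * y) * psit y))"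
   by (simp only:)
  also have "\<dots> = (\<phi> ((a * t + b) / (c * t + d)) * \<phi> t) * (LBINT y. y * psi ((c * t + d) * y) * psit y)" by (rule integral_mult_right_zero)
  finally show "(LBINT y. y * ?F (t * y, y)) = \<phi> ((a * t + b) / (c * t + d)) * (\<phi> t * (LBINT y. y * psi ((c * t + d) * y) * psit y))" by simp
 qed
 finally show ?thesis .
qed

text \<open>The top row is integrated by \<open>flattening\<close>, which contributes R / 2^Mo, and
  the bottom row over a square of area 4 R^2; together R^3.\<close>

lemma integral_boxcorr:
 assumes R: "R >= 1"
 shows "(LBINT m. (ind (box R) m * corr \<phi> m)\<^sup>2) <= 2^74 * R^3 / 2^Mo * (LBINT x. (\<phi> x)\<^sup>2)\<^sup>2"
proof -
 define n2 where "n2 = (LBINT x. (\<phi> x)\<^sup>2)"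
 have n20: "n2 >= 0" by (simp add: n2_def)
 define Q where "Q z = (LBINT y. y * psi (z * y) * psit y)" for z
 have Q: "\<bar>Q z\<bar> <= 81" "Q z \<noteq> 0 ==> 1/288 <= z \<and> z <= 576" "Q \<in> borel_measurable borel" for z
  unfolding Q_def[abs_def] by (rule psi_psit_weight; assumption?)+
 have [measurable]: "Q \<in> borel_measurable borel" by (rule Q(3))
 let ?q = "%m. (ind (box R) m * corr \<phi> m)\<^sup>2"
 have tq: "tame ?q" by (intro tame_power2 tame_boxcorr)
 define Kc where "Kc = 2^72 * R / 2^Mo * n2\<^sup>2"
 have Kc0: "Kc >= 0" using R by (simp add: Kc_def)
 have inner: "(LBINT r1. ?q (r1, r2)) <= Kc * ind ({-R..R} \<times> {-R..R}) r2" for r2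
 proof (cases "r2 \<in> {-R..R} \<times> {-R..R}")
  case False
  then have "?q (r1, r2) = 0" for r1 by (cases r2) (auto simp: box_def indicator_def abs_le_iff)
  then have "(LBINT r1. ?q (r1, r2)) = 0" by (simp only: integral_zero)
  then show ?thesis using Kc0 by simp
 next
  case True
  obtain c d where r2: "r2 = (c, d)" by (cases r2)
  define z where "z t = c * t + d" for t
  define g where "g t = \<phi> t * Q (z t)" for t
  have zm [measurable]: "z \<in> borel_measurable borel" unfolding z_def by measurable
  have tg: "tame g" unfolding g_def by (rule tame_mult[OF phi(1), where B = 81]) (use Q(1) in \<open>auto\<close>)
  have gs: "1/288 <= z t \<and> z t <= 576 \<and> \<bar>t\<bar> <= 1024" if "g t \<noteq> 0" for t
   using that Q(2)[of "z t"] phi(3)[of t] by (auto simp: g_def)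
  \<comment> \<open>The near term is proportional to \<open>tau\<close> and the far term to 2^(-3
    Mo) / tau^2; they balance at this value. This is why mean zero is assumed at level 3 Mo for a
    gain of 2^(-Mo).\<close>
  define tau where "tau = 1 / (2::real)^Mo"
  have tau0: "tau > 0" by (simp add: tau_def)
  define cc where "cc a b = (LBINT t. \<phi> ((a * t + b) / z t) * g t)" for a b
  have ce: "corr \<phi> ((a,b),(c,d)) = cc a b" for a b unfolding corr_formula cc_def g_def z_def Q_def ..
  note fl = flattening[OF phi(1,2) tg gs zm _ R tau0, folded cc_def]
  have flt: "tame (%(a, b). cutoff R a * cutoff R b * (cc a b)\<^sup>2)" by (rule fl(1)) auto
  have fli: "(LBINT r. cutoff R (fst r) * cutoff R (snd r) * (cc (fst r) (snd r))\<^sup>2)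
   <= 8 * R * 576 * tau * n2 * (LBINT t. (g t)\<^sup>2) + (1 + 1024) * 576^3 / 2^(3*Mo) / tau\<^sup>2 * (LBINT x. \<bar>\<phi> x\<bar>)\<^sup>2 * (LBINT t. \<bar>g t\<bar>)\<^sup>2"
   unfolding n2_def by (rule fl(2)) auto
  have g2: "(LBINT t. (g t)\<^sup>2) <= 6561 * n2"
  proof -
   have "(LBINT t. (g t)\<^sup>2) <= (LBINT t. 6561 * (\<phi> t)\<^sup>2)"
   proof (rule lint_mono)
    show "integrable lborel (%t. (g t)\<^sup>2)" "integrable lborel (%t. 6561 * (\<phi> t)\<^sup>2)" by (intro tame_integrable tame_cmult tame_power2 tg phi(1))+
    show "(g t)\<^sup>2 <= 6561 * (\<phi> t)\<^sup>2" for t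
    proof -
     have "(Q (z t))\<^sup>2 <= 81\<^sup>2" using power_mono[OF Q(1)[of "z t"], of 2] by simp
     then have "(\<phi> t)\<^sup>2 * (Q (z t))\<^sup>2 <= (\<phi> t)\<^sup>2 * 81\<^sup>2" by (intro mult_left_mono) auto
     then show ?thesis by (simp add: g_def power_mult_distrib)
    qed
   qed
   then show ?thesis by (simp add: n2_def)
  qed
  have f1: "(LBINT x. \<bar>\<phi> x\<bar>)\<^sup>2 <= 1024 * n2" unfolding n2_def by (rule L1_le_L2[OF phi(1,3)]) auto
  have "(LBINT t. \<bar>g t\<bar>)\<^sup>2 <= 1024 * (LBINT t. (g t)\<^sup>2)" by (rule L1_le_L2[OF tg]) (use phi(3) in \<open>auto simp: g_def\<close>)
  then have g1: "(LBINT t. \<bar>g t\<bar>)\<^sup>2 <= 1024 * (6561 * n2)" using g2 by linarith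
  have tau3: "1 / 2^(3*Mo) / tau\<^sup>2 = tau"
  proof -
   have "(2::real)^(3*Mo) = 2^Mo * 2^Mo * 2^Mo" by (simp flip: power_add)
   then show ?thesis by (simp add: tau_def power2_eq_square)
  qed
  have "(LBINT r1. ?q (r1, r2)) <= (LBINT r. cutoff R (fst r) * cutoff R (snd r) * (cc (fst r) (snd r))\<^sup>2)"
  proof (rule lint_mono)
   show "integrable lborel (%r1. ?q (r1, r2))" by (rule tame_integrable[OF tame_Fubini(2)[OF tq]])
   show "integrable lborel (%r. cutoff R (fst r) * cutoff R (snd r) * (cc (fst r) (snd r))\<^sup>2)"
    using tame_integrable[OF flt] by (simp add: case_prod_unfold)
   show "?q (r, r2) <= cutoff R (fst r) * cutoff R (snd r) * (cc (fst r) (snd r))\<^sup>2" for r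
   proof (cases "(r, r2) \<in> box R")
    case True
    then have "cutoff R (fst r) = 1" "cutoff R (snd r) = 1" using cutoff_eq_1 R by (auto simp: box_def)
    then show ?thesis using True ce[of "fst r" "snd r"] by (simp add: r2)
   next
    case False
    then show ?thesis using cutoff_bounds(1) by simp
   qed
  qed
  also have "\<dots> <= 8 * R * 576 * tau * n2 * (6561 * n2) + (1 + 1024) * 576^3 / 2^(3*Mo) / tau\<^sup>2 * (1024 * n2) * (1024 * (6561 * n2))"
   by (rule order_trans[OF fli], intro add_mono mult_mono g2 g1 f1) (use R tau0 n20 in auto)
  also have "\<dots> = (R * tau) * (8 * 576 * 6561 * n2\<^sup>2) + (1 / 2^(3*Mo) / tau\<^sup>2) * (1025 * 576^3 * 1024 * 1024 * 6561 * n2\<^sup>2)"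
   by (simp add: power2_eq_square)
  also have "\<dots> = (R * tau) * (8 * 576 * 6561 * n2\<^sup>2) + (1 * tau) * (1025 * 576^3 * 1024 * 1024 * 6561 * n2\<^sup>2)" unfolding tau3 by simp
  also have "\<dots> <= (R * tau) * (8 * 576 * 6561 * n2\<^sup>2) + (R * tau) * (1025 * 576^3 * 1024 * 1024 * 6561 * n2\<^sup>2)"
   using R tau0 by (intro add_mono mult_right_mono order_refl) auto
  also have "\<dots> = (R * tau * n2\<^sup>2) * (8 * 576 * 6561 + 1025 * 576^3 * 1024 * 1024 * 6561)" by (simp add: algebra_simps)
  also have "\<dots> <= (R * tau * n2\<^sup>2) * 2^72" using R tau0 by (intro mult_left_mono) auto
  also have "\<dots> = Kc" by (simp add: Kc_def tau_def)
  finally show ?thesis using True by simp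
 qed
 have tI: "tame (%r2. Kc * ind ({-R..R} \<times> {-R..R}) r2)"
  by (intro tame_cmult tame_indicator) (auto intro!: borel_closed closed_Times bounded_Times)
 have "(LBINT m. ?q m) = (LBINT r2. LBINT r1. ?q (r1, r2))" by (rule tame_Fubini(6)[OF tq])
 also have "\<dots> <= (LBINT r2. Kc * ind ({-R..R} \<times> {-R..R}) r2)"
  by (rule lint_mono[OF tame_integrable[OF tame_Fubini(4)[OF tq]] tame_integrable[OF tI] inner])
 also have "\<dots> = (LBINT x. LBINT y. Kc * ind ({-R..R} \<times> {-R..R}) (x, y))" by (rule tame_Fubini(5)[OF tI])
 also have "\<dots> = Kc * (2*R) * (2*R)"
 proof -
  have "Kc * ind ({-R..R} \<times> {-R..R}) (x, y) = (Kc * ind {-R..R} x) * ind {-R..R} y" for x y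
   by (auto simp: indicator_def)
  then have "(LBINT x. LBINT y. Kc * ind ({-R..R} \<times> {-R..R}) (x, y)) = (LBINT x. LBINT y. (Kc * ind {-R..R} x) * ind {-R..R} y)"
   by (simp only:)
  also have "\<dots> = Kc * (LBINT x. ind {-R..R} x) * (LBINT y. ind {-R..R} y)"
   by (simp only: integral_mult_right_zero integral_mult_left_zero)
  finally show ?thesis using R by simp
 qed
 also have "\<dots> = 2^74 * R^3 / 2^Mo * n2\<^sup>2" by (simp add: Kc_def power3_eq_cube)
 finally show ?thesis by (simp add: n2_def)
qed

end

lemma scaled_lift:
 assumes "l \<noteq> 0" shows "lift f h (l *\<^sub>R u) = f (fst u / snd u) * h (l * snd u)"
 using assms by (simp add: lift_def)

lemma lift_psit_eq: "lift f psit u = (LBINT l. ind {1..2} l * lift f psi (l *\<^sub>R u))"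
proof -
 have "ind {1..2} l * lift f psi (l *\<^sub>R u) = f (fst u / snd u) * (ind {1..2} l * psi (l * snd u))" for l
  by (cases "l \<in> {1..2}") (auto simp: scaled_lift)
 then have "(LBINT l. ind {1..2} l * lift f psi (l *\<^sub>R u)) = (LBINT l. f (fst u / snd u) * (ind {1..2} l * psi (l * snd u)))"
  by (simp only:)
 also have "\<dots> = f (fst u / snd u) * (LBINT l. ind {1..2} l * psi (l * snd u))" by (rule integral_mult_right_zero)
 finally show ?thesis by (simp add: lift_def psit_def)
qed

context
 fixes \<phi> :: "real \<Rightarrow> real" and Mo N' :: nat and \<delta> :: real
 assumes phi: "tame \<phi>" "mean_zero (3*Mo) \<phi>" "\<And>x. \<phi> x \<noteq> 0 ==> 0 <= x \<and> x <= 1024" "step N' \<phi>"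
  and d: "0 < \<delta>" "\<delta> * 2^(24+N') <= 1"
begin

lemma d1: "\<delta> <= 1"
proof -
 have "\<delta> * 1 <= \<delta> * 2^(24+N')" using d(1) by (intro mult_left_mono) auto
 then show ?thesis using d(2) by simp
qed

lemma pmeas [measurable]: "\<phi> \<in> borel_measurable borel" using phi(1) by (rule tame_measurable)

abbreviation "cor \<equiv> corr \<phi>"

text \<open>By \<open>lift_psit_eq\<close> the correlation of the lifts is an integral over
  dilations l. Each dilation is replaced by the matrices of \<open>EE\<close> with upper left entry
  l, a set of volume 8 \<delta>^3 per unit of l. Cauchy-Schwarz and
  \<open>perturbation_error\<close> bound the change; 2^47 = 2^40 * 128, where 128 rounds up the 81
  of \<open>norm_lift_psit\<close>.\<close>

lemma word_smoothing:
 assumes w: "unimodular w"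
 shows "\<bar>8 * \<delta>^3 * (LBINT v. lift \<phi> psit (lin w v) * lift \<phi> psit v) - (LBINT E. ind (EE \<delta>) E * cor (mrow E w))\<bar>
  <= 8 * \<delta>^3 * (sqrt (2^47 * \<delta> * 2^N') * (LBINT x. (\<phi> x)\<^sup>2))"
proof -
 define n2 where "n2 = (LBINT x. (\<phi> x)\<^sup>2)"
 have n20: "n2 >= 0" by (simp add: n2_def)
 define \<Psi> where "\<Psi> = lift \<phi> psit"
 define \<Phi> where "\<Phi> = lift \<phi> psi"
 have tP: "tame \<Psi>" "tame \<Phi>" unfolding \<Psi>_def \<Phi>_def by (intro tame_lift_psit tame_lift_psi phi(1))+
 have [measurable]: "\<Psi> \<in> borel_measurable borel" "\<Phi> \<in> borel_measurable borel" using tP by (auto intro: tame_measurable)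
 obtain M where M: "M >= 0" "\<And>v. \<bar>\<Phi> v\<bar> <= M" using tP(2) by (rule tameE) blast
 obtain M' R' where M': "M' >= 0" "\<And>v. \<bar>\<Psi> v\<bar> <= M'" "\<And>v. \<Psi> v \<noteq> 0 ==> norm v <= R'" using tP(1) by (rule tameE) blast
 define h where "h l = (LBINT v. \<Phi> (l *\<^sub>R lin w v) * \<Psi> v)" for l
 have mm: "(%q::real \<times> (real\<times>real). \<Phi> (fst q *\<^sub>R lin w (snd q))) \<in> borel_measurable borel"
 proof -
  obtain a b c d where we: "w = (a,b,c,d)" by (cases w)
  have "(%q::real\<times>(real\<times>real). fst q *\<^sub>R lin w (snd q)) = (%q. (fst q * (a * fst (snd q) + b * snd (snd q)), fst q * (c * fst (snd q) + d * snd (snd q))))"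
   by (auto simp: we)
  then have "(%q::real\<times>(real\<times>real). fst q *\<^sub>R lin w (snd q)) \<in> borel_measurable borel"
   by (simp add: borel_measurable_continuous_onI continuous_on_Pair continuous_intros)
  from measurable_compose[OF this, of \<Phi> borel] show ?thesis by simp
 qed
 have ms: "(%q::real \<times> (real\<times>real). \<Psi> (snd q)) \<in> borel_measurable borel"
  by (rule measurable_compose[of snd borel borel]) (simp_all add: borel_measurable_continuous_onI continuous_intros)
 have tl: "tame (%(l, v). ind A l * (\<Phi> (l *\<^sub>R lin w v) * \<Psi> v))" if A: "A \<in> sets borel" "bounded A" for A :: "real set"
 proof -
  obtain Ra where Ra: "\<And>l. l \<in> A ==> norm l <= Ra" using A(2) by (auto simp: bounded_iff)
  have mi: "(%q::real \<times> (real\<times>real). ind A (fst q)) \<in> borel_measurable borel"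
   by (rule measurable_compose[of fst borel borel]) (use A(1) in \<open>simp_all add: borel_measurable_continuous_onI continuous_intros\<close>)
  show ?thesis
  proof (rule tameI[where M = "1 * (M * M')" and R = "Ra + R'"])
   show "(%(l, v). ind A l * (\<Phi> (l *\<^sub>R lin w v) * \<Psi> v)) \<in> borel_measurable borel"
    unfolding case_prod_unfold by (intro borel_measurable_times mi mm ms)
   show "\<bar>case q of (l, v) \<Rightarrow> ind A l * (\<Phi> (l *\<^sub>R lin w v) * \<Psi> v)\<bar> <= 1 * (M * M')" for q
    unfolding case_prod_unfold abs_mult by (intro mult_mono) (use M M' in \<open>auto simp: indicator_def\<close>)
   show "norm q <= Ra + R'" if "(case q of (l, v) \<Rightarrow> ind A l * (\<Phi> (l *\<^sub>R lin w v) * \<Psi> v)) \<noteq> 0" for q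
   proof -
    have "fst q \<in> A" "\<Psi> (snd q) \<noteq> 0" using that by (auto simp: case_prod_unfold indicator_def split: if_splits)
    then show ?thesis using Ra[of "fst q"] M'(3)[of "snd q"] norm_Pair_le[of "fst q" "snd q"] by simp
   qed
  qed
 qed
 have hb: "\<bar>h l\<bar> <= M * (LBINT v. \<bar>\<Psi> v\<bar>)" for l
 proof -
  have "\<bar>h l\<bar> <= (LBINT v. \<bar>\<Phi> (l *\<^sub>R lin w v) * \<Psi> v\<bar>)" unfolding h_def by (rule integral_abs_bound)
  also have "\<dots> <= (LBINT v. M * \<bar>\<Psi> v\<bar>)"
  proof (rule lint_mono)
   have "tame (%v. \<Phi> (l *\<^sub>R lin w v) * \<Psi> v)" using tame_Fubini(1)[OF tl[of "{l}"], of l] by simp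
   then show "integrable lborel (%v. \<bar>\<Phi> (l *\<^sub>R lin w v) * \<Psi> v\<bar>)" by (intro tame_integrable tame_abs)
   show "integrable lborel (%v. M * \<bar>\<Psi> v\<bar>)" by (intro tame_integrable tame_cmult tame_abs tP)
   show "\<bar>\<Phi> (l *\<^sub>R lin w v) * \<Psi> v\<bar> <= M * \<bar>\<Psi> v\<bar>" for v unfolding abs_mult by (intro mult_right_mono M) simp
  qed
  finally show ?thesis by simp
 qed
 have hm: "h \<in> borel_measurable borel"
 proof -
  have "(%q. \<Phi> (fst q *\<^sub>R lin w (snd q)) * \<Psi> (snd q)) \<in> borel_measurable (borel \<Otimes>\<^sub>M borel)"
   using borel_measurable_times[OF mm ms] by (simp add: borel_prod)
  then have "(%(l, v). \<Phi> (l *\<^sub>R lin w v) * \<Psi> v) \<in> borel_measurable (borel \<Otimes>\<^sub>M lborel)"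
   by (simp add: case_prod_unfold cong: measurable_cong_sets)
  then show ?thesis unfolding h_def by (rule sigma_finite_measure.borel_measurable_lebesgue_integral[OF lborel.sigma_finite_measure_axioms])
 qed
 have e1: "(LBINT l. ind {1..2} l * h l) = (LBINT v. \<Psi> (lin w v) * \<Psi> v)"
 proof -
  have "(LBINT l. ind {1..2} l * h l) = (LBINT l. LBINT v. ind {1..2} l * (\<Phi> (l *\<^sub>R lin w v) * \<Psi> v))"
   unfolding h_def by (simp only: integral_mult_right_zero)
  also have "\<dots> = (LBINT v. LBINT l. ind {1..2} l * (\<Phi> (l *\<^sub>R lin w v) * \<Psi> v))"
   by (rule tame_swap[OF tl]) auto
  also have "\<dots> = (LBINT v. \<Psi> (lin w v) * \<Psi> v)"
   unfolding mult.assoc[symmetric] integral_mult_left_zero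
   by (simp add: \<Psi>_def \<Phi>_def lift_psit_eq[of \<phi> "lin w v" for v])
  finally show ?thesis .
 qed
 have e2: "8 * \<delta>^3 * (LBINT v. \<Psi> (lin w v) * \<Psi> v) = (LBINT E. ind (EE \<delta>) E * h (fst (fst E)))"
  using integral_EE[OF d(1) d1 hm hb] e1 by simp
 have diff: "\<bar>h (fst (fst E)) - cor (mrow E w)\<bar> <= sqrt (2^47 * \<delta> * 2^N') * n2" if E: "E \<in> EE \<delta>" for E
 proof -
  define G where "G u = \<Phi> (fst (fst E) *\<^sub>R u) - \<Phi> (lr E u)" for u
  have pe: "tame (%u. (G u)\<^sup>2)" "(LBINT u. (G u)\<^sup>2) <= 2^40 * \<delta> * 2^N' * n2"
   using perturbation_error[OF phi(1) phi(4) phi(3) d E] unfolding G_def \<Phi>_def n2_def by auto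
  have t1: "tame (%v. \<Phi> (fst (fst E) *\<^sub>R lin w v) * \<Psi> v)" using tame_Fubini(1)[OF tl[of "{fst (fst E)}"], of "fst (fst E)"] by simp
  have t2: "tame (%v. \<Phi> (lr E (lin w v)) * \<Psi> v)" using tame_corr_integrand[OF phi(1,2,3), of "mrow E w"] unfolding lr_mrow \<Psi>_def \<Phi>_def .
  have tG: "tame G"
  proof -
   obtain l e2 e3 l' where E': "E = ((l, e2), (e3, l'))" by (metis surj_pair)
   have hh: "1 <= l" "\<bar>e2\<bar> <= \<delta>" "\<bar>e3\<bar> <= \<delta>" "\<bar>l' - l\<bar> <= \<delta>" using E by (auto simp: EE_def E')
   have d2: "\<delta> <= 1/16777216"
   proof -
    have "\<delta> * 2^24 <= \<delta> * 2^(24+N')" using d(1) by (intro mult_left_mono power_increasing) auto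
    then have "\<delta> * 2^24 <= 1" using d(2) by linarith
    then show ?thesis by simp
   qed
   have a: "1 * (1/2) <= l * l'" using hh d2 by (intro mult_mono) auto
   have b: "\<bar>e2 * e3\<bar> <= 1/4 * 1" unfolding abs_mult using hh d2 by (intro mult_mono) auto
   have "l * l' - e2 * e3 \<noteq> 0" using a b by linarith
   then have "tame (%u. \<Phi> (lin (l,e2,e3,l') u))" by (rule tame_lin[OF tP(2)])
   moreover have "tame (%u. \<Phi> (lin (l,0,0,l) u))" by (rule tame_lin[OF tP(2)]) (use hh in auto)
   moreover have "lin (l,e2,e3,l') u = lr E u" "lin (l,0,0,l) u = l *\<^sub>R u" for u by (cases u; simp add: lr_def E')+
   ultimately show ?thesis unfolding G_def using tame_diff by (simp add: E')
  qed
  have "h (fst (fst E)) - cor (mrow E w) = (LBINT v. G (lin w v) * \<Psi> v)"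
  proof -
   have "cor (mrow E w) = (LBINT v. \<Phi> (lr E (lin w v)) * \<Psi> v)"
    using corr_def[of \<phi> "mrow E w"] by (simp only: lr_mrow \<Phi>_def \<Psi>_def)
   then show ?thesis unfolding h_def G_def using t1 t2 by (simp add: left_diff_distrib tame_integrable)
  qed
  also have "\<bar>\<dots>\<bar> <= sqrt ((LBINT v. (G (lin w v))\<^sup>2) * (LBINT v. (\<Psi> v)\<^sup>2))"
   using tame_CauchySchwarz[OF tame_unimodular[OF tG w] tP(1)] by (simp add: real_le_rsqrt)
  also have "(LBINT v. (G (lin w v))\<^sup>2) = (LBINT v. (G v)\<^sup>2)" by (rule integral_unimodular[OF pe(1) w])
  also have "sqrt ((LBINT v. (G v)\<^sup>2) * (LBINT v. (\<Psi> v)\<^sup>2)) <= sqrt ((2^40 * \<delta> * 2^N' * n2) * (128 * n2))"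
  proof (intro real_sqrt_le_mono mult_mono pe(2))
   have "(LBINT v. (\<Psi> v)\<^sup>2) <= 81 * n2" unfolding \<Psi>_def n2_def by (rule norm_lift_psit[OF phi(1)])
   then show "(LBINT v. (\<Psi> v)\<^sup>2) <= 128 * n2" using n20 by linarith
  qed (use d n20 in auto)
  also have "(2^40 * \<delta> * 2^N' * n2) * (128 * n2) = (2^47 * \<delta> * 2^N') * n2\<^sup>2" by (simp add: power2_eq_square)
  also have "sqrt \<dots> = sqrt (2^47 * \<delta> * 2^N') * n2" using n20 by (simp only: real_sqrt_mult real_sqrt_abs abs_of_nonneg)
  finally show ?thesis .
 qed
 have tI1: "tame (%E. ind (EE \<delta>) E * h (fst (fst E)))"
 proof (rule tame_mult[OF tame_EE[OF d1], where B = "M * (LBINT v. \<bar>\<Psi> v\<bar>)"])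
  have "(%E::rows. fst (fst E)) \<in> borel_measurable borel" by (simp add: borel_measurable_continuous_onI continuous_intros)
  from measurable_compose[OF this hm] show "(%E::rows. h (fst (fst E))) \<in> borel_measurable borel" .
 qed (use hb in auto)
 have tI2: "tame (%E. ind (EE \<delta>) E * cor (mrow E w))"
 proof -
  obtain Re where Re: "\<And>E. E \<in> EE \<delta> ==> norm E <= Re" using EE_bounded[OF d1] by (auto simp: bounded_iff)
  obtain a b c dd where we: "w = (a,b,c,dd)" by (cases w)
  define R where "R = (\<bar>a\<bar>+\<bar>b\<bar>+\<bar>c\<bar>+\<bar>dd\<bar>) * Re"
  have bx: "mrow E w \<in> box R" if "E \<in> EE \<delta>" for E
  proof -
   have n: "\<bar>fst (fst E)\<bar> <= Re" "\<bar>snd (fst E)\<bar> <= Re" "\<bar>fst (snd E)\<bar> <= Re" "\<bar>snd (snd E)\<bar> <= Re"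
    using Re[OF that] norm_fst_le[of "fst E" "snd E"] norm_snd_le[of "snd E" "fst E"] norm_fst_le[of "fst (fst E)" "snd (fst E)"]
     norm_snd_le[of "snd (fst E)" "fst (fst E)"] norm_fst_le[of "fst (snd E)" "snd (snd E)"] norm_snd_le[of "snd (snd E)" "fst (snd E)"] by auto
   have Re0: "Re >= 0" using n(1) by linarith
   have k: "\<bar>p * x + q * y\<bar> <= R" if "\<bar>x\<bar> <= Re" "\<bar>y\<bar> <= Re" "\<bar>p\<bar> + \<bar>q\<bar> <= \<bar>a\<bar>+\<bar>b\<bar>+\<bar>c\<bar>+\<bar>dd\<bar>" for p q x y
   proof -
    have "\<bar>p * x + q * y\<bar> <= \<bar>p\<bar> * Re + \<bar>q\<bar> * Re"
     by (rule order_trans[OF abs_triangle_ineq]) (auto simp: abs_mult intro!: add_mono mult_left_mono that)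
    also have "\<dots> = (\<bar>p\<bar>+\<bar>q\<bar>) * Re" by (simp add: algebra_simps)
    also have "\<dots> <= R" unfolding R_def by (intro mult_right_mono that Re0)
    finally show ?thesis .
   qed
   obtain e1 e2 e3 e4 where E': "E = ((e1, e2), (e3, e4))" by (metis surj_pair)
   show ?thesis unfolding box_def we E' using n by (auto simp: E' intro!: k)
  qed
  have t: "tame (%E. ind (box R) (mrow E w) * cor (mrow E w))" by (rule tame_mrow[OF tame_boxcorr[OF phi(1,2,3)] w])
  have "ind (EE \<delta>) E * (ind (box R) (mrow E w) * cor (mrow E w)) = ind (EE \<delta>) E * cor (mrow E w)" for E
   using bx[of E] by (cases "E \<in> EE \<delta>") auto
  then show ?thesis using tame_mult_tame[OF tame_EE[OF d1] t] by (simp only:)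
 qed
 have "8 * \<delta>^3 * (LBINT v. \<Psi> (lin w v) * \<Psi> v) - (LBINT E. ind (EE \<delta>) E * cor (mrow E w))
   = (LBINT E. ind (EE \<delta>) E * h (fst (fst E)) - ind (EE \<delta>) E * cor (mrow E w))"
  unfolding e2 using tI1 tI2 by (simp add: tame_integrable)
 also have "\<bar>\<dots>\<bar> <= (LBINT E. \<bar>ind (EE \<delta>) E * h (fst (fst E)) - ind (EE \<delta>) E * cor (mrow E w)\<bar>)" by (rule integral_abs_bound)
 also have "\<dots> <= (LBINT E. ind (EE \<delta>) E * (sqrt (2^47 * \<delta> * 2^N') * n2))"
 proof (rule lint_mono)
  show "integrable lborel (%E. \<bar>ind (EE \<delta>) E * h (fst (fst E)) - ind (EE \<delta>) E * cor (mrow E w)\<bar>)"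
   by (intro tame_integrable tame_abs tame_diff tI1 tI2)
  show "integrable lborel (%E. ind (EE \<delta>) E * (sqrt (2^47 * \<delta> * 2^N') * n2))"
   by (intro integrable_mult_left tame_integrable tame_EE d1)
  show "\<bar>ind (EE \<delta>) E * h (fst (fst E)) - ind (EE \<delta>) E * cor (mrow E w)\<bar> <= ind (EE \<delta>) E * (sqrt (2^47 * \<delta> * 2^N') * n2)" for E
   using diff[of E] by (cases "E \<in> EE \<delta>") auto
 qed
 also have "\<dots> = 8 * \<delta>^3 * (sqrt (2^47 * \<delta> * 2^N') * n2)"
  unfolding integral_mult_left_zero using integral_EE[OF d(1) d1, of "%_. 1" 1] by simp
 finally show ?thesis by (simp add: \<Psi>_def n2_def)
qed

text \<open>After smoothing, a word w contributes the integral of the correlation over the translate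
  of \<open>EE\<close> by w, whose indicator is \<open>g w\<close>. The sum over words is the
  integral of the multiplicity \<open>N\<close> against the correlation, and Cauchy-Schwarz
  separates arithmetic from analysis: the square mean of \<open>N\<close> counts close pairs of
  words, that of the correlation is \<open>integral_boxcorr\<close>.\<close>

lemma word_average_bound:
 fixes W :: "'w set" and M :: "'w \<Rightarrow> real \<times> real \<times> real \<times> real"
 assumes W: "finite W" "\<And>w. w \<in> W ==> unimodular (M w)" and R: "R >= 1"
  and box: "\<And>w E. w \<in> W ==> E \<in> EE \<delta> ==> mrow E (M w) \<in> box R"
 defines "close \<equiv> {q \<in> W \<times> W. \<exists>E\<in>EE \<delta>. \<exists>E'\<in>EE \<delta>. mrow E (M (fst q)) = mrow E' (M (snd q))}"
 shows "(\<Sum>w\<in>W. LBINT v. lift \<phi> psit (lin (M w) v) * lift \<phi> psit v)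
  <= (real (card W) * sqrt (2^47 * \<delta> * 2^N') + sqrt (real (card close) / (8 * \<delta>^3)) * sqrt (2^74 * R^3 / 2^Mo)) * (LBINT x. (\<phi> x)\<^sup>2)"
proof -
 define n2 where "n2 = (LBINT x. (\<phi> x)\<^sup>2)"
 have n20: "n2 >= 0" by (simp add: n2_def)
 define V where "V = 8 * \<delta>^3"
 have V0: "V > 0" using d by (simp add: V_def)
 define cB where "cB m = ind (box R) m * cor m" for m
 have tcB: "tame cB" unfolding cB_def by (rule tame_boxcorr[OF phi(1,2,3)])
 define g where "g w m = ind (EE \<delta>) (mrow m (rinv (M w)))" for w m
 have tg: "tame (g w)" if "w \<in> W" for w unfolding g_def by (rule tame_mrow[OF tame_EE[OF d1] unimodular_rinv[OF W(2)[OF that]]])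
 have gE: "g w (mrow E (M w)) = ind (EE \<delta>) E" if "w \<in> W" for w E
  unfolding g_def using mrow_rinv[OF W(2)[OF that]] by simp
 have ge: "\<exists>E\<in>EE \<delta>. mrow E (M w) = m" if "w \<in> W" "g w m \<noteq> 0" for w m
 proof -
  have "mrow m (rinv (M w)) \<in> EE \<delta>" using that(2) by (auto simp: g_def indicator_def split: if_splits)
  moreover have "mrow (mrow m (rinv (M w))) (M w) = m"
  proof -
   have "rinv (rinv (M w)) = M w" by (cases "M w") simp
   then show ?thesis using mrow_rinv[OF unimodular_rinv[OF W(2)[OF that(1)]], of m] by simp
  qed
  ultimately show ?thesis by blast
 qed
 have g01: "0 <= g w m" "g w m <= 1" for w m by (auto simp: g_def)
 have gint: "(LBINT m. g w m) = V" if "w \<in> W" for w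
  using integral_mrow[OF tame_EE[OF d1] unimodular_rinv[OF W(2)[OF that]]] integral_EE[OF d(1) d1, of "%_. 1" 1]
  by (simp add: g_def V_def)
 have conv: "(LBINT E. ind (EE \<delta>) E * cor (mrow E (M w))) = (LBINT m. g w m * cB m)" if "w \<in> W" for w
 proof -
  have "(LBINT m. g w m * cB m) = (LBINT E. g w (mrow E (M w)) * cB (mrow E (M w)))"
   using integral_mrow[OF tame_mult_tame[OF tg[OF that] tcB] W(2)[OF that]] by simp
  also have "\<dots> = (LBINT E. ind (EE \<delta>) E * cor (mrow E (M w)))"
  proof (intro lint_cong refl)
   fix E
   show "g w (mrow E (M w)) * cB (mrow E (M w)) = ind (EE \<delta>) E * cor (mrow E (M w))"
    unfolding gE[OF that] cB_def using box[OF that, of E] by (cases "E \<in> EE \<delta>") auto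
  qed
  finally show ?thesis by simp
 qed
 define N where "N m = (\<Sum>w\<in>W. g w m)" for m
 have tN: "tame N" unfolding N_def by (intro tame_sum tg)
 \<comment> \<open>Two translates of \<open>EE\<close> intersect only for a close pair, and then in
   volume at most V.\<close>
 have N2: "(LBINT m. (N m)\<^sup>2) <= real (card close) * V"
 proof -
  have "(LBINT m. (N m)\<^sup>2) = (LBINT m. (\<Sum>q\<in>W\<times>W. g (fst q) m * g (snd q) m))"
   by (intro lint_cong refl) (simp add: N_def power2_eq_square sum_product sum.cartesian_product case_prod_unfold)
  also have "\<dots> = (\<Sum>q\<in>W\<times>W. LBINT m. g (fst q) m * g (snd q) m)"
   by (rule lint_sum) (auto intro!: tame_integrable tame_mult_tame tg)
  also have "\<dots> = (\<Sum>q\<in>close. LBINT m. g (fst q) m * g (snd q) m)"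
  proof (rule sum.mono_neutral_right)
   show "\<forall>q\<in>W\<times>W - close. (LBINT m. g (fst q) m * g (snd q) m) = 0"
   proof
    fix q assume q: "q \<in> W\<times>W - close"
    have "g (fst q) m * g (snd q) m = 0" for m
    proof (rule ccontr)
     assume "g (fst q) m * g (snd q) m \<noteq> 0"
     then have "g (fst q) m \<noteq> 0" "g (snd q) m \<noteq> 0" by auto
     moreover have "fst q \<in> W" "snd q \<in> W" using q by auto
     ultimately obtain E E' where "E \<in> EE \<delta>" "mrow E (M (fst q)) = m" "E' \<in> EE \<delta>" "mrow E' (M (snd q)) = m"
      using ge[of "fst q" m] ge[of "snd q" m] by blast
     then have "\<exists>E\<in>EE \<delta>. \<exists>E'\<in>EE \<delta>. mrow E (M (fst q)) = mrow E' (M (snd q))"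
      by (intro bexI[of _ E] bexI[of _ E']) auto
     then have "q \<in> close" using q unfolding close_def by blast
     then show False using q by blast
    qed
    then show "(LBINT m. g (fst q) m * g (snd q) m) = 0" by (simp only: integral_zero)
   qed
  qed (use W(1) in \<open>auto simp: close_def\<close>)
  also have "\<dots> <= (\<Sum>q\<in>close. V)"
  proof (rule sum_mono)
   fix q assume "q \<in> close"
   then have q: "fst q \<in> W" "snd q \<in> W" by (auto simp: close_def)
   have "(LBINT m. g (fst q) m * g (snd q) m) <= (LBINT m. g (fst q) m)"
    by (rule lint_mono)
     (use q g01 in \<open>auto intro!: tame_integrable tame_mult_tame tg simp: mult_left_le\<close>)
   then show "(LBINT m. g (fst q) m * g (snd q) m) <= V" using gint[OF q(1)] by simp
  qed
  finally show ?thesis by simp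
 qed
 have sumc: "(\<Sum>w\<in>W. LBINT m. g w m * cB m) <= sqrt (real (card close) * V) * (sqrt (2^74 * R^3 / 2^Mo) * n2)"
 proof -
  have "(\<Sum>w\<in>W. LBINT m. g w m * cB m) = (LBINT m. (\<Sum>w\<in>W. g w m * cB m))"
   by (rule lint_sum[symmetric]) (auto intro!: tame_integrable tame_mult_tame tg tcB)
  also have "\<dots> = (LBINT m. N m * cB m)" by (simp add: N_def sum_distrib_right)
  also have "\<dots> <= sqrt ((LBINT m. (N m)\<^sup>2) * (LBINT m. (cB m)\<^sup>2))"
   using tame_CauchySchwarz[OF tN tcB] by (simp add: real_le_rsqrt)
  also have "\<dots> <= sqrt ((real (card close) * V) * (2^74 * R^3 / 2^Mo * n2\<^sup>2))"
  proof (intro real_sqrt_le_mono mult_mono N2)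
   show "(LBINT m. (cB m)\<^sup>2) <= 2^74 * R^3 / 2^Mo * n2\<^sup>2"
    unfolding cB_def n2_def by (rule integral_boxcorr[OF phi(1,2,3) R])
  qed (use V0 in auto)
  also have "\<dots> = sqrt (real (card close) * V) * (sqrt (2^74 * R^3 / 2^Mo) * n2)"
   using n20 by (simp only: real_sqrt_mult[of "real (card close) * V"] real_sqrt_mult[of "2^74 * R^3 / 2^Mo"] real_sqrt_abs abs_of_nonneg)
  finally show ?thesis .
 qed
 have "V * (\<Sum>w\<in>W. LBINT v. lift \<phi> psit (lin (M w) v) * lift \<phi> psit v) = (\<Sum>w\<in>W. V * (LBINT v. lift \<phi> psit (lin (M w) v) * lift \<phi> psit v))"
  by (simp add: sum_distrib_left)
 also have "\<dots> <= (\<Sum>w\<in>W. V * (sqrt (2^47 * \<delta> * 2^N') * n2) + (LBINT m. g w m * cB m))"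
 proof (rule sum_mono)
  fix w assume w: "w \<in> W"
  show "V * (LBINT v. lift \<phi> psit (lin (M w) v) * lift \<phi> psit v) <= V * (sqrt (2^47 * \<delta> * 2^N') * n2) + (LBINT m. g w m * cB m)"
   using word_smoothing[OF W(2)[OF w]] conv[OF w] unfolding V_def n2_def by linarith
 qed
 also have "\<dots> = V * (real (card W) * (sqrt (2^47 * \<delta> * 2^N') * n2)) + (\<Sum>w\<in>W. LBINT m. g w m * cB m)"
  by (simp add: sum.distrib)
 also have "\<dots> <= V * (real (card W) * (sqrt (2^47 * \<delta> * 2^N') * n2)) + sqrt (real (card close) * V) * (sqrt (2^74 * R^3 / 2^Mo) * n2)"
  using sumc by simp
 also have "sqrt (real (card close) * V) = V * sqrt (real (card close) / V)"
 proof -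
  have "real (card close) * V = (real (card close) / V) * V\<^sup>2" using V0 by (simp add: power2_eq_square)
  then have "sqrt (real (card close) * V) = sqrt ((real (card close) / V) * V\<^sup>2)" by (rule arg_cong)
  also have "\<dots> = sqrt (real (card close) / V) * V" using V0 by (simp only: real_sqrt_mult[of _ "V\<^sup>2"] real_sqrt_abs abs_of_pos)
  finally show ?thesis by simp
 qed
 finally have "V * (\<Sum>w\<in>W. LBINT v. lift \<phi> psit (lin (M w) v) * lift \<phi> psit v)
  <= V * ((real (card W) * sqrt (2^47 * \<delta> * 2^N') + sqrt (real (card close) / V) * sqrt (2^74 * R^3 / 2^Mo)) * n2)"
  by (simp add: algebra_simps)
 then show ?thesis using V0 unfolding V_def n2_def by simp
qed

end

section \<open>The band estimate\<close>

fun rm :: "real \<Rightarrow> imat \<Rightarrow> real \<times> real \<times> real \<times> real" where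
 "rm r (a, b, c, d) = (real_of_int a / r, real_of_int b / r, real_of_int c / r, real_of_int d / r)"

lemma lin_rm: "lin (rm r G) (lin (rm r' G') v) = lin (rm (r * r') (mat_mul G G')) v"
 by (cases G; cases G'; cases v) (simp add: add_divide_distrib algebra_simps)

lemma lin_rm_one: "r \<noteq> 0 ==> lin (rm r (mat_scale r' mat_one)) v = (real_of_int r' / r) *\<^sub>R v"
 by (cases v) (simp add: mat_one_def)

lemma unimodular_rm:
 assumes "real_of_int (mat_det G) = r * r" "r \<noteq> 0" shows "unimodular (rm r G)"
proof -
 obtain a b c d where G: "G = (a,b,c,d)" by (cases G)
 have "real_of_int a * real_of_int d - real_of_int b * real_of_int c = r * r" using assms(1) by (simp add: G)
 then have "(real_of_int a * real_of_int d - real_of_int b * real_of_int c) / (r * r) = 1" using assms(2) by simp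
 then show ?thesis by (simp add: G unimodular_def diff_divide_distrib)
qed

definition letters :: "(imat \<times> imat) list \<Rightarrow> imat list" where
 "letters ws = concat (map (%q. [fst q, mat_adj (snd q)]) ws)"

lemma letters_simps [simp]: "letters [] = []" "letters (q # ws) = fst q # mat_adj (snd q) # letters ws"
 by (auto simp: letters_def)

lemma length_letters [simp]: "length (letters ws) = 2 * length ws"
 by (induction ws) auto

lemma letters_inj: "letters ws = letters ws' ==> ws = ws'"
proof (induction ws arbitrary: ws')
 case Nil
 then show ?case by (cases ws') auto
next
 case (Cons q ws)
 then obtain q' ws'' where w: "ws' = q' # ws''" by (cases ws') auto
 have "mat_adj (snd q) = mat_adj (snd q')" using Cons.prems w by simp
 then have "snd q = snd q'" by (metis mat_adj_adj)
 then show ?case using Cons w by (auto simp: prod_eq_iff)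
qed

lemma adj_letter: "x \<in> bounded_letters K p ==> mat_adj x \<in> bounded_letters K p"
 by (cases x) (auto simp: bounded_letters_def mult.commute)

lemma mat_adj_one [simp]: "mat_adj mat_one = mat_one"
 by (simp add: mat_one_def)

lemma mat_adj_prod: "mat_adj (mat_prod xs) = mat_prod (map mat_adj (rev xs))"
 by (induction xs) (auto simp: mat_adj_mul mat_prod_append)

definition entry_le :: "imat \<Rightarrow> real \<Rightarrow> bool" where
 "entry_le G B = (case G of (a, b, c, d) \<Rightarrow> \<bar>real_of_int a\<bar> <= B \<and> \<bar>real_of_int b\<bar> <= B \<and> \<bar>real_of_int c\<bar> <= B \<and> \<bar>real_of_int d\<bar> <= B)"

lemma entry_le_mul:
 assumes "entry_le G B" "entry_le G' B'" "B >= 0" "B' >= 0"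
 shows "entry_le (mat_mul G G') (2 * B * B')"
proof -
 obtain a b c d where G: "G = (a,b,c,d)" by (cases G)
 obtain a' b' c' d' where G': "G' = (a',b',c',d')" by (cases G')
 have k: "\<bar>real_of_int x * real_of_int y + real_of_int z * real_of_int w\<bar> <= 2 * B * B'"
  if "\<bar>real_of_int x\<bar> <= B" "\<bar>real_of_int y\<bar> <= B'" "\<bar>real_of_int z\<bar> <= B" "\<bar>real_of_int w\<bar> <= B'" for x y z w
 proof -
  have "\<bar>real_of_int x * real_of_int y\<bar> <= B * B'" "\<bar>real_of_int z * real_of_int w\<bar> <= B * B'"
   unfolding abs_mult using that assms by (auto intro!: mult_mono)
  then show ?thesis by linarith
 qed
 have hs: "\<bar>real_of_int a\<bar> <= B" "\<bar>real_of_int b\<bar> <= B" "\<bar>real_of_int c\<bar> <= B" "\<bar>real_of_int d\<bar> <= B"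
  "\<bar>real_of_int a'\<bar> <= B'" "\<bar>real_of_int b'\<bar> <= B'" "\<bar>real_of_int c'\<bar> <= B'" "\<bar>real_of_int d'\<bar> <= B'"
  using assms(1,2) by (auto simp: G G' entry_le_def)
 show ?thesis unfolding G G' mat_mul.simps entry_le_def prod.case of_int_add of_int_mult by (intro conjI k hs)
qed

lemma letter_entry:
 assumes "x \<in> bounded_letters 1600 p" "p >= 0" shows "entry_le x (40 * sqrt p)"
proof -
 have k: "\<bar>real_of_int z\<bar> <= 40 * sqrt p" if "z\<^sup>2 <= 1600 * p" for z
 proof -
  have "(real_of_int z)\<^sup>2 <= 1600 * p" using that by (metis of_int_le_iff of_int_mult of_int_numeral of_int_power)
  then have "sqrt ((real_of_int z)\<^sup>2) <= sqrt (1600 * p)" by (rule real_sqrt_le_mono)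
  also have "\<dots> = 40 * sqrt p"
  proof -
   have "sqrt (1600::real) = 40" by (rule real_sqrt_unique) auto
   then show ?thesis by (simp add: real_sqrt_mult)
  qed
  finally show ?thesis by simp
 qed
 show ?thesis using assms k by (cases x) (auto simp: bounded_letters_def entry_le_def)
qed

lemma prod_entry:
 assumes "set xs \<subseteq> bounded_letters 1600 p" "p >= 0" shows "entry_le (mat_prod xs) ((80 * sqrt p)^length xs)"
 using assms(1)
proof (induction xs)
 case Nil
 then show ?case by (simp add: mat_one_def entry_le_def)
next
 case (Cons x xs)
 have "entry_le (mat_mul x (mat_prod xs)) (2 * (40 * sqrt p) * (80 * sqrt p)^length xs)"
  using Cons assms by (intro entry_le_mul letter_entry) auto
 then show ?case by simp
qed

text \<open>The equations say that E = E' Z. The dilation factors l and k of E and E' vary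
  independently in [1, 2], so nearness of Z to the identity is not immediate. But det Z = 1 makes
  the determinants of E and E' equal; these are l^2 and k^2 up to O(\<delta>), so l and k differ by
  O(\<delta>), and Cramer's rule bounds the entries of Z.\<close>

lemma EE_quotient:
 assumes E: "((l,e2),(e3,l')) \<in> EE \<delta>" and E': "((k,f2),(f3,k')) \<in> EE \<delta>" and d: "0 < \<delta>" "\<delta> <= 1/16"
  and eq: "k*z1 + f2*z3 = l" "k*z2 + f2*z4 = e2" "f3*z1 + k'*z3 = e3" "f3*z2 + k'*z4 = l'" and det: "z1*z4 - z2*z3 = 1"
 shows "\<bar>z1 - 1\<bar> <= 32 * \<delta>" "\<bar>z4 - 1\<bar> <= 32 * \<delta>" "\<bar>z2\<bar> <= 32 * \<delta>" "\<bar>z3\<bar> <= 32 * \<delta>"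
proof -
 have h: "1 <= l" "l <= 2" "\<bar>e2\<bar> <= \<delta>" "\<bar>e3\<bar> <= \<delta>" "\<bar>l' - l\<bar> <= \<delta>" "1 <= k" "k <= 2" "\<bar>f2\<bar> <= \<delta>" "\<bar>f3\<bar> <= \<delta>" "\<bar>k' - k\<bar> <= \<delta>"
  using E E' by (auto simp: EE_def)
 define D where "D = k*k' - f2*f3"
 have sm: "\<bar>u * v\<bar> <= \<delta> * \<delta>" if "\<bar>u\<bar> <= \<delta>" "\<bar>v\<bar> <= \<delta>" for u v unfolding abs_mult using that d by (intro mult_mono) auto
 have dd: "\<delta> * \<delta> <= \<delta> * (1/16)" using d by (intro mult_left_mono) auto
 have m3: "\<bar>u * v\<bar> <= 3 * B" if "\<bar>u\<bar> <= 3" "\<bar>v\<bar> <= B" for u v B :: real unfolding abs_mult using that by (intro mult_mono) auto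
 have b3: "\<bar>l\<bar> <= 3" "\<bar>l'\<bar> <= 3" "\<bar>k\<bar> <= 3" "\<bar>k'\<bar> <= 3" using h d by linarith+
 have D2: "D >= 1/2"
 proof -
  have "1 * (15/16) <= k * k'" using h d by (intro mult_mono) auto
  moreover have "\<bar>f2*f3\<bar> <= \<delta> * \<delta>" using h by (intro sm) auto
  ultimately show ?thesis using dd d unfolding D_def by linarith
 qed
 have "l*l' - e2*e3 = D"
 proof -
  have "l*l' - e2*e3 = (k*k' - f2*f3) * (z1*z4 - z2*z3)" unfolding eq[symmetric] by (simp add: algebra_simps)
  then show ?thesis using det by (simp add: D_def)
 qed
 then have ll: "(l - k) * (l + k) = e2*e3 - f2*f3 - l*(l'-l) + k*(k'-k)" by (simp add: D_def algebra_simps)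
 have "\<bar>l*(l'-l)\<bar> <= 3 * \<delta>" "\<bar>k*(k'-k)\<bar> <= 3 * \<delta>" by (rule m3[OF b3(1) h(5)], rule m3[OF b3(3) h(10)])
 moreover have "\<bar>e2*e3\<bar> <= \<delta> * \<delta>" "\<bar>f2*f3\<bar> <= \<delta> * \<delta>" by (rule sm[OF h(3,4)], rule sm[OF h(8,9)])
 ultimately have "\<bar>(l - k) * (l + k)\<bar> <= 7 * \<delta>" unfolding ll using dd by linarith
 moreover have "\<bar>l - k\<bar> * 2 <= \<bar>(l - k) * (l + k)\<bar>" unfolding abs_mult using h by (intro mult_left_mono) auto
 ultimately have "\<bar>l - k\<bar> * 2 <= 7 * \<delta>" by (meson order_trans)
 then have lk: "\<bar>l - k\<bar> <= 4 * \<delta>" using d by simp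
 have lk': "\<bar>l' - k'\<bar> <= 6 * \<delta>" using lk h by linarith
 have z: "D * z1 = k'*l - f2*e3" "D * z2 = k'*e2 - f2*l'" "D * z3 = k*e3 - f3*l" "D * z4 = k*l' - f3*e2"
  unfolding eq[symmetric] D_def by (auto simp: algebra_simps)
 have fin: "\<bar>u\<bar> <= 32 * \<delta>" if "\<bar>D * u\<bar> <= 16 * \<delta>" for u
 proof -
  have "(1/2) * \<bar>u\<bar> <= \<bar>D\<bar> * \<bar>u\<bar>" using D2 by (intro mult_right_mono) auto
  also have "\<dots> <= 16 * \<delta>" using that by (simp add: abs_mult)
  finally show ?thesis by simp
 qed
 have "D * (z1 - 1) = k'*(l - k) - f2*e3 + f2*f3" using z(1) by (simp add: algebra_simps D_def)
 moreover have "\<bar>k'*(l-k)\<bar> <= 3 * (4 * \<delta>)" by (intro m3 b3 lk)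
 moreover have "\<bar>f2*e3\<bar> <= \<delta>*\<delta>" "\<bar>f2*f3\<bar> <= \<delta>*\<delta>" by (rule sm[OF h(8,4)], rule sm[OF h(8,9)])
 ultimately show "\<bar>z1 - 1\<bar> <= 32 * \<delta>" using dd d by (intro fin) linarith
 have a2: "\<bar>k'*e2\<bar> <= 3 * \<delta>" "\<bar>l'*f2\<bar> <= 3 * \<delta>" by (rule m3[OF b3(4) h(3)], rule m3[OF b3(2) h(8)])
 have "\<bar>D * z2\<bar> <= 16 * \<delta>" unfolding z(2) mult.commute[of f2] using a2 d by linarith
 then show "\<bar>z2\<bar> <= 32 * \<delta>" by (rule fin)
 have a3: "\<bar>k*e3\<bar> <= 3 * \<delta>" "\<bar>l*f3\<bar> <= 3 * \<delta>" by (rule m3[OF b3(3) h(4)], rule m3[OF b3(1) h(9)])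
 have "\<bar>D * z3\<bar> <= 16 * \<delta>" unfolding z(3) mult.commute[of f3] using a3 d by linarith
 then show "\<bar>z3\<bar> <= 32 * \<delta>" by (rule fin)
 have "D * (z4 - 1) = k*(l' - k') - f3*e2 + f2*f3" using z(4) by (simp add: algebra_simps D_def)
 moreover have "\<bar>k*(l'-k')\<bar> <= 2 * (6 * \<delta>)" unfolding abs_mult using h lk' by (intro mult_mono) auto
 moreover have "\<bar>f3*e2\<bar> <= \<delta>*\<delta>" "\<bar>f2*f3\<bar> <= \<delta>*\<delta>" by (rule sm[OF h(9,3)], rule sm[OF h(8,9)])
 ultimately show "\<bar>z4 - 1\<bar> <= 32 * \<delta>" using dd d by (intro fin) linarith
qed

locale generators =
 fixes p X :: int
 assumes p: "prime p" and X: "X >= 1" "X\<^sup>2 <= p" "p < (X+1)\<^sup>2"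
begin

abbreviation "S \<equiv> gens p X"
definition "sp = sqrt (real_of_int p)"
definition "mA s = rm sp s"
definition "mA' s = rm sp (mat_adj s)"

lemma p0: "p > 0" using p by (rule prime_gt_0_int)
lemma sp0: "sp > 0" using p0 by (simp add: sp_def)
lemma sp2: "sp * sp = p" using p0 by (simp add: sp_def)

lemma S_letters: "S \<subseteq> bounded_letters 1600 p" by (rule gens_subset_letters[OF X])
lemma detS: "s \<in> S ==> mat_det s = p" using S_letters mat_det_letter by blast

sublocale linear_averages S mA mA'
proof
 show "finite S" by (rule card_gens(1)[OF X])
 show "S \<noteq> {}" using card_gens(3)[OF X] p0 by auto
 show "unimodular (mA s)" if "s \<in> S" for s unfolding mA_def by (rule unimodular_rm) (use detS[OF that] sp0 sp2 in auto)
 show "unimodular (mA' s)" if "s \<in> S" for s unfolding mA'_def by (rule unimodular_rm) (use detS[OF that] sp0 sp2 in auto)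
 show "lin (mA s) (lin (mA' s) v) = v" "lin (mA' s) (lin (mA s) v) = v" if "s \<in> S" for s v
  unfolding mA_def mA'_def lin_rm mat_mul_adj detS[OF that] sp2 using p0 by (simp_all add: lin_rm_one)
qed

definition "Lt = S \<union> mat_adj ` S"

lemma Lt: "Lt \<subseteq> bounded_letters 1600 p" "finite Lt" "int (card Lt) <= 2 * p"
proof -
 show "Lt \<subseteq> bounded_letters 1600 p" unfolding Lt_def using S_letters adj_letter by auto
 show "finite Lt" unfolding Lt_def using fin(1) by simp
 have "card Lt <= card S + card (mat_adj ` S)" unfolding Lt_def by (rule card_Un_le)
 also have "\<dots> <= card S + card S" using card_image_le[OF fin(1), of mat_adj] by simp
 finally show "int (card Lt) <= 2 * p" using card_gens(2)[OF X] by linarith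
qed

lemma letters_Lt: "ws \<in> words S n ==> set (letters ws) \<subseteq> Lt"
proof
 fix x assume ws: "ws \<in> words S n" and "x \<in> set (letters ws)"
 then obtain q where q: "q \<in> set ws" "x = fst q \<or> x = mat_adj (snd q)" unfolding letters_def set_concat set_map by auto
 then have "fst q \<in> S" "snd q \<in> S" using ws by (auto simp: words_def)
 then show "x \<in> Lt" using q(2) unfolding Lt_def by blast
qed

definition "MW ws = rm (real_of_int p ^ length ws) (mat_prod (letters ws))"

lemma wmap_eq: "wmap ws v = lin (MW ws) v"
proof (induction ws)
 case Nil
 show ?case by (cases v) (simp add: MW_def mat_one_def)
next
 case (Cons q ws)
 then have "wmap (q # ws) v = lin (mA (fst q)) (lin (mA' (snd q)) (lin (MW ws) v))" by simp
 also have "\<dots> = lin (rm (sp * sp * real_of_int p ^ length ws) (mat_mul (fst q) (mat_mul (mat_adj (snd q)) (mat_prod (letters ws))))) v"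
  by (simp only: MW_def mA_def mA'_def lin_rm mult.assoc)
 also have "\<dots> = lin (MW (q # ws)) v" unfolding sp2 by (simp add: MW_def)
 finally show ?case .
qed

lemma det_MW: "ws \<in> words S n ==> mat_det (mat_prod (letters ws)) = p^(2*n)"
 using mat_det_prod[of "letters ws" 1600 p] letters_Lt[of ws n] Lt(1) by (auto simp: words_def)

lemma unimodular_MW: assumes "ws \<in> words S n" shows "unimodular (MW ws)"
 unfolding MW_def
proof (rule unimodular_rm)
 have "length ws = n" using assms by (simp add: words_def)
 then show "real_of_int (mat_det (mat_prod (letters ws))) = real_of_int p ^ length ws * real_of_int p ^ length ws"
  using det_MW[OF assms] by (simp flip: power_add add: mult_2)
qed (use p0 in simp)

text \<open>A letter has entries at most 40 sqrt p, and each multiplication of two-by-two matrices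
  costs a factor 2. The two letters of a pair therefore contribute 80^2 p, and p is divided out. The
  factor 4 bounds the sum of the absolute values in a row of \<open>E\<close>.\<close>

lemma MW_box:
 assumes ws: "ws \<in> words S n" and E: "E \<in> EE \<delta>" and d: "\<delta> <= 1"
 shows "mrow E (MW ws) \<in> box (4 * 6400^n)"
proof -
 obtain a b c d' where G: "mat_prod (letters ws) = (a,b,c,d')" by (cases "mat_prod (letters ws)")
 have len: "length ws = n" using ws by (simp add: words_def)
 have "entry_le (mat_prod (letters ws)) ((80 * sqrt p)^length (letters ws))"
  using letters_Lt[OF ws] Lt(1) p0 by (intro prod_entry) auto
 moreover have "(80 * sqrt p)^length (letters ws) = 6400^n * real_of_int p^n"
  using p0 by (simp add: len power_mult power_mult_distrib)
 ultimately have h: "\<bar>real_of_int a\<bar> <= 6400^n * real_of_int p^n" "\<bar>real_of_int b\<bar> <= 6400^n * real_of_int p^n"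
  "\<bar>real_of_int c\<bar> <= 6400^n * real_of_int p^n" "\<bar>real_of_int d'\<bar> <= 6400^n * real_of_int p^n" by (auto simp: G entry_le_def)
 have q: "\<bar>real_of_int z / real_of_int p^n\<bar> <= 6400^n" if "\<bar>real_of_int z\<bar> <= 6400^n * real_of_int p^n" for z
  using that p0 by (simp add: abs_divide divide_le_eq)
 obtain e1 e2 e3 e4 where E': "E = ((e1, e2), (e3, e4))" by (metis surj_pair)
 have e: "\<bar>e1\<bar> <= 2" "\<bar>e2\<bar> <= 1" "\<bar>e3\<bar> <= 1" "\<bar>e4\<bar> <= 3" using E d by (auto simp: E' EE_def)
 have k: "\<bar>u * x + v * y\<bar> <= 4 * 6400^n" if "\<bar>u\<bar> <= 6400^n" "\<bar>v\<bar> <= 6400^n" "\<bar>x\<bar> + \<bar>y\<bar> <= 4" for u v x y :: real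
 proof -
  have "\<bar>u * x + v * y\<bar> <= 6400^n * \<bar>x\<bar> + 6400^n * \<bar>y\<bar>"
   by (rule order_trans[OF abs_triangle_ineq]) (auto simp: abs_mult intro!: add_mono mult_right_mono that)
  also have "\<dots> = 6400^n * (\<bar>x\<bar>+\<bar>y\<bar>)" by (simp add: algebra_simps)
  also have "\<dots> <= 6400^n * 4" by (intro mult_left_mono that) simp
  finally show ?thesis by simp
 qed
 have e12: "\<bar>e1\<bar> + \<bar>e2\<bar> <= 4" "\<bar>e3\<bar> + \<bar>e4\<bar> <= 4" using e by linarith+
 show ?thesis unfolding box_def MW_def G E' mrow.simps rm.simps lin.simps len mem_Collect_eq fst_conv snd_conv
  by (intro conjI k q h e12)
qed

text \<open>If E w = E' w' as normalised matrices, then w' times the inverse of w is the Z of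
  \<open>EE_quotient\<close>, hence within 32 \<delta> of the identity. Multiplied by p^(2n) it is
  the product of the integral word consisting of the letters of w' followed by the reversed
  adjugates of the letters of w. This word has 4 n letters and determines the pair, so
  \<open>card_words_near_one\<close> counts the pairs.\<close>

lemma card_close:
 fixes \<delta> D :: real
 assumes d: "0 < \<delta>" "\<delta> <= 1/64" "(32*\<delta>)^3 * p^(2*n) >= 1"
  and D: "\<And>m. 0 < m ==> real m <= p^(4*n) ==> real (divs m) <= D"
 shows "real (card {q \<in> words S n \<times> words S n. \<exists>E\<in>EE \<delta>. \<exists>E'\<in>EE \<delta>. mrow E (MW (fst q)) = mrow E' (MW (snd q))})
  <= real_of_int word_const^(4*n) * real (2*n+1) * D * 42 * (32*\<delta>)^3 * real_of_int p^(4*n)"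
proof -
 let ?Q = "{q \<in> words S n \<times> words S n. \<exists>E\<in>EE \<delta>. \<exists>E'\<in>EE \<delta>. mrow E (MW (fst q)) = mrow E' (MW (snd q))}"
 let ?T = "{xs. length xs = 4*n \<and> set xs \<subseteq> Lt \<and> mat_prod xs \<in> near_scalar (p^(2*n)) ((32*\<delta>) * p^(2*n))}"
 let ?h = "%q. letters (snd q) @ map mat_adj (rev (letters (fst q)))"
 have inj: "inj_on ?h ?Q"
 proof (rule inj_onI)
  fix q q' assume q: "q \<in> ?Q" "q' \<in> ?Q" and e: "?h q = ?h q'"
  have len: "length (snd q) = length (snd q')" using q by (auto simp: words_def)
  then have "letters (snd q) = letters (snd q')" "map mat_adj (rev (letters (fst q))) = map mat_adj (rev (letters (fst q')))"
   using e by (auto simp: append_eq_append_conv)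
  moreover have "inj mat_adj" by (rule inj_on_inverseI[of _ mat_adj]) simp
  ultimately have "letters (snd q) = letters (snd q')" "letters (fst q) = letters (fst q')"
   by (auto simp: inj_map_eq_map)
  then show "q = q'" using letters_inj by (auto simp: prod_eq_iff)
 qed
 have sub: "?h ` ?Q \<subseteq> ?T"
 proof
  fix xs assume "xs \<in> ?h ` ?Q"
  then obtain q0 where q0: "q0 \<in> ?Q" "xs = ?h q0" by blast
  define w where "w = fst q0"
  define w' where "w' = snd q0"
  have q: "(w,w') \<in> ?Q" and xs: "xs = letters w' @ map mat_adj (rev (letters w))" using q0 by (simp_all add: w_def w'_def)
  have ww: "w \<in> words S n" "w' \<in> words S n" using q by auto
  have len: "length w = n" "length w' = n" using ww by (auto simp: words_def)
  obtain E E' where EE: "E \<in> EE \<delta>" "E' \<in> EE \<delta>" "mrow E (MW w) = mrow E' (MW w')" using q by auto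
  have adjLt: "mat_adj x \<in> Lt" if "x \<in> Lt" for x using that by (auto simp: Lt_def)
  have "set xs \<subseteq> Lt" using letters_Lt[OF ww(1)] letters_Lt[OF ww(2)] adjLt by (auto simp: xs)
  moreover have "length xs = 4*n" by (simp add: xs len)
  moreover have "mat_prod xs \<in> near_scalar (p^(2*n)) ((32*\<delta>) * p^(2*n))"
  proof -
   define G where "G = mat_prod (letters w)"
   define G' where "G' = mat_prod (letters w')"
   have px: "mat_prod xs = mat_mul G' (mat_adj G)" by (simp add: xs mat_prod_append mat_adj_prod G_def G'_def)
   obtain a b c d where Ge: "G = (a,b,c,d)" by (cases G)
   obtain a' b' c' d' where Ge': "G' = (a',b',c',d')" by (cases G')
   have detG: "a*d - b*c = p^(2*n)" "a'*d' - b'*c' = p^(2*n)"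
    using det_MW[OF ww(1)] det_MW[OF ww(2)] by (auto simp flip: G_def G'_def simp: Ge Ge')
   define P where "P = real_of_int p^n"
   have P0: "P > 0" using p0 by (simp add: P_def)
   define Q where "Q = real_of_int p^(2*n)"
   have QP: "Q = P * P" by (simp add: Q_def P_def mult_2 flip: power_add)
   have Q0: "Q > 0" using P0 QP by simp
   have detR: "real_of_int a * d - real_of_int b * c = Q" "real_of_int a' * d' - real_of_int b' * c' = Q"
    using detG unfolding Q_def by (metis of_int_diff of_int_mult of_int_power)+
   obtain l e2 e3 l' where E1: "E = ((l, e2), (e3, l'))" by (metis surj_pair)
   obtain k f2 f3 k' where E2: "E' = ((k, f2), (f3, k'))" by (metis surj_pair)
   have cl: "u1 * x1 + u2 * x2 = u3 * x3 + u4 * x4" if "u1/P * x1 + u2/P * x2 = u3/P * x3 + u4/P * x4" for u1 u2 u3 u4 x1 x2 x3 x4 :: real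
   proof -
    have "(u1 * x1 + u2 * x2)/P = (u3 * x3 + u4 * x4)/P" using that by (simp add: add_divide_distrib)
    then show ?thesis using P0 by simp
   qed
   have rows: "a * l + c * e2 = a' * k + c' * f2" "b * l + d * e2 = b' * k + d' * f2"
    "a * e3 + c * l' = a' * f3 + c' * k'" "b * e3 + d * l' = b' * f3 + d' * k'"
    by (rule cl; use EE(3) in \<open>simp add: MW_def len E1 E2 G_def[symmetric] G'_def[symmetric] Ge Ge' P_def[symmetric]\<close>)+
   define z1 where "z1 = (real_of_int a' * d - real_of_int b' * c) / Q"
   define z2 where "z2 = (real_of_int b' * a - real_of_int a' * b) / Q"
   define z3 where "z3 = (real_of_int c' * d - real_of_int d' * c) / Q"
   define z4 where "z4 = (real_of_int d' * a - real_of_int c' * b) / Q"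
   have zz: "k*z1 + f2*z3 = l" "k*z2 + f2*z4 = e2" "f3*z1 + k'*z3 = e3" "f3*z2 + k'*z4 = l'"
   proof -
    have "k*z1 + f2*z3 = (k * (real_of_int a' * d - real_of_int b' * c) + f2 * (real_of_int c' * d - real_of_int d' * c)) / Q" by (simp add: z1_def z3_def add_divide_distrib)
    also have "k * (real_of_int a' * d - real_of_int b' * c) + f2 * (real_of_int c' * d - real_of_int d' * c) = d * (a' * k + c' * f2) - c * (b' * k + d' * f2)" by (simp add: algebra_simps)
    also have "\<dots> = (real_of_int a * d - real_of_int b * c) * l" unfolding rows[symmetric] by (simp add: algebra_simps)
    finally show "k*z1 + f2*z3 = l" using Q0 unfolding detR by simp
    have "k*z2 + f2*z4 = (k * (real_of_int b' * a - real_of_int a' * b) + f2 * (real_of_int d' * a - real_of_int c' * b)) / Q" by (simp add: z2_def z4_def add_divide_distrib)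
    also have "k * (real_of_int b' * a - real_of_int a' * b) + f2 * (real_of_int d' * a - real_of_int c' * b) = a * (b' * k + d' * f2) - b * (a' * k + c' * f2)" by (simp add: algebra_simps)
    also have "\<dots> = (real_of_int a * d - real_of_int b * c) * e2" unfolding rows[symmetric] by (simp add: algebra_simps)
    finally show "k*z2 + f2*z4 = e2" using Q0 unfolding detR by simp
    have "f3*z1 + k'*z3 = (f3 * (real_of_int a' * d - real_of_int b' * c) + k' * (real_of_int c' * d - real_of_int d' * c)) / Q" by (simp add: z1_def z3_def add_divide_distrib)
    also have "f3 * (real_of_int a' * d - real_of_int b' * c) + k' * (real_of_int c' * d - real_of_int d' * c) = d * (a' * f3 + c' * k') - c * (b' * f3 + d' * k')" by (simp add: algebra_simps)
    also have "\<dots> = (real_of_int a * d - real_of_int b * c) * e3" unfolding rows[symmetric] by (simp add: algebra_simps)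
    finally show "f3*z1 + k'*z3 = e3" using Q0 unfolding detR by simp
    have "f3*z2 + k'*z4 = (f3 * (real_of_int b' * a - real_of_int a' * b) + k' * (real_of_int d' * a - real_of_int c' * b)) / Q" by (simp add: z2_def z4_def add_divide_distrib)
    also have "f3 * (real_of_int b' * a - real_of_int a' * b) + k' * (real_of_int d' * a - real_of_int c' * b) = a * (b' * f3 + d' * k') - b * (a' * f3 + c' * k')" by (simp add: algebra_simps)
    also have "\<dots> = (real_of_int a * d - real_of_int b * c) * l'" unfolding rows[symmetric] by (simp add: algebra_simps)
    finally show "f3*z2 + k'*z4 = l'" using Q0 unfolding detR by simp
   qed
   have detz: "z1*z4 - z2*z3 = 1"
   proof -
    have "z1*z4 - z2*z3 = ((real_of_int a' * d' - real_of_int b' * c') * (real_of_int a * d - real_of_int b * c)) / (Q*Q)"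
     by (simp add: z1_def z2_def z3_def z4_def diff_divide_distrib[symmetric] algebra_simps)
    then show ?thesis using Q0 unfolding detR by simp
   qed
   note bz = EE_quotient[OF EE(1)[unfolded E1] EE(2)[unfolded E2] d(1) _ zz detz]
   have bb: "\<bar>z1 - 1\<bar> <= 32 * \<delta>" "\<bar>z4 - 1\<bar> <= 32 * \<delta>" "\<bar>z2\<bar> <= 32 * \<delta>" "\<bar>z3\<bar> <= 32 * \<delta>" using bz d(2) by auto
   have sc: "\<bar>Q * u\<bar> <= 32 * \<delta> * Q" if "\<bar>u\<bar> <= 32 * \<delta>" for u
    using mult_left_mono[OF that, of Q] Q0 by (simp add: abs_mult mult.commute)
   have ent: "mat_mul G' (mat_adj G) = (a'*d - b'*c, b'*a - a'*b, c'*d - d'*c, d'*a - c'*b)"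
    by (simp add: Ge Ge' algebra_simps)
   have "mat_det (mat_mul G' (mat_adj G)) = (p^(2*n))\<^sup>2"
   proof -
    have "mat_det (mat_mul G' (mat_adj G)) = mat_det G' * mat_det G" by (simp only: mat_det_mul mat_det_adj)
    then show ?thesis using detG by (simp add: Ge Ge' power2_eq_square)
   qed
   moreover have "\<bar>real_of_int (a'*d - b'*c - p^(2*n))\<bar> <= 32 * \<delta> * Q"
   proof -
    have "Q * z1 = real_of_int a' * d - real_of_int b' * c" using Q0 by (simp add: z1_def)
    then have "Q * (z1 - 1) = (real_of_int a' * d - real_of_int b' * c) - Q" by (simp only: right_diff_distrib mult_1_right)
    then show ?thesis using sc[OF bb(1)] by (simp add: Q_def)
   qed
   moreover have "\<bar>real_of_int (d'*a - c'*b - p^(2*n))\<bar> <= 32 * \<delta> * Q"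
   proof -
    have "Q * z4 = real_of_int d' * a - real_of_int c' * b" using Q0 by (simp add: z4_def)
    then have "Q * (z4 - 1) = (real_of_int d' * a - real_of_int c' * b) - Q" by (simp only: right_diff_distrib mult_1_right)
    then show ?thesis using sc[OF bb(2)] by (simp add: Q_def)
   qed
   moreover have "\<bar>real_of_int (b'*a - a'*b)\<bar> <= 32 * \<delta> * Q"
   proof -
    have "Q * z2 = real_of_int b' * a - real_of_int a' * b" using Q0 by (simp add: z2_def)
    then show ?thesis using sc[OF bb(3)] by simp
   qed
   moreover have "\<bar>real_of_int (c'*d - d'*c)\<bar> <= 32 * \<delta> * Q"
   proof -
    have "Q * z3 = real_of_int c' * d - real_of_int d' * c" using Q0 by (simp add: z3_def)
    then show ?thesis using sc[OF bb(4)] by simp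
   qed
   ultimately show ?thesis unfolding px ent near_scalar_def Q_def by simp
  qed
  ultimately show "xs \<in> ?T" by blast
 qed
 have finT: "finite ?T" by (rule finite_lists_subset[OF Lt(2)])
 have "card ?Q <= card ?T" by (rule card_inj_on_le[OF inj sub finT])
 then have "real (card ?Q) <= real (card ?T)" by simp
 also have "\<dots> <= real_of_int word_const^(4*n) * real (2*n+1) * D * 42 * (32*\<delta>)^3 * real_of_int p^(4*n)"
  by (rule card_words_near_one[OF p Lt]) (use d D in auto)
 finally show ?thesis .
qed

end

definition mob :: "imat \<Rightarrow> real \<Rightarrow> real" where
 "mob s t = (case s of (a, b, c, d) \<Rightarrow> (real_of_int a * t + real_of_int b) / (real_of_int c * t + real_of_int d))"

context generators
begin

text \<open>The unit in which gains and losses are measured. For words of n = 8 * 2^i pairs, p^(2^i)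
  is \<pi>p^(12 n); the flattening gain 2^(-Mo) is then at most \<pi>p^(-4 n), while the divisor
  bound costs \<pi>p^(2 n).\<close>

definition "\<pi>p = real_of_int p powr (1/96)"

lemma pip: "\<pi>p^96 = real_of_int p" "\<pi>p >= 1"
proof -
 have p1: "real_of_int p >= 1" using p0 by simp
 show "\<pi>p >= 1" unfolding \<pi>p_def using p1 by (intro ge_one_powr_ge_zero) auto
 have "\<pi>p^96 = \<pi>p powr (real 96)" using \<open>\<pi>p >= 1\<close> by (intro powr_realpow[symmetric]) auto
 also have "\<dots> = real_of_int p powr 1" unfolding \<pi>p_def powr_powr by simp
 finally show "\<pi>p^96 = real_of_int p" using p1 by simp
qed

text \<open>The factors before the parenthesis occur once: CD from the divisor bound, 42 from
  \<open>card_words_near_one\<close>, 4096 = 32^3 / 8 from comparing (32 \<delta>)^3 with the volume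
  of \<open>EE\<close>, 2^74 from \<open>integral_boxcorr\<close>, and 64 = 4^3 from the cube of R.
  The parenthesis occurs to the power n: four letters per unit of n, 4^n >= 2 n + 1, p <= 32 k four
  times, and 6400^3 from the cube of R. Nothing in it depends on p.\<close>

definition band_const :: "nat \<Rightarrow> real" where
 "band_const CD = real CD * 42 * 4096 * 2^74 * 64 * (real_of_int word_const^4 * 4 * 32^4 * 6400^3)"

lemma word_const_ge: "real_of_int word_const >= 1"
 by (simp add: word_const_def)

text \<open>Since p^(4n) = \<pi>p^(384 n), a 192-th root leaves \<pi>p^(2n); this is the reason for
  the exponent 192.\<close>

lemma divs_le:
 assumes CD: "CD > 0" "\<And>m. m > 0 ==> divs m ^ 192 <= CD * m" and m: "0 < m" "real m <= real_of_int (p^(4*n))"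
 shows "real (divs m) <= real CD * \<pi>p^(2*n)"
proof -
 have CD1: "real CD >= 1" using CD(1) by simp
 have "(real (divs m))^192 = real (divs m ^ 192)" by simp
 also have "\<dots> <= real (CD * m)" using CD(2)[OF m(1)] by (simp only: of_nat_le_iff)
 also have "\<dots> <= real CD * real_of_int (p^(4*n))" using m(2) by (simp add: mult_left_mono)
 also have "real_of_int (p^(4*n)) = \<pi>p^(96*(4*n))" by (simp only: power_mult[of \<pi>p 96] pip of_int_power)
 also have "real CD * \<pi>p^(96*(4*n)) <= real CD^192 * \<pi>p^(96*(4*n))"
  using CD1 pip(2) power_increasing[of 1 192 "real CD"] by (intro mult_right_mono) auto
 also have "\<dots> = (real CD * \<pi>p^(2*n))^192"
 proof -
  have "\<pi>p^(96*(4*n)) = (\<pi>p^(2*n))^192" by (simp flip: power_mult)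
  then show ?thesis by (simp add: power_mult_distrib)
 qed
 finally have "(real (divs m))^192 <= (real CD * \<pi>p^(2*n))^192" .
 then show ?thesis using power_mono_iff[of "real (divs m)" "real CD * \<pi>p^(2*n)" 192] pip(2) by simp
qed

text \<open>With Mo = l 2^i, the function is a step function of level 6 Mo, so thickening by
  \<delta> = 2^(-12 Mo) disturbs it by about 2^(-3 Mo) in norm. Words must be long enough for
  \<delta>^3 p^(2n) >= 1, and n = 8 * 2^i achieves this. The flattening gain under the root,
  \<pi>p^(-4n), beats the divisor loss \<pi>p^(2n), so the mean correlation over words is at most a
  constant to the n over \<pi>p^n. The n-th root in \<open>power_trick_words\<close> makes the bound
  independent of i. In the result, 162 = 2 * 81, with 2 for the two error terms and 81 from
  \<open>norm_lift_psit\<close>.\<close>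

lemma band_estimate_plane:
 assumes l: "real_of_int p <= 2^(3*l)" "2^(3*l) <= 8 * real_of_int p" "l >= 4"
  and CD: "CD > 0" "\<And>m. m > 0 ==> divs m ^ 192 <= CD * m"
  and phi: "tame \<phi>" "mean_zero (3*(l*2^i)) \<phi>" "\<And>x. \<phi> x \<noteq> 0 ==> 0 <= x \<and> x <= 1024" "step (6*(l*2^i)) \<phi>"
 shows "(LBINT v. (avg (lift \<phi> psit) v)\<^sup>2) <= 162 * band_const CD / \<pi>p * (LBINT x. (\<phi> x)\<^sup>2)"
proof -
 define n where "n = (2::nat)^(i+3)"
 define Mo where "Mo = l * 2^i"
 define N' where "N' = 6 * Mo"
 define \<delta> where "\<delta> = 1 / (2::real)^(12*Mo)"
 define n2 where "n2 = (LBINT x. (\<phi> x)\<^sup>2)"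
 have n20: "n2 >= 0" by (simp add: n2_def)
 have n8: "n = 8 * 2^i" by (simp add: n_def power_add)
 have n1: "n >= 1" by (simp add: n_def)
 have Mo4: "Mo >= 4"
 proof -
  have "4 * 1 <= l * 2^i" using l(3) by (intro mult_mono) auto
  then show ?thesis by (simp add: Mo_def)
 qed
 have d0: "\<delta> > 0" by (simp add: \<delta>_def)
 have d24: "\<delta> * 2^(24+N') <= 1"
 proof -
  have "(2::real)^(24+N') <= 2^(12*Mo)" using Mo4 by (intro power_increasing) (auto simp: N'_def)
  then show ?thesis by (simp add: \<delta>_def)
 qed
 have d64: "\<delta> <= 1/64"
 proof -
  have "(2::real)^6 <= 2^(12*Mo)" using Mo4 by (intro power_increasing) auto
  then show ?thesis unfolding \<delta>_def by (intro divide_left_mono) auto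
 qed
 have dP: "(32*\<delta>)^3 * real_of_int (p^(2*n)) >= 1"
 proof -
  have pl: "2^(3*l-3) <= real_of_int p"
  proof -
   have "3*l = (3*l-3) + 3" using l(3) by simp
   then have "(2::real)^(3*l) = 2^(3*l-3) * 2^3" by (metis power_add)
   then show ?thesis using l(2) by simp
  qed
  have "(2::real)^(36*Mo) <= 2^((3*l-3)*(2*n))"
  proof (intro power_increasing)
   \<comment> \<open>This is where the factor 8 in n and the bound l >= 4 come from: 48 l - 48 has
     to be at least 36 l.\<close>
   have "36 * l <= 16 * (3*l-3)" using l(3) by linarith
   then have "(36 * l) * 2^i <= (16 * (3*l-3)) * 2^i" by (intro mult_right_mono) auto
   then show "36*Mo <= (3*l-3)*(2*n)" by (simp add: Mo_def n8 mult_ac)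
  qed simp
  also have "\<dots> = (2^(3*l-3))^(2*n)" by (simp add: power_mult)
  also have "\<dots> <= real_of_int p^(2*n)" using pl by (intro power_mono) auto
  finally have a: "(2::real)^(36*Mo) <= real_of_int p^(2*n)" .
  have "\<delta>^3 * 2^(36*Mo) = 1" by (simp add: \<delta>_def power_divide flip: power_mult)
  then have "1 <= \<delta>^3 * real_of_int p^(2*n)" using mult_left_mono[OF a, of "\<delta>^3"] d0 by simp
  also have "\<dots> <= (32*\<delta>)^3 * real_of_int p^(2*n)" using d0 p0 by (intro mult_right_mono power_mono) auto
  finally show ?thesis by simp
 qed
 define W where "W = words S n"
 define close where "close = {q \<in> W \<times> W. \<exists>E\<in>EE \<delta>. \<exists>E'\<in>EE \<delta>. mrow E (MW (fst q)) = mrow E' (MW (snd q))}"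
 define D where "D = real CD * \<pi>p^(2*n)"
 have cl: "real (card close) <= real_of_int word_const^(4*n) * real (2*n+1) * D * 42 * (32*\<delta>)^3 * real_of_int p^(4*n)"
  unfolding close_def W_def by (rule card_close[OF d0 d64 dP]) (unfold D_def, rule divs_le[OF CD])
 define R where "R = 4 * (6400::real)^n"
 have R1: "R >= 1" 
 proof -
  have "(1::real) <= 6400^n" by (rule one_le_power) simp
  then show ?thesis unfolding R_def by linarith
 qed
 have sumW: "(\<Sum>w\<in>W. LBINT v. lift \<phi> psit (lin (MW w) v) * lift \<phi> psit v)
  <= (real (card W) * sqrt (2^47 * \<delta> * 2^N') + sqrt (real (card close) / (8 * \<delta>^3)) * sqrt (2^74 * R^3 / 2^Mo)) * n2"
  unfolding close_def n2_def
 proof (rule word_average_bound[OF phi(1) _ phi(3) _ d0 d24])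
  show "mean_zero (3*Mo) \<phi>" using phi(2) by (simp add: Mo_def)
  show "step N' \<phi>" using phi(4) by (simp add: N'_def Mo_def)
  show "finite W" unfolding W_def by (rule finite_words[OF fin(1)])
  show "unimodular (MW w)" if "w \<in> W" for w using unimodular_MW that by (simp add: W_def)
  show "mrow E (MW w) \<in> box R" if "w \<in> W" "E \<in> EE \<delta>" for w E
   unfolding R_def using MW_box[of w n E \<delta>] that d64 by (simp add: W_def)
 qed (use R1 in auto)
 have cW: "real (card W) = k^(2*n)" unfolding W_def card_words[OF fin(1)] by (simp add: k_def)
 have kp: "32 * k >= real_of_int p" using card_gens(3)[OF X] unfolding k_def by linarith
 define K2 where "K2 = band_const CD"
 have CD1: "real CD >= 1" using CD(1) by simp
 define y where "y = real_of_int word_const^4 * 4 * 32^4 * 6400^3"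
 define K1 where "K1 = real CD * 42 * 4096 * 2^74 * 64"
 have K2: "K2 = K1 * y" by (simp add: K2_def band_const_def K1_def y_def)
 have y1: "y >= 1" using one_le_power[OF word_const_ge, of 4] by (simp add: y_def)
 have K11: "K1 >= 2^24" using CD1 by (simp add: K1_def)
 have "2^24 * 1 <= K1 * y" using K11 by (intro mult_mono y1) auto
 then have K21: "K2 >= 2^24" by (simp add: K2)
 have pi0: "\<pi>p > 0" using pip(2) by simp
 \<comment> \<open>Both sides are 2^i-th powers, as 12 n = 96 * 2^i; the bases are 2^(3l) and
   p.\<close>
 have two3: "(2::real)^(3*Mo) >= \<pi>p^(12*n)"
 proof -
  have "\<pi>p^(12*n) = (\<pi>p^96)^(2^i)" by (simp add: n8 flip: power_mult)
  also have "\<dots> <= (2^(3*l))^(2^i)" unfolding pip(1) using l(1) p0 by (intro power_mono) auto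
  also have "\<dots> = 2^(3*Mo)" by (simp add: Mo_def mult.assoc flip: power_mult)
  finally show ?thesis .
 qed
 have two1: "(2::real)^Mo >= \<pi>p^(4*n)"
 proof (rule power_le_imp_le_base[of _ 2])
  have "(\<pi>p^(4*n))^Suc 2 = \<pi>p^(12*n)" "((2::real)^Mo)^Suc 2 = 2^(3*Mo)" by (simp_all add: mult.commute flip: power_mult)
  then show "(\<pi>p^(4*n))^Suc 2 <= ((2::real)^Mo)^Suc 2" using two3 by simp
 qed simp
 have first: "sqrt (2^47 * \<delta> * 2^N') <= 2^24 / \<pi>p^n"
 proof (rule real_le_lsqrt)
  have "2^47 * \<delta> * 2^N' = 2^47 / 2^(6*Mo)"
  proof -
   have "(2::real)^(12*Mo) = 2^(6*Mo) * 2^(6*Mo)" by (simp flip: power_add)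
   then show ?thesis by (simp add: \<delta>_def N'_def)
  qed
  also have "\<dots> = 2^47 / (2^(3*Mo))\<^sup>2" by (simp add: mult.commute flip: power_mult)
  also have "\<dots> <= 2^48 / (\<pi>p^n)\<^sup>2"
  proof (intro frac_le power_mono)
   have "\<pi>p^n <= \<pi>p^(12*n)" using pip(2) by (intro power_increasing) auto
   then show "\<pi>p^n <= 2^(3*Mo)" using two3 by linarith
  qed (use pi0 in auto)
  also have "\<dots> = (2^24 / \<pi>p^n)\<^sup>2" by (simp add: power_divide)
  finally show "2^47 * \<delta> * 2^N' <= (2^24 / \<pi>p^n)\<^sup>2" .
 qed (use pi0 in simp)
 have second: "sqrt (real (card close) / (8 * \<delta>^3)) * sqrt (2^74 * R^3 / 2^Mo) <= k^(2*n) * (K2^n / \<pi>p^n)"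
 proof -
  have "sqrt (real (card close) / (8 * \<delta>^3)) * sqrt (2^74 * R^3 / 2^Mo) = sqrt ((real (card close) / (8 * \<delta>^3)) * (2^74 * R^3 / 2^Mo))"
   by (simp only: real_sqrt_mult)
  also have "\<dots> <= k^(2*n) * (K2^n / \<pi>p^n)"
  proof (rule real_le_lsqrt)
   have c1: "real (card close) / (8 * \<delta>^3) <= (real_of_int word_const^4)^n * 4^n * D * 42 * 4096 * (32^4)^n * k^(4*n)"
   proof -
    have n4: "real (2*n+1) <= 4^n"
    proof -
     have "2*m+1 <= 4^m" for m :: nat by (induction m) auto
     then have "real (2*n+1) <= real (4^n)" by (simp only: of_nat_le_iff)
     then show ?thesis by simp
    qed
    have pk: "real_of_int p^(4*n) <= (32^4)^n * k^(4*n)"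
    proof -
     have "real_of_int p^(4*n) <= (32*k)^(4*n)" using kp p0 by (intro power_mono) auto
     then show ?thesis by (simp add: power_mult_distrib power_mult)
    qed
    have D0: "D >= 0" using pi0 by (simp add: D_def)
    have "real (card close) / (8 * \<delta>^3) <= (real_of_int word_const^(4*n) * real (2*n+1) * D * 42 * (32*\<delta>)^3 * real_of_int p^(4*n)) / (8 * \<delta>^3)"
     using cl d0 by (intro divide_right_mono) auto
    also have "\<dots> = real_of_int word_const^(4*n) * real (2*n+1) * D * 42 * 4096 * real_of_int p^(4*n)"
     using d0 by (simp add: power_mult_distrib)
    also have "\<dots> <= real_of_int word_const^(4*n) * 4^n * D * 42 * 4096 * ((32^4)^n * k^(4*n))"
     using n4 pk D0 word_const_ge p0 by (intro mult_mono mult_nonneg_nonneg) auto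
    finally show ?thesis by (simp add: power_mult mult.assoc)
   qed
   have c2: "2^74 * R^3 / 2^Mo <= 2^74 * (64 * (6400^3)^n) / \<pi>p^(4*n)"
   proof (intro frac_le mult_left_mono two1)
    have "((6400::real)^n)^3 = (6400^3)^n" by (simp only: mult.commute flip: power_mult)
    then show "R^3 <= 64 * (6400^3)^n" by (simp add: R_def power_mult_distrib)
   qed (use pi0 R1 in auto)
   have "(real (card close) / (8 * \<delta>^3)) * (2^74 * R^3 / 2^Mo) <=
    ((real_of_int word_const^4)^n * 4^n * D * 42 * 4096 * (32^4)^n * k^(4*n)) * (2^74 * (64 * (6400^3)^n) / \<pi>p^(4*n))"
    using c1 c2 R1 d0 by (intro mult_mono) (auto intro!: mult_nonneg_nonneg simp: D_def pi0 less_imp_le k0)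
   also have "\<dots> = k^(4*n) * (K1 * y^n * (\<pi>p^(2*n) / \<pi>p^(4*n)))"
   proof -
    have "y^n = (real_of_int word_const^4)^n * 4^n * (32^4)^n * (6400^3)^n" by (simp only: y_def power_mult_distrib)
    then show ?thesis by (simp add: D_def K1_def)
   qed
   also have "\<pi>p^(2*n) / \<pi>p^(4*n) = 1 / (\<pi>p^n)\<^sup>2"
   proof -
    have "\<pi>p^(4*n) = \<pi>p^(2*n) * (\<pi>p^n)\<^sup>2" by (simp add: mult.commute flip: power_mult power_add)
    then show ?thesis using pi0 by simp
   qed
   also have "k^(4*n) * (K1 * y^n * (1 / (\<pi>p^n)\<^sup>2)) <= k^(4*n) * ((K2^n)\<^sup>2 * (1 / (\<pi>p^n)\<^sup>2))"
   proof (intro mult_left_mono mult_right_mono)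
    have K11': "K1 >= 1" using K11 by simp
    have "K1 * y^n <= K1^n * y^n" using K11' y1 n1 power_increasing[of 1 n K1] by (intro mult_right_mono) auto
    also have "\<dots> = K2^n" by (simp add: K2 power_mult_distrib)
    also have "\<dots> <= (K2^n)\<^sup>2" using K21 by (intro self_le_power one_le_power) auto
    finally show "K1 * y^n <= (K2^n)\<^sup>2" .
   qed (use k0 in auto)
   also have "\<dots> = (k^(2*n) * (K2^n / \<pi>p^n))\<^sup>2"
    by (simp add: power_mult_distrib power_divide mult.commute flip: power_mult)
   finally show "(real (card close) / (8 * \<delta>^3)) * (2^74 * R^3 / 2^Mo) <= (k^(2*n) * (K2^n / \<pi>p^n))\<^sup>2" .
  qed (use k0 pi0 K21 in auto)
  finally show ?thesis .
 qed
 have ksum: "(\<Sum>w\<in>W. LBINT v. lift \<phi> psit (wmap w v) * lift \<phi> psit v) / k^(2*n) <= (2 * K2 / \<pi>p)^n * n2"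
 proof -
  have "(\<Sum>w\<in>W. LBINT v. lift \<phi> psit (wmap w v) * lift \<phi> psit v) <= (k^(2*n) * (2^24 / \<pi>p^n) + k^(2*n) * (K2^n / \<pi>p^n)) * n2"
   unfolding wmap_eq using sumW first second n20 k0 unfolding cW
   by (elim order_trans, intro mult_right_mono add_mono mult_left_mono) auto
  also have "\<dots> = k^(2*n) * (((2^24 + K2^n) / \<pi>p^n) * n2)" by (simp add: algebra_simps add_divide_distrib)
  also have "\<dots> <= k^(2*n) * (((2*K2)^n / \<pi>p^n) * n2)"
  proof (intro mult_left_mono mult_right_mono divide_right_mono)
   have "K2 <= K2^n" using K21 n1 by (intro self_le_power) auto
   then have "2^24 + K2^n <= 2 * K2^n" using K21 by linarith
   also have "\<dots> <= 2^n * K2^n" using K21 n1 power_increasing[of 1 n "2::real"] by (intro mult_right_mono) auto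
   finally show "2^24 + K2^n <= (2*K2)^n" by (simp add: power_mult_distrib)
  qed (use k0 pi0 n20 in auto)
  finally show ?thesis using k0 by (simp add: power_divide divide_le_eq mult.commute)
 qed
 define \<beta> where "\<beta> = (LBINT v. (avg (lift \<phi> psit) v)\<^sup>2)"
 have "\<beta>^n <= (LBINT v. (lift \<phi> psit v)\<^sup>2)^(n-1) * ((\<Sum>w\<in>W. LBINT v. lift \<phi> psit (wmap w v) * lift \<phi> psit v) / k^(2*n))"
  using power_trick_words[OF tame_lift_psit[OF phi(1)], of "i+3"] unfolding \<beta>_def W_def n_def[symmetric] .
 also have "\<dots> <= (LBINT v. (lift \<phi> psit v)\<^sup>2)^(n-1) * ((2 * K2 / \<pi>p)^n * n2)"
  using ksum by (intro mult_left_mono) auto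
 also have "\<dots> <= (81 * n2)^(n-1) * ((2 * K2 / \<pi>p)^n * n2)"
 proof (intro mult_right_mono power_mono)
  show "(LBINT v. (lift \<phi> psit v)\<^sup>2) <= 81 * n2" unfolding n2_def by (rule norm_lift_psit[OF phi(1)])
 qed (use n20 K21 pi0 in auto)
 also have "\<dots> <= (81 * n2)^(n-1) * ((2 * K2 / \<pi>p)^n * (81 * n2))"
  using n20 K21 pi0 by (intro mult_left_mono) auto
 also have "\<dots> = (81 * n2 * (2 * K2 / \<pi>p))^n"
 proof -
  obtain m where m: "n = Suc m" using n1 by (cases n) auto
  have "u^(n-1) * (w^n * u) = (u * w)^n" for u w :: real by (simp add: m power_mult_distrib mult_ac)
  then show ?thesis .
 qed
 finally have "\<beta>^n <= (162 * K2 / \<pi>p * n2)^n" by (simp add: mult_ac)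
 then have "\<beta> <= 162 * K2 / \<pi>p * n2"
  using power_le_imp_le_base[of \<beta> "n-1" "162 * K2 / \<pi>p * n2"] n1 n20 K21 pi0 by simp
 then show ?thesis by (simp add: \<beta>_def n2_def K2_def)
qed

section \<open>The generators on the unit interval\<close>

lemma X_sp: "2 * X >= sp" "X <= sp"
proof -
 have "(X+1)\<^sup>2 <= (2*X)\<^sup>2" using X by (intro power_mono) auto
 then have "p <= (2*X)\<^sup>2" using X by linarith
 then have "real_of_int p <= real_of_int ((2*X)\<^sup>2)" by (simp only: of_int_le_iff)
 also have "real_of_int ((2*X)\<^sup>2) = (2 * real_of_int X)\<^sup>2" by simp
 finally have "sp <= sqrt ((2 * real_of_int X)\<^sup>2)" unfolding sp_def by (rule real_sqrt_le_mono)
 then have "sp <= \<bar>2 * real_of_int X\<bar>" by (simp only: real_sqrt_abs)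
 then show "2 * X >= sp" using X by simp
 have "real_of_int (X\<^sup>2) <= real_of_int p" using X(2) by (simp only: of_int_le_iff)
 then have "sqrt ((real_of_int X)\<^sup>2) <= sp" unfolding sp_def by (intro real_sqrt_le_mono) simp
 then show "X <= sp" using X by simp
qed

lemma gens_denominator:
 assumes s: "(a,b,c,d) \<in> S" and t: "0 <= t" "t <= 1"
 shows "sp / 16 <= c * t + d" "c * t + d <= 2 * sp"
proof -
 have h: "1 <= c" "c <= X" "1 <= d" "d <= X" "X <= 8*d" using s by (auto simp: gens_def)
 have ct: "0 <= c * t" "c * t <= c * 1" using h t by (auto intro!: mult_left_mono)
 have "real_of_int X <= real_of_int (8*d)" using h by (simp only: of_int_le_iff)
 then show "sp / 16 <= c * t + d" using X_sp(1) ct by simp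
 have "real_of_int c <= X" "real_of_int d <= X" using h by auto
 then show "c * t + d <= 2 * sp" using X_sp(2) ct by simp
qed

text \<open>Multiplying the value by d (c t + d) gives p t + b (c t + d). Here p is at most 256
  times d (c t + d), and b < d. The bound is rounded up to 512, a power of two, so that division by
  it takes dyadic cells to dyadic cells.\<close>

lemma mob_bounds:
 assumes s: "s \<in> S" and t: "0 <= t" "t <= 1"
 shows "0 <= mob s t" "mob s t < 512"
proof -
 obtain a b c d where se: "s = (a,b,c,d)" by (cases s)
 have h: "1 <= c" "1 <= d" "0 <= b" "b < d" "a*d - b*c = p" using s by (auto simp: se gens_def)
 have den: "sp / 16 <= c * t + d" "c * t + d <= 2 * sp" using gens_denominator s t by (auto simp: se)
 have a0: "a > 0" using gens_pos s p0 X(1) se by blast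
 have den0: "c * t + d > 0" using den(1) sp0 by simp
 show "0 <= mob s t" using a0 h t den0 by (simp add: mob_def se)
 have d16: "real_of_int d >= sp / 16" using gens_denominator(1)[of a b c d 0] s by (simp add: se)
 have "mob s t * (c*t+d) = a*t + b" using den0 by (simp add: mob_def se)
 then have "mob s t * (c*t+d) * d = (a*t + b) * d" by simp
 also have "(a*t + b) * d = a*d*t + b*d" by (simp add: algebra_simps)
 also have "\<dots> = p * t + b * (c*t+d)"
 proof -
  have "real_of_int a * d = p + real_of_int b * c" using h(5) by (metis add_diff_cancel_right' diff_add_cancel of_int_add of_int_mult)
  then show ?thesis by (simp add: algebra_simps)
 qed
 also have "\<dots> < 511 * ((c*t+d) * d) + d * (c*t+d)"
 proof (intro add_less_le_mono mult_right_mono)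
  have "real_of_int p * t <= real_of_int p * 1" using t p0 by (intro mult_left_mono) auto
  also have "\<dots> = 256 * ((sp/16) * (sp/16))" using sp2 by simp
  also have "\<dots> < 511 * ((sp/16) * (sp/16))" using sp0 by simp
  also have "\<dots> <= 511 * ((c*t+d) * d)" using den d16 sp0 by (intro mult_left_mono mult_mono) auto
  finally show "p * t < 511 * ((c*t+d) * d)" .
 qed (use h den0 in auto)
 also have "\<dots> = 512 * ((c*t+d) * d)" by simp
 finally have "mob s t * ((c*t+d) * d) < 512 * ((c*t+d) * d)" by (simp add: mult.assoc)
 then show "mob s t < 512" using den0 h by (simp add: mult_less_cancel_right)
qed

text \<open>On the sector where the slope t is in [0, 1] and y in [1, 2], all images lie where
  \<open>psit\<close> is 1, so the average of the lift equals the average of \<phi> over the Moebius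
  maps at t, independently of y. Restricting the plane integral to the sector and using that the
  weight y has integral at least 1 gives the bound.\<close>

lemma band_estimate_line:
 assumes phi: "tame \<phi>"
 shows "tame (%t. ind {0..1} t * ((\<Sum>s\<in>S. \<phi> (mob s t)) / k)\<^sup>2)"
  "(LBINT t. ind {0..1} t * ((\<Sum>s\<in>S. \<phi> (mob s t)) / k)\<^sup>2) <= (LBINT v. (avg (lift \<phi> psit) v)\<^sup>2)"
proof -
 define F where "F v = (avg (lift \<phi> psit) v)\<^sup>2" for v
 have tF: "tame F" unfolding F_def by (intro tame_power2 tame_avg tame_lift_psit phi)
 have [measurable]: "\<phi> \<in> borel_measurable borel" using phi by (rule tame_measurable)
 define h where "h t = ((\<Sum>s\<in>S. \<phi> (mob s t)) / k)\<^sup>2" for t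
 obtain M where M: "M >= 0" "\<And>v. \<bar>\<phi> v\<bar> <= M" using phi by (rule tameE) blast
 have hb: "\<bar>h t\<bar> <= M\<^sup>2" for t
 proof -
  have "\<bar>\<Sum>s\<in>S. \<phi> (mob s t)\<bar> <= (\<Sum>s\<in>S. M)" by (rule order_trans[OF sum_abs sum_mono]) (rule M)
  also have "\<dots> = k * M" by (simp add: k_def)
  finally have "\<bar>(\<Sum>s\<in>S. \<phi> (mob s t)) / k\<bar> <= M" using k0 by (simp add: abs_divide divide_le_eq mult.commute)
  then have "\<bar>(\<Sum>s\<in>S. \<phi> (mob s t)) / k\<bar>\<^sup>2 <= M\<^sup>2" by (intro power_mono) auto
  then show ?thesis unfolding h_def by (simp only: power2_abs abs_power2)
 qed
 have mobm [measurable]: "mob s \<in> borel_measurable borel" for s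
  by (cases s) (simp add: mob_def[abs_def])
 have hm [measurable]: "h \<in> borel_measurable borel" unfolding h_def by measurable
 show t0: "tame (%t. ind {0..1} t * ((\<Sum>s\<in>S. \<phi> (mob s t)) / k)\<^sup>2)"
  unfolding h_def[symmetric] by (rule tame_mult[OF tame_indicator, where B = "M\<^sup>2"]) (use hb in auto)
 have pm: "{0..1} \<times> {1..2} \<in> sets (borel :: (real\<times>real) measure)" by (intro borel_closed closed_Times) auto
 define J where "J = {v::real\<times>real. 0 <= fst v \<and> fst v <= snd v \<and> 1 <= snd v \<and> snd v <= 2}"
 have Jm: "J \<in> sets borel" unfolding J_def by (intro borel_closed closed_Collect_conj closed_Collect_le continuous_intros)
 have tG: "tame (%v. F v * ind J v)" by (rule tame_mult[OF tF, where B = 1]) (use Jm in auto)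
 have s: "y >= 1" if "F (x,y) * ind J (x,y) \<noteq> 0" for x y
  using that by (auto simp: J_def indicator_def split: if_splits)
 have pol: "tame (%(t, y). y * (F (t * y, y) * ind J (t * y, y)))"
  "(LBINT v. F v * ind J v) = (LBINT t. LBINT y. y * (F (t * y, y) * ind J (t * y, y)))"
  by (rule integral_polar[OF tG _ s]; simp)+
 have pt: "y * (F (t * y, y) * ind J (t * y, y)) = (ind {0..1} t * h t) * (y * ind {1..2} y)" for t y
 proof (cases "t \<in> {0..1} \<and> y \<in> {1..2}")
  case True
  have ty: "0 <= t" "t <= 1" "1 <= y" "y <= 2" using True by auto
  have inJ: "(t*y,y) \<in> J" using ty mult_right_mono[of t 1 y] by (auto simp: J_def)
  have "lift \<phi> psit (lin (mA s) (t*y,y)) = \<phi> (mob s t)" if s: "s \<in> S" for s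
  proof -
   obtain a b c d where se: "s = (a,b,c,d)" by (cases s)
   have den: "sp / 16 <= c * t + d" "c * t + d <= 2 * sp" using gens_denominator s ty by (auto simp: se)
   have den0: "c * t + d > 0" using den(1) sp0 by simp
   have y': "real_of_int c / sp * (t*y) + real_of_int d / sp * y = (c*t+d)/sp * y" by (simp add: algebra_simps add_divide_distrib)
   have x': "real_of_int a / sp * (t*y) + real_of_int b / sp * y = (a*t+b)/sp * y" by (simp add: algebra_simps add_divide_distrib)
   have "1/16 <= (c*t+d)/sp" "(c*t+d)/sp <= 2" using den sp0 by (auto simp: field_simps)
   then have dn: "1/16 <= (c*t+d)/sp" "(c*t+d)/sp <= 2" "0 <= (c*t+d)/sp" by linarith+
   have "1/16 * 1 <= (c*t+d)/sp * y" by (rule mult_mono[OF dn(1) ty(3) dn(3)]) simp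
   moreover have "(c*t+d)/sp * y <= 2 * 2" by (rule mult_mono[OF dn(2) ty(4)]) (use ty in auto)
   ultimately have "psit ((c*t+d)/sp * y) = 1" by (intro psit_one) auto
   moreover have "((a*t+b)/sp * y) / ((c*t+d)/sp * y) = mob s t" using sp0 ty by (simp add: mob_def se)
   moreover have "lin (mA s) (t*y,y) = ((a*t+b)/sp * y, (c*t+d)/sp * y)"
    unfolding mA_def se rm.simps lin.simps x' y' ..
   ultimately show ?thesis by (simp only: lift_def fst_conv snd_conv mult_1_right)
  qed
  then have "F (t*y,y) = h t" unfolding F_def h_def avg_def by simp
  then show ?thesis using True inJ by simp
 next
  case False
  have "(t*y,y) \<notin> J"
  proof
   assume "(t*y,y) \<in> J"
   then have j: "0 <= t*y" "t*y <= 1*y" "1 <= y" "y <= 2" by (auto simp: J_def)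
   then have "0 <= t" "t <= 1" using mult_le_cancel_right_pos[of y t 1] by (auto simp: zero_le_mult_iff)
   then show False using False j by auto
  qed
  then show ?thesis using False by auto
 qed
 have ty: "tame (%y::real. y * ind {1..2} y)"
  using tame_mult[OF tame_indicator[of "{1..2::real}"], of "%y. y" 2] by (simp add: mult.commute indicator_def)
 have yint: "(LBINT y. y * ind {1..2} y) >= 1"
 proof -
  have "1 = (LBINT y. ind {1..2::real} y)" by simp
  also have "\<dots> <= (LBINT y. y * ind {1..2} y)"
  proof (rule lint_mono)
   show "integrable lborel (ind {1..2::real})" by (intro tame_integrable tame_indicator) auto
   show "integrable lborel (%y::real. y * ind {1..2} y)" by (rule tame_integrable[OF ty])
  qed (auto simp: indicator_def)
  finally show ?thesis .
 qed
 have "(LBINT t. ind {0..1} t * h t) * 1 <= (LBINT t. ind {0..1} t * h t) * (LBINT y. y * ind {1..2} y)"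
  using yint by (intro mult_left_mono Bochner_Integration.integral_nonneg) (auto simp: h_def)
 also have "\<dots> = (LBINT v. F v * ind J v)"
  unfolding pol(2) pt integral_mult_right_zero integral_mult_left_zero by (rule refl)
 also have "\<dots> <= (LBINT v. F v)"
  by (rule lint_mono[OF tame_integrable[OF tG] tame_integrable[OF tF]]) (auto simp: F_def indicator_def)
 finally show "(LBINT t. ind {0..1} t * ((\<Sum>s\<in>S. \<phi> (mob s t)) / k)\<^sup>2) <= (LBINT v. (avg (lift \<phi> psit) v)\<^sup>2)"
  by (simp add: h_def F_def)
qed

end

section \<open>Interaction of different scales under one Moebius map\<close>

text \<open>A single generator with \<rho> = sqrt p. All hypotheses are relative to \<rho>, so the
  constants derived are absolute. Within it \<open>r\<close> inverts \<open>m\<close> and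
  \<open>J\<close> is the derivative of \<open>r\<close>. The map is controlled on [0, 2], although
  the functions live on [0, 1], to leave room for rounding beyond the image of 1.\<close>

locale chart =
 fixes a b c d P \<rho> :: real
 assumes det: "a * d - b * c = P" "P = \<rho>\<^sup>2" and r0: "\<rho> > 0"
  and c: "c >= 0" "c <= \<rho>" and b: "b >= 0" and d: "\<rho> / 16 <= d" and cd: "c + d <= 2 * \<rho>"
begin

definition "m x = (a * x + b) / (c * x + d)"
definition "r u = (d * u - b) / (a - c * u)"
definition "J u = P / (a - c * u)\<^sup>2"

lemma m_measurable [measurable]: "m \<in> borel_measurable borel"
 unfolding m_def by measurable

lemma r_measurable [measurable]: "r \<in> borel_measurable borel"
 unfolding r_def by measurable

lemma J_measurable [measurable]: "J \<in> borel_measurable borel"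
 unfolding J_def by measurable

lemma P0: "P > 0" using det r0 by simp

lemma den: assumes "0 <= x" "x <= 2" shows "\<rho> / 16 <= c * x + d" "c * x + d <= 4 * \<rho>" "c * x + d > 0"
proof -
 have x: "0 <= c * x" "c * x <= c * 2" using assms c by (auto intro: mult_left_mono)
 show "\<rho> / 16 <= c * x + d" "c * x + d <= 4 * \<rho>" "c * x + d > 0" using x d cd r0 by linarith+
qed

lemma den1: assumes "0 <= x" "x <= 1" shows "c * x + d <= 2 * \<rho>"
proof -
 have x: "c * x <= c * 1" using assms c by (intro mult_left_mono)
 then show ?thesis using cd by linarith
qed

lemma m_diff: assumes "0 <= x" "x <= 2" "0 <= y" "y <= 2"
 shows "m y - m x = P * (y - x) / ((c * x + d) * (c * y + d))"
proof -
 have nz: "c * y + d \<noteq> 0" "c * x + d \<noteq> 0" using den(3)[OF assms(1,2)] den(3)[OF assms(3,4)] by auto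
 show ?thesis unfolding m_def diff_frac_eq[OF nz] det(1)[symmetric] mult.commute[of "c * y + d"]
  by (rule arg_cong2[where f="(/)"]) (simp_all add: algebra_simps)
qed

lemma m_mono: assumes "0 <= x" "x <= y" "y <= 2" shows "m x <= m y"
proof -
 have "m y - m x >= 0" using m_diff[of x y] den(3)[of x] den(3)[of y] assms P0 by simp
 then show ?thesis by simp
qed

lemma m_lipschitz: assumes "0 <= x" "x <= 2" "0 <= y" "y <= 2" shows "\<bar>m y - m x\<bar> <= 256 * \<bar>y - x\<bar>"
proof -
 have "(\<rho>/16) * (\<rho>/16) <= (c * x + d) * (c * y + d)" using den[OF assms(1,2)] den[OF assms(3,4)] r0 by (intro mult_mono) auto
 then have q: "P <= 256 * ((c * x + d) * (c * y + d))" using det by (simp add: power2_eq_square)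
 have pos: "(c * x + d) * (c * y + d) > 0" using den[OF assms(1,2)] den[OF assms(3,4)] by simp
 have "P / ((c * x + d) * (c * y + d)) <= 256" using q pos by (simp add: divide_simps)
 then have "P / ((c * x + d) * (c * y + d)) * \<bar>y - x\<bar> <= 256 * \<bar>y - x\<bar>" by (intro mult_right_mono) auto
 then show ?thesis using m_diff[OF assms] P0 pos den(3)[OF assms(1,2)] den(3)[OF assms(3,4)] by (simp add: abs_mult)
qed

lemma m_deriv: assumes "0 <= x" "x <= 2" shows "(m has_real_derivative P / (c * x + d)\<^sup>2) (at x)"
proof -
 have nz: "c * x + d \<noteq> 0" using den(3)[OF assms] by simp
 have "((%x. (a * x + b) / (c * x + d)) has_real_derivative (a * (c * x + d) - (a * x + b) * c) / ((c * x + d) * (c * x + d))) (at x)"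
  by (rule DERIV_divide) (auto intro!: derivative_eq_intros simp: nz)
 moreover have "a * (c * x + d) - (a * x + b) * c = P" unfolding det(1)[symmetric] by (simp add: algebra_simps)
 ultimately show ?thesis unfolding m_def[abs_def] by (simp add: power2_eq_square)
qed

lemma deriv_bounds:
 assumes "0 <= x" "x <= 2" shows "P / (c * x + d)\<^sup>2 <= 256" "0 < P / (c * x + d)\<^sup>2" "x <= 1 ==> P / (c * x + d)\<^sup>2 >= 1/4"
proof -
 have "(\<rho>/16)\<^sup>2 <= (c * x + d)\<^sup>2" using den[OF assms] r0 by (intro power_mono) auto
 then have "P <= 256 * (c * x + d)\<^sup>2" using det by (simp add: power_divide)
 then show "P / (c * x + d)\<^sup>2 <= 256" using den[OF assms] by (simp add: divide_simps)
 show "0 < P / (c * x + d)\<^sup>2" using P0 den[OF assms] by simp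
 assume "x <= 1"
 then have "(c * x + d)\<^sup>2 <= (2*\<rho>)\<^sup>2" using den[OF assms] den1 assms by (intro power_mono) auto
 then have "(c * x + d)\<^sup>2 <= 4 * P" using det by (simp add: power_mult_distrib)
 then show "P / (c * x + d)\<^sup>2 >= 1/4" using den[OF assms] by (simp add: divide_simps)
qed

lemma substitution:
 assumes F: "tame F" and be: "0 <= \<beta>" "\<beta> <= 2"
 shows "(LBINT u. F u * ind {m 0..m \<beta>} u) = (LBINT x. F (m x) * (P / (c * x + d)\<^sup>2) * ind {0..\<beta>} x)"
  and "integrable lborel (%x. F (m x) * (P / (c * x + d)\<^sup>2) * ind {0..\<beta>} x)"
proof -
 have i: "set_integrable lborel {m 0..m \<beta>} F" unfolding set_integrable_def
  using integrable_mult_indicator[OF _ tame_integrable[OF F]] by simp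
 have co: "continuous_on {0..\<beta>} (%x. P / (c * x + d)\<^sup>2)"
  using den(3) be by (intro continuous_intros) (smt (verit) atLeastAtMost_iff power2_eq_square mult_eq_0_iff)
 have de: "(m has_real_derivative P / (c * x + d)\<^sup>2) (at x)" "0 <= P / (c * x + d)\<^sup>2" if "x \<in> {0..\<beta>}" for x
  using m_deriv[of x] deriv_bounds(2)[of x] that be by auto
 note s = integral_substitution[OF i de(1) co de(2) be(1)]
 show "(LBINT u. F u * ind {m 0..m \<beta>} u) = (LBINT x. F (m x) * (P / (c * x + d)\<^sup>2) * ind {0..\<beta>} x)"
  using s(2) by simp
 show "integrable lborel (%x. F (m x) * (P / (c * x + d)\<^sup>2) * ind {0..\<beta>} x)"
  using s(1) unfolding set_integrable_def by (simp add: mult.commute)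
qed

lemma tame_pull: assumes "tame F" shows "tame (%x. ind {0..1} x * F (m x))"
proof -
 obtain M R where F: "\<And>v. \<bar>F v\<bar> <= M" using assms by (rule tameE) blast
 have [measurable]: "F \<in> borel_measurable borel" using assms by (rule tame_measurable)
 show ?thesis by (rule tame_mult[where B=M]) (auto simp: F intro!: tame_indicator)
qed

text \<open>On the unit interval the derivative of \<open>m\<close> is at least 1/4, so the image of
  Lebesgue measure has density at most 4.\<close>

lemma push:
 assumes F: "tame F" "\<And>u. F u >= 0"
 shows "(LBINT x. ind {0..1} x * F (m x)) <= 4 * (LBINT u. F u)"
proof -
 note s = substitution[OF F(1), of 1]
 have "(LBINT x. ind {0..1} x * F (m x)) <= (LBINT x. 4 * (F (m x) * (P / (c * x + d)\<^sup>2) * ind {0..1} x))"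
 proof (rule lint_mono)
  show "integrable lborel (%x. ind {0..1} x * F (m x))" by (rule tame_integrable[OF tame_pull[OF F(1)]])
  show "integrable lborel (%x. 4 * (F (m x) * (P / (c * x + d)\<^sup>2) * ind {0..1} x))" by (rule integrable_mult_right) (use s(2) in simp)
  show "ind {0..1} x * F (m x) <= 4 * (F (m x) * (P / (c * x + d)\<^sup>2) * ind {0..1} x)" for x
  proof (cases "x \<in> {0..1}")
   case True
   then have "F (m x) * (1/4) <= F (m x) * (P / (c * x + d)\<^sup>2)" using deriv_bounds(3)[of x] F(2) by (intro mult_left_mono) auto
   then have "F (m x) <= 4 * (F (m x) * (P / (c * x + d)\<^sup>2))" by linarith
   then show ?thesis using True by (simp only: indicator_simps mult_1 mult_1_right)
  qed simp
 qed
 also have "\<dots> = 4 * (LBINT u. F u * ind {m 0..m 1} u)" using s(1) by (simp only: integral_mult_right_zero)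
 also have "\<dots> <= 4 * (LBINT u. F u)"
 proof (intro mult_left_mono lint_mono)
  show "integrable lborel (%u. F u * ind {m 0..m 1} u)"
   by (rule tame_integrable[OF tame_mult_tame[OF F(1) tame_indicator]]) auto
  show "integrable lborel F" by (rule tame_integrable[OF F(1)])
  show "F x * ind {m 0..m 1} x <= F x" for x using F(2)[of x] by (auto simp: indicator_def)
 qed simp
 finally show ?thesis .
qed

text \<open>If \<psi> lives at much finer scales than \<phi>, then \<phi> composed with
  \<open>m\<close> is constant on most cells of \<psi>: \<open>m\<close> is 256-Lipschitz, so a cell
  of level N is mapped into an interval of length 2^(8-N), and only edges of the cells of \<phi>
  matter. Hence N >= M + 8. The constant is 4 * 12 * 256, from \<open>push\<close>,
  \<open>oscillation_integral\<close> and the Lipschitz bound, rounded up to 2^14.\<close>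

lemma cross_fine:
 assumes phi: "tame \<phi>" "step M \<phi>" and psi: "tame \<psi>" "mean_zero N \<psi>" "\<And>x. \<psi> x \<noteq> 0 ==> 0 <= x \<and> x < 1"
  and N: "N >= M + 8"
 shows "(LBINT x. \<phi> (m x) * \<psi> x)\<^sup>2 <= 2^14 * 2^M / 2^N * (LBINT u. (\<phi> u)\<^sup>2) * (LBINT x. (\<psi> x)\<^sup>2)"
proof -
 obtain B R where B: "\<And>v. \<bar>\<phi> v\<bar> <= B" using phi(1) by (rule tameE) blast
 have [measurable]: "\<phi> \<in> borel_measurable borel" using phi(1) by (rule tame_measurable)
 define t where "t = 256 / (2::real)^N"
 have t: "t >= 0" "t <= 1 / 2^M"
 proof -
  have "(2::real)^(M+8) <= 2^N" using N by (intro power_increasing) auto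
  then show "t <= 1 / 2^M" by (simp add: t_def power_add divide_simps)
 qed (simp add: t_def)
 define osc where "osc = oscillation M t \<phi>"
 have osc: "tame osc" "(LBINT u. osc u) <= 12 * t * 2^M * (LBINT u. (\<phi> u)\<^sup>2)" "\<And>u. osc u >= 0"
  unfolding osc_def using oscillation_integral[OF phi t(1)] oscillation_nonneg by auto
 define \<Delta> where "\<Delta> x = ind {0..1} x * (\<phi> (m x) - \<phi> (m (fl N x)))" for x
 have "(LBINT x. \<phi> (m x) * \<psi> x) = (LBINT x. \<psi> x * \<phi> (m x))" by (simp only: mult.commute)
 also have "\<dots> = (LBINT x. \<psi> x * (\<phi> (m x) - \<phi> (m (fl N x))))"
  by (rule mean_zero_cancel[OF psi(1,2), where B=B]) (auto simp: B)
 also have "\<dots> = (LBINT x. \<psi> x * \<Delta> x)"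
 proof (rule lint_cong[OF refl])
  fix x show "\<psi> x * (\<phi> (m x) - \<phi> (m (fl N x))) = \<psi> x * \<Delta> x"
   using psi(3)[of x] by (cases "\<psi> x = 0") (auto simp: \<Delta>_def)
 qed
 finally have e: "(LBINT x. \<phi> (m x) * \<psi> x) = (LBINT x. \<psi> x * \<Delta> x)" .
 have tD: "tame \<Delta>" unfolding \<Delta>_def[abs_def]
 proof (rule tame_mult[where B="2*B"])
  show "\<bar>\<phi> (m v) - \<phi> (m (fl N v))\<bar> <= 2 * B" for v using B[of "m v"] B[of "m (fl N v)"] by linarith
 qed (auto intro!: tame_indicator)
 have "(LBINT x. (\<Delta> x)\<^sup>2) <= (LBINT x. ind {0..1} x * osc (m x))"
 proof (rule lint_mono[OF tame_integrable[OF tame_power2[OF tD]] tame_integrable[OF tame_pull[OF osc(1)]]])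
  fix x :: real
  show "(\<Delta> x)\<^sup>2 <= ind {0..1} x * osc (m x)"
  proof (cases "x \<in> {0..1}")
   case True
   have f: "fl N x <= x" "x < fl N x + 1/2^N" by (rule fl_le, rule fl_gt)
   have f0: "0 <= fl N x" using True by (simp add: fl_def)
   have "\<bar>m x - m (fl N x)\<bar> <= 256 * \<bar>x - fl N x\<bar>" using True f f0 by (intro m_lipschitz) auto
   also have "\<dots> <= t" using f by (simp add: t_def)
   finally show ?thesis using step_diff_le[OF phi(2) _ t(2), of "m x" "m (fl N x)"] True by (simp add: \<Delta>_def osc_def)
  qed (simp add: \<Delta>_def)
 qed
 also have "\<dots> <= 4 * (LBINT u. osc u)" by (rule push[OF osc(1,3)])
 also have "\<dots> <= 2^14 * 2^M / 2^N * (LBINT u. (\<phi> u)\<^sup>2)"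
 proof -
  have "12288 * (2^M / 2^N * (LBINT u. (\<phi> u)\<^sup>2)) <= 2^14 * (2^M / 2^N * (LBINT u. (\<phi> u)\<^sup>2))" by (intro mult_right_mono) auto
  then show ?thesis using osc(2) by (simp add: t_def)
 qed
 finally have D: "(LBINT x. (\<Delta> x)\<^sup>2) <= 2^14 * 2^M / 2^N * (LBINT u. (\<phi> u)\<^sup>2)" .
 have "(LBINT x. \<psi> x * \<Delta> x)\<^sup>2 <= (LBINT x. (\<psi> x)\<^sup>2) * (LBINT x. (\<Delta> x)\<^sup>2)"
  by (rule tame_CauchySchwarz[OF psi(1) tD])
 also have "\<dots> <= (LBINT x. (\<psi> x)\<^sup>2) * (2^14 * 2^M / 2^N * (LBINT u. (\<phi> u)\<^sup>2))"
  by (rule mult_left_mono[OF D]) simp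
 finally show ?thesis unfolding e by (simp only: mult_ac)
qed

lemma r_m: assumes "0 <= x" "x <= 2" shows "a - c * m x = P / (c * x + d)" "r (m x) = x"
proof -
 note q = den(3)[OF assms]
 show e: "a - c * m x = P / (c * x + d)" unfolding m_def det(1)[symmetric] using q by (simp add: divide_simps) (simp add: algebra_simps)
 have "d * m x - b = x * (P / (c * x + d))" unfolding m_def det(1)[symmetric] using q by (simp add: divide_simps) (simp add: algebra_simps)
 then show "r (m x) = x" unfolding r_def e using q P0 by simp
qed

lemma m_r: assumes "a - c * u \<noteq> 0" "r u = x" "0 <= x" "x <= 2" shows "u = m x"
proof -
 have "d * u - b = x * (a - c * u)" using assms(1,2) by (simp add: r_def field_simps)
 then have "u * (c * x + d) = a * x + b" by (simp add: algebra_simps)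
 then show ?thesis using den(3)[OF assms(3,4)] by (simp add: m_def field_simps)
qed

lemma r_range: assumes "m 0 <= u" "u <= m 2"
 shows "a - c * u >= \<rho> / 4" "0 <= r u" "r u <= 2"
proof -
 have d0: "d > 0" and c2: "2 * c + d > 0" using den(3)[of 0] den(3)[of 2] by (auto simp: mult.commute)
 have "c * u <= c * m 2" using c assms by (intro mult_left_mono)
 then have "a - c * u >= P / (c * 2 + d)" using r_m(1)[of 2] by simp
 moreover have "P / (c * 2 + d) >= \<rho> / 4"
 proof -
  have "\<rho> * (c * 2 + d) <= \<rho> * (4 * \<rho>)" using den(2)[of 2] r0 by (intro mult_left_mono) auto
  then show ?thesis using c2 det by (simp add: divide_simps power2_eq_square mult_ac)
 qed
 ultimately show D: "a - c * u >= \<rho> / 4" by linarith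
 then have D0: "a - c * u > 0" using r0 by simp
 have "b / d <= u" "u <= (a * 2 + b) / (c * 2 + d)" using assms by (auto simp: m_def)
 then have "b <= d * u" "u * (c * 2 + d) <= a * 2 + b" using d0 c2 by (auto simp: field_simps)
 then show "0 <= r u" "r u <= 2" unfolding r_def using D0 by (auto simp: divide_simps algebra_simps)
qed

lemma r_lipschitz: assumes "a - c * u >= \<rho> / 4" "u' <= u"
 shows "\<bar>r u - r u'\<bar> <= 16 * (u - u')" "0 <= J u'" "J u' <= J u" "J u <= 16" "\<bar>J u - J u'\<bar> <= 128 * (u - u')"
proof -
 define D where "D = a - c * u"
 define D' where "D' = a - c * u'"
 have DD: "D' - D = c * (u - u')" by (simp add: D_def D'_def algebra_simps)
 have cu: "0 <= c * (u - u')" "c * (u - u') <= \<rho> * (u - u')" using assms c by (auto intro: mult_right_mono)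
 have D: "D >= \<rho> / 4" "D' >= D" "D > 0" "D' > 0" using assms(1) DD cu r0 by (auto simp: D_def)
 have q2: "(\<rho>/4) * (\<rho>/4) <= D * D" "(\<rho>/4) * (\<rho>/4) <= D * D'" using D r0 by (intro mult_mono; linarith)+
 have PP: "P <= 16 * (D * D)" "P <= 16 * (D * D')" using q2 det by (auto simp: power2_eq_square)
 have "r u - r u' = P / (D * D') * (u - u')"
  unfolding r_def det(1)[symmetric] using D unfolding D_def D'_def by (simp add: divide_simps) (simp add: algebra_simps)
 moreover have "P / (D * D') <= 16" "P / (D * D') >= 0" using PP D P0 by (auto simp: divide_simps)
 moreover have "0 <= P / (D * D') * (u - u')" using \<open>P / (D * D') >= 0\<close> assms(2) by (intro mult_nonneg_nonneg) auto
 moreover have "P / (D * D') * (u - u') <= 16 * (u - u')" using \<open>P / (D * D') <= 16\<close> assms(2) by (intro mult_right_mono) auto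
 ultimately show "\<bar>r u - r u'\<bar> <= 16 * (u - u')" by linarith
 show "0 <= J u'" using P0 by (simp add: J_def)
 show "J u <= 16" using PP D unfolding J_def D_def[symmetric] by (simp add: divide_simps power2_eq_square)
 have JJ: "J u - J u' = P * (1 / D + 1 / D') / (D * D') * (D' - D)"
  unfolding J_def D_def[symmetric] D'_def[symmetric] using D by (simp add: divide_simps power2_eq_square) (simp add: algebra_simps)
 have nn: "P * (1 / D + 1 / D') / (D * D') >= 0" using P0 D by simp
 then have "J u - J u' >= 0" unfolding JJ DD by (rule mult_nonneg_nonneg[OF _ cu(1)])
 then show "J u' <= J u" by simp
 have "1 / D <= 4 / \<rho>" "1 / D' <= 4 / \<rho>" using D r0 by (auto simp: divide_simps)
 then have "(1 / D + 1 / D') * (P / (D * D')) <= (8 / \<rho>) * 16" using \<open>P / (D * D') <= 16\<close> \<open>P / (D * D') >= 0\<close> D r0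
  by (intro mult_mono) auto
 then have "P * (1 / D + 1 / D') / (D * D') <= 128 / \<rho>" by (simp add: mult_ac)
 then have "J u - J u' <= (128 / \<rho>) * (\<rho> * (u - u'))" unfolding JJ DD using r0
  by (intro mult_mono[OF _ cu(2) _ cu(1)]) auto
 then show "\<bar>J u - J u'\<bar> <= 128 * (u - u')" using r0 \<open>J u - J u' >= 0\<close> by simp
qed

text \<open>The dual case: now \<phi> is the fine function, and the change of variables u =
  \<open>m x\<close> moves the coarse function to \<open>G\<close>, the composition of e with the
  inverse map times the Jacobian. Its rounding error comes from edges of the cells of e and from the
  variation of \<open>J\<close>. It is estimated at u and then transported back to the variable
  x.\<close>

lemma cross_coarse:
 assumes phi: "tame \<phi>" "mean_zero N \<phi>" and e: "tame e" "step M e" "\<And>x. e x \<noteq> 0 ==> 0 <= x \<and> x < 1"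
  and N: "N >= M + 4"
 shows "(LBINT x. \<phi> (m x) * e x)\<^sup>2 <= 2^25 * 2^M / 2^N * (LBINT u. (\<phi> u)\<^sup>2) * (LBINT x. (e x)\<^sup>2)"
proof -
 obtain B R where B: "B >= 0" "\<And>v. \<bar>e v\<bar> <= B" using e(1) by (rule tameE) blast
 have [measurable]: "\<phi> \<in> borel_measurable borel" "e \<in> borel_measurable borel" using phi(1) e(1) by (auto intro: tame_measurable)
 define G where "G u = e (r u) * J u" for u
 have [measurable]: "G \<in> borel_measurable borel" unfolding G_def[abs_def] by measurable
 have G0: "\<exists>x. 0 <= x \<and> x < 1 \<and> u = m x \<and> r u = x" if "G u \<noteq> 0" for u
 proof -
  have "e (r u) \<noteq> 0" "a - c * u \<noteq> 0" using that by (auto simp: G_def J_def)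
  then show ?thesis using e(3)[of "r u"] m_r[of u "r u"] by (intro exI[of _ "r u"]) auto
 qed
 have GR: "m 0 <= u \<and> u <= m 1" if "G u \<noteq> 0" for u
  using G0[OF that] m_mono by (metis less_eq_real_def order_refl one_le_numeral order_trans)
 \<comment> \<open>Rounding down can move a point just above the image of [0, 1] back into it. The
   gap 1/8 exceeds the cell length 2^(-N) <= 1/16, so such points stay below \<open>m 2\<close>,
   where the inverse map is under control.\<close>
 have G12: "m 1 + 1/8 <= m 2"
 proof -
  have "(c + d) * (c * 2 + d) <= (2*\<rho>) * (4*\<rho>)" using den[of 2] den(3)[of 1] cd r0 by (intro mult_mono) auto
  then have "(c + d) * (c * 2 + d) <= 8 * P" using det by (simp add: power2_eq_square)
  moreover have "(c + d) * (c * 2 + d) > 0" using den(3)[of 1] den(3)[of 2] by simp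
  ultimately have "P / ((c + d) * (c * 2 + d)) >= 1/8" by (simp add: divide_simps)
  moreover have "m 2 - m 1 = P / ((c + d) * (c * 2 + d))" using m_diff[of 1 2] by simp
  ultimately show ?thesis by linarith
 qed
 have GB: "\<bar>G u\<bar> <= B * 16" for u
 proof (cases "G u = 0")
  case False
  then have "a - c * u >= \<rho> / 4" using r_range(1)[of u] GR[of u] G12 by simp
  then have "0 <= J u" "J u <= 16" using r_lipschitz(2,4)[of u u] by auto
  then show ?thesis unfolding G_def abs_mult using B by (intro mult_mono) auto
 qed (use B in simp)
 have tF: "tame (%u. \<phi> u * G u)" by (rule tame_mult[OF phi(1)]) (use GB in auto)
 have "(LBINT x. \<phi> (m x) * e x) = (LBINT x. (\<phi> (m x) * G (m x)) * (P / (c * x + d)\<^sup>2) * ind {0..1} x)"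
 proof (rule lint_cong[OF refl])
  fix x show "\<phi> (m x) * e x = (\<phi> (m x) * G (m x)) * (P / (c * x + d)\<^sup>2) * ind {0..1} x"
  proof (cases "x \<in> {0..1}")
   case True
   have "J (m x) * (P / (c * x + d)\<^sup>2) = 1" 
   proof -
    have y: "a - c * m x = P / (c * x + d)" "c * x + d > 0" using r_m(1)[of x] den(3)[of x] True by auto
    have "P / (P / y)\<^sup>2 * (P / y\<^sup>2) = 1" if "y > 0" for y using that P0 by (simp add: power2_eq_square)
    then show ?thesis unfolding J_def y(1) using y(2) by blast
   qed
   then have "\<phi> (m x) * e x = (\<phi> (m x) * e x) * (J (m x) * (P / (c * x + d)\<^sup>2))" by (simp only: mult_1_right)
   also have "\<dots> = (\<phi> (m x) * G (m x)) * (P / (c * x + d)\<^sup>2)" using True r_m(2)[of x] by (simp add: G_def)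
   finally show ?thesis using True by (simp only: indicator_simps mult_1_right)
  qed (use e(3)[of x] in auto)
 qed
 also have "\<dots> = (LBINT u. \<phi> u * G u * ind {m 0..m 1} u)" using substitution(1)[OF tF, of 1] by simp
 also have "\<dots> = (LBINT u. \<phi> u * G u)"
  by (rule lint_cong[OF refl]) (use GR in \<open>auto simp: indicator_def\<close>)
 also have "\<dots> = (LBINT u. \<phi> u * (G u - G (fl N u)))"
  by (rule mean_zero_cancel[OF phi, where B="B*16"]) (auto simp: GB)
 finally have eq: "(LBINT x. \<phi> (m x) * e x) = (LBINT u. \<phi> u * (G u - G (fl N u)))" .
 define t where "t = 16 / (2::real)^N"
 have two: "(2::real)^(M+4) <= 2^N" using N by (intro power_increasing) auto
 have t: "t >= 0" "t <= 1 / 2^M" using two by (simp_all add: t_def power_add divide_simps)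
 have N16: "1 / 2^N <= 1 / (16::real)"
 proof -
  have "(2::real)^4 <= 2^N" using N by (intro power_increasing) auto
  then show ?thesis by simp
 qed
 define osc where "osc = oscillation M t e"
 have osc: "tame osc" "(LBINT u. osc u) <= 12 * t * 2^M * (LBINT u. (e u)\<^sup>2)" "\<And>u. osc u >= 0"
  unfolding osc_def using oscillation_integral[OF e(1,2) t(1)] oscillation_nonneg by auto
 \<comment> \<open>512 = 2 * 16^2 from the bound 16 on \<open>J\<close>, and 32768 = 2 * 128^2 from
   its Lipschitz constant 128; each 2 comes from the square of a sum. With the factor 256 for the
   return to x, the total is 256 * (512 * 12 * 16 + 32768) = 2^25.\<close>
 define w where "w x = 512 * osc x + 32768 / (2^N * 2^N) * (e x)\<^sup>2" for x
 have w: "tame w" unfolding w_def[abs_def] by (intro tame_add tame_cmult osc tame_power2 e)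
 have w0: "w x >= 0" for x using osc(3)[of x] by (simp add: w_def)
 have [measurable]: "w \<in> borel_measurable borel" by (rule tame_measurable[OF w])
 define H where "H u = ind {m 0..m 2} u * w (r u)" for u
 have tH: "tame H" unfolding H_def[abs_def]
 proof -
  obtain Bw R where "\<And>v. \<bar>w v\<bar> <= Bw" using w by (rule tameE) blast
  then show "tame (%u. ind {m 0..m 2} u * w (r u))"
   by (intro tame_mult[where B=Bw] tame_indicator) auto
 qed
 have DH: "(G u - G (fl N u))\<^sup>2 <= H u" for u
 proof -
  define u' where "u' = fl N u"
  have u': "u' <= u" "u - u' <= 1/2^N" using fl_le[of N u] fl_gt[of u N] by (auto simp: u'_def)
  consider "u < m 0" | "u > m 2" | "m 0 <= u" "u <= m 2" by linarith
  then show ?thesis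
  proof cases
   case 1
   then have "G u = 0" "G u' = 0" using GR[of u] GR[of u'] u' by force+
   then show ?thesis using 1 by (simp add: H_def u'_def)
  next
   case 2
   then have "G u = 0" "G u' = 0" using GR[of u] GR[of u'] u' G12 N16 by force+
   then show ?thesis using 2 by (simp add: H_def u'_def)
  next
   case 3
   note rr = r_lipschitz[OF r_range(1)[OF 3] u'(1)]
   define x where "x = r u"
   define x' where "x' = r u'"
   have "\<bar>x - x'\<bar> <= t" using rr(1) u'(2) by (simp add: x_def x'_def t_def)
   then have s: "(e x - e x')\<^sup>2 <= osc x" unfolding osc_def by (rule step_diff_le[OF e(2) _ t(2)])
   have dJ: "\<bar>J u - J u'\<bar> <= 128 / 2^N" using rr(5) u'(2) by simp
   have J': "\<bar>J u'\<bar> <= 16" using rr by linarith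
   define X where "X = (e x - e x') * J u'"
   define Y where "Y = e x * (J u - J u')"
   have "G u - G u' = X + Y" by (simp add: G_def x_def x'_def X_def Y_def algebra_simps)
   then have "(G u - G u')\<^sup>2 <= 2 * X\<^sup>2 + 2 * Y\<^sup>2" using sum_squares_bound[of X Y] by (simp add: power2_sum)
   moreover have "X\<^sup>2 <= osc x * 16\<^sup>2" unfolding X_def power_mult_distrib
    using s power_mono[OF J', of 2] osc(3)[of x] by (intro mult_mono) auto
   moreover have "Y\<^sup>2 <= (e x)\<^sup>2 * (128 / 2^N)\<^sup>2" unfolding Y_def power_mult_distrib
    using power_mono[OF dJ, of 2] by (intro mult_left_mono) auto
   moreover have "(128 / (2::real)^N)\<^sup>2 = 16384 / (2^N * 2^N)" by (simp add: power2_eq_square)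
   ultimately have "(G u - G u')\<^sup>2 <= w x" by (simp add: w_def)
   then show ?thesis using 3 by (simp add: H_def x_def u'_def)
  qed
 qed
 have tD: "tame (%u. G u - G (fl N u))"
 proof -
  obtain R where R: "\<And>u. H u \<noteq> 0 ==> norm u <= R" using tH by (rule tameE) blast
  show ?thesis
  proof (rule tameI)
   show "\<bar>G u - G (fl N u)\<bar> <= 2 * (B * 16)" for u using GB[of u] GB[of "fl N u"] by linarith
   show "norm u <= R" if "G u - G (fl N u) \<noteq> 0" for u
   proof (rule R)
    have "(G u - G (fl N u))\<^sup>2 > 0" using that by simp
    then show "H u \<noteq> 0" using DH[of u] by linarith
   qed
  qed measurable
 qed
 have "(LBINT u. (G u - G (fl N u))\<^sup>2) <= (LBINT u. H u)"
  by (rule lint_mono[OF tame_integrable[OF tame_power2[OF tD]] tame_integrable[OF tH] DH])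
 also have "\<dots> = (LBINT u. H u * ind {m 0..m 2} u)"
  by (rule lint_cong[OF refl]) (auto simp: H_def indicator_def)
 also have "\<dots> = (LBINT x. H (m x) * (P / (c * x + d)\<^sup>2) * ind {0..2} x)"
  by (rule substitution(1)[OF tH]) auto
 also have "\<dots> <= (LBINT x. 256 * w x)"
 proof (rule lint_mono[OF substitution(2)[OF tH] tame_integrable[OF tame_cmult[OF w]]])
  fix x :: real
  show "H (m x) * (P / (c * x + d)\<^sup>2) * ind {0..2} x <= 256 * w x"
  proof (cases "x \<in> {0..2}")
   case True
   then have "H (m x) = w x" using m_mono[of 0 x] m_mono[of x 2] r_m(2)[of x] by (simp add: H_def)
   moreover have "w x * (P / (c * x + d)\<^sup>2) <= w x * 256" using deriv_bounds(1)[of x] True w0 by (intro mult_left_mono) auto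
   ultimately show ?thesis using True by simp
  qed (use w0[of x] in auto)
 qed auto
 also have "\<dots> = 256 * (512 * (LBINT x. osc x) + 32768 / (2^N * 2^N) * (LBINT x. (e x)\<^sup>2))"
  unfolding w_def using tame_integrable[OF osc(1)] tame_integrable[OF tame_power2[OF e(1)]] by simp
 also have "\<dots> <= 256 * (512 * (12 * t * 2^M * (LBINT u. (e u)\<^sup>2)) + 32768 * (2^M / 2^N) * (LBINT x. (e x)\<^sup>2))"
 proof -
  have "1 / (2^N * 2^N) <= (2::real)^M / 2^N"
  proof -
   have "1 * 1 <= (2::real)^M * 2^N" by (intro mult_mono) auto
   then show ?thesis by (simp add: divide_simps)
  qed
  then have "32768 * (1 / (2^N * 2^N)) * (LBINT x. (e x)\<^sup>2) <= 32768 * (2^M / 2^N) * (LBINT x. (e x)\<^sup>2)"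
   by (intro mult_right_mono mult_left_mono) auto
  then have q: "32768 / (2^N * 2^N) * (LBINT x. (e x)\<^sup>2) <= 32768 * (2^M / 2^N) * (LBINT x. (e x)\<^sup>2)"
   by (simp only: times_divide_eq_right mult_1_right)
  show ?thesis by (intro mult_left_mono add_mono osc(2) q) auto
 qed
 also have "\<dots> = 2^25 * 2^M / 2^N * (LBINT x. (e x)\<^sup>2)" by (simp add: t_def)
 finally have D: "(LBINT u. (G u - G (fl N u))\<^sup>2) <= 2^25 * 2^M / 2^N * (LBINT x. (e x)\<^sup>2)" .
 have "(LBINT u. \<phi> u * (G u - G (fl N u)))\<^sup>2 <= (LBINT x. (\<phi> x)\<^sup>2) * (LBINT u. (G u - G (fl N u))\<^sup>2)"
  by (rule tame_CauchySchwarz[OF phi(1) tD])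
 also have "\<dots> <= (LBINT x. (\<phi> x)\<^sup>2) * (2^25 * 2^M / 2^N * (LBINT x. (e x)\<^sup>2))"
  by (rule mult_left_mono[OF D]) simp
 finally show ?thesis unfolding eq by (simp only: mult_ac)
qed

end

section \<open>Conditional expectations on dyadic cells\<close>

definition cexp :: "nat \<Rightarrow> (real \<Rightarrow> real) \<Rightarrow> real \<Rightarrow> real" where
 "cexp N g x = 2^N * (LBINT t. g t * ind (cell N \<lfloor>2^N * x\<rfloor>) t)"

lemma floor_fl: "\<lfloor>2^N * fl N x\<rfloor> = \<lfloor>2^N * x\<rfloor>"
 by (simp add: fl_def)

lemma step_cexp: "step N (cexp N g)"
 by (simp add: step_def cexp_def floor_fl)

lemma fl_fl: "N <= M ==> fl N (fl M x) = fl N x"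
proof -
 assume NM: "N <= M"
 have "\<lfloor>2^N * fl M x\<rfloor> = \<lfloor>2^N * x\<rfloor>"
 proof (rule floor_unique)
  define j where "j = \<lfloor>2^N * x\<rfloor>"
  have j: "real_of_int j <= 2^N * x" by (simp add: j_def)
  have e: "(2::real)^M = 2^(M-N) * 2^N" using NM by (simp flip: power_add)
  have "real_of_int (2^(M-N) * j) <= 2^M * x" using mult_left_mono[OF j, of "2^(M-N)"] by (simp add: e mult.assoc)
  then have "2^(M-N) * j <= \<lfloor>2^M * x\<rfloor>" by (simp only: le_floor_iff)
  then have "real_of_int (2^(M-N) * j) <= real_of_int \<lfloor>2^M * x\<rfloor>" by (simp only: of_int_le_iff)
  then have "2^(M-N) * real_of_int j <= 2^(M-N) * 2^N * fl M x" by (simp add: fl_def e)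
  then show "real_of_int \<lfloor>2^N * x\<rfloor> <= 2^N * fl M x" by (simp add: j_def mult.assoc)
  have "2^N * fl M x <= 2^N * x" by (intro mult_left_mono fl_le) auto
  then show "2^N * fl M x < real_of_int \<lfloor>2^N * x\<rfloor> + 1" by linarith
 qed
 then show ?thesis by (simp add: fl_def)
qed

lemma step_mono: "step N f ==> N <= M ==> step M f"
 unfolding step_def by (metis fl_fl)

lemma cexp_bound:
 assumes g: "tame g" "\<And>x. \<bar>g x\<bar> <= B" shows "\<bar>cexp N g x\<bar> <= B"
proof -
 define C where "C = cell N \<lfloor>2^N * x\<rfloor>"
 have t: "tame (%t. g t * ind C t)" unfolding C_def by (intro tame_mult_tame g tame_cell)
 have "\<bar>LBINT t. g t * ind C t\<bar> <= (LBINT t. \<bar>g t * ind C t\<bar>)" by (rule integral_abs_bound)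
 also have "\<dots> <= (LBINT t. B * ind C t)"
  by (rule lint_mono[OF tame_integrable[OF tame_abs[OF t]] tame_integrable[OF tame_cmult]])
   (auto simp: C_def abs_mult indicator_def g(2) tame_cell[unfolded indicator_def[abs_def]] intro!: tame_cell)
 also have "\<dots> = B / 2^N" by (simp only: C_def integral_mult_right_zero integral_cell) simp
 finally have "2^N * \<bar>LBINT t. g t * ind C t\<bar> <= 2^N * (B / 2^N)" by (intro mult_left_mono) auto
 then show ?thesis unfolding cexp_def C_def[symmetric] by (simp add: abs_mult)
qed

lemma cexp_support:
 assumes g: "\<And>x. g x \<noteq> 0 ==> 0 <= x \<and> x < real K" and x: "cexp N g x \<noteq> 0"
 shows "0 <= x \<and> x < real K"
proof -
 have "(LBINT t. g t * ind (cell N \<lfloor>2^N * x\<rfloor>) t) \<noteq> 0" using x by (simp add: cexp_def)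
 then obtain t where "g t * ind (cell N \<lfloor>2^N * x\<rfloor>) t \<noteq> 0" using integral_nonzeroD by blast
 then have t: "0 <= t" "t < real K" "\<lfloor>2^N * t\<rfloor> = \<lfloor>2^N * x\<rfloor>" using g[of t] by (auto simp: in_cell_iff indicator_def split: if_splits)
 have "0 <= \<lfloor>2^N * t\<rfloor>" using t(1) by simp
 moreover have "2^N * t < real_of_int (2^N * int K)" using t by simp
 then have "\<lfloor>2^N * t\<rfloor> < 2^N * int K" by (simp only: floor_less_iff)
 ultimately have "0 <= \<lfloor>2^N * x\<rfloor>" "\<lfloor>2^N * x\<rfloor> < 2^N * int K" using t by auto
 then have "2^N * 0 <= 2^N * x" "2^N * x < real_of_int (2^N * int K)" by (simp_all only: floor_less_iff zero_le_floor mult_zero_right)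
 then show ?thesis using mult_le_cancel_left_pos[of "2^N" 0 x] by simp
qed

lemma tame_cexp: assumes g: "tame g" shows "tame (cexp N g)"
proof -
 obtain B R where B: "R >= 0" "\<And>x. \<bar>g x\<bar> <= B" "\<And>x. g x \<noteq> 0 ==> norm x <= R" using g by (rule tameE) blast
 show ?thesis
 proof (rule tameI)
  show "cexp N g \<in> borel_measurable borel" by (rule step_measurable[OF step_cexp])
  show "\<bar>cexp N g x\<bar> <= B" for x by (rule cexp_bound[OF g B(2)])
  show "norm x <= R + 1" if "cexp N g x \<noteq> 0" for x
  proof -
   have "(LBINT t. g t * ind (cell N \<lfloor>2^N * x\<rfloor>) t) \<noteq> 0" using that by (simp add: cexp_def)
   then obtain t where "g t * ind (cell N \<lfloor>2^N * x\<rfloor>) t \<noteq> 0" using integral_nonzeroD by blast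
   then have t: "norm t <= R" "\<lfloor>2^N * t\<rfloor> = \<lfloor>2^N * x\<rfloor>" using B(3)[of t] by (auto simp: in_cell_iff indicator_def split: if_splits)
   have "fl N t = fl N x" using t by (simp add: fl_def)
   then have "\<bar>x - t\<bar> <= 1 / 2^N" using fl_le[of N t] fl_gt[of t N] fl_le[of N x] fl_gt[of x N] by linarith
   also have "\<dots> <= 1" by simp
   finally show ?thesis using t(1) by simp
  qed
 qed
qed

lemma mean_zero_diff:
 assumes "tame f" "tame g" "mean_zero N f" "mean_zero N g" shows "mean_zero N (%x. f x - g x)"
 unfolding mean_zero_def
proof
 fix k
 have "(LBINT x. (f x - g x) * ind (cell N k) x)
  = (LBINT x. f x * ind (cell N k) x - g x * ind (cell N k) x)" by (simp add: left_diff_distrib)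
 also have "\<dots> = (LBINT x. f x * ind (cell N k) x) - (LBINT x. g x * ind (cell N k) x)"
  by (intro lint_diff tame_integrable tame_mult_tame assms tame_cell)
 finally show "(LBINT x. (f x - g x) * ind (cell N k) x) = 0" using assms(3,4) by (simp add: mean_zero_def)
qed

lemma mean_zero_cexp: assumes g: "tame g" shows "mean_zero N (%x. g x - cexp N g x)"
 unfolding mean_zero_def
proof
 fix k
 define I where "I = (LBINT t. g t * ind (cell N k) t)"
 have e: "(g x - cexp N g x) * ind (cell N k) x = g x * ind (cell N k) x - (2^N * I) * ind (cell N k) x" for x
  by (cases "x \<in> cell N k") (auto simp: in_cell_iff cexp_def I_def)
 have "(LBINT x. (g x - cexp N g x) * ind (cell N k) x) = I - (LBINT x. (2^N * I) * ind (cell N k) x)"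
  unfolding e I_def by (intro lint_diff tame_integrable tame_mult_tame tame_cmult g tame_cell)
 then show "(LBINT x. (g x - cexp N g x) * ind (cell N k) x) = 0" by (simp only: integral_mult_right_zero integral_cell) simp
qed

lemma step_indicator_cell: "N <= M ==> step M (ind (cell N k))"
 by (rule step_mono[of N]) (auto simp: step_def in_cell_iff floor_fl indicator_def)

lemma mean_zero_mono: assumes f: "tame f" "mean_zero M f" "N <= M" shows "mean_zero N f"
 unfolding mean_zero_def
proof
 show "(LBINT x. f x * ind (cell N k) x) = 0" for k
  by (rule mean_zero_step[OF f(1,2) step_indicator_cell[OF f(3)], where B=1]) (auto simp: indicator_def)
qed

lemma mean_zero_band: assumes g: "tame g" and NM: "N <= M" shows "mean_zero N (%x. cexp M g x - cexp N g x)"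
proof -
 have "mean_zero N (%x. (g x - cexp N g x) - (g x - cexp M g x))"
  by (intro mean_zero_diff tame_diff g tame_cexp mean_zero_cexp mean_zero_mono[OF _ mean_zero_cexp[OF g] NM])
 then show ?thesis by simp
qed

lemma pythagoras:
 assumes u: "tame u" and v: "tame v" "step N v" and z: "mean_zero N (%x. u x - v x)"
 shows "(LBINT x. (u x - v x)\<^sup>2) = (LBINT x. (u x)\<^sup>2) - (LBINT x. (v x)\<^sup>2)"
proof -
 obtain B R where B: "\<And>x. \<bar>v x\<bar> <= B" using v(1) by (rule tameE) blast
 have "(LBINT x. (u x - v x) * v x) = 0" by (rule mean_zero_step[OF tame_diff[OF u v(1)] z v(2) B])
 moreover have "(LBINT x. (u x - v x)\<^sup>2) = (LBINT x. ((u x)\<^sup>2 - (v x)\<^sup>2) - 2 * ((u x - v x) * v x))"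
  by (rule lint_cong[OF refl]) (simp add: power2_eq_square algebra_simps)
 moreover have "\<dots> = (LBINT x. (u x)\<^sup>2 - (v x)\<^sup>2) - (LBINT x. 2 * ((u x - v x) * v x))"
  by (intro lint_diff tame_integrable tame_diff tame_cmult tame_mult_tame tame_power2 u v)
 moreover have "(LBINT x. (u x)\<^sup>2 - (v x)\<^sup>2) = (LBINT x. (u x)\<^sup>2) - (LBINT x. (v x)\<^sup>2)"
  by (intro lint_diff tame_integrable tame_power2 u v)
 ultimately show ?thesis by simp
qed

lemma cexp_norm:
 assumes g: "tame g"
 shows "(LBINT x. (g x - cexp N g x)\<^sup>2) = (LBINT x. (g x)\<^sup>2) - (LBINT x. (cexp N g x)\<^sup>2)"
  and "N <= M ==> (LBINT x. (cexp M g x - cexp N g x)\<^sup>2) = (LBINT x. (cexp M g x)\<^sup>2) - (LBINT x. (cexp N g x)\<^sup>2)"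
  and "(LBINT x. (cexp N g x)\<^sup>2) <= (LBINT x. (g x)\<^sup>2)"
proof -
 show 1: "(LBINT x. (g x - cexp N g x)\<^sup>2) = (LBINT x. (g x)\<^sup>2) - (LBINT x. (cexp N g x)\<^sup>2)"
  by (intro pythagoras[of _ _ N] g tame_cexp step_cexp mean_zero_cexp)
 show "(LBINT x. (cexp M g x - cexp N g x)\<^sup>2) = (LBINT x. (cexp M g x)\<^sup>2) - (LBINT x. (cexp N g x)\<^sup>2)" if "N <= M"
  by (intro pythagoras[of _ _ N] tame_cexp g step_cexp mean_zero_band that)
 have "0 <= (LBINT x. (g x - cexp N g x)\<^sup>2)" by simp
 then show "(LBINT x. (cexp N g x)\<^sup>2) <= (LBINT x. (g x)\<^sup>2)" using 1 by simp
qed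

lemma cexp_step: assumes g: "step J g" "J <= N" shows "cexp N g = g"
proof
 fix x
 have s: "step N g" by (rule step_mono[OF g])
 have "g t * ind (cell N \<lfloor>2^N * x\<rfloor>) t = g x * ind (cell N \<lfloor>2^N * x\<rfloor>) t" for t
 proof (cases "t \<in> cell N \<lfloor>2^N * x\<rfloor>")
  case True
  then have "fl N t = fl N x" by (simp add: in_cell_iff fl_def)
  then have "g t = g x" using s unfolding step_def by metis
  then show ?thesis by simp
 qed simp
 then have "cexp N g x = 2^N * (g x * (1 / 2^N))" unfolding cexp_def by (simp only: integral_mult_right_zero integral_cell)
 then show "cexp N g x = g x" by simp
qed

lemma abs_le_mean:
 fixes z \<kappa> A B :: real
 assumes "z\<^sup>2 <= \<kappa>\<^sup>2 * A * B" "\<kappa> >= 0" "A >= 0" "B >= 0" shows "\<bar>z\<bar> <= \<kappa> * (A + B) / 2"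
proof -
 have "4 * (A * B) <= (A + B)\<^sup>2" using sum_squares_bound[of A B] by (simp add: power2_sum)
 then have "\<kappa>\<^sup>2 * (4 * (A * B)) <= \<kappa>\<^sup>2 * (A + B)\<^sup>2" by (intro mult_left_mono) auto
 then have "z\<^sup>2 <= (\<kappa> * (A + B) / 2)\<^sup>2" using assms(1) by (simp add: power_mult_distrib power_divide mult_ac)
 then show ?thesis by (rule abs_le_square_iff[THEN iffD2, THEN order_trans]) (use assms in simp)
qed

section \<open>Decay of averages over the generators for functions without coarse component\<close>

context generators
begin

lemma chart:
 assumes "(a,b,c,d) \<in> S"
 shows "chart (real_of_int a) (real_of_int b) (real_of_int c) (real_of_int d) (real_of_int p) sp"
  and "chart.m (real_of_int a) (real_of_int b) (real_of_int c) (real_of_int d) = mob (a,b,c,d)"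
proof -
 have g: "1 <= c" "c <= X" "0 <= b" "a*d - b*c = p" using assms unfolding gens_def by auto
 have "real_of_int (a*d - b*c) = real_of_int p" using g by simp
 then have det: "real_of_int a * real_of_int d - real_of_int b * real_of_int c = real_of_int p" by simp
 show c: "chart (real_of_int a) (real_of_int b) (real_of_int c) (real_of_int d) (real_of_int p) sp"
 proof
  show "real_of_int p = sp\<^sup>2" using sp2 by (simp add: power2_eq_square)
  show "real_of_int c <= sp" using X_sp(2) g(2) by linarith
  show "sp / 16 <= real_of_int d" using gens_denominator(1)[OF assms, of 0] by simp
  show "real_of_int c + real_of_int d <= 2 * sp" using gens_denominator(2)[OF assms, of 1] by simp
 qed (use det sp0 g in auto)
 show "chart.m (real_of_int a) (real_of_int b) (real_of_int c) (real_of_int d) = mob (a,b,c,d)"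
  by (auto simp: chart.m_def[OF c] mob_def)
qed

lemma mob_facts:
 assumes s: "s \<in> S"
 shows mob_measurable: "mob s \<in> borel_measurable borel"
  and mob_pull: "tame F ==> tame (%x. ind {0..1} x * F (mob s x))"
  and mob_push: "tame F ==> (\<And>u. F u >= 0) ==> (LBINT x. ind {0..1} x * F (mob s x)) <= 4 * (LBINT u. F u)"
  and mob_fine: "tame \<phi> ==> step M \<phi> ==> tame \<psi> ==> mean_zero N \<psi> ==> (\<And>x. \<psi> x \<noteq> 0 ==> 0 <= x \<and> x < 1) ==> N >= M + 8 ==>
   (LBINT x. \<phi> (mob s x) * \<psi> x)\<^sup>2 <= 2^14 * 2^M / 2^N * (LBINT u. (\<phi> u)\<^sup>2) * (LBINT x. (\<psi> x)\<^sup>2)"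
  and mob_coarse: "tame \<phi> ==> mean_zero N \<phi> ==> tame e ==> step M e ==> (\<And>x. e x \<noteq> 0 ==> 0 <= x \<and> x < 1) ==> N >= M + 4 ==>
   (LBINT x. \<phi> (mob s x) * e x)\<^sup>2 <= 2^25 * 2^M / 2^N * (LBINT u. (\<phi> u)\<^sup>2) * (LBINT x. (e x)\<^sup>2)"
proof -
 obtain a b c d where e: "s = (a,b,c,d)" by (metis prod.collapse)
 note ch = chart[OF s[unfolded e]]
 note pull = chart.tame_pull[OF ch(1), unfolded ch(2), folded e]
 note push = chart.push[OF ch(1), unfolded ch(2), folded e]
 note fine = chart.cross_fine[OF ch(1), unfolded ch(2), folded e]
 note coarse = chart.cross_coarse[OF ch(1), unfolded ch(2), folded e]
 show "mob s \<in> borel_measurable borel" using chart.m_measurable[OF ch(1)] by (simp only: ch(2) e)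
 show "tame F ==> tame (%x. ind {0..1} x * F (mob s x))"
  by (rule pull)
 show "tame F ==> (\<And>u. F u >= 0) ==> (LBINT x. ind {0..1} x * F (mob s x)) <= 4 * (LBINT u. F u)"
  by (rule push)
 show "tame \<phi> ==> step M \<phi> ==> tame \<psi> ==> mean_zero N \<psi> ==> (\<And>x. \<psi> x \<noteq> 0 ==> 0 <= x \<and> x < 1) ==> N >= M + 8 ==>
   (LBINT x. \<phi> (mob s x) * \<psi> x)\<^sup>2 <= 2^14 * 2^M / 2^N * (LBINT u. (\<phi> u)\<^sup>2) * (LBINT x. (\<psi> x)\<^sup>2)"
  by (rule fine)
 show "tame \<phi> ==> mean_zero N \<phi> ==> tame e ==> step M e ==> (\<And>x. e x \<noteq> 0 ==> 0 <= x \<and> x < 1) ==> N >= M + 4 ==>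
   (LBINT x. \<phi> (mob s x) * e x)\<^sup>2 <= 2^25 * 2^M / 2^N * (LBINT u. (\<phi> u)\<^sup>2) * (LBINT x. (e x)\<^sup>2)"
  by (rule coarse)
qed

text \<open>The average of g over the generators, tested against f. As a mean of integrals it
  inherits every bound that holds for each single generator, and as an integral of a mean it can use
  the averaging itself.\<close>

definition pairing :: "(real \<Rightarrow> real) \<Rightarrow> (real \<Rightarrow> real) \<Rightarrow> real" where
 "pairing g f = (\<Sum>s\<in>S. LBINT x. g (mob s x) * f x) / k"

lemma tame_pairing: assumes "s \<in> S" "tame g" "tame f" shows "tame (%x. g (mob s x) * f x)"
proof -
 obtain B R where B: "\<And>x. \<bar>g x\<bar> <= B" using assms(2) by (rule tameE) blast
 have [measurable]: "g \<in> borel_measurable borel" "mob s \<in> borel_measurable borel" using assms by (auto intro: tame_measurable mob_measurable)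
 have "tame (%x. f x * g (mob s x))" by (rule tame_mult[OF assms(3), where B=B]) (auto simp: B)
 then show ?thesis by (simp only: mult.commute)
qed

lemma pairing_add_right:
 assumes "tame g" "tame f" "tame h" shows "pairing g (%x. f x + h x) = pairing g f + pairing g h"
proof -
 have "(LBINT x. g (mob s x) * (f x + h x)) = (LBINT x. g (mob s x) * f x) + (LBINT x. g (mob s x) * h x)" if "s \<in> S" for s
  unfolding distrib_left by (intro lint_add tame_integrable tame_pairing that assms)
 then show ?thesis by (simp add: pairing_def sum.distrib add_divide_distrib)
qed

lemma pairing_add_left:
 assumes "tame g" "tame h" "tame f" shows "pairing (%x. g x + h x) f = pairing g f + pairing h f"
proof -
 have "(LBINT x. (g (mob s x) + h (mob s x)) * f x) = (LBINT x. g (mob s x) * f x) + (LBINT x. h (mob s x) * f x)" if "s \<in> S" for s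
  unfolding distrib_right by (intro lint_add tame_integrable tame_pairing that assms)
 then show ?thesis by (simp add: pairing_def sum.distrib add_divide_distrib)
qed

lemma pairing_bound:
 assumes "\<And>s. s \<in> S ==> (LBINT x. g (mob s x) * f x)\<^sup>2 <= K" shows "(pairing g f)\<^sup>2 <= K"
proof -
 obtain s where "s \<in> S" using fin by blast
 then have K: "K >= 0" using assms[of s] by (smt (verit) zero_le_power2)
 have "\<bar>\<Sum>s\<in>S. LBINT x. g (mob s x) * f x\<bar> <= (\<Sum>s\<in>S. \<bar>LBINT x. g (mob s x) * f x\<bar>)" by (rule sum_abs)
 also have "\<dots> <= (\<Sum>s\<in>S. sqrt K)" by (intro sum_mono real_le_rsqrt) (simp add: assms)
 also have "\<dots> = k * sqrt K" by (simp add: k_def)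
 finally have "\<bar>pairing g f\<bar> <= sqrt K" using k0 by (simp add: pairing_def divide_simps mult.commute)
 then have "\<bar>pairing g f\<bar>\<^sup>2 <= (sqrt K)\<^sup>2" by (intro power_mono) auto
 then show ?thesis using K by simp
qed

end

lemma sum_geometric_half: "(\<Sum>i<n. (1/2::real)^i) <= 2"
proof -
 have "(\<Sum>i<n. (1/2::real)^i) = 2 - 2 * (1/2)^n" by (induction n) auto
 then show ?thesis by simp
qed

lemma sum_telescope3:
 fixes a :: "nat \<Rightarrow> real"
 assumes "\<And>j. 0 <= a j" "\<And>j. a j <= A" shows "(\<Sum>i<n. a (i+3) - a i) <= 3 * A"
proof -
 have "(\<Sum>i<n. a (i+3) - a i) = a n + a (n+1) + a (n+2) - a 0 - a 1 - a 2"
  by (induction n) (auto simp: numeral_3_eq_3 numeral_2_eq_2)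
 then show ?thesis using assms(1)[of 0] assms(1)[of 1] assms(1)[of 2] assms(2)[of n] assms(2)[of "n+1"] assms(2)[of "n+2"] by linarith
qed

context generators
begin

definition "band_gain CD = 162 * band_const CD / \<pi>p"

lemma band_gain_nonneg: "band_gain CD >= 0"
 using pip(2) word_const_ge by (simp add: band_gain_def band_const_def)

lemma pairing_zero_right: "pairing g (%_. 0) = 0"
 by (simp add: pairing_def)

lemma pairing_sum_left:
 assumes "finite I" "\<And>i. i \<in> I ==> tame (\<phi> i)" "tame f"
 shows "pairing (%x. \<Sum>i\<in>I. \<phi> i x) f = (\<Sum>i\<in>I. pairing (\<phi> i) f)"
 using assms(1,2)
proof (induction I rule: finite_induct)
 case empty then show ?case by (simp add: pairing_def)
next
 case (insert i I)
 have "pairing (%x. \<phi> i x + (\<Sum>i\<in>I. \<phi> i x)) f = pairing (\<phi> i) f + pairing (%x. \<Sum>i\<in>I. \<phi> i x) f"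
  using insert.prems by (intro pairing_add_left tame_sum assms(3)) auto
 then show ?case using insert by simp
qed

lemma pairing_integral:
 assumes "tame g" "tame f" "\<And>x. f x \<noteq> 0 ==> 0 <= x \<and> x < 1"
 shows "pairing g f = (LBINT x. (ind {0..1} x * ((\<Sum>s\<in>S. g (mob s x)) / k)) * f x)"
proof -
 have "pairing g f = (LBINT x. (\<Sum>s\<in>S. g (mob s x) * f x) / k)"
  unfolding pairing_def by (subst integral_divide_zero, subst lint_sum)
   (auto intro!: tame_integrable tame_pairing assms)
 also have "\<dots> = (LBINT x. (ind {0..1} x * ((\<Sum>s\<in>S. g (mob s x)) / k)) * f x)"
 proof (rule lint_cong[OF refl])
  fix x
  show "(\<Sum>s\<in>S. g (mob s x) * f x) / k = (ind {0..1} x * ((\<Sum>s\<in>S. g (mob s x)) / k)) * f x"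
   using assms(3)[of x] by (cases "f x = 0") (auto simp: sum_distrib_right)
 qed
 finally show ?thesis .
qed

lemma pairing_band:
 assumes l: "real_of_int p <= 2^(3*l)" "2^(3*l) <= 8 * real_of_int p" "l >= 4"
  and CD: "CD > 0" "\<And>m. m > 0 ==> divs m ^ 192 <= CD * m"
  and phi: "tame \<phi>" "mean_zero (3*(l*2^i)) \<phi>" "\<And>x. \<phi> x \<noteq> 0 ==> 0 <= x \<and> x < 512" "step (6*(l*2^i)) \<phi>"
  and f: "tame f" "\<And>x. f x \<noteq> 0 ==> 0 <= x \<and> x < 1"
 shows "(pairing \<phi> f)\<^sup>2 <= band_gain CD * (LBINT x. (\<phi> x)\<^sup>2) * (LBINT x. (f x)\<^sup>2)"
proof -
 define h where "h x = ind {0..1} x * ((\<Sum>s\<in>S. \<phi> (mob s x)) / k)" for x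
 have th: "tame h"
 proof -
  have "tame (%x. (1/k) * (\<Sum>s\<in>S. ind {0..1} x * \<phi> (mob s x)))"
   by (intro tame_cmult tame_sum mob_pull phi(1))
  moreover have "h = (%x. (1/k) * (\<Sum>s\<in>S. ind {0..1} x * \<phi> (mob s x)))"
   by (simp add: h_def fun_eq_iff sum_distrib_left[symmetric])
  ultimately show ?thesis by simp
 qed
 have "(h x)\<^sup>2 = ind {0..1} x * ((\<Sum>s\<in>S. \<phi> (mob s x)) / k)\<^sup>2" for x
  by (simp add: h_def indicator_def)
 then have "(LBINT x. (h x)\<^sup>2) <= (LBINT v. (avg (lift \<phi> psit) v)\<^sup>2)"
  using band_estimate_line(2)[OF phi(1)] by simp
 also have "\<dots> <= band_gain CD * (LBINT x. (\<phi> x)\<^sup>2)"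
 proof -
  have "\<And>x. \<phi> x \<noteq> 0 ==> 0 <= x \<and> x <= 1024" using phi(3) by force
  then show ?thesis unfolding band_gain_def by (intro band_estimate_plane[OF l CD phi(1,2) _ phi(4)])
 qed
 finally have H: "(LBINT x. (h x)\<^sup>2) <= band_gain CD * (LBINT x. (\<phi> x)\<^sup>2)" .
 have "pairing \<phi> f = (LBINT x. h x * f x)" unfolding h_def by (rule pairing_integral[OF phi(1) f])
 then have "(pairing \<phi> f)\<^sup>2 <= (LBINT x. (h x)\<^sup>2) * (LBINT x. (f x)\<^sup>2)" using tame_CauchySchwarz[OF th f(1)] by simp
 also have "\<dots> <= band_gain CD * (LBINT x. (\<phi> x)\<^sup>2) * (LBINT x. (f x)\<^sup>2)" by (rule mult_right_mono[OF H]) simp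
 finally show ?thesis .
qed

text \<open>Littlewood--Paley decomposition: in \<open>pairing \<phi>\<^sub>i f\<close> with \<open>\<phi>\<^sub>i\<close> living between the scales
 \<open>3l2\<^sup>i\<close> and \<open>6l2\<^sup>i\<close>, the parts of \<open>f\<close> at much coarser or much finer scales are
 nearly orthogonal to \<open>\<phi>\<^sub>i \<circ> mob s\<close> for every single \<open>s\<close>; only for the middle part is the average over
 \<open>S\<close> needed.\<close>

lemma pairing_decay:
 assumes l: "real_of_int p <= 2^(3*l)" "2^(3*l) <= 8 * real_of_int p" "l >= 4"
  and CD: "CD > 0" "\<And>m. m > 0 ==> divs m ^ 192 <= CD * m"
  and g: "tame g" "step n g" "\<And>x. g x \<noteq> 0 ==> 0 <= x \<and> x < 512"
  and f: "tame f" "\<And>x. f x \<noteq> 0 ==> 0 <= x \<and> x < 1"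
 shows "\<bar>pairing g f\<bar> <= 64 * (LBINT x. (cexp (3*l) g x)\<^sup>2) + (LBINT x. (f x)\<^sup>2) / 64
  + (2 * sqrt (band_gain CD) + 2^15 / 2^l) * ((LBINT x. (g x)\<^sup>2) + (LBINT x. (f x)\<^sup>2))"
proof -
 define Nn where "Nn i = 3 * (l * 2^i)" for i :: nat
 define E where "E i = cexp (Nn i) g" for i
 define \<phi> where "\<phi> i x = E (Suc i) x - E i x" for i x
 \<comment> \<open>The index is shifted by one: \<open>F i\<close> is f at scale
   \<open>Nn (i-1)\<close>, one step coarser than the coarse end of the i-th band. The value 0 at
   index 0 says that the lowest band has no coarser part to split off.\<close>
 define F where "F j = (case j of 0 \<Rightarrow> (%_. 0) | Suc i \<Rightarrow> cexp (Nn i) f)" for j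
 define gg where "gg = (LBINT x. (g x)\<^sup>2)"
 define ff where "ff = (LBINT x. (f x)\<^sup>2)"
 have gg0: "gg >= 0" and ff0: "ff >= 0" by (simp_all add: gg_def ff_def)
 have F0: "F 0 = (%_. 0)" and FS: "F (Suc i) = cexp (Nn i) f" for i by (simp_all add: F_def)
 have Nm: "Nn i <= Nn j" if "i <= j" for i j using that by (simp add: Nn_def)
 have NS: "Nn (Suc i) = 6 * (l * 2^i)" "Nn (Suc i) = 2 * Nn i" for i by (simp_all add: Nn_def)
 have N12: "Nn i >= 12" for i using mult_mono[of 4 l 1 "2^i"] l(3) by (simp add: Nn_def)
 have tE: "tame (E i)" for i unfolding E_def by (rule tame_cexp[OF g(1)])
 have tphi: "tame (\<phi> i)" for i unfolding \<phi>_def[abs_def] by (intro tame_diff tE)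
 have supE: "0 <= x \<and> x < 512" if "E i x \<noteq> 0" for i x
  using cexp_support[of g 512 "Nn i" x] g(3) that by (simp add: E_def)
 have phi: "mean_zero (3*(l*2^i)) (\<phi> i)" "step (6*(l*2^i)) (\<phi> i)" "\<And>x. \<phi> i x \<noteq> 0 ==> 0 <= x \<and> x < 512" for i
 proof -
  show "mean_zero (3*(l*2^i)) (\<phi> i)" unfolding \<phi>_def[abs_def] E_def Nn_def[of i, symmetric] by (intro mean_zero_band g Nm) simp
  show "step (6*(l*2^i)) (\<phi> i)" using step_cexp[of "Nn (Suc i)" g] step_mono[OF step_cexp[of "Nn i" g] Nm[of i "Suc i"]]
   unfolding step_def \<phi>_def E_def NS(1)[symmetric] by auto
  show "0 <= x \<and> x < 512" if "\<phi> i x \<noteq> 0" for x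
  proof -
   have "E i x \<noteq> 0 \<or> E (Suc i) x \<noteq> 0" using that by (auto simp: \<phi>_def)
   then show ?thesis using supE by blast
  qed
 qed
 define eg where "eg i = (LBINT x. (E i x)\<^sup>2)" for i
 have nphi: "(LBINT x. (\<phi> i x)\<^sup>2) = eg (Suc i) - eg i" for i
  unfolding \<phi>_def eg_def E_def by (rule cexp_norm(2)[OF g(1) Nm]) simp
 have eg: "0 <= eg i" "eg i <= gg" for i unfolding gg_def by (auto simp: eg_def E_def cexp_norm(3)[OF g(1)])
 have tF: "tame (F j)" for j by (cases j) (auto simp: F0 FS intro: tame_zero tame_cexp f)
 have supF: "0 <= x \<and> x < 1" if "F j x \<noteq> 0" for j x
  using that cexp_support[of f 1 _ x] f(2) by (cases j) (auto simp: F0 FS)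
 define af where "af j = (LBINT x. (F j x)\<^sup>2)" for j
 have af: "0 <= af j" "af j <= ff" for j
  using cexp_norm(3)[OF f(1)] ff0 by (cases j; auto simp: af_def F0 FS ff_def)+
 have nD: "(LBINT x. (F (i+3) x - F i x)\<^sup>2) = af (i+3) - af i" for i
 proof (cases i)
  case 0 then show ?thesis by (simp add: af_def F0)
 next
  case (Suc j)
  have "i + 3 = Suc (j + 3)" using Suc by simp
  then show ?thesis unfolding af_def Suc FS by (simp only: add_Suc FS) (rule cexp_norm(2)[OF f(1) Nm], simp)
 qed
 have nU: "(LBINT x. (f x - F (i+3) x)\<^sup>2) <= ff" for i
 proof -
  have F3: "F (i+3) = cexp (Nn (i+2)) f" using FS[of "i+2"] by (simp add: numeral_3_eq_3)
  show ?thesis using cexp_norm(1)[OF f(1), of "Nn (i+2)"] af(1)[of "i+3"] unfolding af_def F3 ff_def by linarith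
 qed
 \<comment> \<open>Its square, 2^28 / 2^(2l + 2i), dominates the constants of
   \<open>mob_coarse\<close> and \<open>mob_fine\<close>. Consecutive values of \<open>Nn\<close>
   differ by at least about 2 l + 2 i, so the true decay is faster; the geometric factor is kept for
   the sum over i, and 2^(-l) makes the total small.\<close>
 define \<kappa> where "\<kappa> i = 2^14 / 2^l * (1/2::real)^i" for i
 have kap: "\<kappa> i >= 0" for i by (simp add: \<kappa>_def)
 have kap2: "2^26 / 2^(2*l) / 2^(2*i) * (4::real) = (\<kappa> i)\<^sup>2" for i
  by (simp add: \<kappa>_def power_mult_distrib power_divide power_mult[symmetric] mult.commute[of _ 2])
 have low: "\<bar>pairing (\<phi> i) (F i)\<bar> <= \<kappa> i * (gg + ff) / 2" for i
 proof (cases i)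
  case 0 then show ?thesis using kap gg0 ff0 by (simp add: F0 pairing_zero_right)
 next
  case (Suc j)
  have "(pairing (\<phi> i) (F i))\<^sup>2 <= 2^25 * 2^Nn j / 2^Nn i * (LBINT u. (\<phi> i u)\<^sup>2) * (LBINT x. (F i x)\<^sup>2)"
  proof (rule pairing_bound, rule mob_coarse[OF _ tphi _ tF])
   show "mean_zero (Nn i) (\<phi> i)" using phi(1)[of i] by (simp add: Nn_def)
   show "step (Nn j) (F i)" unfolding Suc FS by (rule step_cexp)
   show "Nn j + 4 <= Nn i" using NS(2)[of j] N12[of j] by (simp add: Suc)
  qed (use supF in auto)
  also have "\<dots> <= (\<kappa> i)\<^sup>2 * gg * ff"
  proof (intro mult_mono)
   have "2 * l + 2 * i + Nn j <= Nn i + 2"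
   proof -
    have "j + 1 <= 2^j" by (simp add: Suc_leI less_exp)
    then have "3 * (l * (j+1)) <= Nn j" unfolding Nn_def by (intro mult_le_mono2)
    moreover have "4 * j <= l * j" using l(3) by (intro mult_right_mono) auto
    moreover have "3 * (l * (j+1)) = 3 * (l * j) + 3 * l" by (simp add: algebra_simps)
    ultimately have "2 * l + 2 * j <= Nn j" by linarith
    then show ?thesis using NS(2)[of j] by (simp add: Suc)
   qed
   then have "(2::real)^(2*l + 2*i + Nn j) <= 2^(Nn i + 2)" by (intro power_increasing) auto
   then have "2^(2*l) * (2^(2*i) * 2^Nn j) <= 2^Nn i * (4::real)" by (simp add: power_add)
   then have "2^25 * (2^(2*l) * (2^(2*i) * 2^Nn j)) <= 2^26 * (2^Nn i * (4::real))" by (intro mult_mono[where a="2^25" and b="2^26"]) auto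
   then have "2^25 * (2::real)^Nn j / 2^Nn i <= 2^26 / 2^(2*l) / 2^(2*i) * 4" by (simp add: divide_simps mult_ac)
   then show "2^25 * (2::real)^Nn j / 2^Nn i <= (\<kappa> i)\<^sup>2" by (simp only: kap2)
   show "(LBINT u. (\<phi> i u)\<^sup>2) <= gg" unfolding nphi using eg(1)[of i] eg(2)[of "Suc i"] by linarith
   show "(LBINT x. (F i x)\<^sup>2) <= ff" using af(2)[of i] by (simp add: af_def)
  qed (auto simp: gg0)
  finally show ?thesis by (rule abs_le_mean[OF _ kap gg0 ff0])
 qed
 have high: "\<bar>pairing (\<phi> i) (%x. f x - F (i+3) x)\<bar> <= \<kappa> i * (gg + ff) / 2" for i
 proof -
  have F3: "F (i+3) = cexp (Nn (i+2)) f" using FS[of "i+2"] by (simp add: numeral_3_eq_3)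
  have "(pairing (\<phi> i) (%x. f x - F (i+3) x))\<^sup>2 <= 2^14 * 2^Nn (Suc i) / 2^Nn (i+2) * (LBINT u. (\<phi> i u)\<^sup>2) * (LBINT x. (f x - F (i+3) x)\<^sup>2)"
  proof (rule pairing_bound, rule mob_fine[OF _ tphi _ tame_diff[OF f(1) tF]])
   show "step (Nn (Suc i)) (\<phi> i)" unfolding NS(1) by (rule phi(2))
   show "mean_zero (Nn (i+2)) (%x. f x - F (i+3) x)" unfolding F3 by (rule mean_zero_cexp[OF f(1)])
   show "Nn (Suc i) + 8 <= Nn (i+2)" using NS(2)[of "Suc i"] N12[of "Suc i"] by simp
   show "0 <= x \<and> x < 1" if "f x - F (i+3) x \<noteq> 0" for x
   proof -
    have "f x \<noteq> 0 \<or> F (i+3) x \<noteq> 0" using that by auto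
    then show ?thesis using f(2) supF by blast
   qed
  qed
  also have "\<dots> <= (\<kappa> i)\<^sup>2 * gg * ff"
  proof (intro mult_mono nU)
   have "2 * l + 2 * i + Nn (Suc i) <= Nn (i+2) + 2"
   proof -
    have "i + 1 <= 2^i" by (simp add: Suc_leI less_exp)
    then have "6 * (l * (i+1)) <= Nn (Suc i)" unfolding NS(1) by (intro mult_le_mono2)
    moreover have "4 * i <= l * i" using l(3) by (intro mult_right_mono) auto
    moreover have "6 * (l * (i+1)) = 6 * (l * i) + 6 * l" by (simp add: algebra_simps)
    ultimately have "2 * l + 2 * i <= Nn (Suc i)" by linarith
    then show ?thesis using NS(2)[of "Suc i"] by simp
   qed
   then have "(2::real)^(2*l + 2*i + Nn (Suc i)) <= 2^(Nn (i+2) + 2)" by (intro power_increasing) auto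
   then have "2^(2*l) * (2^(2*i) * 2^Nn (Suc i)) <= 2^Nn (i+2) * (4::real)" by (simp add: power_add)
   then have "2^14 * (2^(2*l) * (2^(2*i) * 2^Nn (Suc i))) <= 2^26 * (2^Nn (i+2) * (4::real))" by (intro mult_mono[where a="2^14" and b="2^26"]) auto
   then have "2^14 * (2::real)^Nn (Suc i) / 2^Nn (i+2) <= 2^26 / 2^(2*l) / 2^(2*i) * 4" by (simp add: divide_simps mult_ac)
   then show "2^14 * (2::real)^Nn (Suc i) / 2^Nn (i+2) <= (\<kappa> i)\<^sup>2" by (simp only: kap2)
   show "(LBINT u. (\<phi> i u)\<^sup>2) <= gg" unfolding nphi using eg(1)[of i] eg(2)[of "Suc i"] by linarith
  qed (auto simp: gg0)
  finally show ?thesis by (rule abs_le_mean[OF _ kap gg0 ff0])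
 qed
 define \<rho> where "\<rho> = sqrt (band_gain CD)"
 have rho: "\<rho> >= 0" "\<rho>\<^sup>2 = band_gain CD" using band_gain_nonneg by (simp_all add: \<rho>_def)
 \<comment> \<open>Each band of f occurs for three consecutive indices and each band of g for one.
   Since the squared norms are differences of energies, their sums over i telescope to at most three
   times the energy of f and once that of g.\<close>
 have mid: "\<bar>pairing (\<phi> i) (%x. F (i+3) x - F i x)\<bar> <= \<rho> * ((eg (Suc i) - eg i) + (af (i+3) - af i)) / 2" for i
 proof (rule abs_le_mean)
  have "0 <= x \<and> x < 1" if "F (i+3) x - F i x \<noteq> 0" for x
  proof -
   have "F (i+3) x \<noteq> 0 \<or> F i x \<noteq> 0" using that by auto
   then show ?thesis using supF by blast
  qed
  then show "(pairing (\<phi> i) (%x. F (i+3) x - F i x))\<^sup>2 <= \<rho>\<^sup>2 * (eg (Suc i) - eg i) * (af (i+3) - af i)"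
   unfolding rho(2) nphi[symmetric] nD[symmetric]
   by (intro pairing_band[OF l CD tphi phi(1) phi(3) phi(2) tame_diff[OF tF tF]])
  show "0 <= eg (Suc i) - eg i" unfolding nphi[symmetric] by simp
  show "0 <= af (i+3) - af i" unfolding nD[symmetric] by simp
 qed (rule rho)
 have each: "\<bar>pairing (\<phi> i) f\<bar> <= \<kappa> i * (gg + ff) + \<rho> * ((eg (Suc i) - eg i) + (af (i+3) - af i)) / 2" for i
 proof -
  have "pairing (\<phi> i) f = pairing (\<phi> i) (%x. F i x + ((F (i+3) x - F i x) + (f x - F (i+3) x)))" by simp
  also have "\<dots> = pairing (\<phi> i) (F i) + (pairing (\<phi> i) (%x. F (i+3) x - F i x) + pairing (\<phi> i) (%x. f x - F (i+3) x))"
   by (subst pairing_add_right; (subst pairing_add_right)?; (intro tame_add tame_diff tphi tF f)?; simp?)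
  finally show ?thesis using low[of i] mid[of i] high[of i] by linarith
 qed
 \<comment> \<open>The coarse part of g is not contracted, only bounded, through the factor 4 of
   \<open>push\<close>. The unequal weights suit the application, where \<open>eg 0\<close> is tiny
   and \<open>ff\<close> is not.\<close>
 have zero: "\<bar>pairing (E 0) f\<bar> <= 64 * eg 0 + ff / 64"
 proof -
  have "(pairing (E 0) f)\<^sup>2 <= 4 * eg 0 * ff"
  proof (rule pairing_bound)
   fix s assume s: "s \<in> S"
   have i: "(%x. (ind {0..1} x * E 0 (mob s x))\<^sup>2) = (%x. ind {0..1} x * (E 0 (mob s x))\<^sup>2)"
    by (auto simp: indicator_def)
   have "(LBINT x. E 0 (mob s x) * f x) = (LBINT x. (ind {0..1} x * E 0 (mob s x)) * f x)"
   proof (rule lint_cong[OF refl])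
    show "E 0 (mob s x) * f x = (ind {0..1} x * E 0 (mob s x)) * f x" for x
     using f(2)[of x] by (cases "f x = 0") auto
   qed
   then have "(LBINT x. E 0 (mob s x) * f x)\<^sup>2 <= (LBINT x. (ind {0..1} x * E 0 (mob s x))\<^sup>2) * ff"
    unfolding ff_def using tame_CauchySchwarz[OF mob_pull[OF s tE[of 0]] f(1)] by simp
   also have "\<dots> <= 4 * eg 0 * ff"
    unfolding i eg_def by (intro mult_right_mono mob_push[OF s tame_power2[OF tE]] ff0) simp
   finally show "(LBINT x. E 0 (mob s x) * f x)\<^sup>2 <= 4 * eg 0 * ff" .
  qed
  then have "(pairing (E 0) f)\<^sup>2 <= 2\<^sup>2 * (64 * eg 0) * (ff / 64)" by (simp add: mult_ac)
  then have "\<bar>pairing (E 0) f\<bar> <= 2 * (64 * eg 0 + ff / 64) / 2" by (rule abs_le_mean) (use eg ff0 in auto)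
  then show ?thesis by simp
 qed
 \<comment> \<open>The decomposition is finite because g is a step function of level n and n <=
   \<open>Nn n\<close>.\<close>
 have dec: "g = (%x. E 0 x + (\<Sum>i\<in>{..<n}. \<phi> i x))"
 proof
  fix x
  have "(\<Sum>i\<in>{..<n}. \<phi> i x) = E n x - E 0 x" unfolding \<phi>_def by (rule sum_lessThan_telescope)
  moreover have "n <= Nn n"
  proof -
   have "n <= 2^n" by simp
   also have "(2::nat)^n <= Nn n" using l(3) by (simp add: Nn_def)
   finally show ?thesis .
  qed
  then have "E n = g" unfolding E_def by (rule cexp_step[OF g(2)])
  ultimately show "g x = E 0 x + (\<Sum>i\<in>{..<n}. \<phi> i x)" by simp
 qed
 have "pairing g f = pairing (E 0) f + pairing (%x. \<Sum>i\<in>{..<n}. \<phi> i x) f"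
  by (subst dec) (intro pairing_add_left tE tame_sum tphi f)
 also have "pairing (%x. \<Sum>i\<in>{..<n}. \<phi> i x) f = (\<Sum>i\<in>{..<n}. pairing (\<phi> i) f)"
  by (intro pairing_sum_left tphi f) simp
 finally have "\<bar>pairing g f\<bar> <= \<bar>pairing (E 0) f\<bar> + \<bar>\<Sum>i\<in>{..<n}. pairing (\<phi> i) f\<bar>" by simp
 also have "\<bar>\<Sum>i\<in>{..<n}. pairing (\<phi> i) f\<bar> <= (\<Sum>i\<in>{..<n}. \<kappa> i * (gg + ff) + \<rho> * ((eg (Suc i) - eg i) + (af (i+3) - af i)) / 2)"
  by (rule order_trans[OF sum_abs]) (intro sum_mono each)
 also have "\<dots> = 2^14 / 2^l * (\<Sum>i<n. (1/2::real)^i) * (gg + ff) + \<rho> * ((\<Sum>i<n. eg (Suc i) - eg i) + (\<Sum>i<n. af (i+3) - af i)) / 2"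
  unfolding \<kappa>_def sum.distrib by (simp only: sum_distrib_left sum_distrib_right sum_divide_distrib sum.distrib[symmetric])
 also have "\<dots> <= 2^14 / 2^l * 2 * (gg + ff) + \<rho> * (gg + 3 * ff) / 2"
 proof (intro add_mono mult_mono divide_right_mono)
  show "(\<Sum>i<n. eg (Suc i) - eg i) <= gg" unfolding sum_lessThan_telescope using eg(1)[of 0] eg(2)[of n] by linarith
  show "(\<Sum>i<n. af (i+3) - af i) <= 3 * ff" by (rule sum_telescope3) (use af in auto)
  have "0 <= (\<Sum>i<n. eg (Suc i) - eg i)" by (rule sum_nonneg) (simp flip: nphi)
  moreover have "0 <= (\<Sum>i<n. af (i+3) - af i)" by (rule sum_nonneg) (simp flip: nD)
  ultimately show "0 <= (\<Sum>i<n. eg (Suc i) - eg i) + (\<Sum>i<n. af (i+3) - af i)" by simp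
 qed (use gg0 ff0 rho sum_geometric_half in \<open>auto intro!: sum_nonneg\<close>)
 also have "\<dots> <= (2 * \<rho> + 2^15 / 2^l) * (gg + ff)"
 proof -
  have "\<rho> * (gg + 3 * ff) <= \<rho> * (4 * (gg + ff))" using gg0 ff0 rho by (intro mult_left_mono) auto
  then have "\<rho> * (gg + 3 * ff) / 2 <= 2 * \<rho> * (gg + ff)" by (simp add: algebra_simps)
  moreover have "2^14 / 2^l * 2 * (gg + ff) = 2^15 / 2^l * (gg + ff)" by simp
  ultimately show ?thesis unfolding distrib_right[of "2*\<rho>"] by linarith
 qed
 finally have "\<bar>pairing g f\<bar> <= \<bar>pairing (E 0) f\<bar> + (2 * \<rho> + 2^15 / 2^l) * (gg + ff)" by simp
 moreover have "eg 0 = (LBINT x. (cexp (3*l) g x)\<^sup>2)" by (simp add: eg_def E_def Nn_def)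
 ultimately show ?thesis using zero unfolding gg_def ff_def \<rho>_def by simp
qed

end

section \<open>Expansion of compact sets\<close>

lemma fl_scale: "fl (j+9) (u / 512) = fl j u / 512"
 by (simp add: fl_def power_add mult.commute)

lemma indicator_fl: "0 <= fl j u \<longleftrightarrow> 0 <= u" "fl j u < real K \<longleftrightarrow> u < real K"
proof -
 have "0 <= fl j u \<longleftrightarrow> real_of_int 0 <= real_of_int \<lfloor>2^j * u\<rfloor>" by (simp add: fl_def divide_simps)
 also have "\<dots> \<longleftrightarrow> 2^j * 0 <= 2^j * u" by (simp only: of_int_le_iff zero_le_floor mult_zero_right)
 also have "\<dots> \<longleftrightarrow> 0 <= u" by (rule mult_le_cancel_left_pos) simp
 finally show "0 <= fl j u \<longleftrightarrow> 0 <= u" .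
 have "fl j u < real K \<longleftrightarrow> real_of_int \<lfloor>2^j * u\<rfloor> < real_of_int (2^j * int K)" by (simp add: fl_def divide_simps mult.commute)
 also have "\<dots> \<longleftrightarrow> 2^j * u < real_of_int (2^j * int K)" by (simp only: of_int_less_iff floor_less_iff)
 also have "\<dots> \<longleftrightarrow> u < real K" by simp
 finally show "fl j u < real K \<longleftrightarrow> u < real K" .
qed

text \<open>The unions of the dyadic cells that meet K decrease to K because K is closed, so their
  measures converge to that of K. A dyadic set is needed since \<open>pairing_decay\<close> asks for
  a step function. The level j + 9 becomes j after stretching by 512 = 2^9. The point 1 lies in no
  cell of [0, 1) and is given up.\<close>

lemma compact_dyadic_cover:
 assumes K: "compact (K :: real set)" "K \<subseteq> {0..1}" and d: "\<delta> > 0"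
 obtains V j where "step (j+9) (ind V)" "V \<subseteq> {0..<1}" "K \<inter> {0..<1} \<subseteq> V" "V \<in> sets borel"
  "measure lborel V <= measure lborel K + \<delta>"
proof -
 define V where "V J = {x. 0 <= x \<and> x < 1 \<and> (\<exists>y\<in>K. fl J y = fl J x)}" for J
 have st: "step J (ind (V J))" for J
  using indicator_fl(1)[of J] indicator_fl(2)[of J _ 1] fl_fl[of J J] by (auto simp: step_def V_def indicator_def)
 have bV: "V J \<in> sets borel" for J
  using step_measurable[OF st[of J]] by (simp add: borel_measurable_indicator_iff)
 have V01: "V J \<subseteq> {0..<1}" for J by (auto simp: V_def)
 have fin: "emeasure lborel (V J) \<noteq> \<infinity>" for J
  using emeasure_mono[OF V01[of J], of lborel] by (auto simp: top_unique)
 have dec: "decseq V"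
 proof (rule decseq_SucI)
  show "V (Suc n) \<subseteq> V n" for n unfolding V_def using fl_fl[of n "Suc n"] by (auto; metis)
 qed
 have sub: "(\<Inter>J. V J) \<subseteq> K"
 proof
  fix x assume x: "x \<in> (\<Inter>J. V J)"
  have "\<exists>y\<in>K. dist y x < e" if e: "e > 0" for e
  proof -
   obtain J where J: "(1/2)^J < e" using real_arch_pow_inv[OF e, of "1/2"] by auto
   obtain y where y: "y \<in> K" "fl J y = fl J x" using x by (auto simp: V_def)
   have "\<bar>y - x\<bar> <= 1 / 2^J" using fl_le[of J y] fl_gt[of y J] fl_le[of J x] fl_gt[of x J] y(2) by linarith
   then show ?thesis using y(1) J by (intro bexI[of _ y]) (auto simp: dist_real_def power_one_over)
  qed
  then have "x \<in> closure K" by (simp add: closure_approachable)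
  then show "x \<in> K" using compact_imp_closed[OF K(1)] by simp
 qed
 have Kb: "K \<in> sets borel" using K(1) by (simp add: compact_imp_closed borel_closed)
 have fK: "emeasure lborel K < \<infinity>" using K(1) by (rule emeasure_compact_finite)
 have "(%n. measure lborel (V n)) \<longlonglongrightarrow> measure lborel (\<Inter>i. V i)"
  by (rule Lim_measure_decseq[OF _ dec fin]) (use bV in auto)
 moreover have "measure lborel (\<Inter>i. V i) <= measure lborel K"
  by (rule measure_mono_fmeasurable[OF sub]) (use bV Kb fK in \<open>auto simp: fmeasurable_def\<close>)
 ultimately have "eventually (%n. measure lborel (V n) < measure lborel K + \<delta>) sequentially"
  using d by (intro order_tendstoD(2)) auto
 then obtain n0 where n0: "\<And>n. n >= n0 ==> measure lborel (V n) < measure lborel K + \<delta>" by (auto simp: eventually_sequentially)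
 show ?thesis
 proof (rule that[of n0 "V (n0+9)"])
  show "K \<inter> {0..<1} \<subseteq> V (n0+9)" by (auto simp: V_def)
  show "measure lborel (V (n0+9)) <= measure lborel K + \<delta>" using n0[of "n0+9"] by simp
 qed (use st V01 bV in auto)
qed

lemma integral_affine: "\<beta> > 0 ==> (LBINT x. F x) = \<beta> * (LBINT x. F (t + \<beta> * x))" for F :: "real \<Rightarrow> real"
 using lborel_integral_real_affine[of \<beta> F t] by simp

context generators
begin

text \<open>All three kinds of maps are stored as integral matrices with nonnegative entries, so
  that one evaluation procedure serves them all. Multiplying the bottom row by 512 divides the value
  by 512.\<close>

definition family :: "nat \<Rightarrow> imat set" where
 "family N = insert (1,0,0,1) ((%j. (1, j, 0, 2^N)) ` {0..<2^N} \<union> (%(a,b,c,d). (a,b,512*c,512*d)) ` S)"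

lemma family_mob:
 shows "mob (1,0,0,1) x = x" "mob (1,j,0,2^N) x = (x + real_of_int j) / 2^N"
  and "(case s of (a,b,c,d) \<Rightarrow> mob (a,b,512*c,512*d) x) = mob s x / 512"
proof -
 show "mob (1,0,0,1) x = x" "mob (1,j,0,2^N) x = (x + real_of_int j) / 2^N" by (simp_all add: mob_def)
 obtain a b c d where e: "s = (a,b,c,d)" by (metis prod.collapse)
 have "real_of_int (512*c) * x + real_of_int (512*d) = 512 * (real_of_int c * x + real_of_int d)" by (simp add: algebra_simps)
 then show "(case s of (a,b,c,d) \<Rightarrow> mob (a,b,512*c,512*d) x) = mob s x / 512"
  unfolding e mob_def by simp
qed

text \<open>Suppose that only \<beta> <= \<eta> \<alpha> of the image lies outside K, where \<alpha>
  is the measure of K. Nearly all of K is then mapped into K by every generator, so the balanced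
  indicator of the covering V pairs with the indicator of V to about \<alpha> - \<alpha>^2, which is
  above \<alpha> / 4 because \<alpha> <= 1/2. On the other hand K is equidistributed among the cells
  of length 2^(-N), so the balanced indicator has almost no coarse part and
  \<open>pairing_decay\<close> bounds the same pairing by 3 \<alpha> / 20.\<close>

lemma compact_expansion:
 assumes l: "real_of_int p <= 2^(3*l)" "2^(3*l) <= 8 * real_of_int p" "l >= 4"
  and CD: "CD > 0" "\<And>m. m > 0 ==> divs m ^ 192 <= CD * m"
  and small: "2 * sqrt (band_gain CD) + 2^15 / 2^l <= 1 / 20000"
  and K: "compact K" "K \<subseteq> {0..1}" "measure lborel K <= 1/2" "measure lborel K > 0"
 defines "N \<equiv> 3 * l + 9"
 defines "PK \<equiv> (\<Union>q\<in>family N. mob q ` K)"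
 assumes PK: "PK \<in> sets borel" "PK \<subseteq> {0..1}"
 shows "measure lborel (PK - K) >= measure lborel K / 2^(2*N+16)"
proof (rule ccontr)
 define \<eta> where "\<eta> = 1 / (2::real)^(2*N+16)"
 define \<alpha> where "\<alpha> = measure lborel K"
 define \<beta> where "\<beta> = measure lborel (PK - K)"
 assume "\<not> ?thesis"
 then have be: "\<beta> <= \<eta> * \<alpha>" by (simp add: \<beta>_def \<eta>_def \<alpha>_def)
 have al: "\<alpha> > 0" "\<alpha> <= 1/2" using K by (simp_all add: \<alpha>_def)
 have et: "\<eta> > 0" by (simp add: \<eta>_def)
 obtain V j where V: "step (j+9) (ind V)" "V \<subseteq> {0..<1}" "K \<inter> {0..<1} \<subseteq> V" "V \<in> sets borel" "measure lborel V <= \<alpha> + \<eta> * \<alpha>"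
  using compact_dyadic_cover[OF K(1,2), of "\<eta> * \<alpha>"] et al unfolding \<alpha>_def by (metis mult_pos_pos)
 have Kb: "K \<in> sets borel" using K(1) by (simp add: compact_imp_closed borel_closed)
 define D where "D = PK - K"
 have Db: "D \<in> sets borel" using PK(1) Kb by (simp add: D_def)
 have bnd: "bounded K" "bounded D" "bounded V" "bounded PK"
 proof -
  have b: "bounded {0..1::real}" by simp
  have "D \<subseteq> {0..1}" "V \<subseteq> {0..1}" using PK(2) V(2) by (auto simp: D_def)
  then show "bounded K" "bounded D" "bounded V" "bounded PK" using bounded_subset[OF b] K(2) PK(2) by blast+
 qed
 have tK: "tame (ind K)" and tD: "tame (ind D)" and tV: "tame (ind V)" and tPK: "tame (ind PK)"
  by (intro tame_indicator Kb Db V PK bnd)+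
 have iK: "(LBINT x. ind K x) = \<alpha>" and iD: "(LBINT x. ind D x) = \<beta>"
  and iV: "(LBINT x. ind V x) = measure lborel V"
  using Kb Db V(4) by (simp_all add: \<alpha>_def \<beta>_def D_def)
 have inPK: "mob q x \<in> PK" if "q \<in> family N" "x \<in> K" for q x unfolding PK_def using that by blast
 have KPK: "K \<subseteq> PK" using inPK[of "(1,0,0,1)"] family_mob(1) by (auto simp: family_def)
 have PKe: "ind PK x = ind K x + ind D x" for x
  using KPK by (auto simp: D_def indicator_def)
 have KV: "ind K x <= ind V x + ind {1} x" for x
 proof (cases "x \<in> K \<and> x \<noteq> 1")
  case True
  then have "x \<in> K \<inter> {0..<1}" using K(2) by force
  then show ?thesis using V(3) by (auto simp: indicator_def)
 qed (auto simp: indicator_def)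
 have null1: "(LBINT x. ind {1::real} x) = 0" by simp
 have t1: "tame (ind {1::real})" by (rule tame_indicator) auto
 have VK: "measure lborel V >= \<alpha>"
 proof -
  have "\<alpha> <= (LBINT x. ind V x + ind {1} x)" unfolding iK[symmetric]
   by (intro lint_mono tame_integrable tK tame_add tV t1 KV)
  also have "\<dots> = measure lborel V" using lint_add[OF tame_integrable[OF tV] tame_integrable[OF t1]] null1 iV by simp
  finally show ?thesis .
 qed
 define I where "I i = cell N (int i)" for i
 have I01: "x / 1 \<in> I i \<longleftrightarrow> real i <= 2^N * x \<and> 2^N * x < real i + 1" for x i
  by (auto simp: I_def cell_def divide_simps mult.commute)
 have tI: "tame (ind (I i))" for i unfolding I_def by (rule tame_cell)
 define mK where "mK i = (LBINT x. ind K x * ind (I i) x)" for i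
 define mV where "mV i = (LBINT x. ind V x * ind (I i) x)" for i
 \<comment> \<open>The map x |-> (x + i) / 2^N puts a copy of K, of measure \<alpha> / 2^N, into the
   i-th cell, and at most \<beta> of it lies outside K.\<close>
 have lowK: "mK i >= \<alpha> / 2^N - \<beta>" if i: "i < 2^N" for i
 proof -
  have tPI: "tame (%x. ind PK x * ind (I i) x)" by (intro tame_mult_tame tPK tI)
  have aff: "(LBINT x. ind PK x * ind (I i) x)
   = (1/2^N) * (LBINT x. ind PK (real i / 2^N + (1/2^N) * x) * ind (I i) (real i / 2^N + (1/2^N) * x))"
   by (rule integral_affine) simp
  have "\<alpha> <= (LBINT x. ind PK (real i / 2^N + (1/2^N) * x) * ind (I i) (real i / 2^N + (1/2^N) * x) + ind {1} x)"
   unfolding iK[symmetric]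
  proof (rule lint_mono)
   show "integrable lborel (ind K)" by (rule tame_integrable[OF tK])
   have "integrable lborel (%x. ind PK (real i / 2^N + (1/2^N) * x) * ind (I i) (real i / 2^N + (1/2^N) * x))"
    by (rule lborel_integrable_real_affine[OF tame_integrable[OF tPI]]) simp
   then show "integrable lborel (%x. ind PK (real i / 2^N + (1/2^N) * x) * ind (I i) (real i / 2^N + (1/2^N) * x) + ind {1} x)"
    by (rule Bochner_Integration.integrable_add) (rule tame_integrable[OF t1])
   fix x
   show "ind K x <= ind PK (real i / 2^N + (1/2^N) * x) * ind (I i) (real i / 2^N + (1/2^N) * x) + ind {1} x"
   proof (cases "x \<in> K \<and> x \<noteq> 1")
    case True
    have "(1, int i, 0, 2^N) \<in> family N" using i by (auto simp: family_def)
    then have "(x + real i) / 2^N \<in> PK" using inPK[of "(1, int i, 0, 2^N)" x] True family_mob(2)[of "int i" N x] by simp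
    moreover have "0 <= x" "x < 1" using True K(2) by force+
    then have "(x + real i) / 2^N \<in> I i" by (auto simp: I_def cell_def divide_simps)
    moreover have "real i / 2^N + (1/2^N) * x = (x + real i) / 2^N" by (simp add: add_divide_distrib)
    ultimately show ?thesis by (simp add: indicator_def)
   qed (auto simp: indicator_def)
  qed
  also have "\<dots> = (LBINT x. ind PK (real i / 2^N + (1/2^N) * x) * ind (I i) (real i / 2^N + (1/2^N) * x)) + (LBINT x. ind {1::real} x)"
   by (rule lint_add[OF lborel_integrable_real_affine[OF tame_integrable[OF tPI]] tame_integrable[OF t1]]) simp
  finally have a: "\<alpha> / 2^N <= (LBINT x. ind PK x * ind (I i) x)" unfolding aff null1 by (simp add: divide_right_mono)
  have "(LBINT x. ind PK x * ind (I i) x) = mK i + (LBINT x. ind D x * ind (I i) x)"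
   unfolding PKe distrib_right mK_def by (intro lint_add tame_integrable tame_mult_tame tK tD tI)
  moreover have "(LBINT x. ind D x * ind (I i) x) <= \<beta>" unfolding iD[symmetric]
   by (intro lint_mono tame_integrable tame_mult_tame tD tI) (auto simp: indicator_def)
  ultimately show ?thesis using a by linarith
 qed
 have VKI: "mK i <= mV i" "mV i <= mK i + \<eta> * \<alpha>" for i
 proof -
  have "mK i <= (LBINT x. ind V x * ind (I i) x + ind {1} x)" unfolding mK_def
  proof (intro lint_mono tame_integrable tame_mult_tame tame_add tK tV t1 tI)
   show "ind K x * ind (I i) x <= ind V x * ind (I i) x + ind {1} x" for x
    using KV[of x] by (cases "x \<in> V"; cases "x = 1"; cases "x \<in> K") (auto simp: indicator_def)
  qed
  also have "\<dots> = mV i"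
   using lint_add[OF tame_integrable[OF tame_mult_tame[OF tV tI]] tame_integrable[OF t1], of i] null1 by (simp add: mV_def)
  finally show "mK i <= mV i" .
  have "(LBINT x. ind V x * ind (I i) x + ind K x)
   <= (LBINT x. (ind V x + ind K x * ind (I i) x) + ind {1} x)"
  proof (intro lint_mono tame_integrable tame_mult_tame tame_add tK tV t1 tI)
   show "ind V x * ind (I i) x + ind K x <= (ind V x + ind K x * ind (I i) x) + ind {1} x" for x
    using KV[of x] by (cases "x \<in> V"; cases "x = 1"; cases "x \<in> K") (auto simp: indicator_def)
  qed
  moreover have "(LBINT x. ind V x * ind (I i) x + ind K x) = mV i + \<alpha>"
   unfolding mV_def iK[symmetric] by (intro lint_add tame_integrable tame_mult_tame tV tI tK)
  moreover have "(LBINT x. (ind V x + ind K x * ind (I i) x) + ind {1} x)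
   = (LBINT x. (ind V x + ind K x * ind (I i) x)) + (LBINT x. ind {1::real} x)"
   by (intro lint_add tame_integrable tame_mult_tame tame_add tV tI tK t1)
  moreover have "(LBINT x. (ind V x + ind K x * ind (I i) x)) = measure lborel V + mK i"
   unfolding mK_def iV[symmetric] by (intro lint_add tame_integrable tame_mult_tame tV tI tK)
  ultimately show "mV i <= mK i + \<eta> * \<alpha>" using V(5) null1 by linarith
 qed
 \<comment> \<open>All other cells already hold at least their share, which leaves no more than this
   for the i-th.\<close>
 have upK: "mK i <= \<alpha> / 2^N + 2^N * \<beta>" if i: "i < 2^N" for i
 proof -
  have "(\<Sum>i'<2^N. mK i') = (LBINT x. (\<Sum>i'<2^N. ind K x * ind (I i') x))"
   unfolding mK_def by (intro lint_sum[symmetric] tame_integrable tame_mult_tame tK tI)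
  also have "\<dots> <= \<alpha>" unfolding iK[symmetric]
  proof (intro lint_mono tame_integrable tame_sum tame_mult_tame tK tI)
   fix x
   have "(\<Sum>i'<2^N. ind (I i') x) <= (\<Sum>i'<2^N. if i' = nat \<lfloor>2^N * x\<rfloor> then 1 else (0::real))"
    by (intro sum_mono) (auto simp: I_def in_cell_iff indicator_def)
   also have "\<dots> <= 1" by (simp add: sum.delta)
   finally have "ind K x * (\<Sum>i'<2^N. ind (I i') x) <= ind K x * 1" by (intro mult_left_mono) auto
   then show "(\<Sum>i'<2^N. ind K x * ind (I i') x) <= ind K x" by (simp add: sum_distrib_left)
  qed
  finally have le: "(\<Sum>i'<2^N. mK i') <= \<alpha>" .
  have "(\<Sum>i'<2^N. mK i') = mK i + (\<Sum>i'\<in>{..<2^N} - {i}. mK i')" using i by (intro sum.remove) auto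
  moreover have "(\<Sum>i'\<in>{..<2^N} - {i}. \<alpha> / 2^N - \<beta>) <= (\<Sum>i'\<in>{..<2^N} - {i}. mK i')" by (intro sum_mono lowK) auto
  moreover have "(\<Sum>i'\<in>{..<2^N} - {i}. \<alpha> / 2^N - \<beta>) = (2^N - 1) * (\<alpha> / 2^N - \<beta>)"
   using i by (simp add: of_nat_diff)
  moreover have "(2^N - 1) * (\<alpha> / 2^N - \<beta>) = \<alpha> - \<alpha> / 2^N - 2^N * \<beta> + \<beta>" by (simp add: field_simps)
  moreover have "\<beta> >= 0" by (simp add: \<beta>_def)
  ultimately show ?thesis using le by linarith
 qed
 have dev: "\<bar>mV i - \<alpha> / 2^N\<bar> <= 2^(N+1) * (\<eta> * \<alpha>)" if i: "i < 2^N" for i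
 proof -
  have b: "\<beta> <= 2^N * \<beta>" "2^N * \<beta> <= 2^N * (\<eta> * \<alpha>)" "\<eta> * \<alpha> <= 2^N * (\<eta> * \<alpha>)"
   using be et al mult_right_mono[of 1 "2^N" \<beta>] mult_right_mono[of 1 "2^N" "\<eta> * \<alpha>"] by (auto simp: \<beta>_def)
  moreover have "(2::real)^(N+1) * (\<eta> * \<alpha>) = 2 * (2^N * (\<eta> * \<alpha>))" by simp
  ultimately show ?thesis using lowK[OF i] upK[OF i] VKI[of i] unfolding abs_le_iff by linarith
 qed
 \<comment> \<open>The family contains \<open>mob s\<close> divided by 512; stretching V to [0, 512)
   instead makes g compatible with \<open>mob s\<close> itself. Cells of level 3 l for g correspond
   to cells of level N = 3 l + 9 for V.\<close>
 define g where "g u = ind {0..<512::real} u * (ind V (u / 512) - \<alpha>)" for u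
 have [measurable]: "ind V \<in> borel_measurable borel" using V(4) by simp
 have tg: "tame g" unfolding g_def[abs_def]
 proof (rule tame_mult[OF tame_indicator, where B=1])
  show "\<bar>ind V (v / 512) - \<alpha>\<bar> <= 1" for v using al by (auto simp: indicator_def)
 qed auto
 have sg: "step j g"
 proof -
  have "ind V (u / 512) = ind V (fl j u / 512)" for u
   using V(1) unfolding step_def by (metis fl_scale)
  moreover have "ind {0..<512::real} u = ind {0..<512::real} (fl j u)" for u
   using indicator_fl(1)[of j u] indicator_fl(2)[of j u 512] by (simp add: indicator_def)
  ultimately show ?thesis unfolding step_def g_def by metis
 qed
 have supg: "0 <= x \<and> x < 512" if "g x \<noteq> 0" for x using that by (auto simp: g_def indicator_def split: if_splits)
 have supV: "0 <= x \<and> x < 1" if "ind V x \<noteq> 0" for x using that V(2) by (auto simp: indicator_def split: if_splits)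
 have decay: "\<bar>pairing g (ind V)\<bar> <= 64 * (LBINT x. (cexp (3*l) g x)\<^sup>2) + (LBINT x. (ind V x)\<^sup>2) / 64
  + (2 * sqrt (band_gain CD) + 2^15 / 2^l) * ((LBINT x. (g x)\<^sup>2) + (LBINT x. (ind V x)\<^sup>2))"
  by (rule pairing_decay[OF l CD tg sg supg tV supV])
 have V2: "measure lborel V <= 2 * \<alpha>"
 proof -
  have "\<eta> <= 1" by (simp add: \<eta>_def)
  then have "\<eta> * \<alpha> <= 1 * \<alpha>" using al by (intro mult_right_mono) auto
  then show ?thesis using V(5) by linarith
 qed
 have iV2: "(LBINT x. (ind V x)\<^sup>2) = measure lborel V"
  unfolding iV[symmetric] by (rule lint_cong) (auto simp: indicator_def)
 have i512: "(LBINT x. ind {0..<512::real} x) = 512" by simp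
 have t512: "tame (ind {0..<512::real})" by (rule tame_indicator) auto
 have tV512: "tame (%u. ind {0..<512::real} u * ind V (u / 512))"
  by (rule tame_mult[OF t512, where B=1]) auto
 have iV512: "(LBINT u. ind {0..<512::real} u * ind V (u / 512)) = 512 * measure lborel V"
 proof -
  have "(LBINT u. ind {0..<512::real} u * ind V (u / 512)) = 512 * (LBINT x. ind {0..<512::real} (0 + 512 * x) * ind V ((0 + 512 * x) / 512))"
   by (rule integral_affine) simp
  also have "(%x. ind {0..<512::real} (0 + 512 * x) * ind V ((0 + 512 * x) / 512)) = ind V"
   using V(2) by (auto simp: indicator_def fun_eq_iff)
  finally show ?thesis using iV by simp
 qed
 have gg: "(LBINT x. (g x)\<^sup>2) <= 1300 * \<alpha>"
 proof -
  have "(LBINT x. (g x)\<^sup>2) <= (LBINT u. ind {0..<512::real} u * ind V (u / 512) + \<alpha>\<^sup>2 * ind {0..<512::real} u)"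
  proof (intro lint_mono tame_integrable tame_power2 tg tame_add tame_cmult t512 tV512)
   fix x
   have "(1 - \<alpha>)\<^sup>2 <= 1 + \<alpha>\<^sup>2" using al by (simp add: power2_diff)
   then show "(g x)\<^sup>2 <= ind {0..<512::real} x * ind V (x / 512) + \<alpha>\<^sup>2 * ind {0..<512::real} x"
    by (auto simp: g_def indicator_def)
  qed
  also have "\<dots> = (LBINT u. ind {0..<512::real} u * ind V (u / 512)) + (LBINT u. \<alpha>\<^sup>2 * ind {0..<512::real} u)"
   by (intro lint_add tame_integrable tame_cmult t512 tV512)
  also have "\<dots> = 512 * measure lborel V + \<alpha>\<^sup>2 * 512" by (simp only: iV512 integral_mult_right_zero i512)
  also have "\<alpha>\<^sup>2 <= (1/2) * \<alpha>" unfolding power2_eq_square using al by (intro mult_right_mono) auto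
  finally show ?thesis using V2 al by simp
 qed
 \<comment> \<open>The exponent 2 N + 16 in \<eta> is chosen for this bound. The defect of a cell is
   at most 2^(N+1) \<eta> \<alpha>, and dividing by the cell length multiplies it by 2^N, which
   leaves 2^(-15) \<alpha>.\<close>
 have cz: "\<bar>cexp (3*l) g u\<bar> <= \<alpha> / 2^15 * ind {0..<512::real} u" for u
 proof (cases "0 <= u \<and> u < 512")
  case False
  then have "cexp (3*l) g u = 0" using cexp_support[of g 512 "3*l" u] supg by auto
  then show ?thesis using al by simp
 next
  case True
  define i where "i = nat \<lfloor>2^(3*l) * u\<rfloor>"
  have fl0: "0 <= \<lfloor>2^(3*l) * u\<rfloor>" using True by simp
  have "2^(3*l) * u < 2^(3*l) * 512" using True by simp
  then have "\<lfloor>2^(3*l) * u\<rfloor> < 2^N" by (simp add: floor_less_iff N_def power_add)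
  then have i: "i < 2^N" "int i = \<lfloor>2^(3*l) * u\<rfloor>" using fl0 by (simp_all add: i_def nat_less_iff)
  have ci: "512 * x \<in> cell (3*l) (int i) \<longleftrightarrow> x \<in> I i" for x
   by (simp add: I_def in_cell_iff N_def power_add mult.assoc)
  have "(LBINT t. g t * ind (cell (3*l) (int i)) t)
    = 512 * (LBINT x. g (0 + 512 * x) * ind (cell (3*l) (int i)) (0 + 512 * x))"
   by (rule integral_affine) simp
  also have "(%x. g (0 + 512 * x) * ind (cell (3*l) (int i)) (0 + 512 * x)) = (%x. ind V x * ind (I i) x - \<alpha> * ind (I i) x)"
  proof
   fix x
   have "0 <= x \<and> x < 1" if "x \<in> I i"
   proof -
    have x: "real i / 2^N <= x" "x < (real i + 1) / 2^N" using that by (simp_all add: I_def cell_def)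
    have "real i + 1 <= 2^N" using i(1) by (metis Suc_leI of_nat_Suc of_nat_le_iff of_nat_numeral of_nat_power add.commute)
    then have "(real i + 1) / 2^N <= 1" by simp
    moreover have "0 <= real i / 2^N" by simp
    ultimately show ?thesis using x by linarith
   qed
   then show "g (0 + 512 * x) * ind (cell (3*l) (int i)) (0 + 512 * x) = ind V x * ind (I i) x - \<alpha> * ind (I i) x"
    using ci[of x] by (auto simp: g_def indicator_def)
  qed
  also have "(LBINT x. ind V x * ind (I i) x - \<alpha> * ind (I i) x) = mV i - (LBINT x. \<alpha> * ind (I i) x)"
   unfolding mV_def by (intro lint_diff tame_integrable tame_mult_tame tame_cmult tV tI)
  also have "\<dots> = mV i - \<alpha> / 2^N" unfolding I_def by (simp only: integral_mult_right_zero integral_cell) simp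
  finally have "cexp (3*l) g u = 2^N * (mV i - \<alpha> / 2^N)" unfolding cexp_def i(2)[symmetric] by (simp add: N_def power_add)
  then have "\<bar>cexp (3*l) g u\<bar> = 2^N * \<bar>mV i - \<alpha> / 2^N\<bar>" by (simp add: abs_mult)
  also have "\<dots> <= 2^N * (2^(N+1) * (\<eta> * \<alpha>))" using dev[OF i(1)] by (intro mult_left_mono) auto
  also have "\<dots> = \<alpha> / 2^15"
  proof -
   have "2 * N + 16 = N + (N + 1) + 15" by simp
   then have "(2::real)^(2*N+16) = 2^N * 2^(N+1) * 2^15" by (simp only: power_add)
   then show ?thesis by (simp add: \<eta>_def)
  qed
  finally show ?thesis using True by simp
 qed
 have ce: "(LBINT x. (cexp (3*l) g x)\<^sup>2) <= \<alpha> / 1000000"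
 proof -
  have "(LBINT x. (cexp (3*l) g x)\<^sup>2) <= (LBINT x. (\<alpha> / 2^15)\<^sup>2 * ind {0..<512::real} x)"
  proof (intro lint_mono tame_integrable tame_power2 tame_cexp tg tame_cmult t512)
   show "(cexp (3*l) g x)\<^sup>2 <= (\<alpha> / 2^15)\<^sup>2 * ind {0..<512::real} x" for x
    using power_mono[OF cz[of x], of 2] by (auto simp: power_mult_distrib indicator_def)
  qed
  also have "\<dots> = (\<alpha> / 2^15)\<^sup>2 * 512" by (simp only: integral_mult_right_zero i512)
  also have "\<dots> = \<alpha> * \<alpha> / 2^21" by (simp add: power2_eq_square)
  also have "\<dots> <= (1/2) * \<alpha> / 2^21" using al by (intro divide_right_mono mult_right_mono) auto
  also have "\<dots> <= \<alpha> / 1000000" using al by simp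
  finally show ?thesis .
 qed
 \<comment> \<open>The three contributions are 64 \<alpha> / 10^6 from the coarse part, 2 \<alpha> /
   64 from its companion term, and 1302 \<alpha> / 20000 from the contracted part; their sum is
   below \<alpha> / 10.\<close>
 have up: "\<bar>pairing g (ind V)\<bar> <= 3/20 * \<alpha>"
 proof -
  have "(2 * sqrt (band_gain CD) + 2^15 / 2^l) * ((LBINT x. (g x)\<^sup>2) + (LBINT x. (ind V x)\<^sup>2))
   <= 1/20000 * (1300 * \<alpha> + 2 * \<alpha>)"
   using gg iV2 V2 by (intro mult_mono add_mono small) auto
  from order_trans[OF decay add_left_mono[OF this]] show ?thesis using ce V2 al by (simp add: iV2)
 qed
 \<comment> \<open>Points of K whose image leaves K are mapped into D by \<open>mob s\<close>
   divided by 512. They have measure at most 2048 \<beta>, with 4 from \<open>mob_push\<close> and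
   512 from the scaling.\<close>
 have lows: "(LBINT x. g (mob s x) * ind V x) >= \<alpha> / 4" if s: "s \<in> S" for s
 proof -
  define h where "h x = ind V x * ind V (mob s x / 512)" for x
  have [measurable]: "mob s \<in> borel_measurable borel" using s by (rule mob_measurable)
  have th: "tame h" unfolding h_def[abs_def] by (rule tame_mult[OF tV, where B=1]) auto
  have tDs: "tame (%u. ind D (u / 512))"
  proof (rule tameI[where M=1 and R=512])
   show "(%u. ind D (u / 512)) \<in> borel_measurable borel" using Db by measurable
   show "norm u <= 512" if "ind D (u / 512) \<noteq> 0" for u
   proof -
    have "u / 512 \<in> PK" using that by (auto simp: D_def indicator_def split: if_splits)
    then have "0 <= u / 512" "u / 512 <= 1" using PK(2) by force+
    then show ?thesis by simp
   qed
  qed auto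
  have "(LBINT x. ind {0..1} x * ind D (mob s x / 512)) <= 4 * (LBINT u. ind D (u / 512))"
   by (rule mob_push[OF s tDs]) simp
  also have "(LBINT u. ind D (u / 512)) = 512 * (LBINT x. ind D ((0 + 512 * x) / 512))"
   by (rule integral_affine) simp
  also have "(%x. ind D ((0 + 512 * x) / 512)) = ind D" by simp
  finally have Ds: "(LBINT x. ind {0..1} x * ind D (mob s x / 512)) <= 2048 * \<beta>" unfolding iD by simp
  have tDm: "tame (%x. ind {0..1} x * ind D (mob s x / 512))" by (rule mob_pull[OF s tDs])
  have "\<alpha> <= (LBINT x. (h x + ind {0..1} x * ind D (mob s x / 512)) + ind {1} x)" unfolding iK[symmetric]
  proof (intro lint_mono tame_integrable tK tame_add th tDm t1)
   fix x
   show "ind K x <= (h x + ind {0..1} x * ind D (mob s x / 512)) + ind {1} x"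
   proof (cases "x \<in> K \<and> x \<noteq> 1")
    case True
    then have x: "x \<in> V" "0 <= x" "x <= 1" using V(3) K(2) by force+
    obtain a b c d where e: "s = (a,b,c,d)" by (metis prod.collapse)
    have "(a,b,512*c,512*d) \<in> family N" using s by (force simp: family_def e)
    then have "mob (a,b,512*c,512*d) x \<in> PK" using inPK True by blast
    moreover have "mob (a,b,512*c,512*d) x = mob s x / 512" using family_mob(3)[where s=s and x=x] unfolding e by (simp only: prod.case)
    ultimately have "mob s x / 512 \<in> PK" by (simp only:)
    then have "mob s x / 512 \<in> D \<or> mob s x / 512 \<in> K" by (auto simp: D_def)
    moreover have "mob s x / 512 \<in> {0..<1}" using mob_bounds[OF s x(2,3)] by simp
    ultimately have "mob s x / 512 \<in> D \<or> mob s x / 512 \<in> V" using V(3) by blast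
    then show ?thesis using x by (auto simp: h_def indicator_def)
   qed (auto simp: indicator_def h_def)
  qed
  also have "\<dots> = (LBINT x. (h x + ind {0..1} x * ind D (mob s x / 512))) + (LBINT x. ind {1::real} x)"
   by (intro lint_add tame_integrable tame_add th tDm t1)
  also have "(LBINT x. (h x + ind {0..1} x * ind D (mob s x / 512))) = (LBINT x. h x) + (LBINT x. ind {0..1} x * ind D (mob s x / 512))"
   by (intro lint_add tame_integrable th tDm)
  finally have hh: "(LBINT x. h x) >= \<alpha> - 2048 * \<beta>" using Ds null1 by linarith
  have "(LBINT x. g (mob s x) * ind V x) = (LBINT x. h x - \<alpha> * ind V x)"
  proof (rule lint_cong[OF refl])
   fix x
   show "g (mob s x) * ind V x = h x - \<alpha> * ind V x"
   proof (cases "x \<in> V")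
    case True
    then have "0 <= x" "x <= 1" using V(2) by force+
    then have "mob s x \<in> {0..<512::real}" using mob_bounds[OF s, of x] by auto
    then show ?thesis using True by (simp add: g_def h_def)
   qed (simp add: h_def)
  qed
  also have "\<dots> = (LBINT x. h x) - (LBINT x. \<alpha> * ind V x)"
   by (intro lint_diff tame_integrable th tame_cmult tV)
  also have "(LBINT x. \<alpha> * ind V x) = \<alpha> * measure lborel V" using iV by (simp only: integral_mult_right_zero)
  finally have e: "(LBINT x. g (mob s x) * ind V x) = (LBINT x. h x) - \<alpha> * measure lborel V" .
  have eta: "\<eta> <= 1 / 2^16" by (simp add: \<eta>_def power_add divide_simps)
  have ea: "\<eta> * \<alpha> <= 1 / 2^16 * \<alpha>" using eta al by (intro mult_right_mono) auto
  have "\<alpha> * measure lborel V <= \<alpha> * (1/2 + 1/2^16)"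
  proof (intro mult_left_mono)
   have "1 / 2^16 * \<alpha> <= 1 / 2^16 * (1::real)" using al by (intro mult_left_mono) auto
   then show "measure lborel V <= 1/2 + 1/2^16" using V(5) al ea by linarith
  qed (use al in simp)
  then have "\<alpha> * measure lborel V <= \<alpha> / 2 + \<alpha> / 65536" by (simp add: algebra_simps)
  moreover have "2048 * \<beta> <= \<alpha> / 32" using be ea by simp
  ultimately show ?thesis unfolding e using hh al by linarith
 qed
 have "(\<Sum>s\<in>S. \<alpha> / 4) <= (\<Sum>s\<in>S. LBINT x. g (mob s x) * ind V x)" by (intro sum_mono lows)
 then have "k * (\<alpha> / 4) <= k * pairing g (ind V)" using k0 by (simp add: pairing_def k_def)
 then have "\<alpha> / 4 <= pairing g (ind V)" using k0 by simp
 then show False using up al by linarith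
qed

end

section \<open>A Turing machine for integral Moebius maps\<close>

definition runs :: "tm \<Rightarrow> nat \<Rightarrow> config \<Rightarrow> config \<Rightarrow> bool" where
 "runs M T c c' \<longleftrightarrow> (\<exists>t\<le>T. (tm_step M ^^ t) c = c')"

declare tm_step.simps [simp del]

lemma runs_refl: "runs M T c c"
 unfolding runs_def by (intro exI[of _ 0]) auto

lemma runs_step: "tm_step M c = c' ==> runs M 1 c c'"
 unfolding runs_def by (intro exI[of _ 1]) auto

lemma runs_trans: assumes "runs M T c c'" "runs M T' c' c''" shows "runs M (T + T') c c''"
proof -
 obtain t t' where "t <= T" "(tm_step M ^^ t) c = c'" "t' <= T'" "(tm_step M ^^ t') c' = c''" using assms unfolding runs_def by blast
 then have "(tm_step M ^^ (t' + t)) c = c''" by (simp add: funpow_add)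
 then show ?thesis unfolding runs_def using \<open>t <= T\<close> \<open>t' <= T'\<close> by (intro exI[of _ "t' + t"]) auto
qed

lemma runs_mono: "runs M T c c' ==> T <= T' ==> runs M T' c c'"
 unfolding runs_def using order_trans by blast

lemma runs_Suc: "tm_step M c = c' ==> runs M T c' c'' ==> runs M (Suc T) c c''"
 using runs_trans[OF runs_step, of M c c' T c''] by simp

definition cont :: "nat list \<Rightarrow> int \<Rightarrow> nat" where
 "cont w i = (if 0 <= i \<and> i < int (length w) then w ! nat i else 0)"

lemma cont_upd: "h = int (length w) ==> (cont w)(h := s) = cont (w @ [s])"
 by (auto simp: cont_def fun_eq_iff nth_append)

lemma word_tape_cont: "word_tape w = (0, cont w)"
 by (simp add: word_tape_def cont_def fun_eq_iff)

definition rd :: "(int \<Rightarrow> nat) \<Rightarrow> int \<Rightarrow> nat list \<Rightarrow> bool" where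
 "rd c h w \<longleftrightarrow> (\<forall>i<length w. c (h + int i) = w ! i) \<and> c (h + int (length w)) = 0"

lemma rd_Nil: "rd c h [] \<longleftrightarrow> c h = 0"
 by (simp add: rd_def)

lemma rd_Cons: "rd c h (x # w) \<longleftrightarrow> c h = x \<and> rd c (h + 1) w"
proof
 assume r: "rd c h (x # w)"
 have "c (h + 1 + int i) = w ! i" if "i < length w" for i
  using r that unfolding rd_def by (auto dest: spec[of _ "Suc i"] simp: add.assoc)
 then show "c h = x \<and> rd c (h + 1) w" using r unfolding rd_def by (auto simp: add.assoc dest: spec[of _ 0])
next
 assume r: "c h = x \<and> rd c (h + 1) w"
 show "rd c h (x # w)" unfolding rd_def
 proof (intro conjI allI impI)
  fix i assume i: "i < length (x # w)"
  show "c (h + int i) = (x # w) ! i"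
  proof (cases i)
   case (Suc j) then show ?thesis using r i unfolding rd_def by (auto simp: add.assoc dest: spec[of _ j])
  qed (use r in auto)
 next
  show "c (h + int (length (x # w))) = 0" using r unfolding rd_def by (simp add: add.assoc)
 qed
qed

lemma rd_cont: "rd (cont (u @ w)) (int (length u)) w"
 by (auto simp: rd_def cont_def nth_append nat_add_distrib)

definition lbit :: "bool list \<Rightarrow> nat" where "lbit xs = (case xs of [] \<Rightarrow> 0 | x # _ \<Rightarrow> of_bool x)"

text \<open>Bit-serial computation of u x + v y + \<kappa>, least significant bit first, as the
  machine performs it. The multiplications by u and v are absorbed into the carry, which stays at
  most u + v once it is. Exhausted inputs are read as zeros; from then on the carry is halved until
  it vanishes, which gives the lexicographic termination order.\<close>

function (sequential) emit :: "nat \<Rightarrow> nat \<Rightarrow> bool list \<Rightarrow> bool list \<Rightarrow> nat \<Rightarrow> bool list" where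
 "emit u v xs ys \<kappa> = (if xs = [] \<and> ys = [] \<and> \<kappa> = 0 then []
  else odd (u * lbit xs + v * lbit ys + \<kappa>) # emit u v (tl xs) (tl ys) ((u * lbit xs + v * lbit ys + \<kappa>) div 2))"
 by pat_completeness auto
termination
proof (relation "measures [%(u, v, xs, ys, \<kappa>). length xs + length ys, %(u, v, xs, ys, \<kappa>). \<kappa>]")
 fix u v \<kappa> :: nat and xs ys :: "bool list"
 assume a: "\<not> (xs = [] \<and> ys = [] \<and> \<kappa> = 0)"
 show "((u, v, tl xs, tl ys, (u * lbit xs + v * lbit ys + \<kappa>) div 2), u, v, xs, ys, \<kappa>)
   \<in> measures [%(u, v, xs, ys, \<kappa>). length xs + length ys, %(u, v, xs, ys, \<kappa>). \<kappa>]"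
  using a by (cases xs; cases ys) (auto simp: lbit_def)
qed simp

declare emit.simps [simp del]

lemma emit_Nil: "emit u v [] [] 0 = []"
 by (subst emit.simps) simp

lemma emit_step:
 assumes "\<not> (xs = [] \<and> ys = [] \<and> \<kappa> = 0)" "t = u * lbit xs + v * lbit ys + \<kappa>"
 shows "emit u v xs ys \<kappa> = odd t # emit u v (tl xs) (tl ys) (t div 2)"
 using assms(1) unfolding assms(2) by (simp only: emit.simps[of u v xs ys \<kappa>] if_False)

lemma bits_nat_Cons: "bits_nat (x # xs) = of_bool x + 2 * bits_nat xs"
 by (simp add: bits_nat_def)

lemma bits_nat_lbit: "bits_nat xs = lbit xs + 2 * bits_nat (tl xs)"
 by (cases xs) (simp_all add: lbit_def bits_nat_def)

lemma bits_nat_emit: "bits_nat (emit u v xs ys \<kappa>) = u * bits_nat xs + v * bits_nat ys + \<kappa>"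
proof (induction u v xs ys \<kappa> rule: emit.induct)
 case (1 u v xs ys \<kappa>)
 show ?case
 proof (cases "xs = [] \<and> ys = [] \<and> \<kappa> = 0")
  case True then show ?thesis by (simp add: emit_Nil bits_nat_def)
 next
  case False
  define t where "t = u * lbit xs + v * lbit ys + \<kappa>"
  have "bits_nat (emit u v xs ys \<kappa>) = of_bool (odd t) + 2 * (u * bits_nat (tl xs) + v * bits_nat (tl ys) + t div 2)"
   unfolding emit_step[OF False t_def] bits_nat_Cons 1[OF False, folded t_def] ..
  also have "\<dots> = (t mod 2 + 2 * (t div 2)) + 2 * (u * bits_nat (tl xs) + v * bits_nat (tl ys))"
   by (simp only: of_bool_odd_eq_mod_2 distrib_left add_ac)
  also have "t mod 2 + 2 * (t div 2) = t" by simp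
  also have "t + 2 * (u * bits_nat (tl xs) + v * bits_nat (tl ys)) = u * (lbit xs + 2 * bits_nat (tl xs)) + v * (lbit ys + 2 * bits_nat (tl ys)) + \<kappa>"
   by (simp add: t_def algebra_simps)
  finally show ?thesis by (simp only: bits_nat_lbit[symmetric])
 qed
qed

text \<open>Every step either shortens an input or, with both exhausted, decreases a nonzero carry.
  Thus at most u + v bits follow after the inputs have ended.\<close>

lemma length_emit: "\<kappa> <= u + v ==> length (emit u v xs ys \<kappa>) <= length xs + length ys + u + v"
proof -
 have "length (emit u v xs ys \<kappa>) <= length xs + length ys + (if xs = [] \<and> ys = [] then \<kappa> else u + v)" if "\<kappa> <= u + v"
  using that
 proof (induction u v xs ys \<kappa> rule: emit.induct)
  case (1 u v xs ys \<kappa>)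
  show ?case
  proof (cases "xs = [] \<and> ys = [] \<and> \<kappa> = 0")
   case True then show ?thesis by (simp add: emit_Nil)
  next
   case False
   define t where "t = u * lbit xs + v * lbit ys + \<kappa>"
   have l: "lbit xs <= 1" "lbit ys <= 1" by (auto simp: lbit_def split: list.split)
   have "t <= u * 1 + v * 1 + (u + v)" unfolding t_def using l 1(2) by (intro add_mono mult_left_mono) auto
   then have t2: "t div 2 <= u + v" by linarith
   have IH: "length (emit u v (tl xs) (tl ys) (t div 2)) <= length (tl xs) + length (tl ys) + (if tl xs = [] \<and> tl ys = [] then t div 2 else u + v)"
    by (rule 1(1)[OF False, folded t_def, OF t2])
   have e: "length (emit u v xs ys \<kappa>) = Suc (length (emit u v (tl xs) (tl ys) (t div 2)))"
    by (simp add: emit_step[OF False t_def])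
   show ?thesis
   proof (cases "xs = [] \<and> ys = []")
    case True
    then have "t = \<kappa>" "\<kappa> > 0" using False by (auto simp: t_def lbit_def)
    then show ?thesis using IH e True by simp
   next
    case F: False
    have "Suc (length (tl xs) + length (tl ys)) <= length xs + length ys" using F by (cases xs; cases ys) auto
    moreover have "length (emit u v (tl xs) (tl ys) (t div 2)) <= length (tl xs) + length (tl ys) + (u + v)"
     using IH t2 by (auto split: if_splits)
    ultimately show ?thesis unfolding if_not_P[OF F] e by linarith
   qed
  qed
 qed
 then show "\<kappa> <= u + v ==> length (emit u v xs ys \<kappa>) <= length xs + length ys + u + v" by (fastforce split: if_splits)
qed

text \<open>Phases: 0 reads the index \<open>j\<close> of the map, 1 copies the numerator to the second tape, 2 and 4
 rewind, 3 and 5 add up the numerator and the denominator of the value, with carry \<open>\<kappa>\<close>.\<close>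

definition enc :: "nat \<Rightarrow> nat \<Rightarrow> nat \<Rightarrow> nat \<Rightarrow> nat \<Rightarrow> nat" where
 "enc J C ph j \<kappa> = min (6 * (J+1) * (C+1)) (ph + 6 * (j + (J+1) * \<kappa>))"

text \<open>Phase, index and carry are digits in a mixed radix system. The cap in \<open>enc\<close>
  keeps successor states inside the state set, as \<open>valid_tm\<close> demands of every state and
  symbol; in the range assumed here the encoding is decoded exactly.\<close>

lemma enc_lt: assumes "ph < 6" "j <= J" "\<kappa> <= C"
 shows "ph + 6 * (j + (J+1) * \<kappa>) < 6 * (J+1) * (C+1)" "enc J C ph j \<kappa> = ph + 6 * (j + (J+1) * \<kappa>)"
  "enc J C ph j \<kappa> mod 6 = ph" "enc J C ph j \<kappa> div 6 mod (J+1) = j" "enc J C ph j \<kappa> div 6 div (J+1) = \<kappa>"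
proof -
 define A where "A = (J+1) * (C+1)"
 define B where "B = (J+1) * \<kappa>"
 have "B <= (J+1) * C" unfolding B_def using assms by (intro mult_left_mono) auto
 then have "j + B + 1 <= A" using assms by (simp add: A_def algebra_simps)
 then have "ph + 6 * (j + B) < 6 * A" using assms(1) by simp
 then show lt: "ph + 6 * (j + (J+1) * \<kappa>) < 6 * (J+1) * (C+1)" by (simp only: A_def B_def mult.assoc)
 then show e: "enc J C ph j \<kappa> = ph + 6 * (j + (J+1) * \<kappa>)" by (simp add: enc_def)
 have md: "(ph + 6 * z) mod 6 = ph" "(ph + 6 * z) div 6 = z" for z using assms(1) by simp_all
 show "enc J C ph j \<kappa> mod 6 = ph" unfolding e by (rule md)
 have d: "enc J C ph j \<kappa> div 6 = j + (J+1) * \<kappa>" unfolding e by (rule md)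
 show "enc J C ph j \<kappa> div 6 mod (J+1) = j" unfolding d using assms(2) by (simp only: mod_mult_self2) simp
 have j1: "j < J + 1" using assms(2) by simp
 show "enc J C ph j \<kappa> div 6 div (J+1) = \<kappa>" unfolding d using div_mult_self2[of "J+1" j \<kappa>] j1 by simp
qed

definition coeffs :: "(nat \<times> nat \<times> nat \<times> nat) list \<Rightarrow> nat \<Rightarrow> nat \<Rightarrow> nat \<times> nat" where
 "coeffs qs ph j = (case qs ! j of (a, b, c, d) \<Rightarrow> if ph = 3 then (a, b) else (c, d))"

definition sbit :: "nat \<Rightarrow> nat" where "sbit s = of_bool (s = 2)"

text \<open>The index of the map is given in unary, so reading it is counting in the state. The copy
  of the numerator on the second tape lets both inputs be read bit by bit in parallel. While
  rewinding, the first head stops at the separator before the denominator and the second at the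
  blank before cell 0. The symbol 3 written at the end of phase 3 separates the two halves of the
  output, and 1 + t mod 2 is the tape symbol of an output bit.\<close>

definition machine_step :: "(nat \<times> nat \<times> nat \<times> nat) list \<Rightarrow> nat \<Rightarrow> nat \<Rightarrow> nat \<Rightarrow> nat \<Rightarrow> nat \<Rightarrow> nat \<Rightarrow> nat \<Rightarrow> nat \<times> (nat \<times> move) list" where
 "machine_step qs C ph j \<kappa> s1 s2 s3 =
  (let E = enc (length qs) C in
  if ph = 0 then
   (if s1 = 3 then (E 1 j 0, [(s1, Move_Right), (s2, Stay), (s3, Stay)])
    else (E 0 (j+1) 0, [(s1, Move_Right), (s2, Stay), (s3, Stay)]))
  else if ph = 1 then
   (if s1 = 3 then (E 2 j 0, [(s1, Stay), (s2, Move_Left), (s3, Stay)])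
    else (E 1 j 0, [(s1, Move_Right), (s1, Move_Right), (s3, Stay)]))
  else if ph = 2 \<or> ph = 4 then
   (if s1 = 3 \<and> s2 = 0 then (E (ph+1) j 0, [(s1, Move_Right), (s2, Move_Right), (s3, Stay)])
    else (E ph j 0, [(s1, if s1 = 3 then Stay else Move_Left), (s2, if s2 = 0 then Stay else Move_Left), (s3, Stay)]))
  else if s1 = 0 \<and> s2 = 0 \<and> \<kappa> = 0 then
   (if ph = 3 then (E 4 j 0, [(s1, Move_Left), (s2, Move_Left), (3, Move_Right)])
    else (6 * (length qs + 1) * (C + 1), [(s1, Stay), (s2, Stay), (s3, Stay)]))
  else (let (u, v) = coeffs qs ph j; t = u * sbit s2 + v * sbit s1 + \<kappa> in
   (E ph j (t div 2), [(s1, if s1 = 0 then Stay else Move_Right), (s2, if s2 = 0 then Stay else Move_Right), (1 + t mod 2, Move_Right)])))"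

definition machine :: "(nat \<times> nat \<times> nat \<times> nat) list \<Rightarrow> nat \<Rightarrow> tm" where
 "machine qs C = \<lparr>num_tapes = 3, num_syms = 4, num_states = 6 * (length qs + 1) * (C + 1),
  delta = (%q ss. machine_step qs C (q mod 6) (q div 6 mod (length qs + 1)) (q div 6 div (length qs + 1)) (ss ! 0) (ss ! 1) (ss ! 2))\<rparr>"

lemma valid_machine: "valid_tm (machine qs C)"
proof -
 have m: "case machine_step qs C ph j \<kappa> s1 s2 s3 of (q', acts) \<Rightarrow>
  q' <= 6 * (length qs + 1) * (C + 1) \<and> length acts = 3 \<and> fst ` set acts \<subseteq> {..<4}"
  if "s1 < 4" "s2 < 4" "s3 < 4" for ph j \<kappa> s1 s2 s3
 proof -
  have m: "Suc (t mod 2) < 4" for t :: nat using mod_less_divisor[of 2 t] by linarith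
  show ?thesis using that m unfolding machine_step_def Let_def by (auto simp: enc_def split: prod.split if_splits)
 qed
 have ex: "\<exists>s1 s2 s3. ss = [s1, s2, s3]" if "length ss = 3" for ss :: "nat list"
  using that by (auto simp: numeral_3_eq_3 length_Suc_conv)
 show ?thesis unfolding valid_tm_def
 proof (intro conjI allI impI)
  fix q ss
  assume q: "q < num_states (machine qs C) \<and> length ss = num_tapes (machine qs C) \<and> set ss \<subseteq> {..<num_syms (machine qs C)}"
  then have "length ss = 3" by (simp add: machine_def)
  then obtain s1 s2 s3 where ss: "ss = [s1, s2, s3]" using ex by blast
  then have "s1 < 4" "s2 < 4" "s3 < 4" using q by (auto simp: machine_def)
  from m[OF this] show "case delta (machine qs C) q ss of (q', acts) \<Rightarrow>
    q' <= num_states (machine qs C) \<and> length acts = num_tapes (machine qs C) \<and> fst ` set acts \<subseteq> {..<num_syms (machine qs C)}"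
   by (simp add: machine_def ss)
 qed (simp_all add: machine_def)
qed

context
 fixes qs :: "(nat \<times> nat \<times> nat \<times> nat) list" and C :: nat and M :: tm
 defines "M \<equiv> machine qs C"
begin

lemma step_machine:
 assumes "ph < 6" "j <= length qs" "\<kappa> <= C"
 shows "tm_step M (enc (length qs) C ph j \<kappa>, [(h1, c1), (h2, c2), (h3, c3)]) =
  (case machine_step qs C ph j \<kappa> (c1 h1) (c2 h2) (c3 h3) of (q', acts) \<Rightarrow> (q', map2 act acts [(h1, c1), (h2, c2), (h3, c3)]))"
proof -
 have lt: "enc (length qs) C ph j \<kappa> < num_states M" using enc_lt(1,2)[OF assms] by (simp add: M_def machine_def)
 have "delta M (enc (length qs) C ph j \<kappa>) [c1 h1, c2 h2, c3 h3] = machine_step qs C ph j \<kappa> (c1 h1) (c2 h2) (c3 h3)"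
  unfolding M_def machine_def using enc_lt(3-5)[OF assms] by simp
 then show ?thesis using lt by (simp add: tm_step.simps)
qed

abbreviation "E \<equiv> enc (length qs) C"

lemma phase0:
 assumes "rd c1 h1 (bits_word (replicate n b) @ 3 # w)" "j + n <= length qs"
 shows "runs M (n + 1) (E 0 j 0, [(h1, c1), T2, T3]) (E 1 (j + n) 0, [(h1 + int n + 1, c1), T2, T3])"
 using assms
proof (induction n arbitrary: j h1)
 case 0
 obtain h2 c2 h3 c3 where T: "T2 = (h2, c2)" "T3 = (h3, c3)" by (cases T2; cases T3) auto
 have "c1 h1 = 3" using 0 by (simp add: bits_word_def rd_Cons)
 then have "tm_step M (E 0 j 0, [(h1, c1), T2, T3]) = (E 1 j 0, [(h1 + 1, c1), T2, T3])"
  unfolding T using 0 by (subst step_machine) (auto simp: machine_step_def Let_def)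
 from runs_step[OF this] show ?case by simp
next
 case (Suc n)
 obtain h2 c2 h3 c3 where T: "T2 = (h2, c2)" "T3 = (h3, c3)" by (cases T2; cases T3) auto
 have c: "c1 h1 = (if b then 2 else 1)" "rd c1 (h1 + 1) (bits_word (replicate n b) @ 3 # w)"
  using Suc.prems(1) by (simp_all add: bits_word_def rd_Cons)
 then have "tm_step M (E 0 j 0, [(h1, c1), T2, T3]) = (E 0 (j + 1) 0, [(h1 + 1, c1), T2, T3])"
  unfolding T using Suc.prems(2) by (subst step_machine) (auto simp: machine_step_def Let_def)
 moreover have "runs M (n + 1) (E 0 (j + 1) 0, [(h1 + 1, c1), T2, T3]) (E 1 (j + 1 + n) 0, [(h1 + 1 + int n + 1, c1), T2, T3])"
  using Suc.IH[OF c(2), of "j + 1"] Suc.prems(2) by simp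
 ultimately show ?case using runs_Suc[of M _ _ "n + 1"] by (simp add: add_ac)
qed

lemma phase1:
 assumes "rd c1 h1 (bits_word bs @ 3 # w)" "j <= length qs"
 shows "runs M (length bs + 1) (E 1 j 0, [(h1, c1), (int (length u), cont u), T3])
  (E 2 j 0, [(h1 + int (length bs), c1), (int (length u + length bs) - 1, cont (u @ bits_word bs)), T3])"
 using assms
proof (induction bs arbitrary: h1 u)
 case Nil
 obtain h3 c3 where T: "T3 = (h3, c3)" by (cases T3) auto
 have "c1 h1 = 3" using Nil by (simp add: bits_word_def rd_Cons)
 then have "tm_step M (E 1 j 0, [(h1, c1), (int (length u), cont u), T3]) = (E 2 j 0, [(h1, c1), (int (length u) - 1, cont u), T3])"
  unfolding T using Nil by (subst step_machine) (auto simp: machine_step_def Let_def)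
 from runs_step[OF this] show ?case by (simp add: bits_word_def)
next
 case (Cons b bs)
 obtain h3 c3 where T: "T3 = (h3, c3)" by (cases T3) auto
 define s :: nat where "s = (if b then 2 else 1)"
 have c: "c1 h1 = s" "rd c1 (h1 + 1) (bits_word bs @ 3 # w)"
  using Cons.prems(1) by (simp_all add: bits_word_def rd_Cons s_def)
 have "tm_step M (E 1 j 0, [(h1, c1), (int (length u), cont u), T3]) = (E 1 j 0, [(h1 + 1, c1), (int (length (u @ [s])), cont (u @ [s])), T3])"
  unfolding T using Cons.prems(2) c(1) by (subst step_machine) (auto simp: machine_step_def Let_def cont_upd s_def)
 moreover note Cons.IH[OF c(2) Cons.prems(2), of "u @ [s]"]
 ultimately show ?case using runs_Suc[of M _ _ "length bs + 1"] by (simp add: bits_word_def s_def add_ac)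
qed

text \<open>The two heads return independently, and each waits at its own mark for the other; the
  induction is therefore on the sum of their distances.\<close>

lemma rewind:
 assumes ph: "ph = 2 \<or> ph = 4" and j: "j <= length qs"
  and c1: "c1 P = 3" "\<And>i. P < i ==> i <= P + int m1 ==> c1 i \<noteq> 3"
  and c2: "c2 (-1) = 0" "\<And>i. 0 <= i ==> i < int m2 ==> c2 i \<noteq> 0"
 shows "runs M (m1 + m2 + 1) (E ph j 0, [(P + int m1, c1), (int m2 - 1, c2), T3])
  (E (ph + 1) j 0, [(P + 1, c1), (0, c2), T3])"
 using c1(2) c2(2)
proof (induction "m1 + m2" arbitrary: m1 m2 rule: less_induct)
 case less
 obtain h3 c3 where T: "T3 = (h3, c3)" by (cases T3) auto
 have s1: "c1 (P + int m1) = 3 \<longleftrightarrow> m1 = 0" using c1(1) less.prems(1)[of "P + int m1"] by (cases m1) auto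
 have s2: "c2 (int m2 - 1) = 0 \<longleftrightarrow> m2 = 0" using c2(1) less.prems(2)[of "int m2 - 1"] by (cases m2) auto
 have p6: "ph < 6" using ph by auto
 show ?case
 proof (cases "m1 = 0 \<and> m2 = 0")
  case True
  then have "c1 P = 3" "c2 (-1) = 0" using c1(1) c2(1) by auto
  then have "tm_step M (E ph j 0, [(P, c1), (-1, c2), T3]) = (E (ph + 1) j 0, [(P + 1, c1), (0, c2), T3])"
   unfolding T using ph by (subst step_machine[OF p6 j]) (auto simp: machine_step_def Let_def)
  from runs_step[OF this] show ?thesis using True by simp
 next
  case False
  have "tm_step M (E ph j 0, [(P + int m1, c1), (int m2 - 1, c2), T3]) = (E ph j 0, [(P + int (m1 - 1), c1), (int (m2 - 1) - 1, c2), T3])"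
  proof -
   have e: "P + int (m1 - 1) = (if m1 = 0 then P + int m1 else P + int m1 - 1)"
    "int (m2 - 1) - 1 = (if m2 = 0 then int m2 - 1 else int m2 - 1 - 1)" by auto
   have "machine_step qs C ph j 0 (c1 (P + int m1)) (c2 (int m2 - 1)) (c3 h3) = (E ph j 0,
    [(c1 (P + int m1), if m1 = 0 then Stay else Move_Left), (c2 (int m2 - 1), if m2 = 0 then Stay else Move_Left), (c3 h3, Stay)])"
    using ph False unfolding machine_step_def Let_def s1 s2 by auto
   then show ?thesis unfolding T e by (subst step_machine[OF p6 j]) (simp_all split: if_split)
  qed
  moreover have "runs M ((m1 - 1) + (m2 - 1) + 1) (E ph j 0, [(P + int (m1 - 1), c1), (int (m2 - 1) - 1, c2), T3]) (E (ph + 1) j 0, [(P + 1, c1), (0, c2), T3])"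
   using False by (intro less.hyps less.prems) auto
  ultimately have "runs M (Suc ((m1 - 1) + (m2 - 1) + 1)) (E ph j 0, [(P + int m1, c1), (int m2 - 1, c2), T3]) (E (ph + 1) j 0, [(P + 1, c1), (0, c2), T3])"
   by (rule runs_Suc)
  then show ?thesis by (rule runs_mono) (use False in auto)
 qed
qed

lemma addition:
 assumes ph: "ph = 3 \<or> ph = 5" and j: "j <= length qs" and uv: "coeffs qs ph j = (u, v)" "u + v <= C"
 shows "\<kappa> <= u + v ==> rd c2 h2 (bits_word xs) ==> rd c1 h1 (bits_word ys) ==>
  runs M (length (emit u v xs ys \<kappa>)) (E ph j \<kappa>, [(h1, c1), (h2, c2), (int (length w), cont w)])
   (E ph j 0, [(h1 + int (length ys), c1), (h2 + int (length xs), c2),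
    (int (length w + length (emit u v xs ys \<kappa>)), cont (w @ bits_word (emit u v xs ys \<kappa>)))])"
 using uv
proof (induction u v xs ys \<kappa> arbitrary: h1 h2 w rule: emit.induct)
 case (1 u v xs ys \<kappa>)
 have p6: "ph < 6" using ph by auto
 show ?case
 proof (cases "xs = [] \<and> ys = [] \<and> \<kappa> = 0")
  case True then show ?thesis by (simp add: emit_Nil runs_refl bits_word_def)
 next
  case False
  define t where "t = u * lbit xs + v * lbit ys + \<kappa>"
  have l: "lbit xs <= 1" "lbit ys <= 1" by (auto simp: lbit_def split: list.split)
  have "t <= u * 1 + v * 1 + (u + v)" unfolding t_def using l 1(2) by (intro add_mono mult_left_mono) auto
  then have t2: "t div 2 <= u + v" by linarith
  have kC: "\<kappa> <= C" using 1(2) 1(6) by simp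
  define h1' where "h1' = (if ys = [] then h1 else h1 + 1)"
  define h2' where "h2' = (if xs = [] then h2 else h2 + 1)"
  have s2: "c2 h2 = 0 \<longleftrightarrow> xs = []" "sbit (c2 h2) = lbit xs" "rd c2 h2' (bits_word (tl xs))"
   using 1(3) by (cases xs; auto simp: rd_Nil rd_Cons bits_word_def sbit_def lbit_def h2'_def)+
  have s1: "c1 h1 = 0 \<longleftrightarrow> ys = []" "sbit (c1 h1) = lbit ys" "rd c1 h1' (bits_word (tl ys))"
   using 1(4) by (cases ys; auto simp: rd_Nil rd_Cons bits_word_def sbit_def lbit_def h1'_def)+
  define o1 where "o1 = 1 + t mod 2"
  have ob: "o1 = (if odd t then 2 else 1)" by (auto simp: o1_def odd_iff_mod_2_eq_one even_iff_mod_2_eq_zero)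
  have "machine_step qs C ph j \<kappa> (c1 h1) (c2 h2) (cont w (int (length w))) = (E ph j (t div 2),
   [(c1 h1, if ys = [] then Stay else Move_Right), (c2 h2, if xs = [] then Stay else Move_Right), (o1, Move_Right)])"
   using ph False unfolding machine_step_def Let_def s1(1) s2(1) 1(5) s1(2) s2(2) prod.case t_def o1_def by auto
  then have "tm_step M (E ph j \<kappa>, [(h1, c1), (h2, c2), (int (length w), cont w)])
   = (E ph j (t div 2), [(h1', c1), (h2', c2), (int (length (w @ [o1])), cont (w @ [o1]))])"
   by (subst step_machine[OF p6 j kC]) (simp add: cont_upd h1'_def h2'_def split: if_split)
  moreover note 1(1)[OF False, folded t_def, OF t2 s2(3) s1(3) 1(5) 1(6), of "w @ [o1]"]
  ultimately have r: "runs M (Suc (length (emit u v (tl xs) (tl ys) (t div 2)))) (E ph j \<kappa>, [(h1, c1), (h2, c2), (int (length w), cont w)])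
   (E ph j 0, [(h1' + int (length (tl ys)), c1), (h2' + int (length (tl xs)), c2),
    (int (length (w @ [o1]) + length (emit u v (tl xs) (tl ys) (t div 2))), cont ((w @ [o1]) @ bits_word (emit u v (tl xs) (tl ys) (t div 2))))])"
   by (rule runs_Suc)
  have e: "emit u v xs ys \<kappa> = odd t # emit u v (tl xs) (tl ys) (t div 2)"
   by (rule emit_step[OF False t_def])
  have "h1' + int (length (tl ys)) = h1 + int (length ys)" "h2' + int (length (tl xs)) = h2 + int (length xs)"
   by (cases ys; cases xs; simp add: h1'_def h2'_def)+
  then show ?thesis using r unfolding e by (simp add: bits_word_def ob)
 qed
qed

lemma evaluation:
 assumes j: "j < length qs" and q: "qs ! j = (a, b, c, d)" and C: "a + b <= C" "c + d <= C"
 shows "outputs_within M (bits_word (replicate j True) @ [3] @ rat_word (bs, cs))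
  (rat_word (emit a b bs cs 0, emit c d bs cs 0)) (2 * length qs + 2 * C + 10 * (length bs + length cs) + 20)"
proof -
 define D where "D = bits_word (replicate j True)"
 define W where "W = D @ 3 # bits_word bs @ 3 # bits_word cs"
 define c1 where "c1 = cont W"
 define P where "P = int (j + 1 + length bs)"
 have lD: "length D = j" by (simp add: D_def bits_word_def)
 have lb: "length (bits_word xs) = length xs" for xs by (simp add: bits_word_def)
 have rd0: "rd c1 0 (bits_word (replicate j True) @ 3 # bits_word bs @ 3 # bits_word cs)"
  using rd_cont[of "[]" W] by (simp add: c1_def W_def D_def)
 have rd1: "rd c1 (int j + 1) (bits_word bs @ 3 # bits_word cs)"
  using rd_cont[of "D @ [3]" "bits_word bs @ 3 # bits_word cs"] by (simp add: c1_def W_def lD add.commute)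
 have rd2: "rd c1 P (3 # bits_word cs)"
  using rd_cont[of "D @ 3 # bits_word bs" "3 # bits_word cs"] by (simp add: c1_def W_def lD P_def lb add_ac)
 then have rd3: "rd c1 (P + 1) (bits_word cs)" "c1 P = 3" by (auto simp: rd_Cons)
 have ncs: "c1 i \<noteq> 3" if "P < i" "i <= P + int (length cs)" for i
 proof -
  define n where "n = nat (i - (P + 1))"
  have n: "i = P + 1 + int n" using that(1) by (simp add: n_def)
  then have "n < length cs" using that(2) by simp
  then show ?thesis using rd3(1) n unfolding rd_def by (auto simp: lb) (auto simp: bits_word_def split: if_splits)
 qed
 define c2 where "c2 = cont (bits_word bs)"
 have c2: "c2 (-1) = 0" "\<And>i. 0 <= i ==> i < int (length bs) ==> c2 i \<noteq> 0"
  by (auto simp: c2_def cont_def lb) (auto simp: bits_word_def split: if_splits)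
 have rdc2: "rd c2 0 (bits_word bs)" using rd_cont[of "[]" "bits_word bs"] by (simp add: c2_def)
 define r1 where "r1 = emit a b bs cs 0"
 define r2 where "r2 = emit c d bs cs 0"
 have j': "j <= length qs" using j by simp
 have "init_config M (bits_word (replicate j True) @ [3] @ rat_word (bs, cs)) = (E 0 0 0, [(0, c1), (0, cont []), (0, cont [])])"
  by (simp add: init_config_def M_def machine_def word_tape_cont c1_def W_def D_def enc_def numeral_2_eq_2)
 moreover have "runs M (j + 1) (E 0 0 0, [(0, c1), (0, cont []), (0, cont [])]) (E 1 j 0, [(int j + 1, c1), (0, cont []), (0, cont [])])"
  using phase0[OF rd0, of 0 "(0, cont [])" "(0, cont [])"] j' by simp
 moreover have "runs M (length bs + 1) (E 1 j 0, [(int j + 1, c1), (0, cont []), (0, cont [])]) (E 2 j 0, [(P, c1), (int (length bs) - 1, c2), (0, cont [])])"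
  using phase1[OF rd1 j', of "[]" "(0, cont [])"] by (simp add: c2_def P_def add_ac)
 moreover have "runs M (length bs + 1) (E 2 j 0, [(P, c1), (int (length bs) - 1, c2), (0, cont [])]) (E 3 j 0, [(P + 1, c1), (0, c2), (0, cont [])])"
  using rewind[of 2 j c1 P 0 c2 "length bs" "(0, cont [])"] rd3(2) c2 j' by simp
 moreover have "runs M (length r1) (E 3 j 0, [(P + 1, c1), (0, c2), (0, cont [])])
  (E 3 j 0, [(P + 1 + int (length cs), c1), (int (length bs), c2), (int (length r1), cont (bits_word r1))])"
  using addition[of 3 j a b 0 c2 0 bs c1 "P + 1" cs "[]"] j' q C rdc2 rd3(1) by (simp add: coeffs_def r1_def)
 moreover have "runs M 1 (E 3 j 0, [(P + 1 + int (length cs), c1), (int (length bs), c2), (int (length r1), cont (bits_word r1))])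
  (E 4 j 0, [(P + int (length cs), c1), (int (length bs) - 1, c2), (int (length (bits_word r1 @ [3])), cont (bits_word r1 @ [3]))])"
 proof (rule runs_step)
  have "c1 (P + 1 + int (length cs)) = 0" "c2 (int (length bs)) = 0" using rd3(1) rdc2 by (auto simp: rd_def lb)
  then show "tm_step M (E 3 j 0, [(P + 1 + int (length cs), c1), (int (length bs), c2), (int (length r1), cont (bits_word r1))])
   = (E 4 j 0, [(P + int (length cs), c1), (int (length bs) - 1, c2), (int (length (bits_word r1 @ [3])), cont (bits_word r1 @ [3]))])"
   by (subst step_machine) (use j' in \<open>auto simp: machine_step_def Let_def cont_upd lb\<close>)
 qed
 moreover have "runs M (length cs + length bs + 1) (E 4 j 0, [(P + int (length cs), c1), (int (length bs) - 1, c2), (int (length (bits_word r1 @ [3])), cont (bits_word r1 @ [3]))])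
  (E 5 j 0, [(P + 1, c1), (0, c2), (int (length (bits_word r1 @ [3])), cont (bits_word r1 @ [3]))])"
  using rewind[of 4 j c1 P "length cs" c2 "length bs" "(int (length (bits_word r1 @ [3])), cont (bits_word r1 @ [3]))"] rd3(2) c2 j' ncs by simp
 moreover have "runs M (length r2) (E 5 j 0, [(P + 1, c1), (0, c2), (int (length (bits_word r1 @ [3])), cont (bits_word r1 @ [3]))])
  (E 5 j 0, [(P + 1 + int (length cs), c1), (int (length bs), c2), (int (length (bits_word r1 @ [3]) + length r2), cont ((bits_word r1 @ [3]) @ bits_word r2))])"
  using addition[of 5 j c d 0 c2 0 bs c1 "P + 1" cs "bits_word r1 @ [3]"] j' q C rdc2 rd3(1) by (simp add: coeffs_def r2_def)
 moreover have "runs M 1 (E 5 j 0, [(P + 1 + int (length cs), c1), (int (length bs), c2), (int (length (bits_word r1 @ [3]) + length r2), cont ((bits_word r1 @ [3]) @ bits_word r2))])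
  (num_states M, [(P + 1 + int (length cs), c1), (int (length bs), c2), (int (length (bits_word r1 @ [3]) + length r2), cont ((bits_word r1 @ [3]) @ bits_word r2))])"
 proof (rule runs_step)
  have "c1 (P + 1 + int (length cs)) = 0" "c2 (int (length bs)) = 0" using rd3(1) rdc2 by (auto simp: rd_def lb)
  then show "tm_step M (E 5 j 0, [(P + 1 + int (length cs), c1), (int (length bs), c2), (int (length (bits_word r1 @ [3]) + length r2), cont ((bits_word r1 @ [3]) @ bits_word r2))])
   = (num_states M, [(P + 1 + int (length cs), c1), (int (length bs), c2), (int (length (bits_word r1 @ [3]) + length r2), cont ((bits_word r1 @ [3]) @ bits_word r2))])"
   by (subst step_machine) (use j' in \<open>auto simp: machine_step_def Let_def M_def machine_def\<close>)
 qed
 ultimately have "runs M ((j + 1) + (length bs + 1) + (length bs + 1) + length r1 + 1 + (length cs + length bs + 1) + length r2 + 1)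
  (init_config M (bits_word (replicate j True) @ [3] @ rat_word (bs, cs)))
  (num_states M, [(P + 1 + int (length cs), c1), (int (length bs), c2), (int (length (bits_word r1 @ [3]) + length r2), cont ((bits_word r1 @ [3]) @ bits_word r2))])"
  by (simp only:) (meson runs_trans)
 moreover have "length r1 <= length bs + length cs + a + b" "length r2 <= length bs + length cs + c + d"
  unfolding r1_def r2_def by (simp_all add: length_emit)
 then have "(j + 1) + (length bs + 1) + (length bs + 1) + length r1 + 1 + (length cs + length bs + 1) + length r2 + 1
  <= 2 * length qs + 2 * C + 10 * (length bs + length cs) + 20"
  using C j by simp
 ultimately have "runs M (2 * length qs + 2 * C + 10 * (length bs + length cs) + 20)
  (init_config M (bits_word (replicate j True) @ [3] @ rat_word (bs, cs)))
  (num_states M, [(P + 1 + int (length cs), c1), (int (length bs), c2), (int (length (bits_word r1 @ [3]) + length r2), cont ((bits_word r1 @ [3]) @ bits_word r2))])"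
  by (rule runs_mono)
 moreover have "tape_holds (h, cont (rat_word (r1, r2))) (rat_word (r1, r2))" for h
  using rd_cont[of "[]" "rat_word (r1, r2)"] by (auto simp: tape_holds_def rd_def bits_word_def)
 ultimately show ?thesis unfolding outputs_within_def runs_def r1_def r2_def by fastforce
qed

end

text \<open>The value of the Moebius map at \<open>n / m\<close> is \<open>(a n + b m) / (c n + d m)\<close>.\<close>

lemma explicit_moebius:
 assumes Q: "\<And>a b c d. (a, b, c, d) \<in> set qs ==> d > 0"
 shows "explicit_family ((%(a, b, c, d) x. (real a * x + real b) / (real c * x + real d)) ` set qs)"
proof -
 define f where "f = (%(a :: nat, b :: nat, c :: nat, d :: nat) (x :: real). (real a * x + real b) / (real c * x + real d))"
 \<comment> \<open>A common bound for all carries of all maps in the list. The running time is then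
   linear in the number of bits, which is the polynomial \<open>p\<close>.\<close>
 define C where "C = (\<Sum>(a, b, c, d)\<leftarrow>qs. a + b + c + d)"
 define p where "p = [:2 * length qs + 2 * C + 20, 10:]"
 have ev: "evaluates (machine qs C) p (replicate j True) (f (qs ! j))" if j: "j < length qs" for j
  unfolding evaluates_def
 proof (intro allI impI, elim conjE)
  fix x :: real and r assume r: "describes_rat r x"
  obtain bs cs where bc: "r = (bs, cs)" by (cases r)
  obtain a b c d where q: "qs ! j = (a, b, c, d)" by (metis prod.collapse)
  have mem: "(a, b, c, d) \<in> set qs" using j q nth_mem by metis
  have "a + b + c + d <= C" unfolding C_def using member_le_sum_list[of "a + b + c + d" "map (%(a, b, c, d). a + b + c + d) qs"] mem by force
  then have C: "a + b <= C" "c + d <= C" by auto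
  define n where "n = bits_nat bs"
  define m where "m = bits_nat cs"
  have m: "m > 0" "x = real n / real m" using r by (simp_all add: bc n_def m_def)
  have dm: "c * n + d * m > 0" using Q[OF mem] m(1) by simp
  have fx: "f (qs ! j) x = real (a * n + b * m) / real (c * n + d * m)"
  proof -
   have "real u * x + real v = real (u * n + v * m) / real m" for u v
    unfolding m(2) using m(1) by (simp add: add_divide_distrib)
   then show ?thesis unfolding q f_def using m(1) by simp
  qed
  show "\<exists>r'. describes_rat r' (f (qs ! j) x) \<and> outputs_within (machine qs C) (bits_word (replicate j True) @ [3] @ rat_word r) (rat_word r') (poly p (rat_bits r))"
  proof (intro exI conjI)
   show "describes_rat (emit a b bs cs 0, emit c d bs cs 0) (f (qs ! j) x)"
    using dm unfolding fx by (simp add: bits_nat_emit n_def m_def)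
   show "outputs_within (machine qs C) (bits_word (replicate j True) @ [3] @ rat_word r) (rat_word (emit a b bs cs 0, emit c d bs cs 0)) (poly p (rat_bits r))"
    using evaluation[OF j q C, of bs cs] unfolding bc p_def by (simp add: algebra_simps)
  qed
 qed
 show ?thesis unfolding explicit_family_def
 proof (intro exI conjI)
  show "valid_tm (machine qs C)" by (rule valid_machine)
  show "(%(a, b, c, d) x. (real a * x + real b) / (real c * x + real d)) ` set qs = set (map f qs)" by (simp add: f_def)
  show "list_all2 (evaluates (machine qs C) p) (map (%j. replicate j True) [0..<length qs]) (map f qs)"
   using ev by (simp add: list_all2_conv_all_nth)
 qed
qed

section \<open>Smoothness, monotonicity, and the passage to measurable sets\<close>

lemma power_quotient_deriv:
 fixes c d K x :: real
 assumes "c * x + d \<noteq> 0"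
 shows "((%x. K / (c * x + d)^Suc m) has_real_derivative - (real (Suc m) * c * K) / (c * x + d)^Suc (Suc m)) (at x within S)"
proof -
 define y where "y = c * x + d"
 have "((%x. c * x + d) has_real_derivative c) (at x within S)" by (auto intro!: derivative_eq_intros)
 from DERIV_power_Suc[OF this, of m]
 have p: "((%x. (c * x + d)^Suc m) has_real_derivative (1 + real m) * (c * y^m)) (at x within S)" by (simp add: y_def)
 have "((%x. K / (c * x + d)^Suc m) has_real_derivative (0 * y^Suc m - K * ((1 + real m) * (c * y^m))) / (y^Suc m * y^Suc m)) (at x within S)"
  unfolding y_def by (rule DERIV_divide[OF DERIV_const p[unfolded y_def]]) (use assms in simp)
 moreover have "(0 * y^Suc m - K * ((1 + real m) * (c * y^m))) / (y^Suc m * y^Suc m) = - (real (Suc m) * c * K) / y^Suc (Suc m)"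
 proof -
  have y: "y \<noteq> 0" using assms by (simp add: y_def)
  have "y^Suc m * y^Suc m = y^m * y^Suc (Suc m)" by simp
  moreover have "0 * y^Suc m - K * ((1 + real m) * (c * y^m)) = y^m * (- (real (Suc m) * c * K))" by (simp add: algebra_simps)
  ultimately show ?thesis using y by (simp only:) (simp del: power_Suc)
 qed
 ultimately show ?thesis by (simp only: y_def)
qed

lemma mob_deriv:
 assumes "real_of_int c * x + real_of_int d \<noteq> 0"
 shows "(mob (a,b,c,d) has_real_derivative real_of_int (a*d - b*c) / (real_of_int c * x + real_of_int d)^Suc (Suc 0)) (at x within S)"
proof -
 define y where "y = real_of_int c * x + real_of_int d"
 have "((%x. (real_of_int a * x + real_of_int b) / (real_of_int c * x + real_of_int d)) has_real_derivative
  (real_of_int a * y - (real_of_int a * x + real_of_int b) * real_of_int c) / (y * y)) (at x within S)"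
  unfolding y_def by (rule DERIV_divide) (use assms in \<open>auto intro!: derivative_eq_intros\<close>)
 moreover have "real_of_int a * y - (real_of_int a * x + real_of_int b) * real_of_int c = real_of_int (a*d - b*c)"
  by (simp add: y_def algebra_simps)
 ultimately show ?thesis unfolding mob_def[abs_def] by (simp add: y_def)
qed

lemma mob_denominator_pos: "c >= 0 ==> d > 0 ==> x >= 0 ==> real_of_int c * x + real_of_int d > 0"
 by (intro add_nonneg_pos) auto

lemma mob_smooth:
 assumes "c >= 0" "d > 0"
 shows "smooth_map_on {0..1} (mob (a,b,c,d))"
proof -
 define \<Delta> where "\<Delta> = real_of_int (a*d - b*c)"
 define D where "D n x = (case n of 0 \<Rightarrow> mob (a,b,c,d) x
  | Suc m \<Rightarrow> fact n * (- real_of_int c)^m * \<Delta> / (real_of_int c * x + real_of_int d)^Suc n)" for n x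
 have "(D n has_real_derivative D (Suc n) x) (at x within {0..1})" if x: "x \<in> {0..1}" for n x
 proof -
  have nz: "real_of_int c * x + real_of_int d \<noteq> 0" using mob_denominator_pos[OF assms, of x] x by simp
  show ?thesis
  proof (cases n)
   case 0
   then show ?thesis using mob_deriv[OF nz] by (simp add: D_def[abs_def] \<Delta>_def)
  next
   case (Suc m)
   have "- (real (Suc n) * real_of_int c * (fact n * (- real_of_int c)^m * \<Delta>)) = fact (Suc n) * (- real_of_int c)^n * \<Delta>"
    by (simp add: Suc)
   then show ?thesis using power_quotient_deriv[OF nz, of "fact n * (- real_of_int c)^m * \<Delta>" n "{0..1}"]
    by (simp only: D_def[abs_def] Suc nat.case)
  qed
 qed
 moreover have "D 0 x = mob (a,b,c,d) x" for x by (simp add: D_def)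
 ultimately show ?thesis unfolding smooth_map_on_def by (intro exI[of _ D]) auto
qed

lemma mob_strict_mono:
 assumes "c >= 0" "d > 0" "a*d - b*c > 0"
 shows "strict_mono_on {0..1} (mob (a,b,c,d))"
proof (rule strict_mono_onI)
 fix x y :: real assume xy: "x \<in> {0..1}" "y \<in> {0..1}" "x < y"
 define X where "X = real_of_int c * x + real_of_int d"
 define Y where "Y = real_of_int c * y + real_of_int d"
 have pos: "X > 0" "Y > 0" using mob_denominator_pos[OF assms(1,2)] xy by (auto simp: X_def Y_def)
 have "(real_of_int a * y + real_of_int b) * X - (real_of_int a * x + real_of_int b) * Y = real_of_int (a*d - b*c) * (y - x)"
  by (simp add: X_def Y_def algebra_simps)
 moreover have "real_of_int (a*d - b*c) * (y - x) > 0" using assms(3) xy(3) by (intro mult_pos_pos) (simp_all only: of_int_0_less_iff diff_gt_0_iff_gt)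
 ultimately have "(real_of_int a * x + real_of_int b) * Y < (real_of_int a * y + real_of_int b) * X" by simp
 then show "mob (a,b,c,d) x < mob (a,b,c,d) y" using pos by (simp add: mob_def X_def[symmetric] Y_def[symmetric] divide_simps)
qed

context generators
begin

lemma finite_family: "finite (family N)"
 using fin(1) by (simp add: family_def)

lemma familyD:
 assumes "(a,b,c,d) \<in> family N"
 shows "0 <= a" "0 <= b" "0 <= c" "0 < d" "0 < a*d - b*c" "x \<in> {0..1} ==> mob (a,b,c,d) x \<in> {0..1}"
proof -
 consider "(a,b,c,d) = (1,0,0,1)" | "a = 1" "0 <= b" "b < 2^N" "c = 0" "d = 2^N"
  | c' d' where "(a,b,c',d') \<in> S" "c = 512*c'" "d = 512*d'" using assms by (auto simp: family_def)
 then have "0 <= a \<and> 0 <= b \<and> 0 <= c \<and> 0 < d \<and> 0 < a*d - b*c \<and> (x \<in> {0..1} \<longrightarrow> mob (a,b,c,d) x \<in> {0..1})"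
 proof cases
  case 1 then show ?thesis using family_mob(1)[of x] by auto
 next
  case 2
  have "b + 1 <= 2^N" using 2 by simp
  then have "real_of_int (b + 1) <= real_of_int (2^N)" by (simp only: of_int_le_iff)
  then have "real_of_int b + 1 <= 2^N" by simp
  then have "mob (a,b,c,d) x \<in> {0..1}" if "x \<in> {0..1}" unfolding \<open>a = 1\<close> \<open>c = 0\<close> \<open>d = 2^N\<close> family_mob(2) using that 2(2) by simp
  then show ?thesis using 2 by simp
 next
  case 3
  have g: "1 <= c'" "1 <= d'" "0 <= b" "a*d' - b*c' = p" using 3(1) by (auto simp: gens_def)
  have "a > 0" using gens_pos[OF 3(1)] p0 X(1) by simp
  moreover have "a*d - b*c = 512 * p" using g(4) by (simp add: 3(2,3) algebra_simps)
  moreover have "mob (a,b,c,d) x \<in> {0..1}" if "x \<in> {0..1}"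
  proof -
   have "mob (a,b,c,d) x = mob (a,b,c',d') x / 512" using family_mob(3)[where s="(a,b,c',d')" and x=x] by (simp only: prod.case 3)
   then show ?thesis using mob_bounds[OF 3(1), of x] that by auto
  qed
  ultimately show ?thesis using g 3 p0 by simp
 qed
 then show "0 <= a" "0 <= b" "0 <= c" "0 < d" "0 < a*d - b*c" "x \<in> {0..1} ==> mob (a,b,c,d) x \<in> {0..1}" by auto
qed

lemma family_differentiable: assumes "q \<in> family N" "A \<subseteq> {0..1}" shows "mob q differentiable_on A"
proof -
 obtain a b c d where q: "q = (a,b,c,d)" by (metis prod.collapse)
 have "mob q differentiable (at x within A)" if "x \<in> A" for x
 proof -
  have "real_of_int c * x + real_of_int d \<noteq> 0"
   using mob_denominator_pos[of c d x] familyD(3,4)[OF assms(1)[unfolded q]] that assms(2) by force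
  then show ?thesis unfolding q using mob_deriv real_differentiable_def by blast
 qed
 then show ?thesis by (simp add: differentiable_on_def)
qed

text \<open>Inner regularity gives a compact K inside A that misses less than \<delta> = \<eta>
  \<alpha> / 4. Half of the expansion pays for the missing part: (1 + \<eta>) (\<alpha> - \<delta>)
  is (1 + \<eta>/2) \<alpha> plus a nonnegative term. This is why the exponent here is one larger
  than in \<open>compact_expansion\<close>. The image of A is Lebesgue measurable because the maps
  are differentiable.\<close>

lemma family_expands:
 assumes l: "real_of_int p <= 2^(3*l)" "2^(3*l) <= 8 * real_of_int p" "l >= 4"
  and CD: "CD > 0" "\<And>m. m > 0 ==> divs m ^ 192 <= CD * m"
  and small: "2 * sqrt (band_gain CD) + 2^15 / 2^l <= 1 / 20000"
  and A: "A \<in> sets lebesgue" "A \<subseteq> {0..1}" "measure lebesgue A <= 1 / 2"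
 shows "measure lebesgue (\<Union>q\<in>family (3*l+9). mob q ` A) >= (1 + 1 / 2^(2*(3*l+9)+17)) * measure lebesgue A"
proof -
 define N where "N = 3*l+9"
 define \<eta> where "\<eta> = 1 / (2::real)^(2*N+16)"
 define \<alpha> where "\<alpha> = measure lebesgue A"
 have eta: "0 < \<eta>" "\<eta> <= 1" by (simp_all add: \<eta>_def)
 have half: "1 / (2::real)^(2*N+17) = \<eta> / 2" by (simp add: \<eta>_def power_add)
 show ?thesis
 proof (cases "\<alpha> = 0")
  case True then show ?thesis by (simp add: \<alpha>_def)
 next
  case False
  then have al: "\<alpha> > 0" using measure_nonneg[of lebesgue A] by (simp add: \<alpha>_def less_le)
  define \<delta> where "\<delta> = \<eta> * \<alpha> / 4"
  have de: "\<delta> > 0" using eta al by (simp add: \<delta>_def)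
  obtain K where K: "closed K" "K \<subseteq> A" "A - K \<in> lmeasurable" "emeasure lebesgue (A - K) < ennreal \<delta>"
   using sets_lebesgue_inner_closed[OF A(1) de] .
  have b01: "bounded {0..1::real}" by simp
  have cK: "compact K" using K(1,2) A(2) bounded_subset[OF b01] by (auto simp: compact_eq_bounded_closed)
  have K01: "K \<subseteq> {0..1}" using K(2) A(2) by blast
  have lK: "K \<in> lmeasurable" using cK by (rule lmeasurable_compact)
  have lA: "A \<in> lmeasurable" using A bounded_subset[OF b01] by (intro bounded_set_imp_lmeasurable) auto
  have "measure lebesgue (A - K) < \<delta>" using K(3,4) de by (simp add: emeasure_eq_measure2 ennreal_less_iff)
  moreover have "\<alpha> = measure lebesgue K + measure lebesgue (A - K)"
   using measure_Un2[OF lK lA] K(2) by (simp add: \<alpha>_def Un_absorb1)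
  ultimately have aK: "measure lebesgue K >= \<alpha> - \<delta>" "measure lebesgue K <= \<alpha>" using measure_nonneg[of lebesgue "A - K"] by linarith+
  have Kb: "K \<in> sets borel" using K(1) by (rule borel_closed)
  have mK: "measure lborel K = measure lebesgue K" using Kb by (simp add: measure_completion)
  define PK where "PK = (\<Union>q\<in>family N. mob q ` K)"
  have cPK: "compact PK" unfolding PK_def
   by (intro compact_UN finite_family compact_continuous_image cK differentiable_imp_continuous_on family_differentiable K01)
  have PKb: "PK \<in> sets borel" using cPK by (intro borel_closed compact_imp_closed)
  have PK01: "PK \<subseteq> {0..1}" unfolding PK_def
  proof (intro UN_least image_subsetI)
   fix q x assume "q \<in> family N" "x \<in> K"
   then show "mob q x \<in> {0..1}" using familyD(6)[of "fst q" "fst (snd q)" "fst (snd (snd q))" "snd (snd (snd q))" N x] K01 by auto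
  qed
  have KPK: "K \<subseteq> PK"
  proof
   fix x assume "x \<in> K"
   then have "mob (1,0,0,1) x \<in> PK" unfolding PK_def by (auto simp: family_def)
   then show "x \<in> PK" by (simp only: family_mob(1))
  qed
  have "\<delta> <= 1 * \<alpha> / 4" unfolding \<delta>_def using eta al by (intro divide_right_mono mult_right_mono) auto
  then have Kpos: "measure lborel K > 0" unfolding mK using aK(1) al by linarith
  have "measure lborel (PK - K) >= measure lborel K / 2^(2*N+16)"
   unfolding N_def PK_def
  proof (rule compact_expansion[OF l CD small cK K01 _ Kpos])
   show "measure lborel K <= 1/2" using mK aK(2) A(3) by (simp add: \<alpha>_def)
  qed (use PKb PK01 in \<open>simp_all add: PK_def N_def\<close>)
  then have ex: "measure lebesgue (PK - K) >= \<eta> * measure lebesgue K"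
  proof -
   have "measure lebesgue (PK - K) = measure lborel (PK - K)" by (rule measure_completion) (use PKb Kb in auto)
   moreover have "\<eta> * measure lebesgue K = measure lborel K / 2^(2*N+16)" unfolding mK \<eta>_def by (simp only: times_divide_eq_left mult_1_left)
   ultimately show ?thesis using \<open>measure lborel (PK - K) >= measure lborel K / 2^(2*N+16)\<close> by (simp only:)
  qed
  have lPK: "PK \<in> lmeasurable" using cPK by (rule lmeasurable_compact)
  have "measure lebesgue PK = measure lebesgue K + measure lebesgue (PK - K)"
   using measure_Un2[OF lK lPK] KPK by (simp add: Un_absorb1)
  then have "measure lebesgue PK >= (1 + \<eta>) * measure lebesgue K" using ex by (simp add: distrib_right)
  also have "(1 + \<eta>) * measure lebesgue K >= (1 + \<eta>) * (\<alpha> - \<delta>)" using aK(1) eta by (intro mult_left_mono) auto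
  also have "(1 + \<eta>) * (\<alpha> - \<delta>) = (1 + \<eta> / 2) * \<alpha> + \<eta> * (1 - \<eta>) * \<alpha> / 4" by (simp add: \<delta>_def field_simps)
  also have "\<dots> >= (1 + \<eta> / 2) * \<alpha>" using eta al by simp
  finally have low: "measure lebesgue PK >= (1 + \<eta> / 2) * \<alpha>" .
  have im: "mob q ` A \<in> lmeasurable" if "q \<in> family N" for q
  proof (rule bounded_set_imp_lmeasurable)
   show "mob q ` A \<in> sets lebesgue" by (rule differentiable_image_in_sets_lebesgue[OF A(1) _ family_differentiable[OF that A(2)]]) simp
   have "mob q ` A \<subseteq> {0..1}"
    using familyD(6)[of "fst q" "fst (snd q)" "fst (snd (snd q))" "snd (snd (snd q))" N] that A(2) by auto
   then show "bounded (mob q ` A)" by (rule bounded_subset[OF b01])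
  qed
  have le: "measure lebesgue PK <= measure lebesgue (\<Union>q\<in>family N. mob q ` A)"
  proof (rule measure_mono_fmeasurable)
   show "PK \<subseteq> (\<Union>q\<in>family N. mob q ` A)" unfolding PK_def using K(2) by blast
   show "PK \<in> sets lebesgue" using lPK by (rule fmeasurableD)
   show "(\<Union>q\<in>family N. mob q ` A) \<in> lmeasurable" by (rule fmeasurable.finite_UN[OF finite_family im])
  qed
  show ?thesis unfolding N_def[symmetric] half \<alpha>_def[symmetric] by (rule order_trans[OF low le])
 qed
qed

lemma family_explicit: "explicit_family (mob ` family N)"
proof -
 define f where "f = (%(a :: nat, b :: nat, c :: nat, d :: nat) (x :: real). (real a * x + real b) / (real c * x + real d))"
 define nt where "nt = (%(a,b,c,d). (nat a, nat b, nat c, nat d))"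
 have "finite (nt ` family N)" by (rule finite_imageI[OF finite_family])
 then obtain qs where qs: "set qs = nt ` family N" using finite_list by blast
 have "explicit_family (f ` set qs)" unfolding f_def
 proof (rule explicit_moebius)
  fix a b c d assume "(a,b,c,d) \<in> set qs"
  then obtain a' b' c' d' where "(a',b',c',d') \<in> family N" "d = nat d'" unfolding qs nt_def by auto
  then show "d > 0" using familyD(4) by simp
 qed
 moreover have "f (nt q) = mob q" if "q \<in> family N" for q
 proof -
  obtain a b c d where q: "q = (a,b,c,d)" by (metis prod.collapse)
  have "real (nat a) = real_of_int a" "real (nat b) = real_of_int b" "real (nat c) = real_of_int c" "real (nat d) = real_of_int d"
   using familyD(1-4)[OF that[unfolded q]] by auto
  then show ?thesis by (simp add: q f_def nt_def mob_def fun_eq_iff)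
 qed
 then have "f ` set qs = mob ` family N" unfolding qs image_image by (intro image_cong) auto
 ultimately show ?thesis by simp
qed

lemma family_monotone_expander:
 assumes l: "real_of_int p <= 2^(3*l)" "2^(3*l) <= 8 * real_of_int p" "l >= 4"
  and CD: "CD > 0" "\<And>m. m > 0 ==> divs m ^ 192 <= CD * m"
  and small: "2 * sqrt (band_gain CD) + 2^15 / 2^l <= 1 / 20000"
 shows "continuous_monotone_expander (mob ` family (3*l+9))"
 unfolding continuous_monotone_expander_def continuous_expander_def
proof (intro conjI ballI exI[of _ "1 / (2::real)^(2*(3*l+9)+17)"])
 show "finite (mob ` family (3*l+9))" by (intro finite_imageI finite_family)
 show "1 / (2::real)^(2*(3*l+9)+17) > 0" by simp
 show "\<forall>A. A \<in> sets lebesgue \<and> A \<subseteq> {0..1} \<and> measure lebesgue A <= 1/2 \<longrightarrow>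
  (1 + 1 / 2^(2*(3*l+9)+17)) * measure lebesgue A <= measure lebesgue (\<Union>\<psi>\<in>mob ` family (3*l+9). \<psi> ` A)"
  using family_expands[OF l CD small] by (simp only: image_image UN_simps) blast
next
 fix \<psi> assume "\<psi> \<in> mob ` family (3*l+9)"
 then obtain a b c d where q: "\<psi> = mob (a,b,c,d)" "(a,b,c,d) \<in> family (3*l+9)" by auto
 note f = familyD[OF q(2)]
 show "\<psi> \<in> {0..1} \<rightarrow> {0..1}" using f(6) by (auto simp: q(1))
 show "smooth_map_on {0..1} \<psi>" unfolding q(1) by (rule mob_smooth[OF f(3,4)])
 show "strict_mono_on {0..1} \<psi>" unfolding q(1) by (rule mob_strict_mono[OF f(3,4,5)])
qed

end

text \<open>Minimality of l gives the factor 8, and 93 = 3 * 31 forces l >= 32.\<close>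

lemma exists_scale:
 assumes "(p::real) > 2^93"
 obtains l :: nat where "p <= 2^(3*l)" "2^(3*l) <= 8 * p" "l >= 32"
proof -
 define l where "l = (LEAST l. p <= 2^(3*l))"
 obtain n :: nat where "p < 2^n" using real_arch_pow[of 2 p] by auto
 also have "(2::real)^n <= 2^(3*n)" by (intro power_increasing) auto
 finally have ex: "p <= 2^(3*n)" by simp
 have l1: "p <= 2^(3*l)" unfolding l_def by (rule LeastI[of _ n]) (rule ex)
 have "(2::real)^93 < 2^(3*l)" using assms l1 by (rule less_le_trans)
 then have "93 < 3 * l" by (rule power_less_imp_less_exp[rotated]) simp
 then have l32: "l >= 32" by simp
 have "\<not> p <= 2^(3*(l-1))" using not_less_Least[of "l-1" "%l. p <= 2^(3*l)"] l32 unfolding l_def[symmetric] by simp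
 moreover have "3 * l = 3 * (l-1) + 3" using l32 by simp
 then have "(2::real)^(3*l) = 2^(3*(l-1)) * 2^3" by (simp only: power_add)
 ultimately have "2^(3*l) <= 8 * p" by simp
 then show ?thesis using that l1 l32 by blast
qed

theorem theorem0: "\<exists>\<Psi>. continuous_monotone_expander \<Psi> \<and> explicit_family \<Psi>"
proof -
 obtain CD :: nat where CD: "CD > 0" "\<And>m. m > 0 ==> divs m ^ 192 <= CD * m" using divs_bound[of 192] by blast
 \<comment> \<open>\<open>band_const\<close> does not depend on p, so p may be chosen after it. From
   p >= B^96 follows \<pi>p >= B, hence sqrt (\<open>band_gain CD\<close>) <= 1/80000, and twice
   this is half of the budget 1/20000. The condition p > 2^93 gives 2^15 / 2^l <= 2^(-17), which
   fits into the other half.\<close>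
 define B where "B = max 1 (80000\<^sup>2 * (162 * generators.band_const CD))"
 have B2: "80000\<^sup>2 * (162 * generators.band_const CD) <= B" unfolding B_def by (rule max.cobounded2)
 have B1: "B >= 1" unfolding B_def by (rule max.cobounded1)
 obtain p where p: "prime p" "p > nat \<lceil>max (2^93) (B^96)\<rceil>" using bigger_prime by blast
 have pr: "real p > 2^93" "real p >= B^96"
 proof -
  have "max (2^93) (B^96) < real p" using p(2) by linarith
  then show "real p > 2^93" "real p >= B^96" by auto
 qed
 define X where "X = \<lfloor>sqrt (real p)\<rfloor>"
 have s0: "sqrt (real p) >= 1" using pr(1) by simp
 have X: "X >= 1" "X\<^sup>2 <= int p" "int p < (X+1)\<^sup>2"
 proof -
  show X1: "X >= 1" using s0 by (simp add: X_def)
  have "(real_of_int X)\<^sup>2 <= (sqrt (real p))\<^sup>2" using X1 by (intro power_mono) (simp_all add: X_def)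
  then have "real_of_int (X\<^sup>2) <= real_of_int (int p)" by simp
  then show "X\<^sup>2 <= int p" by (simp only: of_int_le_iff)
  have "(sqrt (real p))\<^sup>2 < (real_of_int X + 1)\<^sup>2" by (intro power_strict_mono) (simp_all add: X_def)
  then have "real_of_int (int p) < real_of_int ((X+1)\<^sup>2)" by simp
  then show "int p < (X+1)\<^sup>2" by (simp only: of_int_less_iff)
 qed
 interpret generators "int p" X using p(1) X by unfold_locales auto
 obtain l where l: "real p <= 2^(3*l)" "2^(3*l) <= 8 * real p" "l >= 32" using exists_scale[OF pr(1)] .
 have "B^96 <= \<pi>p^96" using pr(2) pip(1) by simp
 then have piB: "B <= \<pi>p" by (rule power_mono_iff[THEN iffD1, rotated 3]) (use pip(2) B1 in simp_all)
 have "80000\<^sup>2 * (162 * band_const CD) <= \<pi>p" by (rule order_trans[OF B2 piB])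
 then have "band_gain CD <= (1/80000)\<^sup>2" unfolding band_gain_def using pip(2) by (simp add: divide_simps power2_eq_square)
 then have "sqrt (band_gain CD) <= 1/80000" by (intro real_le_lsqrt) auto
 moreover have "2^15 / (2::real)^l <= 1/40000"
 proof -
  have "(2::real)^32 <= 2^l" using l(3) by (intro power_increasing) auto
  then show ?thesis by (simp add: divide_simps)
 qed
 ultimately have small: "2 * sqrt (band_gain CD) + 2^15 / 2^l <= 1 / 20000" by linarith
 have "continuous_monotone_expander (mob ` family (3*l+9))"
  by (rule family_monotone_expander[OF _ _ _ CD small]) (use l in auto)
 then show ?thesis using family_explicit by blast
qed

end
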